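(* Let $X$ be an infinite dimensional complex Banach space and let $R,T\in L(X)$ be such that $R$ is Riesz and at least one of the following holds: ($R\in\mathrm{comm}_{l}(T)$ and $T\in\mathrm{comm}(TR)$), or ($R\in\mathrm{comm}_{r}(T)$ and $T\in\mathrm{comm}(RT)$). Then $T$ is generalized Drazin-Riesz invertible if and only if $T+R$ is generalized Drazin-Riesz invertible. If this is the case, i.e. if $T$ is generalized Drazin-Riesz invertible, then: (i) $\sigma_{*}(T)=\sigma_{*}(T+R)$ for every $\sigma_{*}\in\{\sigma_{e},\sigma_{uf},\sigma_{lf},\sigma_{w},\sigma_{uw},\sigma_{lw},\sigma_{b},\sigma_{ub},\sigma_{lb}\}$. (ii) If $R$ is nilpotent, then $\sigma_{+}(T)\setminus\{0\}=\sigma_{+}(T+R)\setminus\{0\}$ for every $\sigma_{+}\in\{\sigma_{bf},\sigma_{ubf},\sigma_{lbf},\sigma_{bw},\sigma_{ubw},\sigma_{lbw},\sigma_{d},\sigma_{ld},\sigma_{rd}\}$, and $\sigma_{++}(T)=\sigma_{++}(T+R)$ for every $\sigma_{++}\in\{\sigma_{bf},\sigma_{bw},\sigma_{d}\}$. If in addition $X$ is a Hilbert space, then $\sigma_{+}(T)=\sigma_{+}(T+R)$ for every $\sigma_{+}$ in the list $\{\sigma_{bf},\sigma_{ubf},\sigma_{lbf},\sigma_{bw},\sigma_{ubw},\sigma_{lbw},\sigma_{d},\sigma_{ld},\sigma_{rd}\}$. (iii) If $R$ is in particular quasi-nilpotent, then $\mathrm{acc}\,\sigma_{-}(T)\setminus\{0\}=\mathrm{acc}\,\sigma_{-}(T+R)\setminus\{0\}$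 for every $\sigma_{-}\in\{\sigma,\sigma_{a},\sigma_{s}\}$. If in addition $T$ is generalized Drazin invertible, then $T+R$ is generalized Drazin invertible, $\sigma(T)=\sigma(T+R)$, and for every $\sigma_{\times}\in\{\sigma_{a},\sigma_{s}\}$ we have $\sigma_{\times}(T)\setminus\{0\}=\sigma_{\times}(T+R)\setminus\{0\}$ and $\mathrm{acc}\,\sigma_{\times}(T)=\mathrm{acc}\,\sigma_{\times}(T+R)$.
   Context: $L(X)$ is the algebra of bounded linear operators on $X$; $\mathrm{comm}(A)$ is the set of elements of $L(X)$ commuting with $A$; $\mathrm{comm}_{l}(A)=\{B: AB\in\mathrm{comm}(A)\text{ and }BA\in\mathrm{comm}(B)\}$; $\mathrm{comm}_{r}(A)=\{B: AB\in\mathrm{comm}(B)\text{ and }BA\in\mathrm{comm}(A)\}$. $\mathrm{acc}\,K$ is the set of accumulation points of $K\subset\mathbb{C}$. $T$ is Riesz if $T-\lambda I$ is Fredholm for all $\lambda\neq 0$. $(M,N)\in\mathrm{Red}(T)$ means that $M,N$ are closed $T$-invariant subspaces with $X=M\oplus N$; $T_M$ is the restriction of $T$ to $M$. $T$ is generalized Drazin-Riesz invertible if there is $(M,N)\in\mathrm{Red}(T)$ with $T_M$ invertible and $T_N$ Riesz ($M$ or $N$ may be $\{0\}$). $T$ is generalized Drazin invertible if there is $S\in\mathrm{comm}(T)$ with $S^{2}T=S$ and $T-T^{2}S$ quasi-nilpotent (equivalently $0\notin\mathrm{acc}\,\sigma(T)$). For $T\in L(X)$: $\mathcal{N}(T)$,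 $\mathcal{R}(T)$ are kernel and range, $\alpha(T)=\dim\mathcal{N}(T)$, $\beta(T)=\mathrm{codim}\,\mathcal{R}(T)$; $p(T)=\inf\{n\in\mathbb{N}:\mathcal{N}(T^{n})=\mathcal{N}(T^{n+1})\}$ and $q(T)=\inf\{n\in\mathbb{N}:\mathcal{R}(T^{n})=\mathcal{R}(T^{n+1})\}$ ($\mathbb{N}$ includes $0$, $\inf\emptyset=\infty$). $T_{[n]}$ is the restriction of $T$ to $\mathcal{R}(T^{n})$, as a map $\mathcal{R}(T^n)\to\mathcal{R}(T^n)$. Put $p_{e}(T)=\inf\{n:\alpha(T_{[n]})<\infty\}$, $q_{e}(T)=\inf\{n:\beta(T_{[n]})<\infty\}$, $m_{T}=\inf\{n:\min\{\alpha(T_{[n]}),\beta(T_{[n]})\}<\infty\}$. $T$ is upper semi-B-Fredholm if $p_{e}(T)<\infty$ and $\mathcal{R}(T^{p_{e}(T)+1})$ is closed; lower semi-B-Fredholm if $q_{e}(T)<\infty$ and $\mathcal{R}(T^{q_{e}(T)})$ is closed; B-Fredholm if both. If either holds, $\mathrm{ind}(T)=\alpha(T_{[m_T]})-\beta(T_{[m_T]})$. $T$ is upper semi-B-Weyl if upper semi-B-Fredholm with $\mathrm{ind}(T)\le 0$; lower semi-B-Weyl if lower semi-B-Fredholm with $\mathrm{ind}(T)\geq 0$; B-Weyl if B-Fredholm with $\mathrm{ind}(T)=0$; left Drazin invertible if upper semi-B-Fredholm with $p(T_{[m_T]})<\infty$; right Drazin invertible if lower semi-B-Fredholm with $q(T_{[m_T]})<\infty$;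 Drazin invertible if $m_T<\infty$ and $p(T_{[m_T]})=q(T_{[m_T]})<\infty$ (equivalently $p(T)=q(T)<\infty$). If moreover $m_T=0$, upper semi-B-Fredholm, lower semi-B-Fredholm, B-Fredholm, upper semi-B-Weyl, lower semi-B-Weyl, B-Weyl, left Drazin, right Drazin, Drazin invertible operators are called respectively upper semi-Fredholm, lower semi-Fredholm, Fredholm, upper semi-Weyl, lower semi-Weyl, Weyl, upper semi-Browder, lower semi-Browder, Browder (these are the usual notions). Each spectrum is the set of $\lambda\in\mathbb{C}$ such that $T-\lambda I$ is not in the corresponding class: $\sigma$ (invertible), $\sigma_{a}$ (bounded below), $\sigma_{s}$ (surjective), $\sigma_{e}$ (Fredholm), $\sigma_{uf},\sigma_{lf}$ (upper, lower semi-Fredholm), $\sigma_{w},\sigma_{uw},\sigma_{lw}$ (Weyl, upper, lower semi-Weyl), $\sigma_{b},\sigma_{ub},\sigma_{lb}$ (Browder, upper, lower semi-Browder), $\sigma_{bf},\sigma_{ubf},\sigma_{lbf}$ (B-Fredholm, upper, lower semi-B-Fredholm), $\sigma_{bw},\sigma_{ubw},\sigma_{lbw}$ (B-Weyl, upper, lower semi-B-Weyl), $\sigma_{d},\sigma_{ld},\sigma_{rd}$ (Drazin, left Drazin, right Drazin invertible). *)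

theory Defs
  imports "HOL-Analysis.Analysis"
begin

class complex_banach = banach +
  fixes scaleC :: "complex \<Rightarrow> 'a \<Rightarrow> 'a" (infixr "*\<^sub>C" 75)
  assumes scaleC_add_right: "a *\<^sub>C (x + y) = a *\<^sub>C x + a *\<^sub>C y"
    and scaleC_add_left: "(a + b) *\<^sub>C x = a *\<^sub>C x + b *\<^sub>C x"
    and scaleC_scaleC: "a *\<^sub>C b *\<^sub>C x = (a * b) *\<^sub>C x"
    and scaleR_scaleC: "r *\<^sub>R x = complex_of_real r *\<^sub>C x"
    and norm_scaleC: "norm (a *\<^sub>C x) = cmod a * norm x"

global_interpretation complex_vector:
  vector_space "scaleC :: complex \<Rightarrow> 'a \<Rightarrow> 'a::complex_banach"
  defines csubspace = complex_vector.subspace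
    and cspan = complex_vector.span
    and cdim = complex_vector.dim
proof
  fix x :: 'a
  show "1 *\<^sub>C x = x"
    using scaleR_scaleC[of 1 x] by simp
qed (simp_all add: scaleC_add_right scaleC_add_left scaleC_scaleC)

definition direct_sum :: "'a::complex_banach set \<Rightarrow> 'a set \<Rightarrow> 'a set \<Rightarrow> bool" where
  "direct_sum M N X \<longleftrightarrow>
     csubspace M \<and> csubspace N \<and> M \<inter> N = {0} \<and> {x + y |x y. x \<in> M \<and> y \<in> N} = X"

text \<open>Dimension of a subspace, and codimension of a subspace \<open>N\<close> of \<open>M\<close> (neither needs to be
  closed) as the dimension of an algebraic complement of \<open>N\<close> in \<open>M\<close>. All these complements are
  isomorphic to \<open>M / N\<close>, so the infimum ranges over a single value.\<close>

definition edim :: "'a::complex_banach set \<Rightarrow> enat" where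
  "edim V = (if \<exists>B. finite B \<and> cspan B = V then enat (cdim V) else \<infinity>)"

definition ecodim :: "'a::complex_banach set \<Rightarrow> 'a set \<Rightarrow> enat" where
  "ecodim M N = (INF C\<in>{C. direct_sum N C M}. edim C)"

text \<open>The norm of the type is induced by a complex inner product (completeness is part of the
  class).\<close>

definition hilbert_space :: "'a::complex_banach itself \<Rightarrow> bool" where
  "hilbert_space _ \<longleftrightarrow> (\<exists>ip :: 'a \<Rightarrow> 'a \<Rightarrow> complex.
     (\<forall>x y z. ip (x + y) z = ip x z + ip y z) \<and>
     (\<forall>c x y. ip (c *\<^sub>C x) y = c * ip x y) \<and>
     (\<forall>x y. ip y x = cnj (ip x y)) \<and>
     (\<forall>x. ip x x = complex_of_real ((norm x)\<^sup>2)))"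

definition bounded_clinear :: "('a::complex_banach \<Rightarrow> 'a) \<Rightarrow> bool" where
  "bounded_clinear T \<longleftrightarrow> bounded_linear T \<and> (\<forall>c x. T (c *\<^sub>C x) = c *\<^sub>C T x)"

text \<open>An operator on a subspace \<open>M\<close> is represented by a function on the whole type that maps \<open>M\<close>
  into \<open>M\<close>; its values outside \<open>M\<close> are irrelevant. In this way \<open>T\<close> together with \<open>M\<close> stands for
  the restriction of \<open>T\<close> to \<open>M\<close>, and \<open>T\<close> together with \<open>UNIV\<close> for \<open>T\<close> itself.\<close>

definition bounded_clinear_on :: "'a::complex_banach set \<Rightarrow> ('a \<Rightarrow> 'a) \<Rightarrow> bool" where
  "bounded_clinear_on M T \<longleftrightarrow> T ` M \<subseteq> M \<and>
     (\<forall>x\<in>M. \<forall>y\<in>M. T (x + y) = T x + T y) \<and> (\<forall>c. \<forall>x\<in>M. T (c *\<^sub>C x) = c *\<^sub>C T x) \<and>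
     (\<exists>K. \<forall>x\<in>M. norm (T x) \<le> K * norm x)"

lemma bounded_clinear_on_UNIV: "bounded_clinear_on UNIV T \<longleftrightarrow> bounded_clinear T"
  unfolding bounded_clinear_on_def bounded_clinear_def bounded_linear_def
    bounded_linear_axioms_def linear_iff
  by (auto simp: mult.commute scaleR_scaleC)

definition invertible_on :: "'a::complex_banach set \<Rightarrow> ('a \<Rightarrow> 'a) \<Rightarrow> bool" where
  "invertible_on M T \<longleftrightarrow>
     (\<exists>S. bounded_clinear_on M S \<and> (\<forall>x\<in>M. S (T x) = x \<and> T (S x) = x))"

definition bounded_below :: "('a::complex_banach \<Rightarrow> 'a) \<Rightarrow> bool" where
  "bounded_below T \<longleftrightarrow> (\<exists>c>0. \<forall>x. norm (T x) \<ge> c * norm x)"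

definition op_shift :: "('a::complex_banach \<Rightarrow> 'a) \<Rightarrow> complex \<Rightarrow> 'a \<Rightarrow> 'a" where
  "op_shift T z = (\<lambda>x. T x - z *\<^sub>C x)"

definition comm :: "('a::complex_banach \<Rightarrow> 'a) \<Rightarrow> ('a \<Rightarrow> 'a) set" where
  "comm A = {B. bounded_clinear B \<and> A \<circ> B = B \<circ> A}"

definition comm_l :: "('a::complex_banach \<Rightarrow> 'a) \<Rightarrow> ('a \<Rightarrow> 'a) set" where
  "comm_l A = {B. bounded_clinear B \<and> A \<circ> B \<in> comm A \<and> B \<circ> A \<in> comm B}"

definition comm_r :: "('a::complex_banach \<Rightarrow> 'a) \<Rightarrow> ('a \<Rightarrow> 'a) set" where
  "comm_r A = {B. bounded_clinear B \<and> A \<circ> B \<in> comm B \<and> B \<circ> A \<in> comm A}"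

definition alpha :: "'a::complex_banach set \<Rightarrow> ('a \<Rightarrow> 'a) \<Rightarrow> enat" where
  "alpha M T = edim {x\<in>M. T x = 0}"

definition beta :: "'a::complex_banach set \<Rightarrow> ('a \<Rightarrow> 'a) \<Rightarrow> enat" where
  "beta M T = ecodim M (T ` M)"

text \<open>In \<^typ>\<open>enat\<close> the infimum of the empty set is \<open>\<infinity>\<close>.\<close>

definition ascent :: "'a::complex_banach set \<Rightarrow> ('a \<Rightarrow> 'a) \<Rightarrow> enat" where
  "ascent M T = (INF n\<in>{n. {x\<in>M. (T ^^ n) x = 0} = {x\<in>M. (T ^^ Suc n) x = 0}}. enat n)"

definition descent :: "'a::complex_banach set \<Rightarrow> ('a \<Rightarrow> 'a) \<Rightarrow> enat" where
  "descent M T = (INF n\<in>{n. (T ^^ n) ` M = (T ^^ Suc n) ` M}. enat n)"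

text \<open>The restriction \<open>T\<^sub>[\<^sub>n\<^sub>]\<close> of \<open>T\<close> to the range of \<open>T ^^ n\<close> is \<open>T\<close> on the subspace \<open>(T ^^ n) ` M\<close>.\<close>

definition p_e :: "'a::complex_banach set \<Rightarrow> ('a \<Rightarrow> 'a) \<Rightarrow> enat" where
  "p_e M T = (INF n\<in>{n. alpha ((T ^^ n) ` M) T < \<infinity>}. enat n)"

definition q_e :: "'a::complex_banach set \<Rightarrow> ('a \<Rightarrow> 'a) \<Rightarrow> enat" where
  "q_e M T = (INF n\<in>{n. beta ((T ^^ n) ` M) T < \<infinity>}. enat n)"

definition m_deg :: "'a::complex_banach set \<Rightarrow> ('a \<Rightarrow> 'a) \<Rightarrow> enat" where
  "m_deg M T =
     (INF n\<in>{n. min (alpha ((T ^^ n) ` M) T) (beta ((T ^^ n) ` M) T) < \<infinity>}. enat n)"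

text \<open>The range of \<open>T ^^ m\<close> for \<open>m = m_deg M T\<close>; used only if \<open>m_deg M T\<close> is finite.\<close>

definition m_range :: "'a::complex_banach set \<Rightarrow> ('a \<Rightarrow> 'a) \<Rightarrow> 'a set" where
  "m_range M T = (T ^^ the_enat (m_deg M T)) ` M"

text \<open>Used only if one of the two terms is finite.\<close>

definition ind :: "'a::complex_banach set \<Rightarrow> ('a \<Rightarrow> 'a) \<Rightarrow> ereal" where
  "ind M T = ereal_of_enat (alpha (m_range M T) T) - ereal_of_enat (beta (m_range M T) T)"

definition upper_semi_B_Fredholm :: "'a::complex_banach set \<Rightarrow> ('a \<Rightarrow> 'a) \<Rightarrow> bool" where
  "upper_semi_B_Fredholm M T \<longleftrightarrow>
     p_e M T < \<infinity> \<and> closed ((T ^^ (the_enat (p_e M T) + 1)) ` M)"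

definition lower_semi_B_Fredholm :: "'a::complex_banach set \<Rightarrow> ('a \<Rightarrow> 'a) \<Rightarrow> bool" where
  "lower_semi_B_Fredholm M T \<longleftrightarrow>
     q_e M T < \<infinity> \<and> closed ((T ^^ the_enat (q_e M T)) ` M)"

definition B_Fredholm :: "'a::complex_banach set \<Rightarrow> ('a \<Rightarrow> 'a) \<Rightarrow> bool" where
  "B_Fredholm M T \<longleftrightarrow> upper_semi_B_Fredholm M T \<and> lower_semi_B_Fredholm M T"

definition upper_semi_B_Weyl :: "'a::complex_banach set \<Rightarrow> ('a \<Rightarrow> 'a) \<Rightarrow> bool" where
  "upper_semi_B_Weyl M T \<longleftrightarrow> upper_semi_B_Fredholm M T \<and> ind M T \<le> 0"

definition lower_semi_B_Weyl :: "'a::complex_banach set \<Rightarrow> ('a \<Rightarrow> 'a) \<Rightarrow> bool" where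
  "lower_semi_B_Weyl M T \<longleftrightarrow> lower_semi_B_Fredholm M T \<and> ind M T \<ge> 0"

definition B_Weyl :: "'a::complex_banach set \<Rightarrow> ('a \<Rightarrow> 'a) \<Rightarrow> bool" where
  "B_Weyl M T \<longleftrightarrow> B_Fredholm M T \<and> ind M T = 0"

definition left_Drazin :: "'a::complex_banach set \<Rightarrow> ('a \<Rightarrow> 'a) \<Rightarrow> bool" where
  "left_Drazin M T \<longleftrightarrow> upper_semi_B_Fredholm M T \<and> ascent (m_range M T) T < \<infinity>"

definition right_Drazin :: "'a::complex_banach set \<Rightarrow> ('a \<Rightarrow> 'a) \<Rightarrow> bool" where
  "right_Drazin M T \<longleftrightarrow> lower_semi_B_Fredholm M T \<and> descent (m_range M T) T < \<infinity>"

definition Drazin :: "'a::complex_banach set \<Rightarrow> ('a \<Rightarrow> 'a) \<Rightarrow> bool" where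
  "Drazin M T \<longleftrightarrow> m_deg M T < \<infinity> \<and>
     ascent (m_range M T) T = descent (m_range M T) T \<and> descent (m_range M T) T < \<infinity>"

definition upper_semi_Fredholm :: "'a::complex_banach set \<Rightarrow> ('a \<Rightarrow> 'a) \<Rightarrow> bool" where
  "upper_semi_Fredholm M T \<longleftrightarrow> upper_semi_B_Fredholm M T \<and> m_deg M T = 0"

definition lower_semi_Fredholm :: "'a::complex_banach set \<Rightarrow> ('a \<Rightarrow> 'a) \<Rightarrow> bool" where
  "lower_semi_Fredholm M T \<longleftrightarrow> lower_semi_B_Fredholm M T \<and> m_deg M T = 0"

definition Fredholm :: "'a::complex_banach set \<Rightarrow> ('a \<Rightarrow> 'a) \<Rightarrow> bool" where
  "Fredholm M T \<longleftrightarrow> B_Fredholm M T \<and> m_deg M T = 0"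

definition upper_semi_Weyl :: "'a::complex_banach set \<Rightarrow> ('a \<Rightarrow> 'a) \<Rightarrow> bool" where
  "upper_semi_Weyl M T \<longleftrightarrow> upper_semi_B_Weyl M T \<and> m_deg M T = 0"

definition lower_semi_Weyl :: "'a::complex_banach set \<Rightarrow> ('a \<Rightarrow> 'a) \<Rightarrow> bool" where
  "lower_semi_Weyl M T \<longleftrightarrow> lower_semi_B_Weyl M T \<and> m_deg M T = 0"

definition Weyl :: "'a::complex_banach set \<Rightarrow> ('a \<Rightarrow> 'a) \<Rightarrow> bool" where
  "Weyl M T \<longleftrightarrow> B_Weyl M T \<and> m_deg M T = 0"

definition upper_semi_Browder :: "'a::complex_banach set \<Rightarrow> ('a \<Rightarrow> 'a) \<Rightarrow> bool" where
  "upper_semi_Browder M T \<longleftrightarrow> left_Drazin M T \<and> m_deg M T = 0"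

definition lower_semi_Browder :: "'a::complex_banach set \<Rightarrow> ('a \<Rightarrow> 'a) \<Rightarrow> bool" where
  "lower_semi_Browder M T \<longleftrightarrow> right_Drazin M T \<and> m_deg M T = 0"

definition Browder :: "'a::complex_banach set \<Rightarrow> ('a \<Rightarrow> 'a) \<Rightarrow> bool" where
  "Browder M T \<longleftrightarrow> Drazin M T \<and> m_deg M T = 0"

definition Riesz :: "'a::complex_banach set \<Rightarrow> ('a \<Rightarrow> 'a) \<Rightarrow> bool" where
  "Riesz M T \<longleftrightarrow> (\<forall>z. z \<noteq> 0 \<longrightarrow> Fredholm M (op_shift T z))"

definition spectrum_of ::
  "(('a::complex_banach \<Rightarrow> 'a) \<Rightarrow> bool) \<Rightarrow> ('a \<Rightarrow> 'a) \<Rightarrow> complex set" where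
  "spectrum_of P T = {z. \<not> P (op_shift T z)}"

definition "\<sigma> = spectrum_of (invertible_on UNIV)"
definition "\<sigma>_a = spectrum_of bounded_below"
definition "\<sigma>_s = spectrum_of surj"

definition "\<sigma>_e = spectrum_of (Fredholm UNIV)"
definition "\<sigma>_uf = spectrum_of (upper_semi_Fredholm UNIV)"
definition "\<sigma>_lf = spectrum_of (lower_semi_Fredholm UNIV)"
definition "\<sigma>_w = spectrum_of (Weyl UNIV)"
definition "\<sigma>_uw = spectrum_of (upper_semi_Weyl UNIV)"
definition "\<sigma>_lw = spectrum_of (lower_semi_Weyl UNIV)"
definition "\<sigma>_b = spectrum_of (Browder UNIV)"
definition "\<sigma>_ub = spectrum_of (upper_semi_Browder UNIV)"
definition "\<sigma>_lb = spectrum_of (lower_semi_Browder UNIV)"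

definition "\<sigma>_bf = spectrum_of (B_Fredholm UNIV)"
definition "\<sigma>_ubf = spectrum_of (upper_semi_B_Fredholm UNIV)"
definition "\<sigma>_lbf = spectrum_of (lower_semi_B_Fredholm UNIV)"
definition "\<sigma>_bw = spectrum_of (B_Weyl UNIV)"
definition "\<sigma>_ubw = spectrum_of (upper_semi_B_Weyl UNIV)"
definition "\<sigma>_lbw = spectrum_of (lower_semi_B_Weyl UNIV)"
definition "\<sigma>_d = spectrum_of (Drazin UNIV)"
definition "\<sigma>_ld = spectrum_of (left_Drazin UNIV)"
definition "\<sigma>_rd = spectrum_of (right_Drazin UNIV)"

definition acc :: "complex set \<Rightarrow> complex set" where
  "acc K = {z. z islimpt K}"

definition nilpotent_op :: "('a::complex_banach \<Rightarrow> 'a) \<Rightarrow> bool" where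
  "nilpotent_op T \<longleftrightarrow> (\<exists>n. \<forall>x. (T ^^ n) x = 0)"

text \<open>Inclusion instead of equality only matters for the zero space, where the spectrum is empty.\<close>

definition quasi_nilpotent :: "('a::complex_banach \<Rightarrow> 'a) \<Rightarrow> bool" where
  "quasi_nilpotent T \<longleftrightarrow> \<sigma> T \<subseteq> {0}"

definition Red :: "('a::complex_banach \<Rightarrow> 'a) \<Rightarrow> ('a set \<times> 'a set) set" where
  "Red T = {(M, N). closed M \<and> closed N \<and> T ` M \<subseteq> M \<and> T ` N \<subseteq> N \<and> direct_sum M N UNIV}"

definition gen_Drazin_Riesz_invertible :: "('a::complex_banach \<Rightarrow> 'a) \<Rightarrow> bool" where
  "gen_Drazin_Riesz_invertible T \<longleftrightarrow> (\<exists>(M, N) \<in> Red T. invertible_on M T \<and> Riesz N T)"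

definition gen_Drazin_invertible :: "('a::complex_banach \<Rightarrow> 'a) \<Rightarrow> bool" where
  "gen_Drazin_invertible T \<longleftrightarrow>
     (\<exists>S \<in> comm T. S \<circ> S \<circ> T = S \<and> quasi_nilpotent (\<lambda>x. T x - T (T (S x))))"

end

theory Submission
imports Defs "HOL-Library.Set_Algebras"
begin

text \<open>Put \<open>C = TR - RT\<close>. The hypotheses on \<open>T\<close> and \<open>R\<close> amount to \<open>TC = RC = 0\<close> or \<open>CT = CR = 0\<close>, a
  relation (\<open>semi_comm\<close>) that passes to \<open>T + R\<close> and \<open>- R\<close>; hence it is enough to carry every property from
  \<open>T\<close> to \<open>T + R\<close>.

  Away from zero let \<open>A = T - l\<close> with \<open>l \<noteq> 0\<close>. If \<open>A\<close> and \<open>R\<close> commuted, \<open>A + R\<close> would divide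
  \<open>A\<^sup>n - (- R)\<^sup>n\<close>. In general the division leaves a remainder built from \<open>C\<close>; where it lives, \<open>A\<close> and
  \<open>A + R\<close> act as the scalar \<open>- l\<close>, and so it can be absorbed (\<open>left_factor\<close>, \<open>right_factor\<close>). A Riesz operator
  is quasi-nilpotent modulo operators of finite rank (\<open>riesz_power\<close>), so for some \<open>n\<close> the power \<open>(- R)\<^sup>n\<close> is
  too small to spoil the semi-Fredholm property of \<open>A\<^sup>n\<close>, and the divisor \<open>A + R\<close> inherits it. The
  index does not change, because \<open>A + s R\<close> is a path of Fredholm operators. If the ascent became infinite, \<open>T + R\<close>
  would have a disc of eigenvalues around \<open>l\<close>, which all come from eigenvalues of \<open>T\<close> and \<open>R\<close>, and
  there are too few of those (\<open>fin_asc_perturb\<close>). Finite descent is finite ascent of the adjoint. For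
  quasi-nilpotent \<open>R\<close> the same division preserves boundedness below and surjectivity.

  An operator is generalized Drazin-Riesz invertible iff \<open>T - z\<close> is Browder for all small \<open>z \<noteq> 0\<close>
  (\<open>GDRI_iff_browder_nearby\<close>), and generalized Drazin invertible iff these operators are invertible.
  Both properties are therefore decided away from zero. The
  decomposition of the space comes from a spectral projection, which is constructed as the limit of
  means of resolvents over the \<open>2\<^sup>m\<close>-th roots of unity.

  At zero, let \<open>T\<close> be generalized Drazin-Riesz invertible and \<open>N\<close> its Riesz part. If \<open>T\<close> belongs to any of the
  eighteen classes of (i) and (ii), then some \<open>T\<^sup>n N\<close> has finite dimension, so that \<open>T\<close> has
  finite ascent and descent (\<open>GDRI_semi_B_Fredholm\<close>). At zero the nine classes of Fredholm type thus reduce to the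
  Browder operators and the nine classes of B-Fredholm type to the Drazin invertible ones. If
  \<open>T\<close> is Browder, then \<open>C\<close> has finite rank, the division above works modulo finite rank, and \<open>T + R\<close> is
  upper semi-Fredholm, hence Browder. If \<open>R\<close> is nilpotent, finite ascent and descent pass to \<open>T + R\<close>
  by expanding the powers of the sum (\<open>asc_desc_nilpotent\<close>).

  What remains is (ii) away from zero. If \<open>R\<^sup>d = 0\<close>, the spaces \<open>R(A\<^sup>n)\<close> and \<open>R((A + R)\<^bsup>n + d\<^esup>)\<close> are
  compared on a closed subspace \<open>Y\<close> that contains the ranges of \<open>T\<close> and \<open>R\<close> and on which
  \<open>TC = RC = 0\<close> (\<open>semi_comm_reduce\<close>, \<open>class_range_space\<close>).\<close>

notation scaleC (infixr "*:" 75) and iff (infixr "<->" 25) and infinity ("oo")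

section \<open>Dimensions and codimensions\<close>

abbreviation clinear :: "('a::complex_banach => 'b::complex_banach) => bool" where
"clinear == Vector_Spaces.linear scaleC scaleC"

global_interpretation cpair: vector_space_pair
"scaleC :: complex => 'a => 'a::complex_banach" "scaleC :: complex => 'b => 'b::complex_banach"
by unfold_locales

lemma clinearI:
"[|!!x y. f (x + y) = f x + f y; !!c x. f (c *: x) = c *: f x|] ==> clinear f"
by (simp add: Vector_Spaces.linear_iff complex_vector.vector_space_axioms)

lemma clinear_iff:
"clinear f <-> (ALL x y. f (x + y) = f x + f y) & (ALL c x. f (c *: x) = c *: f x)"
by (auto simp: Vector_Spaces.linear_iff complex_vector.vector_space_axioms)

lemmas csubspace_0 = complex_vector.subspace_0
lemmas csubspace_add = complex_vector.subspace_add
lemmas csubspace_diff = complex_vector.subspace_diff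
lemmas csubspace_neg = complex_vector.subspace_neg
lemmas csubspace_scale = complex_vector.subspace_scale

abbreviation cindependent :: "'a::complex_banach set => bool" where
"cindependent == complex_vector.independent"

lemmas csubspace_def = complex_vector.subspace_def
lemmas csubspace_UNIV = complex_vector.subspace_UNIV
lemmas csubspace_Int = complex_vector.subspace_inter
lemmas csubspace_zero = complex_vector.subspace_single_0
lemmas scaleC_diff_right = complex_vector.scale_right_diff_distrib
lemmas scaleC_diff_left = complex_vector.scale_left_diff_distrib

lemma direct_sum_alt:
"direct_sum N C M <-> csubspace N & csubspace C & N Int C = {0} & N + C = M"
proof -
have "{x + y |x y. x : N & y : C} = N + C" by (auto simp: set_plus_def)
thus ?thesis unfolding direct_sum_def by simp
qed

lemma csubspace_plus:
assumes "csubspace M" "csubspace N" shows "csubspace (M + N)"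
proof -
have "M + N = {x + y|x y. x : M & y : N}"
 by (auto simp: set_plus_def)
thus ?thesis
 using complex_vector.subspace_sums[OF assms] by simp
qed

lemma cspan_Un: "cspan (A Un B) = cspan A + cspan B"
by (auto simp: complex_vector.span_Un set_plus_def)

lemma plus_absorb:
assumes "csubspace M" "csubspace N" "N <= M" shows "M + N = M" "N + M = M"
proof -
show "M + N = M"
proof
 show "M + N <= M" using assms by (auto elim!: set_plus_elim intro: csubspace_add)
 show "M <= M + N" using set_plus_intro[OF _ csubspace_0[OF assms(2)], of _ M] by auto
qed
thus "N + M = M" by (simp add: add.commute)
qed

lemma subset_plus:
"csubspace N ==> M <= M + N" "csubspace M ==> N <= M + N"
proof -
show "csubspace N ==> M <= M + N"
 using set_plus_intro[OF _ csubspace_0, of _ M N] by auto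
show "csubspace M ==> N <= M + N"
 using set_plus_intro[OF csubspace_0, of M _ N] by auto
qed

lemma plus_least:
"[|csubspace L; M <= L; N <= L|] ==> M + N <= L"
by (auto simp: set_plus_def csubspace_add subset_iff)

definition ecard :: "'b set => enat" where
"ecard B = (if finite B then enat (card B) else oo)"

lemma edim_cspan:
assumes "cindependent B" shows "edim (cspan B) = ecard B"
proof (cases "finite B")
case True
thus ?thesis
 unfolding edim_def ecard_def using complex_vector.dim_span_eq_card_independent[OF assms] by auto
next
case False
have "~ (EX B'. finite B' & cspan B' = cspan B)"
proof
 assume "EX B'. finite B' & cspan B' = cspan B"
 then obtain B' where "finite B'" "cspan B' = cspan B" by blast
 thus False
  using complex_vector.independent_span_bound[of B' B] False assms complex_vector.span_superset[of B]
  by simp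
qed
thus ?thesis unfolding edim_def ecard_def using False by simp
qed

lemma csubspace_basis:
assumes "csubspace N" "csubspace M" "N <= M"
obtains A B where "A <= B" "cindependent B" "cspan A = N" "cspan B = M"
proof -
obtain A where A: "A <= N" "cindependent A" "N <= cspan A"
 using complex_vector.maximal_independent_subset by blast
obtain B where B: "A <= B" "B <= M" "cindependent B" "M <= cspan B"
 using complex_vector.maximal_independent_subset_extend[OF order_trans[OF A(1) assms(3)] A(2)]
 by blast
have "cspan A = N" "cspan B = M"
 using complex_vector.span_subspace[OF A(1,3) assms(1)] complex_vector.span_subspace[OF B(2,4) assms(2)]
 by simp_all
thus thesis using that[OF B(1,3)] by simp
qed

lemma csubspace_basis1:
assumes "csubspace M" obtains B where "cindependent B" "cspan B = M"
using csubspace_basis[OF assms assms] by auto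

lemma independent_span_Int:
assumes "cindependent (A Un B)" "A Int B = {}"
shows "cspan A Int cspan B = {0}"
proof -
have "x = 0" if x: "x : cspan A" "x : cspan B" for x
proof -
 have r: "complex_vector.representation (A Un B) x = complex_vector.representation A x"
  "complex_vector.representation (A Un B) x = complex_vector.representation B x"
  using assms x by (auto intro!: complex_vector.representation_extend)
 have z: "complex_vector.representation (A Un B) x b = 0" for b
 proof (rule ccontr)
  assume b: "complex_vector.representation (A Un B) x b ~= 0"
  hence "b : A" "b : B"
   using r complex_vector.representation_ne_zero[of A x b] complex_vector.representation_ne_zero[of B x b]
   by simp_all
  thus False using assms by auto
 qed
 have "x : cspan (A Un B)" using x complex_vector.span_mono[of A "A Un B"] by auto
 thus "x = 0"
  using complex_vector.sum_nonzero_representation_eq[of "A Un B" x] assms z by simp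
qed
thus ?thesis using complex_vector.span_zero by auto
qed

lemma direct_sum_basis:
assumes "csubspace N" "csubspace M" "N <= M"
obtains A B where "A <= B" "cindependent B" "cspan A = N" "cspan B = M" "direct_sum N (cspan (B - A)) M"
proof -
obtain A B where AB: "A <= B" "cindependent B" "cspan A = N" "cspan B = M"
 using csubspace_basis[OF assms] by blast
have eq: "A Un (B - A) = B" using AB by auto
have "direct_sum N (cspan (B - A)) M"
 unfolding direct_sum_alt
 using AB eq independent_span_Int[of A "B - A"] cspan_Un[of A "B - A"] assms by auto
thus thesis using that AB by blast
qed

lemma direct_sum_ex:
assumes "csubspace N" "csubspace M" "N <= M"
obtains C where "direct_sum N C M"
using direct_sum_basis[OF assms] by blast

text \<open>Two complements of \<open>N\<close> are isomorphic: send a basis vector of one of them to its component in the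
  other one.\<close>

lemma edim_unique_le:
assumes "direct_sum N C M" "direct_sum N C' M"
shows "edim C' <= edim C"
proof -
have C: "csubspace N" "csubspace C" "N + C = M"
 and C': "csubspace C'" "N Int C' = {0}" "N + C' = M"
 using assms by (auto simp: direct_sum_alt)
obtain B where B: "cindependent B" "cspan B = C" using csubspace_basis1 C by blast
obtain B' where B': "cindependent B'" "cspan B' = C'" using csubspace_basis1 C' by blast
show ?thesis
proof (cases "finite B")
 case True
 have "EX c:C. b - c : N" if b: "b : B'" for b
 proof -
  have "b : N + C" using b B'(2) complex_vector.span_superset[of B'] subset_plus(2)[OF C(1), of C'] C C' by blast
  thus ?thesis by (auto elim!: set_plus_elim intro!: bexI)
 qed
 then obtain c where c: "!!b. b : B' ==> c b : C & b - c b : N" by metis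
 define f where "f = cpair.construct B' c"
 have f: "clinear f" "!!b. b : B' ==> f b = c b"
  unfolding f_def using cpair.linear_construct[OF B'(1)] cpair.construct_basis[OF B'(1)] by blast+
 have "csubspace {x. x - f x : N}"
  using C(1) f(1) by (auto simp: csubspace_def clinear_iff cpair.linear_0[OF f(1)] add_diff_add
   scaleC_diff_right[symmetric])
 hence "cspan B' <= {x. x - f x : N}"
  using c f(2) by (intro complex_vector.span_minimal) auto
 hence fN: "x - f x : N" if "x : C'" for x using that B'(2) by blast
 have inj: "inj_on f C'"
 proof (rule inj_onI)
  fix x y assume xy: "x : C'" "y : C'" "f x = f y"
  have "x - y : N" using csubspace_diff[OF C(1) fN[OF xy(1)] fN[OF xy(2)]] xy(3) by simp
  hence "x - y : N Int C'" using csubspace_diff[OF C'(1) xy(1,2)] by (rule IntI)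
  thus "x = y" unfolding C'(2) by simp
 qed
 have injB: "inj_on f B'" using inj_on_subset[OF inj] B'(2) complex_vector.span_superset[of B'] by simp
 have "cindependent (f ` B')"
  using cpair.linear_independent_injective_image[OF f(1) B'(1)] B'(2) inj by simp
 hence "finite (f ` B') & card (f ` B') <= card B"
  using f(2) c B(2) by (intro complex_vector.independent_span_bound True) auto
 hence "ecard B' <= ecard B"
  using True injB by (simp add: ecard_def card_image finite_image_iff)
 thus ?thesis using edim_cspan[OF B(1)] edim_cspan[OF B'(1)] B(2) B'(2) by simp
next
 case False
 hence "edim C = oo" using edim_cspan[OF B(1)] B(2) by (simp add: ecard_def)
 thus ?thesis by simp
qed
qed

lemma edim_unique: "direct_sum N C M ==> direct_sum N C' M ==> edim C' = edim C"
by (intro order_antisym edim_unique_le)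

lemma ecodim_eq:
assumes "direct_sum N C M" shows "ecodim M N = edim C"
proof -
have "edim ` {C. direct_sum N C M} = {edim C}" using assms edim_unique[OF assms] by blast
thus ?thesis unfolding ecodim_def by simp
qed

lemma edim_direct_sum:
assumes "direct_sum N C M" shows "edim M = edim N + edim C"
proof -
have C: "csubspace N" "csubspace M" "N <= M"
 using assms csubspace_plus[of N C] subset_plus(1)[of C N] by (auto simp: direct_sum_alt)
obtain A B where AB: "A <= B" "cindependent B" "cspan A = N" "cspan B = M" "direct_sum N (cspan (B - A)) M"
 using direct_sum_basis[OF C] by blast
have ind: "cindependent A" "cindependent (B - A)"
 using AB(1) by (intro complex_vector.independent_mono[OF AB(2)]; blast)+
have "ecard B = ecard A + ecard (B - A)"
 using AB(1) finite_subset[OF AB(1)] card_Un_disjoint[of A "B - A"] by (auto simp: ecard_def Un_absorb1)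
thus ?thesis
 using edim_unique[OF assms AB(5)] edim_cspan[OF ind(1)] edim_cspan[OF ind(2)] edim_cspan[OF AB(2)] AB(3,4) by simp
qed

lemma edim_zero [simp]: "edim {0} = 0"
using edim_cspan[of "{}"] complex_vector.independent_empty by (simp add: ecard_def zero_enat_def)

lemma direct_sum_trivial:
assumes "csubspace M" shows "direct_sum {0} M M" "direct_sum M {0} M"
using assms csubspace_0[OF assms] by (simp_all add: direct_sum_alt set_plus_def)

lemma ecodim_zero: "csubspace M ==> ecodim M {0} = edim M"
by (rule ecodim_eq) (rule direct_sum_trivial)

lemma ecodim_self [simp]: "csubspace M ==> ecodim M M = 0"
using ecodim_eq[OF direct_sum_trivial(2)] by simp

lemma edim_eq_0:
assumes "csubspace M" "edim M = 0" shows "M = {0}"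
proof -
obtain B where B: "cindependent B" "cspan B = M"
 using csubspace_basis1[OF assms(1)] by blast
hence "ecard B = 0" using edim_cspan[OF B(1)] assms(2) by simp
hence "B = {}" by (auto simp: ecard_def zero_enat_def split: if_splits)
thus ?thesis using B by simp
qed

lemma ecodim_eq_0:
assumes "csubspace M" "csubspace N" "N <= M" "ecodim M N = 0" shows "M = N"
proof -
obtain C where C: "direct_sum N C M" using direct_sum_ex[OF assms(2,1,3)] by blast
hence "edim C = 0" using ecodim_eq[OF C] assms(4) by simp
hence "C = {0}" using C by (intro edim_eq_0) (simp_all add: direct_sum_alt)
thus ?thesis using C by (simp add: direct_sum_alt set_plus_def)
qed

lemma direct_sumD:
assumes "direct_sum N C M"
shows "csubspace N" "csubspace C" "csubspace M" "N <= M" "C <= M" "N + C = M"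
proof -
have h: "csubspace N" "csubspace C" "N + C = M" using assms by (simp_all add: direct_sum_alt)
thus "csubspace N" "csubspace C" "N + C = M" by simp_all
show "csubspace M" using csubspace_plus[OF h(1,2)] h(3) by simp
show "N <= M" using subset_plus(1)[OF h(2), of N] h(3) by simp
show "C <= M" using subset_plus(2)[OF h(1), of C] h(3) by simp
qed

lemma direct_sum_Int: "direct_sum N C M ==> x : N ==> x : C ==> x = 0"
unfolding direct_sum_alt by (metis IntI singletonD)

lemma direct_sumI:
assumes "csubspace N" "csubspace C" "!!x. x : N ==> x : C ==> x = 0" "N + C = M"
shows "direct_sum N C M"
proof -
have "N Int C = {0}"
proof (rule equalityI)
 show "N Int C <= {0}" using assms(3) by (intro subsetI) (simp only: Int_iff singleton_iff)
 show "{0} <= N Int C" using csubspace_0[OF assms(1)] csubspace_0[OF assms(2)] by simp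
qed
thus ?thesis using assms by (simp add: direct_sum_alt)
qed

text \<open>Codimensions behave like the dimensions of the quotients they stand for: the next three
  lemmas are additivity along a chain of subspaces and the two isomorphism theorems.\<close>

lemma ecodim_chain:
assumes "csubspace L" "csubspace M" "csubspace N" "N <= M" "M <= L"
shows "ecodim L N = ecodim L M + ecodim M N"
proof -
obtain C where C: "direct_sum N C M" using direct_sum_ex[OF assms(3,2,4)] by blast
obtain D where D: "direct_sum M D L" using direct_sum_ex[OF assms(2,1,5)] by blast
note C' = direct_sumD[OF C] and D' = direct_sumD[OF D]
have CD: "direct_sum C D (C + D)"
 using C'(5) by (intro direct_sumI C'(2) D'(2) refl) (auto intro: direct_sum_Int[OF D])
have "direct_sum N (C + D) L"
proof (rule direct_sumI)
 show "csubspace N" "csubspace (C + D)" using assms C' D' csubspace_plus by simp_all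
 show "N + (C + D) = L" using C'(6) D'(6) by (simp only: add.assoc[symmetric])
 fix x assume x: "x : N" "x : C + D"
 obtain c d where cd: "c : C" "d : D" "x = c + d" using x by (auto elim: set_plus_elim)
 have "x - c : M" using x cd C'(4,5) by (intro csubspace_diff[OF assms(2)]) auto
 hence "d : M" using cd by simp
 hence "d = 0" using cd by (intro direct_sum_Int[OF D])
 thus "x = 0" using x cd by (intro direct_sum_Int[OF C]) auto
qed
hence "ecodim L N = edim (C + D)" by (rule ecodim_eq)
also have "... = edim C + edim D" by (rule edim_direct_sum[OF CD])
finally show ?thesis using ecodim_eq[OF C] ecodim_eq[OF D] by (simp add: add.commute)
qed

lemma ecodim_plus:
assumes "csubspace M" "csubspace N"
shows "ecodim (M + N) N = ecodim M (M Int N)"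
proof -
have sI: "csubspace (M Int N)" using assms by (rule csubspace_Int)
obtain C where C: "direct_sum (M Int N) C M" using direct_sum_ex[OF sI assms(1)] by auto
note C' = direct_sumD[OF C]
have "direct_sum N C (M + N)"
proof (rule direct_sumI)
 show "N + C = M + N"
 proof -
  have "M + N = N + ((M Int N) + C)" using C'(6) by (simp add: add.commute)
  also have "... = (N + (M Int N)) + C" by (simp add: add.assoc)
  also have "N + (M Int N) = N" using plus_absorb(1)[OF assms(2) sI] by simp
  finally show ?thesis by simp
 qed
 show "x = 0" if "x : N" "x : C" for x
  using that C'(5) by (intro direct_sum_Int[OF C]) auto
qed (use assms C' in auto)
thus ?thesis using ecodim_eq[OF C] ecodim_eq by simp
qed

lemma clinear_image_subspace: "clinear f ==> csubspace M ==> csubspace (f ` M)"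
by (simp add: cpair.linear_subspace_image)

lemma clinear_vimage_subspace: "clinear f ==> csubspace M ==> csubspace (f -` M)"
by (simp add: cpair.linear_subspace_vimage)

lemma clinear_0: "clinear f ==> f 0 = 0"
by (simp add: cpair.linear_0)
lemma clinear_diff: "clinear f ==> f (x - y) = f x - f y"
by (simp add: cpair.linear_diff)

lemma clinear_image_plus:
assumes "clinear f" shows "f ` (M + N) = f ` M + f ` N"
proof -
have add: "f (x + y) = f x + f y" for x y using assms by (simp add: clinear_iff)
show ?thesis
proof (intro equalityI subsetI)
 fix z assume "z : f ` (M + N)"
 thus "z : f ` M + f ` N" by (auto simp: add elim!: set_plus_elim intro!: set_plus_intro)
next
 fix z assume "z : f ` M + f ` N"
 then obtain x y where "x : M" "y : N" "z = f (x + y)" by (auto simp: add elim!: set_plus_elim)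
 thus "z : f ` (M + N)" by (auto intro!: imageI set_plus_intro)
qed
qed

lemma csubspace_kernel_on:
assumes "clinear f" "csubspace M" shows "csubspace {x : M. f x = 0}"
using assms by (simp add: csubspace_def clinear_iff clinear_0[OF assms(1)])

lemma edim_image_inj:
assumes "clinear f" "csubspace M" "inj_on f M"
shows "edim (f ` M) = edim M"
proof -
obtain B where B: "cindependent B" "cspan B = M"
 using csubspace_basis1[OF assms(2)] by blast
have "cindependent (f ` B)"
 using cpair.linear_independent_injective_image[OF assms(1) B(1)] B(2) assms(3) by simp
hence "edim (cspan (f ` B)) = ecard (f ` B)" by (rule edim_cspan)
moreover have "ecard (f ` B) = ecard B"
proof -
 have "inj_on f B"
  using inj_on_subset[OF assms(3)] B(2) complex_vector.span_superset[of B] by simp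
 thus ?thesis by (simp add: ecard_def card_image finite_image_iff)
qed
moreover have "cspan (f ` B) = f ` M"
 using cpair.linear_span_image[OF assms(1)] B by simp
ultimately show ?thesis using edim_cspan[OF B(1)] B(2) by simp
qed

lemma ecodim_image:
assumes "clinear f" "csubspace M" "csubspace N" "N <= M"
shows "ecodim (f ` M) (f ` N) = ecodim M (N + {x : M. f x = 0})"
proof -
let ?K = "{x : M. f x = 0}"
have K: "csubspace ?K" by (rule csubspace_kernel_on[OF assms(1,2)])
have NK: "csubspace (N + ?K)" using csubspace_plus assms(3) K by blast
have sub: "N + ?K <= M" by (rule plus_least[OF assms(2,4)]) auto
obtain C where C: "direct_sum (N + ?K) C M" using direct_sum_ex[OF NK assms(2) sub] by blast
note C' = direct_sumD[OF C]
have fK: "f ` (N + ?K) = f ` N"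
proof -
 have "f ` ?K = {0}" using csubspace_0[OF K] clinear_0[OF assms(1)] by (auto intro!: image_eqI[of _ _ 0])
 hence "f ` (N + ?K) = f ` N + {0}" by (simp only: clinear_image_plus[OF assms(1)])
 thus ?thesis by (simp add: set_plus_def)
qed
have inter: "c = 0" if c: "c : C" "n : N" "f c = f n" for c n
proof -
 have "c - n : ?K"
  using c C'(5) assms(4) by (auto simp: clinear_diff[OF assms(1)] intro!: csubspace_diff[OF assms(2)])
 hence "n + (c - n) : N + ?K" using c by (intro set_plus_intro)
 thus "c = 0" using c by (intro direct_sum_Int[OF C]) simp_all
qed
have inj: "inj_on f C"
proof (rule inj_onI)
 fix x y assume xy: "x : C" "y : C" "f x = f y"
 have "x - y = 0"
  using xy inter[of "x - y" 0] csubspace_0[OF assms(3)]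
  by (simp add: csubspace_diff[OF C'(2)] clinear_diff[OF assms(1)] clinear_0[OF assms(1)])
 thus "x = y" by simp
qed
have "direct_sum (f ` N) (f ` C) (f ` M)"
proof (rule direct_sumI)
 show "f ` N + f ` C = f ` M"
  using C'(6) fK clinear_image_plus[OF assms(1), of "N + ?K" C] by simp
 show "x = 0" if x: "x : f ` N" "x : f ` C" for x
 proof -
  obtain n c where nc: "n : N" "c : C" "x = f n" "x = f c" using x by blast
  hence "c = 0" using inter by metis
  thus ?thesis using nc clinear_0[OF assms(1)] by simp
 qed
qed (use assms(1,3) C'(2) in "auto intro: clinear_image_subspace")
hence "ecodim (f ` M) (f ` N) = edim (f ` C)" by (rule ecodim_eq)
also have "... = edim C" by (rule edim_image_inj[OF assms(1) C'(2) inj])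
finally show ?thesis using ecodim_eq[OF C] by simp
qed

lemma edim_finite_iff: "edim V < oo <-> (EX B. finite B & cspan B = V)"
by (simp add: edim_def)

lemma edim_mono:
assumes "csubspace M" "csubspace N" "N <= M" shows "edim N <= edim M"
proof -
have "edim M = ecodim M N + ecodim N {0}"
 using ecodim_chain[OF assms(1,2) csubspace_zero] ecodim_zero[OF assms(1)] assms
  csubspace_0[OF assms(2)] by simp
thus ?thesis using ecodim_zero[OF assms(2)] by (simp add: le_iff_add add.commute)
qed

lemma ecodim_mono1:
assumes "csubspace L" "csubspace M" "csubspace N" "N <= M" "M <= L"
shows "ecodim M N <= ecodim L N"
using ecodim_chain[OF assms] by simp

lemma ecodim_mono2:
assumes "csubspace L" "csubspace M" "csubspace N" "N <= M" "M <= L"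
shows "ecodim L M <= ecodim L N"
using ecodim_chain[OF assms] by simp

lemma ecodim_le_edim:
assumes "csubspace M" "csubspace N" "N <= M"
shows "ecodim M N <= edim M"
using ecodim_mono2[OF assms(1,2) csubspace_zero _ assms(3)] ecodim_zero[OF assms(1)]
 csubspace_0[OF assms(2)] by simp

lemma edim_image_le:
assumes "clinear f" "csubspace M" shows "edim (f ` M) <= edim M"
proof -
have "ecodim (f ` M) (f ` {0}) = ecodim M ({0} + {x : M. f x = 0})"
 using assms csubspace_0[OF assms(2)] by (intro ecodim_image) auto
moreover have "{0} + {x : M. f x = 0} = {x : M. f x = 0}"
 by (simp add: set_plus_def)
ultimately have "edim (f ` M) = ecodim M {x : M. f x = 0}"
 using ecodim_zero[OF clinear_image_subspace[OF assms]] clinear_0[OF assms(1)] by simp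
thus ?thesis
 using ecodim_le_edim[OF assms(2) csubspace_kernel_on[OF assms]] by simp
qed

lemma ecodim_image_le:
assumes "clinear f" "csubspace M" "csubspace N" "N <= M"
shows "ecodim (f ` M) (f ` N) <= ecodim M N"
proof -
have K: "csubspace {x : M. f x = 0}" by (rule csubspace_kernel_on[OF assms(1,2)])
show ?thesis
 unfolding ecodim_image[OF assms]
 using assms K by (intro ecodim_mono2 csubspace_plus subset_plus plus_least) auto
qed

lemma ecodim_vimage_le:
assumes "clinear f" "csubspace U" "csubspace V" "csubspace W" "W <= V" "f ` U <= V"
shows "ecodim U {x : U. f x : W} <= ecodim V W"
proof -
let ?P = "{x : U. f x : W}"
have eq: "?P = U Int f -` W" by auto
have P: "csubspace ?P"
 unfolding eq using assms by (intro csubspace_Int clinear_vimage_subspace)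
have fU: "csubspace (f ` U)" using assms by (intro clinear_image_subspace)
have "{x : U. f x = 0} <= ?P" using csubspace_0[OF assms(4)] by auto
hence "?P + {x : U. f x = 0} = ?P"
 by (intro plus_absorb P csubspace_kernel_on assms)
hence "ecodim U ?P = ecodim (f ` U) (f ` ?P)"
 using ecodim_image[OF assms(1,2) P] by simp
also have "f ` ?P = f ` U Int W" by auto
also have "ecodim (f ` U) (f ` U Int W) = ecodim (f ` U + W) W"
 using ecodim_plus[OF fU assms(4)] by simp
also have "... <= ecodim V W"
 using assms fU by (intro ecodim_mono1 csubspace_plus subset_plus plus_least)
finally show ?thesis .
qed

lemma ecodim_Int_le:
assumes "csubspace V" "csubspace W" "csubspace W'" "W <= V" "W' <= V"
shows "ecodim V (W Int W') <= ecodim V W + ecodim V W'"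
proof -
have "ecodim V (W Int W') = ecodim V W + ecodim W (W Int W')"
 using assms by (intro ecodim_chain csubspace_Int) auto
also have "ecodim W (W Int W') = ecodim (W + W') W'"
 using ecodim_plus[OF assms(2,3)] by simp
also have "... <= ecodim V W'"
 using assms by (intro ecodim_mono1 csubspace_plus subset_plus plus_least)
finally show ?thesis by (simp add: add_left_mono)
qed

lemma ecodim_le_edim_supplement:
assumes "csubspace M" "csubspace N" "csubspace G" "N <= M" "M <= N + G"
shows "ecodim M N <= edim G"
proof -
have "ecodim M N <= ecodim (G + N) N"
 using assms by (intro ecodim_mono1 csubspace_plus) (auto simp: add.commute)
also have "... = ecodim G (G Int N)" by (rule ecodim_plus[OF assms(3,2)])
also have "... <= edim G" using assms by (intro ecodim_le_edim csubspace_Int) auto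
finally show ?thesis .
qed

lemma edim_plus_le:
assumes "csubspace M" "csubspace N" shows "edim (M + N) <= edim M + edim N"
proof -
have "edim (M + N) = ecodim (M + N) N + edim N"
 using ecodim_chain[OF csubspace_plus[OF assms] assms(2) csubspace_zero]
  ecodim_zero[OF csubspace_plus[OF assms]] ecodim_zero[OF assms(2)] subset_plus(2)[OF assms(1)]
  csubspace_0[OF assms(2)] by simp
also have "ecodim (M + N) N <= edim M"
 unfolding ecodim_plus[OF assms] using assms by (intro ecodim_le_edim csubspace_Int) auto
finally show ?thesis by (simp add: add_right_mono)
qed

lemma ecodim_finite_supplement:
assumes "csubspace M" "csubspace N" "N <= M" "ecodim M N < oo"
obtains G where "direct_sum N G M" "edim G < oo"
proof -
obtain G where G: "direct_sum N G M" using direct_sum_ex[OF assms(2,1,3)] by blast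
hence "edim G < oo" using assms(4) ecodim_eq[OF G] by simp
thus thesis using that G by blast
qed

section \<open>Counting kernels and cokernels\<close>

lemma ecodim_image_split:
assumes "clinear f" "csubspace V" "f ` V <= V" "csubspace V'" "V' <= V"
shows "ecodim V (f ` V') + ecodim {x : V. f x = 0} ({x : V. f x = 0} Int V') = ecodim V V' + beta V f"
proof -
let ?N = "{x : V. f x = 0}"
have N: "csubspace ?N" by (rule csubspace_kernel_on[OF assms(1,2)])
have "ecodim V (f ` V') = ecodim V (f ` V) + ecodim (f ` V) (f ` V')"
 using assms by (intro ecodim_chain clinear_image_subspace image_mono)
also have "ecodim (f ` V) (f ` V') = ecodim V (V' + ?N)"
 by (rule ecodim_image[OF assms(1,2,4,5)])
finally have 1: "ecodim V (f ` V') = beta V f + ecodim V (V' + ?N)"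
 by (simp add: beta_def)
have "ecodim V V' = ecodim V (V' + ?N) + ecodim (V' + ?N) V'"
 using assms N by (intro ecodim_chain csubspace_plus subset_plus plus_least) auto
also have "ecodim (V' + ?N) V' = ecodim ?N (?N Int V')"
 using ecodim_plus[OF N assms(4)] by (simp add: add.commute)
finally show ?thesis using 1 by (simp add: add_ac)
qed

text \<open>If \<open>f\<close> is injective on \<open>V'\<close>, then the index of \<open>f\<close> is \<open>codim V' - codim f(V')\<close>. This form of the
  index is the one that can be seen to be stable under small perturbations.\<close>

lemma index_via_injective_part:
assumes "clinear f" "csubspace V" "f ` V <= V" "csubspace V'" "V' <= V" "!!x. x : V' ==> f x = 0 ==> x = 0"
shows "ecodim V (f ` V') + alpha V f = ecodim V V' + beta V f"
proof -
have N: "csubspace {x : V. f x = 0}" by (rule csubspace_kernel_on[OF assms(1,2)])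
have "{x : V. f x = 0} Int V' = {0}"
proof
 show "{x : V. f x = 0} Int V' <= {0}" using assms(6) by blast
 show "{0} <= {x : V. f x = 0} Int V'" using csubspace_0[OF N] csubspace_0[OF assms(4)] by simp
qed
thus ?thesis
 using ecodim_image_split[OF assms(1-5)] ecodim_zero[OF N] by (simp add: alpha_def)
qed

lemma index_step:
assumes "clinear f" "csubspace V" "f ` V <= V"
shows "EX e. alpha V f = alpha (f ` V) f + e & beta V f = beta (f ` V) f + e & e <= alpha V f & e <= beta V f"
proof -
let ?N = "{x : V. f x = 0}" let ?e = "ecodim (?N + f ` V) (f ` V)"
have N: "csubspace ?N" by (rule csubspace_kernel_on[OF assms(1,2)])
have fV: "csubspace (f ` V)" by (rule clinear_image_subspace[OF assms(1,2)])
have NfV: "csubspace (?N Int f ` V)" using N fV by (rule csubspace_Int)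
have "?N Int f ` V = {x : f ` V. f x = 0}" using assms(3) by auto
hence "alpha (f ` V) f = ecodim (?N Int f ` V) {0}"
 using ecodim_zero[OF NfV] by (simp add: alpha_def)
moreover have "edim ?N = ecodim ?N (?N Int f ` V) + ecodim (?N Int f ` V) {0}"
 using ecodim_chain[OF N NfV csubspace_zero] ecodim_zero[OF N] csubspace_0[OF NfV] by simp
ultimately have a: "alpha V f = alpha (f ` V) f + ?e"
 using ecodim_plus[OF N fV] by (simp add: alpha_def add.commute)
have sum: "f ` V + ?N <= V" by (rule plus_least[OF assms(2,3)]) auto
have "ecodim V (f ` V) = ecodim V (f ` V + ?N) + ecodim (f ` V + ?N) (f ` V)"
 using sum by (intro ecodim_chain assms csubspace_plus fV N subset_plus)
moreover have "beta (f ` V) f = ecodim V (f ` V + ?N)"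
 unfolding beta_def by (rule ecodim_image[OF assms(1,2) fV assms(3)])
ultimately have b: "beta V f = beta (f ` V) f + ?e"
 by (simp add: beta_def add.commute)
show ?thesis using a b by (intro exI[of _ ?e]) simp
qed

text \<open>Kernel and cokernel both grow by the codimension of \<open>N(f) \<inter> U\<close> in \<open>N(f)\<close>, so the index stays the same.\<close>

lemma index_restrict:
assumes "clinear f" "csubspace V" "f ` V <= V" "csubspace U" "U <= V" "f ` U <= U" "ecodim V U < oo"
shows "EX e<oo. alpha V f = alpha U f + e & beta V f = beta U f + e"
proof -
let ?N = "{x : V. f x = 0}" let ?e = "ecodim ?N (?N Int U)"
have N: "csubspace ?N" by (rule csubspace_kernel_on[OF assms(1,2)])
have NU: "csubspace (?N Int U)" using N assms(4) by (rule csubspace_Int)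
have "?N Int U = {x : U. f x = 0}" using assms(5) by auto
hence "alpha U f = ecodim (?N Int U) {0}"
 using ecodim_zero[OF NU] by (simp add: alpha_def)
moreover have "edim ?N = ecodim ?N (?N Int U) + ecodim (?N Int U) {0}"
 using ecodim_chain[OF N NU csubspace_zero] ecodim_zero[OF N] csubspace_0[OF NU] by simp
ultimately have a: "alpha V f = alpha U f + ?e"
 by (simp add: alpha_def add.commute)
have "?e = ecodim (?N + U) U" using ecodim_plus[OF N assms(4)] by simp
also have "... <= ecodim V U"
 using N assms by (intro ecodim_mono1 csubspace_plus subset_plus plus_least) auto
finally have e: "?e < oo" using assms(7) by (rule le_less_trans)
have "ecodim V (f ` U) + ?e = ecodim V U + beta V f"
 by (rule ecodim_image_split[OF assms(1-5)])
moreover have "ecodim V (f ` U) = ecodim V U + beta U f"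
 unfolding beta_def using assms by (intro ecodim_chain clinear_image_subspace)
ultimately have "ecodim V U + (beta U f + ?e) = ecodim V U + beta V f"
 by (simp add: add.assoc)
hence b: "beta V f = beta U f + ?e" using assms(7) by (auto simp: enat_add_left_cancel)
show ?thesis using a b e by (intro exI[of _ ?e]) simp
qed

section \<open>The Hahn-Banach theorem\<close>

definition sublinear :: "('b::real_vector => real) => bool" where
"sublinear p <-> (ALL x y. p (x + y) <= p x + p y) & (ALL t x. t > 0 --> p (t *\<^sub>R x) <= t * p x)"

lemma sublinearD:
assumes "sublinear p"
shows "p (x + y) <= p x + p y" "t > 0 ==> p (t *\<^sub>R x) = t * p x" "p 0 = 0" "- p (- x) <= p x"
proof -
show 1: "p (x + y) <= p x + p y" for x y using assms by (simp add: sublinear_def)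
have le: "p (t *\<^sub>R x) <= t * p x" if "t > 0" for t x using assms that by (simp add: sublinear_def)
show 2: "p (t *\<^sub>R x) = t * p x" if "t > 0" for t x
 using le[OF that, of x] le[of "1 / t" "t *\<^sub>R x"] that by (simp add: field_simps)
show 0: "p 0 = 0" using 2[of 2 0] by simp
show "- p (- x) <= p x" using 1[of x "- x"] 0 by simp
qed

definition sub_reduce :: "('b::real_vector => real) => 'b => 'b => real" where
"sub_reduce q x y = (INF t\<in>{0..}. q (y + t *\<^sub>R x) - t * q x)"

lemma sub_reduce_lower:
assumes "sublinear q" "t >= 0" shows "sub_reduce q x y <= q (y + t *\<^sub>R x) - t * q x"
proof -
have "- q (- y) <= q (y + t *\<^sub>R x) - t * q x" if "t >= 0" for t
proof -
 have "q (t *\<^sub>R x) = t * q x"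
  using that sublinearD(2,3)[OF assms(1)] by (cases "t = 0") auto
 thus ?thesis using sublinearD(1)[OF assms(1), of "y + t *\<^sub>R x" "- y"] by simp
qed
hence "bdd_below ((%t. q (y + t *\<^sub>R x) - t * q x) ` {0..})"
 by (intro bdd_belowI[of _ "- q (- y)"]) auto
thus ?thesis unfolding sub_reduce_def using assms(2) by (intro cINF_lower) auto
qed

lemma sub_reduce_greatest:
"(!!t. t >= 0 ==> b <= q (y + t *\<^sub>R x) - t * q x) ==> b <= sub_reduce q x y"
unfolding sub_reduce_def by (rule cINF_greatest) auto

text \<open>Lowering a sublinear functional along a direction keeps it sublinear; a minimal one can
  therefore not be lowered any more, which forces it to be additive.\<close>

lemma sublinear_sub_reduce:
assumes "sublinear q" shows "sublinear (sub_reduce q x)"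
proof -
have "sub_reduce q x (y + z) <= sub_reduce q x y + sub_reduce q x z" for y z
proof -
 have "sub_reduce q x (y + z) - (q (z + s *\<^sub>R x) - s * q x) <= q (y + t *\<^sub>R x) - t * q x"
  if st: "s >= 0" "t >= 0" for s t
 proof -
  have "sub_reduce q x (y + z) <= q ((y + z) + (t + s) *\<^sub>R x) - (t + s) * q x"
   using st by (intro sub_reduce_lower assms) simp
  also have "(y + z) + (t + s) *\<^sub>R x = (y + t *\<^sub>R x) + (z + s *\<^sub>R x)"
   by (simp add: algebra_simps)
  also have "q ... <= q (y + t *\<^sub>R x) + q (z + s *\<^sub>R x)" by (rule sublinearD[OF assms])
  finally show ?thesis by (simp add: algebra_simps)
 qed
 hence "sub_reduce q x (y + z) - (q (z + s *\<^sub>R x) - s * q x) <= sub_reduce q x y" if "s >= 0" for s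
  using that by (intro sub_reduce_greatest) auto
 hence "sub_reduce q x (y + z) - sub_reduce q x y <= sub_reduce q x z"
  by (intro sub_reduce_greatest) (simp add: algebra_simps)
 thus ?thesis by simp
qed
moreover have "sub_reduce q x (c *\<^sub>R y) <= c * sub_reduce q x y" if c: "c > 0" for c y
proof -
 have "sub_reduce q x (c *\<^sub>R y) / c <= q (y + t *\<^sub>R x) - t * q x" if t: "t >= 0" for t
 proof -
  have "sub_reduce q x (c *\<^sub>R y) <= q (c *\<^sub>R (y + t *\<^sub>R x)) - (c * t) * q x"
   using sub_reduce_lower[OF assms, of "c * t" x "c *\<^sub>R y"] t c by (simp add: scaleR_add_right)
  thus ?thesis unfolding sublinearD(2)[OF assms c] using c by (simp add: field_simps)
 qed
 hence "sub_reduce q x (c *\<^sub>R y) / c <= sub_reduce q x y" by (rule sub_reduce_greatest)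
 thus ?thesis using c by (simp add: field_simps)
qed
ultimately show ?thesis by (simp add: sublinear_def)
qed

lemma sub_reduce_le: "sublinear q ==> sub_reduce q x y <= q y"
using sub_reduce_lower[of q 0 x y] by simp

lemma sub_reduce_neg: "sublinear q ==> sub_reduce q x (- x) <= - q x"
using sub_reduce_lower[of q 1 x "- x"] sublinearD(3)[of q] by simp

lemma hahn_banach_real:
fixes p :: "'b::real_vector => real"
assumes "sublinear p"
obtains f where "linear f" "!!x. f x <= p x" "f x0 = p x0"
proof -
let ?p = "sub_reduce p x0"
have p: "sublinear ?p" by (rule sublinear_sub_reduce[OF assms])
let ?A = "{q. sublinear q & (ALL x. q x <= ?p x)}" let ?P = "%q q'. ALL x. q' x <= (q x :: real)"
have "EX m:?A. ALL q:?A. ?P m q --> q = m"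
proof (rule predicate_Zorn)
 show "partial_order_on ?A (relation_of ?P ?A)"
  by (rule partial_order_on_relation_ofI) (auto intro: order_trans simp: fun_eq_iff order_eq_iff)
next
 fix C assume C: "C : Chains (relation_of ?P ?A)"
 hence CA: "q : ?A" if "q : C" for q
  using that unfolding Chains_def relation_of_def by blast
 have Cc: "?P q q' | ?P q' q" if "q : C" "q' : C" for q q'
  using C that unfolding Chains_def relation_of_def by blast
 show "EX u:?A. ALL a:C. ?P a u"
 proof (cases "C = {}")
  case True
  thus ?thesis using p by auto
 next
  case False
  define u where "u x = (INF q\<in>C. q x)" for x
  have "bdd_below ((%q. q x) ` C)" for x
  proof (rule bdd_belowI)
   fix r assume "r : (%q. q x) ` C"
   then obtain q where "q : C" "r = q x" by blast
   thus "- ?p (- x) <= r"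
    using CA[of q] sublinearD(4)[of q x] by (smt (verit, ccfv_SIG) mem_Collect_eq)
  qed
  hence low: "u x <= q x" if "q : C" for q x
   unfolding u_def using that by (intro cINF_lower)
  have great: "b <= u x" if "!!q. q : C ==> b <= q x" for b x
   unfolding u_def using that False by (intro cINF_greatest)
  have "u (x + y) <= u x + u y" for x y
  proof -
   have "u (x + y) - q' y <= q x" if q: "q : C" "q' : C" for q q'
   proof -
    obtain r where r: "r : C" "r x <= q x" "r y <= q' y" using Cc[OF q] q by (metis order_refl)
    have "u (x + y) <= r x + r y"
     using low[OF r(1), of "x + y"] sublinearD(1)[of r x y] CA[OF r(1)] by simp
    thus ?thesis using r by simp
   qed
   hence "u (x + y) - q' y <= u x" if "q' : C" for q' using that by (intro great)
   hence "u (x + y) - u x <= u y" by (intro great) (simp add: algebra_simps)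
   thus ?thesis by simp
  qed
  moreover have "u (t *\<^sub>R x) <= t * u x" if t: "t > 0" for t x
  proof -
   have "u (t *\<^sub>R x) / t <= q x" if q: "q : C" for q
    using low[OF q, of "t *\<^sub>R x"] sublinearD(2)[of q t x] CA[OF q] t by (simp add: field_simps)
   hence "u (t *\<^sub>R x) / t <= u x" by (rule great)
   thus ?thesis using t by (simp add: field_simps)
  qed
  moreover have "u x <= ?p x" for x
  proof -
   obtain q where q: "q : C" using False by blast
   show ?thesis using low[OF q, of x] CA[OF q] by (smt (verit) mem_Collect_eq)
  qed
  ultimately have "u : ?A" by (simp add: sublinear_def)
  thus ?thesis using low by (intro bexI[of _ u]) auto
 qed
qed
then obtain m where mA: "m : ?A" and mmin: "ALL q:?A. ?P m q --> q = m" by (rule bexE)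
hence m: "sublinear m" "!!x. m x <= ?p x" by simp_all
have min: "q = m" if q: "sublinear q" "!!x. q x <= m x" for q
proof -
 have "q : ?A" using q(1) order_trans[OF q(2) m(2)] by simp
 thus ?thesis using mmin q(2) by simp
qed
have red: "sub_reduce m x = m" for x
 by (rule min) (simp_all add: sublinear_sub_reduce sub_reduce_le m)
have add: "m (x + y) = m x + m y" for x y
proof (rule antisym)
 show "m (x + y) <= m x + m y" by (rule sublinearD[OF m(1)])
 show "m x + m y <= m (x + y)"
  using sub_reduce_lower[OF m(1), of 1 x y] red[of x] by (simp add: add.commute)
qed
have neg: "m (- x) = - m x" for x using add[of x "- x"] sublinearD(3)[OF m(1)] by simp
have "linear m"
proof (rule linearI)
 show "m (x + y) = m x + m y" for x y by (rule add)
 show "m (t *\<^sub>R x) = t *\<^sub>R m x" for t x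
 proof -
  consider "t > 0" | "t = 0" | "- t > 0" by linarith
  thus ?thesis
  proof cases
   case 3
   hence "m ((- t) *\<^sub>R x) = (- t) * m x" by (rule sublinearD(2)[OF m(1)])
   thus ?thesis using neg[of "t *\<^sub>R x"] by simp
  qed (use sublinearD[OF m(1)] in auto)
 qed
qed
moreover have le: "m x <= p x" for x
 using m(2)[of x] sub_reduce_le[OF assms, of x0 x] by linarith
moreover have "m x0 = p x0"
 using m(2)[of "- x0"] sub_reduce_neg[OF assms, of x0] neg[of x0] le[of x0] by linarith
ultimately show thesis using that by blast
qed

lemma csubspace_imp_subspace: "csubspace M ==> subspace M"
by (simp add: subspace_def csubspace_def scaleR_scaleC)

lemma infdist_csubspace:
assumes "csubspace M"
shows "infdist (x + y) M <= infdist x M + infdist y M" "c ~= 0 ==> infdist (c *: x) M <= cmod c * infdist x M"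
proof -
have ne: "M ~= {}" using csubspace_0[OF assms] by blast
have le: "infdist x M <= norm (x - m)" if "m : M" for x m
 using infdist_le[OF that] by (simp add: dist_norm)
have great: "b <= infdist x M" if "!!m. m : M ==> b <= norm (x - m)" for b x
 unfolding infdist_notempty[OF ne] using that ne by (intro cINF_greatest) (auto simp: dist_norm)
show "infdist (x + y) M <= infdist x M + infdist y M"
proof -
 have "infdist (x + y) M - norm (y - m') <= norm (x - m)" if m: "m : M" "m' : M" for m m'
 proof -
  have "infdist (x + y) M <= norm ((x + y) - (m + m'))"
   using m assms by (intro le csubspace_add)
  also have "... <= norm (x - m) + norm (y - m')" by (rule norm_diff_triangle_ineq)
  finally show ?thesis by simp
 qed
 hence "infdist (x + y) M - norm (y - m') <= infdist x M" if "m' : M" for m'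
  using that by (intro great)
 hence "infdist (x + y) M - infdist x M <= infdist y M"
  by (intro great) (simp add: algebra_simps)
 thus ?thesis by simp
qed
show "infdist (c *: x) M <= cmod c * infdist x M" if c: "c ~= 0"
proof -
 have "infdist (c *: x) M <= cmod c * norm (x - m)" if m: "m : M" for m
  using le[OF csubspace_scale[OF assms m], of "c *: x" c]
  by (simp only: scaleC_diff_right[symmetric] norm_scaleC)
 hence "infdist (c *: x) M / cmod c <= infdist x M" using c by (intro great) (simp add: field_simps)
 thus ?thesis using c by (simp add: field_simps)
qed
qed

text \<open>A complex functional is determined by its real part \<open>f\<close> as \<open>f x - i f (i x)\<close>; dominating \<open>f\<close>
  by the distance to \<open>M\<close> makes it vanish on \<open>M\<close>.\<close>

lemma hahn_banach_separation:
fixes M :: "'a::complex_banach set"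
assumes "csubspace M" "closed M" "x0 \<notin> M"
obtains g :: "'a => complex"
where "bounded_linear g" "!!c x. g (c *: x) = c * g x" "!!x. x : M ==> g x = 0" "g x0 = 1"
proof -
let ?p = "%x. infdist x M"
have "sublinear ?p"
 unfolding sublinear_def
proof (intro conjI allI impI)
 show "?p (x + y) <= ?p x + ?p y" for x y by (rule infdist_csubspace[OF assms(1)])
 show "?p (t *\<^sub>R x) <= t * ?p x" if "t > 0" for t x
  using infdist_csubspace(2)[OF assms(1), of "complex_of_real t" x] that by (simp add: scaleR_scaleC)
qed
then obtain f where f: "linear f" "!!x. f x <= ?p x" "f x0 = ?p x0" using hahn_banach_real by blast
have ne: "M ~= {}" using csubspace_0[OF assms(1)] by blast
have pos: "f x0 > 0" using infdist_pos_not_in_closed[OF assms(2) ne assms(3)] f(3) by simp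
have pn: "?p x <= norm x" for x
 using infdist_le[OF csubspace_0[OF assms(1)], of x] by simp
have fM: "f x = 0" if "x : M" for x
 using f(2)[of x] f(2)[of "- x"] that csubspace_neg[OF assms(1) that] linear_neg[OF f(1), of x] by simp
have fb: "\<bar>f x\<bar> <= norm x" for x
 using f(2)[of x] f(2)[of "- x"] pn[of x] pn[of "- x"] linear_neg[OF f(1), of x] by simp
define h where "h x = Complex (f x) (- f (\<i> *: x))" for x
have hadd: "h (x + y) = h x + h y" for x y
 by (simp add: h_def complex_eq_iff scaleC_add_right linear_add[OF f(1)])
have ii: "\<i> *: \<i> *: x = - x" for x by (simp add: scaleC_scaleC)
have hre: "h (t *\<^sub>R x) = t *\<^sub>R h x" for t x
proof -
 have "\<i> *: t *\<^sub>R x = t *\<^sub>R (\<i> *: x)" by (simp add: scaleR_scaleC scaleC_scaleC mult.commute)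
 thus ?thesis by (simp add: h_def complex_eq_iff linear_scale[OF f(1)])
qed
have hi: "h (\<i> *: x) = \<i> * h x" for x
 by (simp add: h_def complex_eq_iff ii linear_neg[OF f(1)])
have hsc: "h (c *: x) = c * h x" for c x
proof -
 have "c *: x = Re c *\<^sub>R x + Im c *\<^sub>R (\<i> *: x)"
  by (simp add: scaleR_scaleC scaleC_scaleC scaleC_add_left[symmetric] complex_eq[of c, symmetric] mult.commute)
 hence "h (c *: x) = Re c *\<^sub>R h x + Im c *\<^sub>R (\<i> * h x)" by (simp add: hadd hre hi)
 also have "... = c * h x" by (simp add: complex_eq_iff algebra_simps)
 finally show ?thesis .
qed
have hbd: "cmod (h x) <= norm x * 2" for x
proof -
 have "cmod (h x) <= \<bar>Re (h x)\<bar> + \<bar>Im (h x)\<bar>" by (rule cmod_le)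
 also have "... <= norm x + norm (\<i> *: x)"
  using fb[of x] fb[of "\<i> *: x"] by (simp add: h_def)
 finally show ?thesis by (simp add: norm_scaleC)
qed
have bl: "bounded_linear h"
 by (rule bounded_linear_intro[OF hadd hre hbd])
have ne0: "h x0 ~= 0" using pos by (auto simp: h_def complex_eq_iff)
show thesis
proof (rule that[of "%x. inverse (h x0) * h x"])
 show "bounded_linear (%x. inverse (h x0) * h x)"
  by (rule bounded_linear_compose[OF bounded_linear_mult_right bl])
 show "inverse (h x0) * h x = 0" if "x : M" for x
  using fM[OF that] fM[OF csubspace_scale[OF assms(1) that]] by (simp add: h_def complex_eq_iff)
qed (use ne0 in "auto simp: hsc")
qed

section \<open>The open mapping theorem and closed subspaces\<close>

text \<open>If every \<open>y \<in> N\<close> is hit by \<open>f\<close> up to an error of half its norm that lies in \<open>N\<close> again,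
  then summing up the successive corrections solves \<open>f x = y\<close> exactly.\<close>

lemma approx_onto:
fixes f :: "'b::banach => 'c::real_normed_vector"
assumes f: "bounded_linear f" and M: "subspace M" "closed M" and k: "k >= 0"
 and ap: "!!y. y : N ==> EX x:M. norm x <= k * norm y & y - f x : N & norm (y - f x) <= norm y / 2"
 and y: "y : N"
shows "EX x:M. f x = y & norm x <= 2 * k * norm y"
proof -
obtain g where g: "!!y. y : N ==> g y : M" "!!y. y : N ==> norm (g y) <= k * norm y"
 "!!y. y : N ==> y - f (g y) : N" "!!y. y : N ==> norm (y - f (g y)) <= norm y / 2"
 using ap by metis
define r where "r n = ((%y. y - f (g y)) ^^ n) y" for n
have rS: "r (Suc n) = r n - f (g (r n))" for n by (simp add: r_def)
have r0: "r 0 = y" by (simp add: r_def)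
have rN: "r n : N" for n by (induction n) (simp_all add: r0 rS y g)
have rn: "norm (r n) <= norm y * (1/2) ^ n" for n
proof (induction n)
 case (Suc n)
 have "norm (r (Suc n)) <= norm (r n) / 2" unfolding rS by (rule g(4)[OF rN])
 thus ?case using Suc by simp
qed (simp add: r0)
have gn: "norm (g (r n)) <= k * norm y * (1/2) ^ n" for n
proof -
 have "norm (g (r n)) <= k * norm (r n)" by (rule g(2)[OF rN])
 also have "... <= k * (norm y * (1/2) ^ n)" by (rule mult_left_mono[OF rn k])
 finally show ?thesis by simp
qed
have geo: "summable (%n. k * norm y * (1/2::real) ^ n)" by (intro summable_mult summable_geometric) simp
have sm: "summable (%n. norm (g (r n)))"
 by (rule summable_comparison_test'[OF geo, of 0]) (use gn in auto)
hence sm': "summable (%n. g (r n))" by (rule summable_norm_cancel)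
define x where "x = (\<Sum>n. g (r n))"
have lim: "(%n. \<Sum>i<n. g (r i)) \<longlonglongrightarrow> x" unfolding x_def by (rule summable_LIMSEQ[OF sm'])
have "x : M"
 by (rule closed_sequentially[OF M(2) _ lim]) (use g(1)[OF rN] M(1) in "auto intro: subspace_sum")
moreover have "f x = y"
proof -
 have part: "f (\<Sum>i<n. g (r i)) = y - r n" for n
  by (induction n) (simp_all add: r0 rS linear_0[OF bounded_linear.linear[OF f]] linear_add[OF bounded_linear.linear[OF f]])
 have "(%n. norm y * (1/2::real) ^ n) \<longlonglongrightarrow> 0"
  by (intro tendsto_mult_right_zero LIMSEQ_power_zero) simp
 hence "r \<longlonglongrightarrow> 0"
  by (rule Lim_null_comparison[rotated]) (use rn in "auto intro!: always_eventually")
 hence "(%n. y - r n) \<longlonglongrightarrow> y - 0" by (intro tendsto_intros)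
 hence "(%n. f (\<Sum>i<n. g (r i))) \<longlonglongrightarrow> y" by (simp add: part)
 moreover have "(%n. f (\<Sum>i<n. g (r i))) \<longlonglongrightarrow> f x" by (rule bounded_linear.tendsto[OF f lim])
 ultimately show ?thesis using LIMSEQ_unique by blast
qed
moreover have "norm x <= 2 * k * norm y"
proof -
 have "norm x <= (\<Sum>n. norm (g (r n)))" unfolding x_def by (rule summable_norm[OF sm])
 also have "... <= (\<Sum>n. k * norm y * (1/2) ^ n)" by (rule suminf_le[OF gn sm geo])
 also have "... = k * norm y * 2" by (subst suminf_mult) (auto simp: suminf_geometric summable_geometric)
 finally show ?thesis by simp
qed
ultimately show ?thesis by blast
qed

text \<open>Baire's theorem in the complete space \<open>f ` M\<close> makes \<open>f\<close> approximately onto on a ball, and \<open>approx_onto\<close>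
  turns approximate solutions into exact ones.\<close>

lemma open_mapping:
fixes f :: "'b::banach => 'c::banach"
assumes f: "bounded_linear f" and M: "subspace M" "closed M" and N: "closed (f ` M)"
obtains k where "k > 0" "!!y. y : f ` M ==> EX x:M. f x = y & norm x <= k * norm y"
proof -
have lin: "linear f" by (rule bounded_linear.linear[OF f])
have sN: "subspace (f ` M)" by (rule linear_subspace_image[OF lin M(1)])
let ?X = "top_of_set (f ` M)" let ?S = "%n::nat. closure (f ` (M Int cball 0 (real n)))"
have SN: "?S n <= f ` M" for n by (rule closure_minimal[OF _ N]) auto
have un: "\<Union>(range ?S) = f ` M"
proof (rule equalityI)
 show "\<Union>(range ?S) <= f ` M" using SN by (intro UN_least)
 show "f ` M <= \<Union>(range ?S)"
 proof
  fix y assume "y : f ` M"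
  then obtain x where x: "x : M" "y = f x" by blast
  obtain n where "norm x <= real n" using real_arch_simple by blast
  hence "y : f ` (M Int cball 0 (real n))" using x by simp
  hence "y : ?S n" using closure_subset[of "f ` (M Int cball 0 (real n))"] by (rule rev_subsetD)
  thus "y : \<Union>(range ?S)" by (intro UnionI[of "?S n"]) auto
 qed
qed
have cm: "completely_metrizable_space ?X"
 by (rule completely_metrizable_space_closedin) (auto simp: completely_metrizable_space_euclidean N)
have "EX n. ?X interior_of (?S n) ~= {}"
proof (rule ccontr)
 assume "~ ?thesis"
 moreover have "closedin ?X (?S n)" for n by (rule closed_subset[OF SN]) simp
 ultimately have "?X interior_of (\<Union>(range ?S)) = {}"
  by (intro Baire_category_alt disjI1 cm) auto
 moreover have "?X interior_of (f ` M) = f ` M"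
  using interior_of_topspace[of ?X] by simp
 ultimately show False using un subspace_0[OF sN] by auto
qed
then obtain n y0 where "y0 : ?X interior_of (?S n)" by blast
then obtain U where U: "openin ?X U" "y0 : U" "U <= ?S n" unfolding interior_of_def by blast
obtain e where e: "e > 0" "ball y0 e Int f ` M <= U" and y0: "y0 : f ` M"
 using U(1,2) unfolding openin_contains_ball by blast
have small: "EX x:M. norm x <= 2 * real n & norm (y - f x) <= d" if y: "y : f ` M" "norm y < e" and d: "d > 0" for y d
proof -
 have "y0 + y : ball y0 e Int f ` M"
  using y subspace_add[OF sN y0 y(1)] by (simp add: dist_norm)
 hence mem: "y0 + y : ?S n" "y0 : ?S n"
  using subsetD[OF e(2)] subsetD[OF U(3)] U(2) by auto
 obtain a where a: "a : M" "norm a <= real n" "dist (f a) (y0 + y) < d / 2"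
  using mem(1) half_gt_zero[OF d] unfolding closure_approachable by fastforce
 obtain b where b: "b : M" "norm b <= real n" "dist (f b) y0 < d / 2"
  using mem(2) half_gt_zero[OF d] unfolding closure_approachable by fastforce
 have "norm (y - f (a - b)) <= dist (f a) (y0 + y) + dist (f b) y0"
 proof -
  have eq: "y - f (a - b) = (f b - y0) - (f a - (y0 + y))" by (simp add: linear_diff[OF lin])
  show ?thesis unfolding eq dist_norm by (subst add.commute) (rule norm_triangle_ineq4)
 qed
 moreover have "norm (a - b) <= 2 * real n" using norm_triangle_ineq4[of a b] a b by simp
 moreover have "a - b : M" using a b M by (intro subspace_diff)
 ultimately show ?thesis using a b by (intro bexI[of _ "a - b"]) auto
qed
define k where "k = 4 * real n / e"
have k0: "k >= 0" using e by (simp add: k_def)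
have ap: "EX x:M. norm x <= k * norm y & y - f x : f ` M & norm (y - f x) <= norm y / 2" if y: "y : f ` M" for y
proof (cases "y = 0")
 case True
 thus ?thesis using subspace_0[OF M(1)] subspace_0[OF sN] by (intro bexI[of _ 0]) (auto simp: linear_0[OF lin])
next
 case False
 define t where "t = e / (2 * norm y)"
 have t: "t > 0" using e False by (simp add: t_def)
 have "norm (t *\<^sub>R y) < e" using e False by (simp add: t_def)
 then obtain x where x: "x : M" "norm x <= 2 * real n" "norm (t *\<^sub>R y - f x) <= t * norm y / 2"
  using small[of "t *\<^sub>R y" "t * norm y / 2"] subspace_scale[OF sN y] t False by auto
 let ?x = "(1 / t) *\<^sub>R x"
 have xM: "?x : M" using x M by (intro subspace_scale)
 have "y - f ?x = (1 / t) *\<^sub>R (t *\<^sub>R y - f x)" using t by (simp add: linear_scale[OF lin] algebra_simps)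
 hence "norm (y - f ?x) = (1 / t) * norm (t *\<^sub>R y - f x)" using t by simp
 also have "... <= (1 / t) * (t * norm y / 2)" using t x(3) by (intro mult_left_mono) auto
 finally have 1: "norm (y - f ?x) <= norm y / 2" using t by simp
 have "norm ?x = norm x / t" using t by simp
 also have "... <= 2 * real n / t" using x(2) t by (intro divide_right_mono) auto
 also have "... = k * norm y" using e by (simp add: k_def t_def)
 finally show ?thesis using 1 xM y by (intro bexI[of _ ?x]) (auto intro!: subspace_diff[OF sN])
qed
have "EX x:M. f x = y & norm x <= (2 * k + 1) * norm y" if y: "y : f ` M" for y
proof -
 obtain x where "x : M" "f x = y" and x: "norm x <= 2 * k * norm y"
  using approx_onto[OF f M k0 ap y] by blast
 have "2 * k * norm y <= (2 * k + 1) * norm y" by (simp add: distrib_right)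
 hence "norm x <= (2 * k + 1) * norm y" by (rule order_trans[OF x])
 thus ?thesis using \<open>x : M\<close> \<open>f x = y\<close> by blast
qed
thus thesis using that[of "2 * k + 1"] k0 by simp
qed

lemma bounded_clinearD:
assumes "bounded_clinear T" shows "bounded_linear T" "clinear T"
proof -
show "bounded_linear T" using assms by (simp add: bounded_clinear_def)
hence "T (x + y) = T x + T y" for x y by (rule linear_add[OF bounded_linear.linear])
thus "clinear T" using assms by (intro clinearI) (simp_all add: bounded_clinear_def)
qed

lemma closed_plus_line:
assumes "csubspace M" "closed M" shows "closed (M + cspan {b})"
proof (cases "b : M")
case True
hence "cspan {b} <= M" using assms(1) by (intro complex_vector.span_minimal) auto
hence "M + cspan {b} = M" by (intro plus_absorb assms) auto
thus ?thesis using assms by simp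
next
case False
obtain g :: "'a => complex" where g: "bounded_linear g" "!!c x. g (c *: x) = c * g x"
 "!!x. x : M ==> g x = 0" "g b = 1"
 using hahn_banach_separation[OF assms False] by blast
have gadd: "g (x + y) = g x + g y" for x y by (rule linear_add[OF bounded_linear.linear[OF g(1)]])
have "M + cspan {b} = (%y. y - g y *: b) -` M"
proof (intro equalityI subsetI)
 fix y assume "y : M + cspan {b}"
 then obtain m c where m: "m : M" "y = m + c *: b"
  by (auto simp: complex_vector.span_singleton elim!: set_plus_elim)
 hence "g y = c" by (simp add: gadd g)
 thus "y : (%y. y - g y *: b) -` M" using m by simp
next
 fix y assume "y : (%y. y - g y *: b) -` M"
 hence "(y - g y *: b) + g y *: b : M + cspan {b}"
  by (intro set_plus_intro) (auto simp: complex_vector.span_singleton)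
 thus "y : M + cspan {b}" by simp
qed
moreover have "closed ((%y. y - g y *: b) -` M)"
proof (rule closed_vimage[OF assms(2)])
 have "bounded_linear (%c. c *: b)"
  by (rule bounded_linear_intro[of _ "norm b"])
   (simp_all add: scaleC_add_left norm_scaleC scaleR_scaleC scaleC_scaleC scaleR_conv_of_real)
 hence "bounded_linear (%y. g y *: b)" by (rule bounded_linear_compose[OF _ g(1)])
 thus "continuous_on UNIV (%y. y - g y *: b)"
  by (intro continuous_on_diff continuous_on_id linear_continuous_on)
qed
ultimately show ?thesis by simp
qed

lemma closed_plus_findim:
assumes "csubspace M" "closed M" "edim G < oo" shows "closed (M + G)"
proof -
obtain B where B: "finite B" "cspan B = G" using assms(3) edim_finite_iff by blast
have "closed (M + cspan B)" using B(1)
proof induction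
 case empty
 thus ?case using assms by (simp add: set_plus_def)
next
 case (insert b B)
 have "M + cspan (insert b B) = (M + cspan B) + cspan {b}"
  using cspan_Un[of B "{b}"] by (simp add: add.assoc)
 thus ?case
  using closed_plus_line[OF csubspace_plus[OF assms(1)] insert.IH] by simp
qed
thus ?thesis using B by simp
qed

lemma findim_closed:
assumes "edim G < oo" shows "closed G"
using closed_plus_findim[OF csubspace_zero _ assms] by (simp add: set_plus_def)

text \<open>The common kernel of the functionals dual to a basis of \<open>Z\<close>.\<close>

lemma closed_complement_UNIV:
assumes "edim Z < oo"
shows "EX W. closed W & direct_sum Z W UNIV"
proof -
obtain B0 where B0: "finite B0" "cspan B0 = Z" using assms edim_finite_iff by blast
obtain B where B: "B <= B0" "cindependent B" "B0 <= cspan B"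
 by (rule complex_vector.maximal_independent_subset) (rule that)
have fB: "finite B" and sB: "cspan B = Z"
 using finite_subset[OF B(1) B0(1)] complex_vector.span_eq[of B B0] B(1,3) B0(2) complex_vector.span_superset[of B0] by auto
have "EX g. bounded_linear g & (ALL c x. g (c *: x) = c * g x) & (ALL x:cspan (B - {b}). g x = 0) & g b = 1" if b: "b : B" for b
proof (rule hahn_banach_separation[OF complex_vector.subspace_span])
 have "edim (cspan (B - {b})) < oo" using fB edim_finite_iff by blast
 thus "closed (cspan (B - {b}))" by (rule findim_closed)
 show "b \<notin> cspan (B - {b})" using B(2) b unfolding complex_vector.dependent_def by blast
qed blast
then obtain g where g: "!!b. b : B ==> bounded_linear (g b)" "!!b c x. b : B ==> g b (c *: x) = c * g b x"
 "!!b x. b : B ==> x : cspan (B - {b}) ==> g b x = 0" "!!b. b : B ==> g b b = 1" by metis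
have dual: "g b (\<Sum>a\<in>B. c a *: a) = c b" if b: "b : B" for b c
proof -
 have "g b (c a *: a) = (if a = b then c b else 0)" if "a : B" for a
  using g(2,4)[OF b] g(3)[OF b complex_vector.span_base, of a] that by auto
 thus ?thesis using b fB by (simp add: linear_sum[OF bounded_linear.linear[OF g(1)[OF b]]])
qed
let ?W = "{x. ALL b:B. g b x = 0}"
have "?W = (\<Inter>b\<in>B. {x. g b x = 0})" by auto
hence cl: "closed ?W"
 by (simp add: closed_INT closed_Collect_eq linear_continuous_on g(1) continuous_on_const)
have "direct_sum Z ?W UNIV"
proof (rule direct_sumI)
 show "csubspace Z" unfolding sB[symmetric] by (rule complex_vector.subspace_span)
 show "csubspace ?W"
  using g(1)[THEN bounded_linear.linear] by (auto simp: csubspace_def linear_0 linear_add g(2))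
 show "x = 0" if x: "x : Z" "x : ?W" for x
 proof -
  obtain c where c: "x = (\<Sum>a\<in>B. c a *: a)" using x(1) unfolding sB[symmetric] complex_vector.span_finite[OF fB] by blast
  hence "c b = 0" if "b : B" for b using dual[OF that, of c] x(2) that by simp
  thus ?thesis unfolding c by simp
 qed
 have "x : Z + ?W" for x
 proof -
  let ?p = "\<Sum>a\<in>B. g a x *: a"
  have "?p : Z" unfolding sB[symmetric] by (intro complex_vector.span_sum complex_vector.span_scale complex_vector.span_base)
  moreover have "x - ?p : ?W" using dual[of _ "%a. g a x"] g(1)[THEN bounded_linear.linear] by (simp add: linear_diff)
  ultimately have "?p + (x - ?p) : Z + ?W" by (rule set_plus_intro)
  thus ?thesis by simp
 qed
 thus "Z + ?W = UNIV" by blast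
qed
thus ?thesis using cl by blast
qed

lemma closed_complement:
assumes "csubspace V" "closed V" "csubspace Z" "edim Z < oo" "Z <= V"
obtains W where "closed W" "direct_sum Z W V"
proof -
obtain W where W: "closed W" "direct_sum Z W UNIV" using closed_complement_UNIV[OF assms(4)] by blast
note W' = direct_sumD[OF W(2)]
have "direct_sum Z (V Int W) V"
proof (rule direct_sumI)
 show "csubspace (V Int W)" using assms(1) W'(2) by (rule csubspace_Int)
 show "Z + V Int W = V"
 proof (intro equalityI subsetI)
  fix x assume "x : Z + V Int W"
  thus "x : V" using assms(1,5) by (auto elim!: set_plus_elim intro: csubspace_add)
 next
  fix x assume x: "x : V"
  have "x : Z + W" using W'(6) by simp
  then obtain z w where zw: "z : Z" "w : W" "x = z + w" by (auto elim: set_plus_elim)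
  have "x - z : V" using x zw assms(5) by (intro csubspace_diff[OF assms(1)]) auto
  hence "w : V" using zw by simp
  thus "x : Z + V Int W" using zw by (auto intro: set_plus_intro)
 qed
qed (use assms(3) direct_sum_Int[OF W(2)] in auto)
thus thesis using that[of "V Int W"] W(1) assms(2) by (simp add: closed_Int)
qed

lemma bounded_linear_pair_sum:
fixes f :: "'b::real_normed_vector => 'c::real_normed_vector"
assumes "bounded_linear f" shows "bounded_linear (%p. f (fst p) + snd p)"
by (intro bounded_linear_add bounded_linear_compose[OF assms] bounded_linear_fst bounded_linear_snd)

lemma image_pair_sum: "(%p. f (fst p) + snd p) ` (V \<times> G) = f ` V + G"
proof (intro equalityI subsetI)
fix y assume "y : f ` V + G"
then obtain x g where "x : V" "g : G" "y = f x + g" by (auto elim!: set_plus_elim)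
thus "y : (%p. f (fst p) + snd p) ` (V \<times> G)" by (intro image_eqI[of _ _ "(x, g)"]) auto
qed (auto intro: set_plus_intro)

lemma open_mapping_plus:
fixes f :: "'a::complex_banach => 'a"
assumes "bounded_linear f" "csubspace V" "closed V" "csubspace G" "closed G" "closed (f ` V + G)"
obtains k where "k > 0"
 "!!y. y : f ` V + G ==> EX x:V. EX g:G. y = f x + g & norm x <= k * norm y & norm g <= k * norm y"
proof -
have sp: "subspace (V \<times> G)" "closed (V \<times> G)"
 by (intro subspace_Times closed_Times csubspace_imp_subspace assms)+
obtain k where k: "k > 0" "!!y. y : f ` V + G ==> EX p:V \<times> G. f (fst p) + snd p = y & norm p <= k * norm y"
 using open_mapping[OF bounded_linear_pair_sum[OF assms(1)], of "V \<times> G", OF sp, unfolded image_pair_sum, OF assms(6)]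
 by blast
have "EX x:V. EX g:G. y = f x + g & norm x <= k * norm y & norm g <= k * norm y" if y: "y : f ` V + G" for y
proof -
 obtain x g where p: "x : V" "g : G" "f x + g = y" "norm (x, g) <= k * norm y" using k(2)[OF y] by auto
 have "norm x <= norm (x, g)" "norm g <= norm (x, g)" using norm_fst_le[of x g] norm_snd_le[of g x] by auto
 thus ?thesis using p by (intro bexI[of _ x] bexI[of _ g]) auto
qed
thus thesis using that k(1) by blast
qed

lemma approx_onto_plus:
fixes f :: "'a::complex_banach => 'a"
assumes "bounded_linear f" "csubspace V" "closed V" "csubspace G" "closed G" "k >= 0"
 and ap: "!!y. y : N ==> EX x:V. EX g:G. norm x <= k * norm y & norm g <= k * norm y &
  y - (f x + g) : N & norm (y - (f x + g)) <= norm y / 2"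
shows "N <= f ` V + G"
proof
fix y assume y: "y : N"
have "EX p:V \<times> G. f (fst p) + snd p = y & norm p <= 2 * (2 * k) * norm y"
proof (rule approx_onto[OF bounded_linear_pair_sum[OF assms(1)] _ _ _ _ y])
 show "subspace (V \<times> G)" "closed (V \<times> G)"
  by (intro subspace_Times closed_Times csubspace_imp_subspace assms)+
 show "0 <= 2 * k" using assms by simp
 fix y assume "y : N"
 then obtain x g where xg: "x : V" "g : G" "norm x <= k * norm y" "norm g <= k * norm y"
  "y - (f x + g) : N" "norm (y - (f x + g)) <= norm y / 2" using ap by blast
 have "norm (x, g) <= 2 * k * norm y" using norm_Pair_le[of x g] xg by simp
 thus "EX p:V \<times> G. norm p <= 2 * k * norm y & y - (f (fst p) + snd p) : N &
   norm (y - (f (fst p) + snd p)) <= norm y / 2"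
  using xg by (intro bexI[of _ "(x, g)"]) auto
qed
thus "y : f ` V + G" by (force intro: set_plus_intro)
qed

text \<open>By the open mapping theorem for \<open>(x, g) \<mapsto> f x + g\<close>, the component in \<open>G\<close> depends continuously on the sum;
  so it is zero for limits of points of the range.\<close>

lemma range_closed:
fixes f :: "'a::complex_banach => 'a"
assumes f: "bounded_linear f" and V: "csubspace V" "closed V" and G: "csubspace G" "closed G"
 and int: "!!x. x : f ` V ==> x : G ==> x = 0" and cl: "closed (f ` V + G)"
shows "closed (f ` V)"
proof -
note lin = bounded_linear.linear[OF f]
obtain k where k: "k > 0"
 "!!y. y : f ` V + G ==> EX x:V. EX g:G. y = f x + g & norm x <= k * norm y & norm g <= k * norm y"
 using open_mapping_plus[OF f V G cl] by blast
have sV: "subspace (f ` V)" by (rule linear_subspace_image[OF lin csubspace_imp_subspace[OF V(1)]])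
show ?thesis unfolding closed_sequential_limits
proof (intro allI impI, elim conjE)
 fix y l assume y: "ALL n. y n : f ` V" "y \<longlonglongrightarrow> l"
 have yFG: "y n : f ` V + G" for n using y(1) subset_plus(1)[OF G(1)] by auto
 hence "l : f ` V + G" by (rule closed_sequentially[OF cl _ y(2)])
 then obtain x0 g0 where x0: "x0 : V" "g0 : G" "l = f x0 + g0" by (auto elim!: set_plus_elim)
 have bound: "norm g0 <= k * norm (y n - l)" for n
 proof -
  have "(y n - f x0) + (- g0) : f ` V + G"
   using y(1) x0 by (intro set_plus_intro subspace_diff[OF sV] csubspace_neg[OF G(1)]) auto
  then obtain x g where xg: "x : V" "g : G" "y n - f x0 - g0 = f x + g" "norm g <= k * norm (y n - f x0 - g0)"
   using k(2) by (metis diff_conv_add_uminus)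
  have "y n - f x0 - f x = g + g0" using xg(3) by (simp add: algebra_simps)
  moreover have "y n - f x0 - f x : f ` V" using y(1) x0 xg by (intro subspace_diff[OF sV]) auto
  moreover have "g + g0 : G" using xg x0 by (intro csubspace_add[OF G(1)])
  ultimately have "g + g0 = 0" using int by metis
  hence "g = - g0" by (simp add: eq_neg_iff_add_eq_0)
  thus ?thesis using xg(4) by (simp add: x0(3) diff_diff_eq)
 qed
 have "(%n. norm (y n - l)) \<longlonglongrightarrow> 0" using y(2) LIM_zero tendsto_norm_zero by blast
 hence "(%n. k * norm (y n - l)) \<longlonglongrightarrow> 0" by (rule tendsto_mult_right_zero)
 hence "norm g0 <= 0" by (rule LIMSEQ_le_const) (use bound in auto)
 thus "l : f ` V" using x0 by simp
qed
qed

lemma finite_codim_range_closed: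
fixes f :: "'a::complex_banach => 'a"
assumes "bounded_linear f" "clinear f" "csubspace V" "closed V" "csubspace W" "closed W" "f ` V <= W" "ecodim W (f ` V) < oo"
shows "closed (f ` V)"
proof -
obtain G where G: "direct_sum (f ` V) G W" "edim G < oo"
 using ecodim_finite_supplement[OF assms(5) clinear_image_subspace[OF assms(2,3)] assms(7,8)] by blast
show ?thesis
 using range_closed[OF assms(1,3,4) direct_sumD(2)[OF G(1)] findim_closed[OF G(2)] direct_sum_Int[OF G(1)]]
  direct_sumD(6)[OF G(1)] assms(6) by simp
qed

section \<open>The algebra of bounded operators\<close>

typedef (overloaded) 'a cop = "{f :: 'a::complex_banach \<Rightarrow>\<^sub>L 'a. ALL c x. f (c *: x) = c *: f x}"
morphisms blin Op by (rule exI[of _ 0]) simp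

setup_lifting type_definition_cop

lift_definition app :: "'a::complex_banach cop => 'a => 'a" is blinfun_apply .

definition Cop :: "('a::complex_banach => 'a) => 'a cop" where "Cop f = Op (Blinfun f)"

lemma app_Cop: "bounded_clinear f ==> app (Cop f) = f"
unfolding Cop_def app.rep_eq by (subst Op_inverse) (simp_all add: bounded_clinear_def bounded_linear_Blinfun_apply)

lemma bounded_clinear_app [simp]: "bounded_clinear (app t)"
unfolding bounded_clinear_def by transfer (simp add: blinfun.bounded_linear_right)

lemma cop_eqI: "(!!x. app s x = app t x) ==> s = t"
by transfer (rule blinfun_eqI)

lemma app_inject: "app s = app t <-> s = t"
by (auto intro: cop_eqI)

lemmas bounded_linear_app = bounded_clinearD(1)[OF bounded_clinear_app]
lemmas clinear_app = bounded_clinearD(2)[OF bounded_clinear_app]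

lemma app_add: "app t (x + y) = app t x + app t y"
and app_diff: "app t (x - y) = app t x - app t y"
and app_minus: "app t (- x) = - app t x"
and app_0 [simp]: "app t 0 = 0"
and app_scaleC: "app t (c *: x) = c *: app t x"
using bounded_linear.linear[OF bounded_linear_app[of t]] clinear_app[of t]
by (simp_all add: linear_add linear_diff linear_neg linear_0 clinear_iff)

lemma bounded_clinearI:
assumes "!!x y. f (x + y) = f x + f y" "!!c x. f (c *: x) = c *: f x" "!!x. norm (f x) <= K * norm x"
shows "bounded_clinear f"
unfolding bounded_clinear_def
proof
show "bounded_linear f"
 by (rule bounded_linear_intro[of f K]) (use assms in "auto simp: scaleR_scaleC mult.commute")
qed (use assms in auto)

lemma bounded_linear_scaleC: "bounded_linear (%x. c *: x :: 'a::complex_banach)"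
by (rule bounded_linear_intro[of _ "cmod c"]) (simp_all add: scaleC_add_right scaleR_scaleC scaleC_scaleC norm_scaleC mult.commute)

instantiation cop :: (complex_banach) real_normed_vector
begin
lift_definition zero_cop :: "'a cop" is 0 by simp
lift_definition plus_cop :: "'a cop => 'a cop => 'a cop" is "(+)" by (simp add: blinfun.add_left scaleC_add_right)
lift_definition minus_cop :: "'a cop => 'a cop => 'a cop" is "(-)"
by (simp add: blinfun.diff_left scaleC_diff_right)
lift_definition uminus_cop :: "'a cop => 'a cop" is uminus by (simp add: blinfun.minus_left)
lift_definition scaleR_cop :: "real => 'a cop => 'a cop" is scaleR
by (simp add: blinfun.scaleR_left scaleR_scaleC scaleC_scaleC mult.commute)
lift_definition norm_cop :: "'a cop => real" is norm .
definition "dist s t = norm (s - t :: 'a cop)"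
definition "sgn (t :: 'a cop) = inverse (norm t) *\<^sub>R t"
definition "uniformity = (INF e\<in>{0<..}. principal {(x, y :: 'a cop). dist x y < e})"
definition "open S = (ALL x:S. \<forall>\<^sub>F (x', y) in uniformity. x' = x --> (y :: 'a cop) : S)"

lemma app_simps1:
"app 0 x = 0" "app (s + t) x = app s x + app t x" "app (s - t) x = app s x - app t x"
"app (- t) x = - app t x" "app (r *\<^sub>R t) x = r *\<^sub>R app t x"
by (transfer, simp add: blinfun.add_left blinfun.diff_left blinfun.minus_left blinfun.scaleR_left)+

instance
by standard (rule dist_cop_def sgn_cop_def uniformity_cop_def open_cop_def
 | transfer, simp add: algebra_simps norm_triangle_ineq)+
end

lemma norm_app: "norm (app t x) <= norm t * norm x"
by transfer (rule norm_blinfun)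

lemma norm_cop_le: "0 <= b ==> (!!x. norm (app t x) <= b * norm x) ==> norm t <= b"
by transfer (rule norm_blinfun_bound)

instantiation cop :: (complex_banach) real_normed_algebra
begin
lift_definition times_cop :: "'a cop => 'a cop => 'a cop" is blinfun_compose by simp

lemma app_mult: "app (s * t) x = app s (app t x)"
by transfer simp

instance
by standard (auto intro!: cop_eqI simp: app_simps1 app_mult app_add linear_scale[OF bounded_linear.linear[OF bounded_linear_app]]
 | transfer, rule norm_blinfun_compose)+
end

instantiation cop :: (complex_banach) monoid_mult
begin
lift_definition one_cop :: "'a cop" is id_blinfun by simp

lemma app_one: "app 1 x = x"
by transfer simp

instance
by standard (auto intro!: cop_eqI simp: app_mult app_one)
end

text \<open>One inequality for the norm of scalar multiples is enough, since scaling can be undone.\<close>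

lemma norm_eq_scaleC:
fixes s :: "complex => 'b::real_normed_vector => 'b"
assumes "!!a x. norm (s a x) <= cmod a * norm x" "!!a x. a ~= 0 ==> s (inverse a) (s a x) = x"
shows "norm (s a x) = cmod a * norm x"
proof (cases "a = 0")
case False
have "norm x <= cmod (inverse a) * norm (s a x)" using assms(1)[of "inverse a" "s a x"] assms(2)[OF False] by simp
hence "cmod a * norm x <= norm (s a x)" using False by (simp add: norm_inverse norm_divide field_simps)
thus ?thesis using assms(1)[of a x] by simp
qed (use assms(1)[of 0 x] in simp)

instantiation cop :: (complex_banach) complex_banach
begin
lift_definition scaleC_cop :: "complex => 'a cop => 'a cop" is "%c t. Blinfun (%x. c *: blinfun_apply t x)"
by (subst (1 2) bounded_linear_Blinfun_apply) (simp_all add: scaleC_scaleC mult.commute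
 bounded_linear_compose[OF bounded_linear_scaleC blinfun.bounded_linear_right])

lemma app_scaleC_left: "app (c *: t) x = c *: app t x"
by transfer (subst bounded_linear_Blinfun_apply,
 simp_all add: bounded_linear_compose[OF bounded_linear_scaleC blinfun.bounded_linear_right])

instance
proof
fix X :: "nat => 'a cop" assume X: "Cauchy X"
have d: "dist s t = dist (blin s) (blin t)" for s t :: "'a cop"
 unfolding dist_cop_def dist_norm by transfer simp
have "Cauchy (%n. blin (X n))" using X unfolding Cauchy_def d .
then obtain L where L: "(%n. blin (X n)) \<longlonglongrightarrow> L" using Cauchy_convergent convergent_def by blast
have pt: "(%n. blin (X n) x) \<longlonglongrightarrow> L x" for x
 using L by (rule bounded_linear.tendsto[OF blinfun.bounded_linear_left])
have "L (c *: x) = c *: L x" for c x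
 by (rule LIMSEQ_unique[OF pt]) (use bounded_linear.tendsto[OF bounded_linear_scaleC[of c] pt[of x]] blin[of "X _"] in simp)
hence "blin (Op L) = L" by (simp add: Op_inverse)
hence "X \<longlonglongrightarrow> Op L" using L unfolding tendsto_iff d by simp
thus "convergent X" by (auto simp: convergent_def)
next
fix s t :: "'a cop" and a b :: complex and r :: real
show "a *: (s + t) = a *: s + a *: t" "(a + b) *: s = a *: s + b *: s" "a *: b *: s = (a * b) *: s"
 "r *\<^sub>R s = complex_of_real r *: s"
 by (auto intro!: cop_eqI simp: app_simps1 app_scaleC_left scaleC_add_left scaleC_add_right scaleC_scaleC scaleR_scaleC)
have "norm (a *: s) <= cmod a * norm s" for a and s :: "'a cop"
 using mult_left_mono[OF norm_app[of s], of "cmod a"]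
 by (intro norm_cop_le) (auto simp: app_scaleC_left norm_scaleC mult.assoc)
thus "norm (a *: s) = cmod a * norm s"
 by (rule norm_eq_scaleC) (auto intro!: cop_eqI simp: app_scaleC_left scaleC_scaleC)
qed
end

lemmas app_simps = app_simps1 app_mult app_one app_scaleC_left app_add app_diff app_minus app_scaleC

lemma scaleC_mult_left [simp]: "(c *: s) * t = c *: (s * (t :: 'a::complex_banach cop))"
and scaleC_mult_right [simp]: "s * (c *: t) = c *: (s * (t :: 'a cop))"
by (auto intro!: cop_eqI simp: app_simps)

lemma app_power: "app (t ^ n) = app t ^^ n"
proof (induction n)
case 0
thus ?case by (auto simp: app_one fun_eq_iff)
next
case (Suc n)
thus ?case by (auto simp: app_mult fun_eq_iff)
qed

lemma app_power_Suc: "app (t ^ Suc n) x = app t (app (t ^ n) x)" "app (t ^ Suc n) x = app (t ^ n) (app t x)"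
by (simp only: power_Suc app_mult) (simp only: power_Suc2 app_mult)

abbreviation "rg t == range (app t)"
abbreviation "ker V t == {x : V. app t x = 0}"

abbreviation minus_scalar (infixl "-." 65) where "t -. z == t - z *: (1 :: 'a::complex_banach cop)"

lemma op_shift_app: "op_shift (app t) z = app (t -. z)"
by (auto simp: op_shift_def app_simps)

lemma norm_one_le: "norm (1 :: 'a::complex_banach cop) <= 1"
by (rule norm_cop_le) (simp_all add: app_one)

lemma norm_power_cop: "norm ((t :: 'a::complex_banach cop) ^ n) <= norm t ^ n"
proof (induction n)
case (Suc n)
have "norm (t * t ^ n) <= norm t * norm (t ^ n)" by (rule norm_mult_ineq)
also have "... <= norm t * norm t ^ n" using Suc by (intro mult_left_mono) auto
finally show ?case by simp
qed (simp add: norm_one_le)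

lemma scaleC_power: "(c *: (t :: 'a::complex_banach cop)) ^ n = c ^ n *: t ^ n"
by (induction n) (simp_all add: scaleC_scaleC)

lemma power_commute_elems: "(s :: 'b::monoid_mult) * t = t * s ==> s * t ^ n = t ^ n * s"
by (induction n) (simp_all add: mult.assoc power_commutes, metis mult.assoc)

definition inv_op :: "'a::complex_banach cop => bool" where
"inv_op t <-> (EX s. s * t = 1 & t * s = 1)"

lemma neumann:
fixes t :: "'a::complex_banach cop"
assumes "norm t < 1"
shows "EX s. s * (1 - t) = 1 & (1 - t) * s = 1 & norm s <= 1 / (1 - norm t) & (ALL u. u * t = t * u --> u * s = s * u)"
proof -
have sm: "summable (%n. norm t ^ n)" using assms by (intro summable_geometric) simp
have smn: "summable (%n. norm (t ^ n))"
 by (rule summable_comparison_test'[OF sm, of 0]) (simp add: norm_power_cop)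
hence smt: "summable (%n. t ^ n)" by (rule summable_norm_cancel)
define s where "s = (\<Sum>n. t ^ n)"
have lim: "(%n. \<Sum>i<n. t ^ i) \<longlonglongrightarrow> s" unfolding s_def by (rule summable_LIMSEQ[OF smt])
have tel1: "(\<Sum>i<n. t ^ i) * (1 - t) = 1 - t ^ n" for n
 by (induction n) (simp_all add: distrib_right, simp add: right_diff_distrib power_commutes)
have tel2: "(1 - t) * (\<Sum>i<n. t ^ i) = 1 - t ^ n" for n
 by (induction n) (simp_all add: distrib_left, simp add: left_diff_distrib)
note tel = tel1 tel2
have lim1: "(%n. 1 - t ^ n) \<longlonglongrightarrow> 1 - 0"
 by (intro tendsto_diff tendsto_const summable_LIMSEQ_zero[OF smt])
have "s * (1 - t) = 1"
 using LIMSEQ_unique[OF tendsto_mult[OF lim tendsto_const[of "1 - t"]]] lim1 by (simp add: tel)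
moreover have "(1 - t) * s = 1"
 using LIMSEQ_unique[OF tendsto_mult[OF tendsto_const[of "1 - t"] lim]] lim1 by (simp add: tel)
moreover have "norm s <= 1 / (1 - norm t)"
proof -
 have "norm s <= (\<Sum>n. norm (t ^ n))" unfolding s_def by (rule summable_norm[OF smn])
 also have "... <= (\<Sum>n. norm t ^ n)" by (rule suminf_le[OF norm_power_cop smn sm])
 finally show ?thesis using suminf_geometric[of "norm t"] assms by simp
qed
moreover have "u * s = s * u" if "u * t = t * u" for u
proof -
 have "u * (\<Sum>i<n. t ^ i) = (\<Sum>i<n. t ^ i) * u" for n
  by (simp add: sum_distrib_left sum_distrib_right power_commute_elems[OF that])
 thus ?thesis
  using LIMSEQ_unique[OF tendsto_mult[OF tendsto_const[of u] lim]] tendsto_mult[OF lim tendsto_const[of u]] by simp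
qed
ultimately show ?thesis by blast
qed

lemma inverse_unique_op:
fixes s :: "'b::monoid_mult"
assumes "s * t = 1" "t * u = 1" shows "s = u"
by (metis assms mult.assoc mult_1_left mult_1_right)

lemma inverse_commutes:
fixes s :: "'b::monoid_mult"
assumes "s * t = 1" "t * s = 1" "u * t = t * u" shows "u * s = s * u"
by (metis assms mult.assoc mult_1_left mult_1_right)

lemma inv_op_mult: "inv_op s ==> inv_op t ==> inv_op (s * t)"
unfolding inv_op_def by (metis (no_types, opaque_lifting) mult.assoc mult_1_left)

lemma inv_op_one [simp]: "inv_op 1"
unfolding inv_op_def by (rule exI[of _ 1]) simp

lemma inv_op_scaleC: "c ~= 0 ==> inv_op (c *: t) <-> inv_op t"
proof -
have "inv_op (c *: t)" if c: "c ~= 0" and t: "inv_op t" for c and t :: "'a cop"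
proof -
 obtain s where "s * t = 1" "t * s = 1" using t inv_op_def by blast
 thus ?thesis unfolding inv_op_def
  using c by (intro exI[of _ "inverse c *: s"]) (simp add: scaleC_scaleC)
qed
from this[of c t] this[of "inverse c" "c *: t"]
show "c ~= 0 ==> inv_op (c *: t) <-> inv_op t" by (auto simp: scaleC_scaleC)
qed

lemma inv_op_one_minus: "norm (t :: 'a::complex_banach cop) < 1 ==> inv_op (1 - t)"
using neumann[of t] unfolding inv_op_def by blast

lemma inv_op_iff_bij: "inv_op t <-> bij (app t)"
proof
assume "inv_op t"
then obtain s where s: "s * t = 1" "t * s = 1" using inv_op_def by blast
thus "bij (app t)"
 by (intro o_bij[of "app s"]) (auto simp: fun_eq_iff app_mult[symmetric] app_one)
next
assume b: "bij (app t)"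
have r: "app t ` UNIV = UNIV" using b by (simp add: bij_is_surj)
obtain k where k: "k > 0" "!!y. EX x. app t x = y & norm x <= k * norm y"
 using open_mapping[OF bounded_linear_app[of t], of UNIV] r by auto
have inv: "inv (app t) (app t x) = x" "app t (inv (app t) x) = x" for x
 using b by (simp_all add: bij_is_inj bij_is_surj surj_f_inv_f)
have bc: "bounded_clinear (inv (app t))"
proof (rule bounded_clinearI)
 show "inv (app t) (x + y) = inv (app t) x + inv (app t) y" for x y
  using inv(1)[of "inv (app t) x + inv (app t) y"] by (simp add: app_add inv)
 show "inv (app t) (c *: x) = c *: inv (app t) x" for c x
  using inv(1)[of "c *: inv (app t) x"] by (simp add: app_scaleC inv)
 show "norm (inv (app t) x) <= k * norm x" for x using k(2)[of x] inv(1) by metis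
qed
show "inv_op t" unfolding inv_op_def
 by (rule exI[of _ "Cop (inv (app t))"]) (auto intro!: cop_eqI simp: app_simps app_Cop[OF bc] inv)
qed

section \<open>Spectral idempotents and the spectral radius\<close>

lemma norm_cis_minus_one: "cmod (cis t - 1) <= 2 * \<bar>t\<bar>"
proof -
have "1 - cos t = 2 * (sin (t / 2))\<^sup>2" using cos_double_sin[of "t / 2"] by simp
also have "(sin (t / 2))\<^sup>2 = \<bar>sin (t / 2)\<bar> * \<bar>sin (t / 2)\<bar>" by (simp add: power2_eq_square)
also have "... <= \<bar>t / 2\<bar> * 1" by (intro mult_mono abs_sin_x_le_abs_x) auto
finally have "\<bar>cos t - 1\<bar> <= \<bar>t\<bar>" using cos_le_one[of t] by simp
moreover have "cmod (cis t - 1) <= \<bar>cos t - 1\<bar> + \<bar>sin t\<bar>" using cmod_le[of "cis t - 1"] by simp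
ultimately show ?thesis using abs_sin_x_le_abs_x[of t] by simp
qed

definition resolvent_inv :: "'a::complex_banach cop => complex => 'a cop" where
"resolvent_inv T z = (SOME s. s * (1 - z *: T) = 1 & (1 - z *: T) * s = 1)"

lemma resolvent_inv:
assumes "inv_op (1 - z *: T)"
shows "resolvent_inv T z * (1 - z *: T) = 1" "(1 - z *: T) * resolvent_inv T z = 1"
proof -
have "EX s. s * (1 - z *: T) = 1 & (1 - z *: T) * s = 1" using assms by (simp add: inv_op_def)
from someI_ex[OF this]
show "resolvent_inv T z * (1 - z *: T) = 1" "(1 - z *: T) * resolvent_inv T z = 1"
 by (simp_all add: resolvent_inv_def)
qed

lemma resolvent_inv_diff:
assumes "inv_op (1 - z *: T)" "inv_op (1 - w *: T)"
shows "resolvent_inv T z - resolvent_inv T w = (z - w) *: (resolvent_inv T z * T * resolvent_inv T w)"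
proof -
let ?f = "resolvent_inv T"
have eq: "(z - w) *: T = (1 - w *: T) - (1 - z *: T)"
 by (simp add: scaleC_diff_left)
have "(z - w) *: (?f z * T * ?f w) = ?f z * ((z - w) *: T) * ?f w" by simp
also have "... = ?f z * ((1 - w *: T) * ?f w) - (?f z * (1 - z *: T)) * ?f w"
 unfolding eq by (simp only: right_diff_distrib left_diff_distrib mult.assoc)
finally show ?thesis using resolvent_inv[OF assms(1)] resolvent_inv[OF assms(2)] by simp
qed

lemma resolvent_inv_lipschitz:
assumes K: "compact K" and inv: "!!z. z : K ==> inv_op (1 - z *: T)"
obtains L where "L >= 0" "!!z w. z : K ==> w : K ==> norm (resolvent_inv T z - resolvent_inv T w) <= L * cmod (z - w)"
proof -
let ?f = "resolvent_inv T"
have lip: "norm (?f z - ?f w) <= cmod (z - w) * (norm (?f z) * norm T * norm (?f w))" if "z : K" "w : K" for z w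
proof -
 have "norm (?f z * T * ?f w) <= norm (?f z * T) * norm (?f w)" by (rule norm_mult_ineq)
 also have "... <= norm (?f z) * norm T * norm (?f w)" by (intro mult_right_mono norm_mult_ineq) auto
 finally show ?thesis
  unfolding resolvent_inv_diff[OF inv[OF that(1)] inv[OF that(2)]] norm_scaleC by (intro mult_left_mono) auto
qed
have "continuous_on K ?f"
 unfolding continuous_on_iff
proof (intro ballI allI impI)
 fix w e assume w: "w : K" and e: "0 < (e :: real)"
 define c where "c = norm T * norm (?f w) + 1"
 have c: "c > 0" by (simp add: c_def add_nonneg_pos)
 define b where "b = 2 * norm (?f w) + 1"
 have b: "b > 0" by (simp add: b_def add_nonneg_pos)
 define d where "d = min (1 / (2 * c)) (e / (b * c))"
 have d: "d > 0" using c b e by (simp add: d_def)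
 show "EX d>0. ALL z:K. dist z w < d --> dist (?f z) (?f w) < e"
 proof (intro exI[of _ d] conjI d ballI impI)
  fix z assume z: "z : K" and dz: "dist z w < d"
  have zd: "cmod (z - w) <= 1 / (2 * c)" "cmod (z - w) < e / (b * c)"
   using dz by (auto simp: d_def dist_norm)
  have cc: "norm T * norm (?f w) <= c" by (simp add: c_def)
  have 1: "norm (?f z - ?f w) <= cmod (z - w) * (norm (?f z) * c)"
   using lip[OF z w] mult_left_mono[OF mult_left_mono[OF cc norm_ge_zero[of "?f z"]] norm_ge_zero[of "z - w"]]
   by (simp add: mult.assoc)
  also have "... <= 1 / (2 * c) * (norm (?f z) * c)" using zd(1) c by (intro mult_right_mono) auto
  also have "... = norm (?f z) / 2" using c by simp
  finally have "norm (?f z) <= 2 * norm (?f w)" using norm_triangle_sub[of "?f z" "?f w"] by linarith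
  hence fb: "norm (?f z) <= b" by (simp add: b_def)
  have "cmod (z - w) * (norm (?f z) * c) <= cmod (z - w) * (b * c)"
   using fb c by (intro mult_left_mono mult_right_mono) auto
  also have "... < e / (b * c) * (b * c)" using zd(2) b c by (intro mult_strict_right_mono) auto
  also have "... = e" using b c by simp
  finally show "dist (?f z) (?f w) < e" using 1 by (simp add: dist_norm)
 qed
qed
hence "bounded (?f ` K)" using K by (intro compact_imp_bounded compact_continuous_image)
then obtain B where B: "!!z. z : K ==> norm (?f z) <= B" unfolding bounded_iff by blast
define L where "L = \<bar>B\<bar> * norm T * \<bar>B\<bar>"
have "norm (?f z - ?f w) <= L * cmod (z - w)" if "z : K" "w : K" for z w
proof -
 have "norm (?f z) * norm T * norm (?f w) <= L"
  unfolding L_def using B[OF that(1)] B[OF that(2)] by (intro mult_mono) auto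
 thus ?thesis
  using lip[OF that] mult_left_mono[of "norm (?f z) * norm T * norm (?f w)" L "cmod (z - w)"] by (simp add: mult.commute)
qed
thus thesis using that[of L] by (simp add: L_def)
qed

text \<open>\<open>dyadic_mean T m z\<close> is the mean of the inverses of \<open>1 - w T\<close> over the \<open>w\<close> with
  \<open>w ^ 2 ^ m = z ^ 2 ^ m\<close>, and it is the inverse of \<open>1 - (z T) ^ 2 ^ m\<close>. As \<open>m\<close> grows it
  tends to an idempotent, the spectral projection for the disc of radius \<open>1 / |z|\<close>.\<close>

primrec dyadic_mean :: "'a::complex_banach cop => nat => complex => 'a cop" where
"dyadic_mean T 0 z = resolvent_inv T z"
| "dyadic_mean T (Suc m) z = (1/2 :: real) *\<^sub>R (dyadic_mean T m z + dyadic_mean T m (cis (pi / 2 ^ m) * z))"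

declare dyadic_mean.simps(2) [simp del]

lemma swap_diff: "(x :: 'b::ab_group_add) - y = c ==> y = x - c"
by auto

lemma half_sum_inverse:
fixes a :: "'a::complex_banach cop"
assumes G: "G * (1 - a) = 1" "(1 - a) * G = 1" and H: "H * (1 + a) = 1" "(1 + a) * H = 1"
shows "((1/2 :: real) *\<^sub>R (G + H)) * (1 - a * a) = 1" "(1 - a * a) * ((1/2 :: real) *\<^sub>R (G + H)) = 1"
 "(1/2 :: real) *\<^sub>R (G + H) = G * H" "a * ((1/2 :: real) *\<^sub>R (G + H)) = (1/2 :: real) *\<^sub>R (G - H)"
proof -
have e: "1 - a * a = (1 - a) * (1 + a)" "1 - a * a = (1 + a) * (1 - a)" by (simp_all add: algebra_simps)
have two: "(1/2 :: real) *\<^sub>R ((1 + a) + (1 - a)) = 1"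
 by (simp add: scaleR_2[symmetric] del: scaleR_2)
have "G * (1 - a * a) = 1 + a" by (simp only: e(1) mult.assoc[symmetric] G(1) mult_1_left)
moreover have "H * (1 - a * a) = 1 - a" by (simp only: e(2) mult.assoc[symmetric] H(1) mult_1_left)
ultimately show 1: "((1/2 :: real) *\<^sub>R (G + H)) * (1 - a * a) = 1"
 using two by (simp only: mult_scaleR_left distrib_right)
have "(1 - a * a) * G = 1 + a" by (simp only: e(2) mult.assoc G(2) mult_1_right)
moreover have "(1 - a * a) * H = 1 - a" by (simp only: e(1) mult.assoc H(2) mult_1_right)
ultimately show 2: "(1 - a * a) * ((1/2 :: real) *\<^sub>R (G + H)) = 1"
 using two by (simp only: mult_scaleR_right distrib_left)
have "(1 - a * a) * (H * G) = (1 - a) * ((1 + a) * H) * G" unfolding e(1) by (simp only: mult.assoc)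
hence HG: "(1 - a * a) * (H * G) = 1" using G H by simp
have "(G * H) * (1 - a * a) = G * (H * (1 + a)) * (1 - a)" unfolding e(2) by (simp only: mult.assoc)
hence "(G * H) * (1 - a * a) = 1" using G H by simp
thus 3: "(1/2 :: real) *\<^sub>R (G + H) = G * H" using inverse_unique_op[OF _ 2] by metis
have aG: "a * G = G - 1" using G(2) by (intro swap_diff) (simp add: left_diff_distrib)
have aH: "a * H = 1 - H" using H(2) by (simp add: distrib_right eq_diff_eq add.commute)
show "a * ((1/2 :: real) *\<^sub>R (G + H)) = (1/2 :: real) *\<^sub>R (G - H)"
 by (simp add: distrib_left aG aH)
qed

locale dyadic =
fixes T :: "'a::complex_banach cop" and K :: "complex set" and L B :: real
assumes inv: "!!z. z : K ==> inv_op (1 - z *: T)"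
 and rot: "!!z w. z : K ==> cmod w = 1 ==> w * z : K"
 and lip0: "!!z w. z : K ==> w : K ==> norm (resolvent_inv T z - resolvent_inv T w) <= L * cmod (z - w)"
 and L0: "L >= 0" and B: "!!z. z : K ==> cmod z <= B"
begin

abbreviation "F == dyadic_mean T"
abbreviation "rt m == cis (pi / 2 ^ m)"
abbreviation "pw m z == (z *: T) ^ 2 ^ m"

lemma pw_root: "pw m (rt m * z) = - pw m z"
proof -
have "rt m ^ 2 ^ m = -1" using Complex.DeMoivre[of "pi / 2 ^ m" "2 ^ m"] by simp
thus ?thesis by (simp add: scaleC_power power_mult_distrib)
qed

lemma pw_Suc: "pw (Suc m) z = pw m z * pw m z"
by (simp add: power_add[symmetric] mult_2)

lemma F_inverse:
"z : K ==> F m z * (1 - pw m z) = 1 & (1 - pw m z) * F m z = 1"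
proof (induction m arbitrary: z)
case 0
thus ?case using resolvent_inv[OF inv] by simp
next
case (Suc m)
have r: "rt m * z : K" using rot[OF Suc.prems] by simp
show ?case
 using half_sum_inverse(1,2)[of "F m z" "pw m z" "F m (rt m * z)"] Suc.IH[OF Suc.prems] Suc.IH[OF r]
 by (simp only: pw_root pw_Suc dyadic_mean.simps) simp
qed

lemma F_Suc:
assumes "z : K"
shows "F (Suc m) z = F m z * F m (rt m * z)"
 "pw m z * F (Suc m) z = (1/2 :: real) *\<^sub>R (F m z - F m (rt m * z))"
proof -
have r: "rt m * z : K" using rot[OF assms] by simp
note h = half_sum_inverse(3,4)[of "F m z" "pw m z" "F m (rt m * z)"]
show "F (Suc m) z = F m z * F m (rt m * z)" "pw m z * F (Suc m) z = (1/2 :: real) *\<^sub>R (F m z - F m (rt m * z))"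
 using h F_inverse[OF assms, of m] F_inverse[OF r, of m] by (simp_all only: pw_root dyadic_mean.simps) simp_all
qed

lemma F_lipschitz: "z : K ==> w : K ==> norm (F m z - F m w) <= L * cmod (z - w)"
proof (induction m arbitrary: z w)
case (Suc m)
let ?r = "rt m"
have r: "?r * z : K" "?r * w : K" using rot Suc.prems by simp_all
have "F (Suc m) z - F (Suc m) w = (1/2 :: real) *\<^sub>R ((F m z - F m w) + (F m (?r * z) - F m (?r * w)))"
 by (simp add: dyadic_mean.simps(2) algebra_simps)
hence "norm (F (Suc m) z - F (Suc m) w) = norm ((F m z - F m w) + (F m (?r * z) - F m (?r * w))) / 2"
 by simp
also have "... <= (norm (F m z - F m w) + norm (F m (?r * z) - F m (?r * w))) / 2"
 by (intro divide_right_mono norm_triangle_ineq) simp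
also have "... <= (L * cmod (z - w) + L * cmod (?r * z - ?r * w)) / 2"
 using Suc.IH[OF Suc.prems] Suc.IH[OF r] by simp
also have "cmod (?r * z - ?r * w) = cmod (z - w)"
 by (simp add: right_diff_distrib[symmetric] norm_mult)
finally show ?case by simp
qed (simp add: lip0)

lemma F_root_diff:
assumes "z : K" shows "norm (F m z - F m (rt m * z)) <= (L * B * 2 * pi) * (1/2) ^ m"
proof -
have r: "rt m * z : K" using rot[OF assms] by simp
have "norm (F m z - F m (rt m * z)) <= L * cmod (z - rt m * z)" by (rule F_lipschitz[OF assms r])
also have "cmod (z - rt m * z) = cmod (rt m - 1) * cmod z"
 by (simp add: norm_mult[symmetric] left_diff_distrib norm_minus_commute)
also have "L * (cmod (rt m - 1) * cmod z) <= L * ((2 * (pi / 2 ^ m)) * B)"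
 using norm_cis_minus_one[of "pi / 2 ^ m"] B[OF assms] L0 by (intro mult_left_mono mult_mono) auto
finally show ?thesis by (simp add: power_one_over mult_ac)
qed

lemma half_power_tendsto: "(%m. c * (1/2) ^ m) \<longlonglongrightarrow> (0 :: real)"
by (intro tendsto_mult_right_zero LIMSEQ_power_zero) simp

lemma F_root_diff_tendsto:
"z : K ==> (%m. F m z - F m (rt m * z)) \<longlonglongrightarrow> 0"
by (rule Lim_null_comparison[OF always_eventually half_power_tendsto]) (use F_root_diff in blast)

lemma F_convergent:
assumes "z : K" shows "convergent (%m. F m z)"
proof -
have d: "norm (F (Suc m) z - F m z) <= (L * B * 2 * pi) * (1/2) ^ m" for m
proof -
 have "F (Suc m) z - F m z = (1/2 :: real) *\<^sub>R (F m (rt m * z) - F m z)"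
  by (simp add: dyadic_mean.simps(2) algebra_simps) (simp add: scaleR_left.diff[symmetric] scaleR_2[symmetric] del: scaleR_2)
 hence "norm (F (Suc m) z - F m z) <= norm (F m z - F m (rt m * z))"
  by (simp add: norm_minus_commute)
 thus ?thesis using F_root_diff[OF assms, of m] by simp
qed
have geo: "summable (%m. (L * B * 2 * pi) * (1/2 :: real) ^ m)"
 by (intro summable_mult summable_geometric) simp
have "summable (%m. F (Suc m) z - F m z)"
 by (rule summable_comparison_test'[OF geo, of 0]) (rule d)
hence "convergent (%n. \<Sum>m<n. F (Suc m) z - F m z)" by (simp add: summable_iff_convergent)
hence "convergent (%n. F n z - F 0 z)" by (simp only: sum_lessThan_telescope[of "%m. F m z"])
thus ?thesis using convergent_add_const_right_iff[of "%n. F n z" "- F 0 z"] by simp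
qed

definition "P z = lim (%m. F m z)"

lemma F_tendsto: "z : K ==> (%m. F m z) \<longlonglongrightarrow> P z"
unfolding P_def using F_convergent convergent_LIMSEQ_iff by blast

lemma F_root_tendsto:
assumes "z : K" shows "(%m. F m (rt m * z)) \<longlonglongrightarrow> P z"
using tendsto_diff[OF F_tendsto[OF assms] F_root_diff_tendsto[OF assms]] by simp

lemma P_idem: assumes "z : K" shows "P z * P z = P z"
proof (rule LIMSEQ_unique)
show "(%m. F (Suc m) z) \<longlonglongrightarrow> P z * P z"
 unfolding F_Suc(1)[OF assms] by (rule tendsto_mult[OF F_tendsto[OF assms] F_root_tendsto[OF assms]])
show "(%m. F (Suc m) z) \<longlonglongrightarrow> P z" by (rule LIMSEQ_Suc[OF F_tendsto[OF assms]])
qed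

lemma F_commutes:
assumes "z : K" shows "T * F m z = F m z * T"
proof -
have "T * (1 - pw m z) = (1 - pw m z) * T"
 using power_commute_elems[of T "z *: T" "2 ^ m"] by (simp add: right_diff_distrib left_diff_distrib)
thus ?thesis using inverse_commutes F_inverse[OF assms] by metis
qed

lemma P_commutes: assumes "z : K" shows "T * P z = P z * T"
proof (rule LIMSEQ_unique)
show "(%m. T * F m z) \<longlonglongrightarrow> T * P z" by (rule tendsto_mult[OF tendsto_const F_tendsto[OF assms]])
show "(%m. T * F m z) \<longlonglongrightarrow> P z * T"
 unfolding F_commutes[OF assms] by (rule tendsto_mult[OF F_tendsto[OF assms] tendsto_const])
qed

lemma P_lipschitz:
assumes "z : K" "w : K" shows "norm (P z - P w) <= L * cmod (z - w)"
by (rule LIMSEQ_le_const2[OF tendsto_norm[OF tendsto_diff[OF F_tendsto F_tendsto]]])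
 (use assms F_lipschitz in auto)

text \<open>With \<open>a = (z T) ^ 2 ^ m\<close> the products \<open>a F (Suc m) z\<close> tend to \<open>0\<close>; the factor
  \<open>F (Suc m) z\<close>, the inverse of \<open>1 - a\<^sup>2\<close>, can be removed on the range of \<open>P z\<close>.\<close>

lemma pw_P_tendsto:
assumes "z : K" shows "(%m. norm (pw m z * P z)) \<longlonglongrightarrow> 0"
proof -
let ?a = "%m. pw m z" let ?U = "%m. ?a m * F (Suc m) z" let ?P = "P z"
have U0: "?U \<longlonglongrightarrow> 0"
 unfolding F_Suc(2)[OF assms]
 using tendsto_scaleR[OF tendsto_const[of "1/2 :: real"] F_root_diff_tendsto[OF assms]] by simp
have FI: "F (Suc m) z * (1 - ?a m * ?a m) = 1" "(1 - ?a m * ?a m) * F (Suc m) z = 1" for m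
 using F_inverse[OF assms, of "Suc m"] unfolding pw_Suc by blast+
hence "?a m * (F (Suc m) z * (1 - ?a m * ?a m)) * ?P = ?a m * ?P" for m by simp
hence eq: "?a m * ?P = ?U m * ?P - ?U m * ?a m * (?a m * ?P)" for m
 by (simp only: right_diff_distrib left_diff_distrib mult.assoc mult_1_right)
have Ta: "T * ?a m = ?a m * T" for m using power_commute_elems[of T "z *: T" "2 ^ m"] by simp
have aP: "?a m * ?P = ?P * ?a m" for m
 using power_commute_elems[of "?P" "z *: T" "2 ^ m"] P_commutes[OF assms] by simp
have aF: "F (Suc m) z * ?a m = ?a m * F (Suc m) z" for m
 using power_commute_elems[of "F (Suc m) z" "z *: T" "2 ^ m"] F_commutes[OF assms, of "Suc m"] by simp
have Ua: "?U m * ?a m = F (Suc m) z - 1" for m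
proof -
 have "?U m * ?a m = (?a m * ?a m) * F (Suc m) z" by (simp only: mult.assoc aF)
 moreover have "(?a m * ?a m) * F (Suc m) z = F (Suc m) z - 1"
  using FI(2)[of m] by (intro swap_diff) (simp add: left_diff_distrib)
 ultimately show ?thesis by simp
qed
define d where "d m = norm (?U m * ?a m * ?P)" for m
have "(%m. (F (Suc m) z - 1) * ?P) \<longlonglongrightarrow> (?P - 1) * ?P"
 by (intro tendsto_mult tendsto_diff tendsto_const LIMSEQ_Suc[OF F_tendsto[OF assms]])
hence d0: "d \<longlonglongrightarrow> 0" unfolding d_def Ua using tendsto_norm by (force simp: left_diff_distrib P_idem[OF assms])
define e where "e m = norm (?U m * ?P)" for m
have e0: "e \<longlonglongrightarrow> 0" unfolding e_def using tendsto_norm[OF tendsto_mult[OF U0 tendsto_const[of ?P]]] by simp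
have ineq: "norm (?a m * ?P) <= e m + d m * norm (?a m * ?P)" for m
proof -
 have "?U m * ?a m * (?a m * ?P) = (?U m * ?a m * ?P) * (?a m * ?P)"
 proof -
  have "?a m * ?P = ?P * (?a m * ?P)" by (metis aP P_idem[OF assms] mult.assoc)
  thus ?thesis by (metis mult.assoc)
 qed
 hence "norm (?U m * ?a m * (?a m * ?P)) <= d m * norm (?a m * ?P)"
  unfolding d_def by (metis norm_mult_ineq)
 thus ?thesis
  using norm_triangle_ineq4[of "?U m * ?P" "?U m * ?a m * (?a m * ?P)"] eq[of m] unfolding e_def by simp
qed
have "eventually (%m. d m < 1/2) sequentially" using order_tendstoD(2)[OF d0, of "1/2"] by simp
hence ev: "eventually (%m. norm (norm (?a m * ?P)) <= 2 * e m) sequentially"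
proof eventually_elim
 case (elim m)
 hence "d m * norm (?a m * ?P) <= 1/2 * norm (?a m * ?P)" by (intro mult_right_mono) auto
 thus ?case using ineq[of m] by simp
qed
show ?thesis
 by (rule Lim_null_comparison[OF ev]) (use tendsto_mult_right_zero[OF e0, of 2] in simp)
qed

end

lemma one_minus_scale:
fixes T :: "'a::complex_banach cop"
assumes "z ~= 0" shows "inv_op (1 - z *: T) <-> inv_op (T - inverse z *: 1)"
proof -
have "1 - z *: T = (- z) *: (T - inverse z *: 1)"
 using assms by (simp add: scaleC_diff_right scaleC_scaleC)
thus ?thesis using inv_op_scaleC[of "- z"] assms by simp
qed

text \<open>If the circle of radius \<open>r\<close> lies in the resolvent set, the space splits: \<open>T\<close> has spectral
  radius less than \<open>r\<close> on the range of \<open>P\<close> and is invertible, with inverse \<open>W\<close>, on its kernel.\<close>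

lemma spectral_split:
fixes T :: "'a::complex_banach cop"
assumes r: "r > 0" and inv: "!!z. cmod z = r ==> inv_op (T -. z)"
obtains P W n where "P * P = P" "T * P = P * T" "W * P = 0" "T * W = 1 - P" "W * T = 1 - P"
 "norm (T ^ n * P) <= r ^ n / 2" "n >= 1"
proof -
let ?K = "sphere 0 (1 / r) :: complex set"
have invK: "inv_op (1 - z *: T)" if "z : ?K" for z
proof -
 have "z ~= 0" "cmod (inverse z) = r" using that r by (auto simp: norm_inverse)
 thus ?thesis using inv one_minus_scale by blast
qed
obtain L where L: "L >= 0" "!!z w. z : ?K ==> w : ?K ==> norm (resolvent_inv T z - resolvent_inv T w) <= L * cmod (z - w)"
 using resolvent_inv_lipschitz[OF compact_sphere invK] by blast
interpret dyadic T ?K L "1 / r"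
 by unfold_locales (use invK L in "auto simp: norm_mult")
have "complex_of_real (1 / r) : ?K" using r by (simp add: norm_divide)
then obtain z where z: "z : ?K" by blast
define p where "p = P z"
define q where "q = 1 - p"
have pp: "p * p = p" unfolding p_def by (rule P_idem[OF z])
have Tp: "T * p = p * T" unfolding p_def by (rule P_commutes[OF z])
have pq: "p * q = 0" "q * p = 0" "q * q = q" using pp by (simp_all add: q_def algebra_simps)
have Tq: "T * q = q * T" using Tp by (simp add: q_def algebra_simps)
have "(%m. F m z * q) \<longlonglongrightarrow> p * q"
 unfolding p_def by (rule tendsto_mult[OF F_tendsto[OF z] tendsto_const])
hence "(%m. norm (F m z * q)) \<longlonglongrightarrow> 0" using pq tendsto_norm_zero by force
hence "eventually (%m. norm (F m z * q) < 1/2) sequentially" by (rule order_tendstoD) simp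
moreover have "eventually (%m. norm (pw m z * p) < 1/2) sequentially"
 using pw_P_tendsto[OF z] unfolding p_def by (rule order_tendstoD) simp
ultimately have "eventually (%m. norm (F m z * q) < 1/2 & norm (pw m z * p) < 1/2) sequentially"
 by (rule eventually_conj)
then obtain m where m: "norm (F m z * q) < 1/2" "norm (pw m z * p) < 1/2"
 using eventually_happens'[OF sequentially_bot] by blast
let ?n = "2 ^ m :: nat" let ?F = "F m z" let ?c = "z ^ ?n"
have pwz: "pw m z = ?c *: T ^ ?n" by (rule scaleC_power)
have c: "cmod ?c = 1 / r ^ ?n" using z by (simp add: norm_power power_one_over)
have Fi: "?F * (1 - ?c *: T ^ ?n) = 1" "(1 - ?c *: T ^ ?n) * ?F = 1"
 using F_inverse[OF z, of m] by (simp_all add: pwz)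
have FT: "T * ?F = ?F * T" by (rule F_commutes[OF z])
have pT: "p * T ^ ?n = T ^ ?n * p" by (rule power_commute_elems) (simp add: Tp)
hence pa: "p * (1 - ?c *: T ^ ?n) = (1 - ?c *: T ^ ?n) * p"
 by (simp add: right_diff_distrib left_diff_distrib)
have Fp: "p * ?F = ?F * p" by (rule inverse_commutes[OF Fi pa])
have Fq: "q * ?F = ?F * q" using Fp by (simp add: q_def algebra_simps)
obtain Y where Y: "Y * (1 - ?F * q) = 1" "(1 - ?F * q) * Y = 1" "!!u. u * (?F * q) = (?F * q) * u ==> u * Y = Y * u"
 using neumann[of "?F * q"] m(1) by fastforce
have YT: "T * Y = Y * T"
proof (rule Y(3))
 have "T * (?F * q) = ?F * (T * q)" by (metis FT mult.assoc)
 thus "T * (?F * q) = (?F * q) * T" by (metis Tq mult.assoc)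
qed
have Yp: "p * Y = Y * p"
proof (rule Y(3))
 have "p * (?F * q) = ?F * (p * q)" by (metis Fp mult.assoc)
 thus "p * (?F * q) = (?F * q) * p" by (simp add: pq mult.assoc)
qed
define V where "V = ?F * q * Y"
have TV: "T * V = V * T" unfolding V_def by (metis FT Tq YT mult.assoc)
have Vp: "V * p = 0" unfolding V_def by (metis Yp mult.assoc mult_zero_left mult_zero_right pq(2))
have aV: "(?c *: T ^ ?n) * V = - q"
proof -
 have e: "(?c *: T ^ ?n) * ?F = ?F - 1"
  using Fi(2) by (intro swap_diff) (simp add: left_diff_distrib)
 have "(?c *: T ^ ?n) * (?F * q) = (?F - 1) * q"
  by (simp only: mult.assoc[symmetric] e)
 also have "... = ?F * q - q" by (simp add: left_diff_distrib)
 also have "... = - (q * (1 - ?F * q))"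
 proof -
  have "q * (?F * q) = ?F * q" by (metis Fq mult.assoc pq(3))
  thus ?thesis by (simp add: right_diff_distrib)
 qed
 finally have "(?c *: T ^ ?n) * (?F * q) * Y = - (q * (1 - ?F * q)) * Y" by simp
 also have "... = - (q * ((1 - ?F * q) * Y))" by (simp only: mult.assoc mult_minus_left)
 finally show ?thesis unfolding V_def using Y(2) by (simp add: mult.assoc)
qed
define W where "W = (- ?c) *: (T ^ (?n - 1) * V)"
have n: "T ^ ?n = T * T ^ (?n - 1)" "T ^ ?n = T ^ (?n - 1) * T"
 using power_Suc[of T "?n - 1"] power_Suc2[of T "?n - 1"] by simp_all
have TW: "T * W = q"
proof -
 have "T * W = (- ?c) *: (T ^ ?n * V)" unfolding W_def by (simp add: n(1) mult.assoc)
 also have "... = - ((?c *: T ^ ?n) * V)" by simp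
 finally show ?thesis using aV by simp
qed
have WT: "W * T = q"
proof -
 have "W * T = (- ?c) *: (T ^ (?n - 1) * (V * T))" unfolding W_def by (simp add: mult.assoc)
 also have "V * T = T * V" by (simp add: TV)
 also have "T ^ (?n - 1) * (T * V) = T ^ ?n * V" by (simp only: n(2) mult.assoc)
 finally have "W * T = - ((?c *: T ^ ?n) * V)" by simp
 thus ?thesis using aV by simp
qed
have "W * p = 0" unfolding W_def by (simp add: mult.assoc Vp)
moreover have "norm (T ^ ?n * p) <= r ^ ?n / 2"
proof -
 have "norm (pw m z * p) = norm (T ^ ?n * p) / r ^ ?n" unfolding pwz by (simp add: norm_scaleC c)
 hence "norm (T ^ ?n * p) / r ^ ?n <= 1/2" using m(2) by linarith
 thus ?thesis using pos_divide_le_eq[of "r ^ ?n" "norm (T ^ ?n * p)" "1/2"] r by simp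
qed
ultimately show thesis using that[of p W ?n] pp Tp TW WT unfolding q_def by simp
qed

lemma idempotent_small:
fixes q :: "'a::complex_banach cop"
assumes "q * q = q" "norm q < 1" shows "q = 0"
proof -
have "norm q <= norm q * norm q" using norm_mult_ineq[of q q] assms(1) by simp
hence "norm q * (1 - norm q) <= 0" by (simp add: algebra_simps)
hence "norm q <= 0" using assms(2) by (simp add: mult_le_0_iff)
thus ?thesis by simp
qed

text \<open>The idempotents \<open>P z\<close> depend continuously on \<open>z\<close> in the disc \<open>|z| \<le> 1/r\<close> and \<open>P 0 = 1\<close>. As an idempotent close
  to \<open>1\<close> is \<open>1\<close>, this gives \<open>P z = 1\<close> along a radius up to the circle, and \<open>pw_P_tendsto\<close> applies.\<close>

lemma spectral_radius:
fixes T :: "'a::complex_banach cop"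
assumes r: "r > 0" and inv: "!!z. cmod z >= r ==> inv_op (T -. z)"
obtains n where "norm (T ^ n) <= r ^ n / 2" "n >= 1"
proof -
let ?K = "cball 0 (1 / r) :: complex set"
have invK: "inv_op (1 - z *: T)" if "z : ?K" for z
proof (cases "z = 0")
 case False
 hence "cmod (inverse z) >= r" using that r by (simp add: norm_inverse norm_divide field_simps)
 thus ?thesis using inv one_minus_scale[OF False] by blast
qed simp
obtain L where L: "L >= 0" "!!z w. z : ?K ==> w : ?K ==> norm (resolvent_inv T z - resolvent_inv T w) <= L * cmod (z - w)"
 using resolvent_inv_lipschitz[OF compact_cball invK] by blast
interpret dyadic T ?K L "1 / r"
 by unfold_locales (use invK L in "auto simp: norm_mult")
obtain N :: nat where N: "real N > L / r" using reals_Archimedean2 by blast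
hence N0: "real N > 0" using L(1) r by (smt (verit) divide_nonneg_pos)
have step: "L * (1 / (r * real N)) < 1" using N N0 r by (simp add: field_simps)
let ?z = "%k. complex_of_real (real k / (r * real N))"
have zK: "?z k : ?K" if "k <= N" for k
proof -
 have "real k / (r * real N) <= real N / (r * real N)" using that r N0 by (intro divide_right_mono) auto
 also have "... = 1 / r" using N0 by simp
 finally show ?thesis using r N0 by (simp only: mem_cball dist_0_norm norm_of_real) simp
qed
have Pk: "k <= N ==> P (?z k) = 1" for k
proof (induction k)
 case 0
 have z0: "0 : ?K" using r by simp
 have F1: "F m 0 = 1" for m
 proof -
  have "pw m 0 = 0" using power_Suc[of "0 :: 'a cop" "2 ^ m - 1"] by simp
  thus ?thesis using F_inverse[OF z0, of m] by simp
 qed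
 have "(%m. F m 0) \<longlonglongrightarrow> 1" by (simp add: F1)
 hence "P 0 = 1" using F_tendsto[OF z0] LIMSEQ_unique by blast
 thus ?case by simp
next
 case (Suc k)
 have "k <= N" using Suc.prems by simp
 hence pk: "P (?z k) = 1" by (rule Suc.IH)
 have k: "?z k : ?K" "?z (Suc k) : ?K" by (rule zK[OF \<open>k <= N\<close>], rule zK[OF Suc.prems])
 have "?z k - ?z (Suc k) = complex_of_real (- (1 / (r * real N)))"
  by (simp only: of_real_diff[symmetric] diff_divide_distrib[symmetric]) simp
 hence cz: "cmod (?z k - ?z (Suc k)) = 1 / (r * real N)" using r N0 by (simp only: norm_of_real) simp
 have "norm (1 - P (?z (Suc k))) <= L * (1 / (r * real N))"
  using P_lipschitz[OF k] unfolding pk cz .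
 hence "norm (1 - P (?z (Suc k))) < 1" using step by (rule le_less_trans)
 moreover have "(1 - P (?z (Suc k))) * (1 - P (?z (Suc k))) = 1 - P (?z (Suc k))"
  using P_idem[OF k(2)] by (simp add: algebra_simps)
 ultimately have "1 - P (?z (Suc k)) = 0" by (intro idempotent_small)
 thus ?case by simp
qed
define z1 where "z1 = complex_of_real (1 / r)"
have "real N / (r * real N) = 1 / r" using N0 by simp
hence P1: "P z1 = 1" using Pk[of N] unfolding z1_def by simp
have z: "z1 : ?K" and cz: "cmod z1 = 1 / r" unfolding z1_def using r by (simp_all add: norm_divide)
have "eventually (%m. norm (pw m z1 * P z1) < 1/2) sequentially"
 using pw_P_tendsto[OF z] by (rule order_tendstoD) simp
then obtain m where m: "norm (pw m z1) < 1/2"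
 unfolding P1 using eventually_happens'[OF sequentially_bot] by fastforce
have "norm (pw m z1) = norm (T ^ 2 ^ m) / r ^ 2 ^ m"
 unfolding scaleC_power using r by (simp add: norm_scaleC norm_power cz power_one_over)
hence "norm (T ^ 2 ^ m) / r ^ 2 ^ m <= 1/2" using m by linarith
hence "norm (T ^ 2 ^ m) <= r ^ 2 ^ m / 2"
 using pos_divide_le_eq[of "r ^ 2 ^ m" "norm (T ^ 2 ^ m)" "1/2"] r by simp
thus thesis using that[of "2 ^ m"] by simp
qed

lemma geometric_bound:
fixes T :: "'a::complex_banach cop"
assumes "r > 0" "n >= 1" "norm (T ^ n) <= r ^ n"
obtains C where "C > 0" "!!k. norm (T ^ k) <= C * r ^ k"
proof -
define C where "C = (\<Sum>i<n. norm (T ^ i) / r ^ i) + 1"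
have C1: "C > 0" unfolding C_def using assms(1) by (intro add_nonneg_pos sum_nonneg) auto
have small: "norm (T ^ i) <= C * r ^ i" if "i < n" for i
proof -
 have "norm (T ^ i) / r ^ i <= (\<Sum>i<n. norm (T ^ i) / r ^ i)"
  using that assms(1) by (intro member_le_sum) auto
 hence "norm (T ^ i) / r ^ i <= C" by (simp add: C_def)
 thus ?thesis using assms(1) by (simp add: field_simps)
qed
have "norm (T ^ k) <= C * r ^ k" for k
proof -
 have "T ^ k = (T ^ n) ^ (k div n) * T ^ (k mod n)"
  by (simp add: power_mult[symmetric] power_add[symmetric])
 hence "norm (T ^ k) <= norm ((T ^ n) ^ (k div n)) * norm (T ^ (k mod n))"
  using norm_mult_ineq by metis
 also have "... <= (r ^ n) ^ (k div n) * (C * r ^ (k mod n))"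
 proof (intro mult_mono)
  show "norm ((T ^ n) ^ (k div n)) <= (r ^ n) ^ (k div n)"
   using norm_power_cop[of "T ^ n" "k div n"] power_mono[OF assms(3) norm_ge_zero, of "k div n"] by linarith
  show "norm (T ^ (k mod n)) <= C * r ^ (k mod n)" using small assms(2) by simp
 qed (use assms(1) in auto)
 also have "... = C * (r ^ (n * (k div n)) * r ^ (k mod n))" by (simp add: power_mult)
 also have "... = C * r ^ k" by (simp add: power_add[symmetric])
 finally show ?thesis .
qed
thus thesis using that C1 by blast
qed

section \<open>Operators bounded below or onto up to finite dimensions\<close>

definition ccsubspace :: "'a::complex_banach set => bool" where
"ccsubspace V <-> csubspace V & closed V"

lemma ccsubspaceD: "ccsubspace V ==> csubspace V" "ccsubspace V ==> closed V"
by (auto simp: ccsubspace_def)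

lemma finite_le: "(a :: enat) <= b ==> b < oo ==> a < oo"
by (rule le_less_trans)

lemma ccsubspace_UNIV [simp]: "ccsubspace UNIV"
and ccsubspace_zero [simp]: "ccsubspace {0}"
by (auto simp: ccsubspace_def)

lemma ccsubspace_Int: "ccsubspace V ==> ccsubspace W ==> ccsubspace (V Int W)"
by (auto simp: ccsubspace_def csubspace_Int)

lemma ccsubspace_vimage_on:
assumes "ccsubspace V" "ccsubspace W"
shows "ccsubspace {x : V. app t x : W}"
proof -
have "{x : V. app t x : W} = V Int app t -` W" by auto
moreover have "closed (app t -` W)"
 by (rule closed_vimage[OF ccsubspaceD(2)[OF assms(2)] linear_continuous_on[OF bounded_linear_app]])
moreover have "csubspace (V Int app t -` W)"
 using assms by (intro csubspace_Int clinear_vimage_subspace clinear_app ccsubspaceD)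
ultimately show ?thesis
 using assms by (simp add: ccsubspace_def closed_Int)
qed

lemma ccsubspace_kernel: "ccsubspace V ==> ccsubspace (ker V t)"
using ccsubspace_vimage_on[of V "{0}" t] by simp

lemma csubspace_im: "csubspace V ==> csubspace (app t ` V)"
by (rule clinear_image_subspace[OF clinear_app])

lemma app_mult_image: "app (s * t) ` V = app s ` app t ` V"
by (auto simp: app_mult image_iff)

lemma power_image_subset: "app t ` V <= V ==> app (t ^ n) ` V <= V"
proof (induction n)
case 0
thus ?case by (auto simp: app_one)
next
case (Suc n)
thus ?case unfolding power_Suc app_mult_image by blast
qed

definition finrank :: "'a::complex_banach cop => bool" where
"finrank f <-> edim (rg f) < oo"

lemma edim_subset_finite:
"csubspace M ==> csubspace N ==> N <= M ==> edim M < oo ==> edim N < oo"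
using edim_mono le_less_trans by blast

lemma edim_plus_finite:
assumes "csubspace M" "csubspace N" "edim M < oo" "edim N < oo" shows "edim (M + N) < oo"
using edim_plus_le[OF assms(1,2)] assms(3,4) by (metis enat_ord_simps(4) le_less_trans plus_eq_infty_iff_enat)

lemma finrank_zero [simp]: "finrank 0"
by (simp add: finrank_def app_simps image_constant_conv)

lemma finrank_add:
assumes "finrank f" "finrank g" shows "finrank (f + g)"
proof -
have "rg (f + g) <= rg f + rg g"
 by (auto simp: app_simps)
thus ?thesis
 using assms edim_plus_finite[of "rg f" "rg g"] edim_subset_finite
 unfolding finrank_def by (metis csubspace_im csubspace_plus csubspace_UNIV)
qed

lemma finrank_mult_left: assumes "finrank f" shows "finrank (s * f)"
proof -
have "rg (s * f) = app s ` rg f" by (rule app_mult_image)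
hence "edim (rg (s * f)) <= edim (rg f)"
 using edim_image_le[OF clinear_app csubspace_im[OF csubspace_UNIV], of s f] by simp
thus ?thesis using assms unfolding finrank_def by (rule finite_le)
qed

lemma finrank_mult_right: assumes "finrank f" shows "finrank (f * s)"
proof -
have "rg (f * s) <= rg f" by (auto simp: app_simps)
thus ?thesis
 using assms edim_subset_finite unfolding finrank_def
 by (metis csubspace_im csubspace_UNIV)
qed

lemma finrank_scale: "finrank f ==> finrank (c *: f)"
using finrank_mult_left[of f "c *: 1"] by simp

lemma finrank_minus: "finrank f ==> finrank (- f)"
using finrank_scale[of f "- 1"] by simp

lemma finrank_diff: "finrank f ==> finrank g ==> finrank (f - g)"
using finrank_add[of f "- g"] finrank_minus[of g] by simp

lemma finrank_kernel:
assumes "finrank f" "csubspace V" shows "ecodim V (ker V f) < oo"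
proof -
have "ecodim V {x : V. app f x : {0}} <= ecodim (rg f) {0}"
 using assms by (intro ecodim_vimage_le clinear_app csubspace_im) (auto intro: image_eqI[of _ _ 0])
hence "ecodim V (ker V f) <= edim (rg f)"
 using ecodim_zero[OF csubspace_im[OF csubspace_UNIV], of f] by simp
thus ?thesis using assms(1) unfolding finrank_def by (rule finite_le)
qed

lemma ecodim_Int_finite:
assumes "csubspace V" "csubspace W" "csubspace W'" "W <= V" "W' <= V" "ecodim V W < oo" "ecodim V W' < oo"
shows "ecodim V (W Int W') < oo"
using ecodim_Int_le[OF assms(1-5)] assms(6,7)
by (metis enat_ord_simps(4) le_less_trans plus_eq_infty_iff_enat)

text \<open>\<open>below_on V t c\<close>: the operator \<open>t\<close> is bounded below by \<open>c\<close> on a closed subspace of finite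
  codimension in \<open>V\<close>. For closed \<open>V\<close> and some \<open>c > 0\<close> this says that \<open>t\<close> is upper semi-Fredholm on
  \<open>V\<close>, but unlike that property it comes with a rate that can be followed through powers.\<close>

definition below_on :: "'a::complex_banach set => 'a cop => real => bool" where
"below_on V t c <-> (EX V'. ccsubspace V' & V' <= V & ecodim V V' < oo &
  (ALL x:V'. c * norm x <= norm (app t x)))"

lemma below_onI:
assumes "ccsubspace V'" "V' <= V" "ecodim V V' < oo" "!!x. x : V' ==> c * norm x <= norm (app t x)"
shows "below_on V t c"
using assms unfolding below_on_def by blast

lemma below_onE:
assumes "below_on V t c"
obtains V' where "ccsubspace V'" "csubspace V'" "V' <= V" "ecodim V V' < oo" "!!x. x : V' ==> c * norm x <= norm (app t x)"
using assms ccsubspaceD unfolding below_on_def by blast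

lemma image_closed_of_below:
assumes "ccsubspace V" "c > 0" "!!x. x : V ==> c * norm x <= norm (app t x)"
shows "closed (app t ` V)"
proof -
note V = ccsubspaceD[OF assms(1)]
have "complete (app t ` V)"
 by (rule complete_isometric_image[OF assms(2) csubspace_imp_subspace[OF V(1)] bounded_linear_app])
  (use assms(3) V(2) in "auto simp: complete_eq_closed mult.commute")
thus ?thesis by (simp add: complete_eq_closed)
qed

lemma below_of_inj_closed:
assumes "ccsubspace V" "closed (app t ` V)" "!!x. x : V ==> app t x = 0 ==> x = 0"
obtains c where "c > 0" "!!x. x : V ==> c * norm x <= norm (app t x)"
proof -
note V = ccsubspaceD[OF assms(1)]
obtain k where k: "k > 0" "!!y. y : app t ` V ==> EX x:V. app t x = y & norm x <= k * norm y"
 using open_mapping[OF bounded_linear_app csubspace_imp_subspace[OF V(1)] V(2) assms(2)] by blast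
have "(1 / k) * norm x <= norm (app t x)" if x: "x : V" for x
proof -
 obtain x' where x': "x' : V" "app t x' = app t x" "norm x' <= k * norm (app t x)"
  using k(2)[OF imageI[OF x]] by blast
 have "x' - x = 0"
  by (rule assms(3)) (use x x' in "simp_all add: app_simps csubspace_diff[OF V(1)]")
 thus ?thesis using x' k(1) by (simp add: field_simps)
qed
thus thesis using that[of "1 / k"] k(1) by simp
qed

lemma below_on_iff:
assumes "ccsubspace V"
shows "(EX c>0. below_on V t c) <-> alpha V (app t) < oo & closed (app t ` V)"
proof
note V = ccsubspaceD[OF assms]
let ?N = "ker V t"
have N: "csubspace ?N" using csubspace_kernel_on[OF clinear_app V(1)] .
{
 assume "EX c>0. below_on V t c"
 then obtain c where c: "c > 0" "below_on V t c" by blast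
 obtain V' where V': "ccsubspace V'" "csubspace V'" "V' <= V" "ecodim V V' < oo"
  "!!x. x : V' ==> c * norm x <= norm (app t x)"
  using below_onE[OF c(2)] by metis
 have "?N Int V' = {0}"
 proof
  show "?N Int V' <= {0}" using V'(5) c(1) by (force simp: mult_le_0_iff)
  show "{0} <= ?N Int V'" using csubspace_0[OF N] csubspace_0[OF V'(2)] by simp
 qed
 hence "alpha V (app t) = ecodim ?N (?N Int V')" using ecodim_zero[OF N] by (simp add: alpha_def)
 also have "... = ecodim (?N + V') V'" using ecodim_plus[OF N V'(2)] by simp
 also have "... <= ecodim V V'"
  using V N V' by (intro ecodim_mono1 csubspace_plus subset_plus plus_least) auto
 finally have 1: "alpha V (app t) < oo" using V'(4) by (rule le_less_trans)
 obtain G where G: "direct_sum V' G V" "edim G < oo"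
  using ecodim_finite_supplement[OF V(1) V'(2,3,4)] by blast
 have "app t ` V = app t ` V' + app t ` G"
  using direct_sumD(6)[OF G(1)] clinear_image_plus[OF clinear_app] by metis
 moreover have "closed (app t ` V' + app t ` G)"
  using image_closed_of_below[OF V'(1) c(1) V'(5)]
   finite_le[OF edim_image_le[OF clinear_app direct_sumD(2)[OF G(1)], of t] G(2)]
  by (intro closed_plus_findim csubspace_im V'(2))
 ultimately show "alpha V (app t) < oo & closed (app t ` V)" using 1 by simp
next
 assume a: "alpha V (app t) < oo & closed (app t ` V)"
 obtain W where W: "closed W" "direct_sum ?N W V"
  using closed_complement[OF V N] a by (auto simp: alpha_def)
 note W' = direct_sumD[OF W(2)]
 have cW: "ccsubspace W" using W W' by (simp add: ccsubspace_def)
 have "app t ` V = app t ` ?N + app t ` W"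
  using W'(6) clinear_image_plus[OF clinear_app] by metis
 moreover have "app t ` ?N = {0}" using csubspace_0[OF N] by (auto intro: image_eqI[of _ _ 0])
 ultimately have "app t ` V = {0} + app t ` W" by (simp only:)
 hence "app t ` V = app t ` W" by (simp add: set_plus_def)
 hence cl: "closed (app t ` W)" using a by simp
 have inj: "x = 0" if "x : W" "app t x = 0" for x
  using that W'(5) by (intro direct_sum_Int[OF W(2)]) auto
 obtain c where c: "c > 0" "!!x. x : W ==> c * norm x <= norm (app t x)"
  using below_of_inj_closed[OF cW cl inj] by blast
 have ds: "direct_sum W ?N V"
  using W(2) by (simp add: direct_sum_alt Int_commute add.commute)
 have "ecodim V W < oo" using a unfolding ecodim_eq[OF ds] alpha_def by blast
 hence "below_on V t c" by (rule below_onI[OF cW W'(5) _ c(2)])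
 thus "EX c>0. below_on V t c" using c(1) by blast
}
qed

lemma below_on_subset:
assumes "below_on V t c" "csubspace V" "ccsubspace U" "U <= V" shows "below_on U t c"
proof -
obtain V' where V': "ccsubspace V'" "csubspace V'" "V' <= V" "ecodim V V' < oo"
 "!!x. x : V' ==> c * norm x <= norm (app t x)"
 using below_onE[OF assms(1)] by metis
note U = ccsubspaceD(1)[OF assms(3)]
have "ecodim U (U Int V') = ecodim (U + V') V'" using ecodim_plus[OF U V'(2)] by simp
also have "... <= ecodim V V'"
 using assms V' U by (intro ecodim_mono1 csubspace_plus subset_plus plus_least) auto
finally have "ecodim U (U Int V') < oo" using V'(4) by (rule le_less_trans)
thus ?thesis using V'(5) ccsubspace_Int[OF assms(3) V'(1)] by (intro below_onI[of "U Int V'"]) auto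
qed

text \<open>Enough for all perturbation arguments below: an estimate by \<open>t\<close> up to a small multiple of the
  norm and up to a finite-rank operator passes the property from \<open>t\<close> to \<open>s\<close>.\<close>

lemma below_on_perturb:
assumes "below_on V t c" "ccsubspace V" "finrank f"
 and "!!x. x : V ==> app f x = 0 ==> b * norm (app t x) <= norm (app s x) + e * norm x" "b >= 0"
shows "below_on V s (b * c - e)"
proof -
note V = ccsubspaceD(1)[OF assms(2)]
obtain V' where V': "ccsubspace V'" "csubspace V'" "V' <= V" "ecodim V V' < oo"
 "!!x. x : V' ==> c * norm x <= norm (app t x)"
 using below_onE[OF assms(1)] by metis
have K: "ccsubspace (ker V f)" by (rule ccsubspace_kernel[OF assms(2)])
show ?thesis
proof (rule below_onI)
 show "ccsubspace (V' Int (ker V f))" by (rule ccsubspace_Int[OF V'(1) K])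
 show "ecodim V (V' Int (ker V f)) < oo"
  using V V' ccsubspaceD(1)[OF K] finrank_kernel[OF assms(3) V] by (intro ecodim_Int_finite) auto
 show "(b * c - e) * norm x <= norm (app s x)" if x: "x : V' Int (ker V f)" for x
 proof -
  have "b * (c * norm x) <= b * norm (app t x)" using V'(5) x assms(5) by (intro mult_left_mono) auto
  also have "... <= norm (app s x) + e * norm x" using assms(4) x by blast
  finally show ?thesis by (simp add: algebra_simps)
 qed
qed (use V' in auto)
qed

lemma below_on_preimage:
assumes "below_on W s c" "ccsubspace V" "ccsubspace W" "app t ` V <= W"
obtains V' where "ccsubspace V'" "V' <= V" "ecodim V V' < oo"
 "!!x. x : V' ==> c * norm (app t x) <= norm (app s (app t x))"
proof -
obtain W' where W': "ccsubspace W'" "csubspace W'" "W' <= W" "ecodim W W' < oo"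
 "!!x. x : W' ==> c * norm x <= norm (app s x)"
 using below_onE[OF assms(1)] by metis
let ?V = "{x : V. app t x : W'}"
have "ecodim V ?V <= ecodim W W'"
 using assms W' ccsubspaceD(1) by (intro ecodim_vimage_le clinear_app) auto
hence "ecodim V ?V < oo" using W'(4) by (rule le_less_trans)
thus thesis
 using that[of ?V] W'(5) ccsubspace_vimage_on[OF assms(2) W'(1)] by auto
qed

lemma below_on_mult:
assumes "below_on W s b" "below_on V t c" "ccsubspace V" "ccsubspace W" "app t ` V <= W" "b >= 0"
shows "below_on V (s * t) (b * c)"
proof -
note V = ccsubspaceD(1)[OF assms(3)]
obtain V1 where V1: "ccsubspace V1" "V1 <= V" "ecodim V V1 < oo"
 "!!x. x : V1 ==> b * norm (app t x) <= norm (app s (app t x))"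
 using below_on_preimage[OF assms(1,3,4,5)] by blast
obtain V2 where V2: "ccsubspace V2" "csubspace V2" "V2 <= V" "ecodim V V2 < oo"
 "!!x. x : V2 ==> c * norm x <= norm (app t x)"
 using below_onE[OF assms(2)] by metis
show ?thesis
proof (rule below_onI)
 show "ccsubspace (V1 Int V2)" by (rule ccsubspace_Int[OF V1(1) V2(1)])
 show "ecodim V (V1 Int V2) < oo"
  using V V1 V2 ccsubspaceD(1)[OF V1(1)] by (intro ecodim_Int_finite) auto
 show "b * c * norm x <= norm (app (s * t) x)" if x: "x : V1 Int V2" for x
 proof -
  have "b * (c * norm x) <= b * norm (app t x)" using V2(5) x assms(6) by (intro mult_left_mono) auto
  also have "... <= norm (app (s * t) x)" using V1(4) x by (simp add: app_simps)
  finally show ?thesis by (simp add: mult.assoc)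
 qed
qed (use V1 in auto)
qed

lemma below_on_power:
assumes "below_on V t c" "ccsubspace V" "app t ` V <= V" "c >= 0"
shows "below_on V (t ^ n) (c ^ n)"
proof (induction n)
case 0
show ?case
 using ccsubspaceD[OF assms(2)] assms(2) by (intro below_onI[of V]) (auto simp: app_one)
next
case (Suc n)
thus ?case
 unfolding power_Suc
 using assms power_image_subset[OF assms(3)] by (intro below_on_mult[of V]) auto
qed

lemma below_on_factor:
assumes "below_on V (s * t) c" "c > 0"
shows "EX c>0. below_on V t c"
proof -
have "norm s + 1 > 0" by (simp add: add_nonneg_pos)
obtain V' where V': "ccsubspace V'" "csubspace V'" "V' <= V" "ecodim V V' < oo"
 "!!x. x : V' ==> c * norm x <= norm (app (s * t) x)"
 using below_onE[OF assms(1)] by metis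
have "c / (norm s + 1) * norm x <= norm (app t x)" if "x : V'" for x
proof -
 have "c * norm x <= norm s * norm (app t x)"
  using V'(5)[OF that] norm_app[of s "app t x"] by (simp add: app_simps)
 also have "... <= (norm s + 1) * norm (app t x)" by (intro mult_right_mono) auto
 finally show ?thesis using \<open>norm s + 1 > 0\<close> by (simp add: field_simps)
qed
thus ?thesis
 using V' assms(2) \<open>norm s + 1 > 0\<close> by (intro exI[of _ "c / (norm s + 1)"] conjI below_onI[of V']) auto
qed

lemma below_on_findim:
assumes "below_on V t c" "ccsubspace V" "finrank f"
 and "!!x. x : V ==> app f x = 0 ==> norm (app t x) <= e * norm x" "e < c"
shows "edim V < oo"
proof -
have "below_on V (0 :: 'a cop) (c - e)"
 using below_on_perturb[OF assms(1-3), of 1 0 e] assms(4) by (simp add: app_simps)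
then obtain V' where V': "ccsubspace V'" "csubspace V'" "V' <= V" "ecodim V V' < oo"
 "!!x. x : V' ==> (c - e) * norm x <= norm (app (0 :: 'a cop) x)"
 using below_onE by metis
have "V' = {0}"
proof
 show "V' <= {0}" using V'(5) assms(5) by (force simp: app_simps mult_le_0_iff)
 show "{0} <= V'" using csubspace_0[OF V'(2)] by simp
qed
thus ?thesis using V'(4) ecodim_zero[OF ccsubspaceD(1)[OF assms(2)]] by (simp only:)
qed

text \<open>The dual notion: \<open>t\<close> maps \<open>V\<close> onto \<open>V\<close> up to a finite-dimensional space, with control \<open>k\<close>
  of the norm of preimages.\<close>

definition onto_on :: "'a::complex_banach set => 'a cop => real => bool" where
"onto_on V t k <-> (EX G. csubspace G & edim G < oo &
  (ALL y:V. EX x:V. EX g:G. y = app t x + g & norm x <= k * norm y))"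

lemma onto_on_of_beta:
assumes "ccsubspace V" "app t ` V <= V" "beta V (app t) < oo"
obtains k where "k > 0" "onto_on V t k"
proof -
note V = ccsubspaceD[OF assms(1)]
obtain G where G: "direct_sum (app t ` V) G V" "edim G < oo"
 using ecodim_finite_supplement[OF V(1) csubspace_im[OF V(1)] assms(2)] assms(3)
 unfolding beta_def by blast
obtain k where k: "k > 0" "!!y. y : app t ` V + G ==> EX x:V. EX g:G. y = app t x + g & norm x <= k * norm y & norm g <= k * norm y"
 using open_mapping_plus[OF bounded_linear_app V direct_sumD(2)[OF G(1)] findim_closed[OF G(2)], of t]
  direct_sumD(6)[OF G(1)] V(2) by metis
have "onto_on V t k"
 unfolding onto_on_def using G k(2) direct_sumD(2,6)[OF G(1)] by (intro exI[of _ G]) metis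
thus thesis using that k(1) by blast
qed

lemma beta_of_onto_on:
assumes "csubspace V" "app t ` V <= V" "onto_on V t k"
shows "beta V (app t) < oo"
proof -
obtain G where G: "csubspace G" "edim G < oo" "!!y. y : V ==> EX x:V. EX g:G. y = app t x + g & norm x <= k * norm y"
 using assms(3) unfolding onto_on_def by blast
have "V <= app t ` V + G" using G(3) by (fastforce intro: set_plus_intro)
hence "ecodim V (app t ` V) <= edim G"
 using assms G(1) by (intro ecodim_le_edim_supplement csubspace_im)
thus ?thesis using G(2) unfolding beta_def by (rule finite_le)
qed

lemma onto_on_power:
assumes "onto_on V t k" "k >= 0" "csubspace V"
shows "onto_on V (t ^ n) (k ^ n)"
proof (induction n)
case 0
show ?case unfolding onto_on_def
 by (intro exI[of _ "{0}"]) (auto simp: app_one)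
next
case (Suc n)
obtain G where G: "csubspace G" "edim G < oo" "!!y. y : V ==> EX x:V. EX g:G. y = app (t ^ n) x + g & norm x <= k ^ n * norm y"
 using Suc unfolding onto_on_def by blast
obtain H where H: "csubspace H" "edim H < oo" "!!y. y : V ==> EX x:V. EX g:H. y = app t x + g & norm x <= k * norm y"
 using assms(1) unfolding onto_on_def by blast
let ?G = "app (t ^ n) ` H + G"
show ?case unfolding onto_on_def
proof (intro exI[of _ ?G] conjI ballI)
 show "csubspace ?G" using G H by (intro csubspace_plus csubspace_im)
 show "edim ?G < oo"
  using G H finite_le[OF edim_image_le[OF clinear_app H(1), of "t ^ n"]] by (intro edim_plus_finite csubspace_im)
 fix y assume y: "y : V"
 obtain x g where x: "x : V" "g : G" "y = app (t ^ n) x + g" "norm x <= k ^ n * norm y" using G(3)[OF y] by blast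
 obtain x' h where x': "x' : V" "h : H" "x = app t x' + h" "norm x' <= k * norm x" using H(3)[OF x(1)] by blast
 have "y = app (t ^ Suc n) x' + (app (t ^ n) h + g)"
  using x x' by (simp add: app_power_Suc(2) app_add del: power_Suc)
 moreover have "app (t ^ n) h + g : ?G" using x x' by (intro set_plus_intro) auto
 moreover have "norm x' <= k ^ Suc n * norm y"
  using x'(4) mult_left_mono[OF x(4) assms(2)] by (simp add: mult.assoc)
 ultimately show "EX x:V. EX g:?G. y = app (t ^ Suc n) x + g & norm x <= k ^ Suc n * norm y"
  using x' by blast
qed
qed

lemma onto_on_perturb:
assumes on: "onto_on V t k" and V: "ccsubspace V" and k: "k >= 0" and f: "finrank f"
 and e: "!!x. x : V ==> norm (app e x) <= d * norm x" "d * k <= 1/2" and eV: "app e ` V <= V" and tV: "app (t + e + f) ` V <= V"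
shows "beta V (app (t + e + f)) < oo"
proof -
note V' = ccsubspaceD[OF V]
obtain G where G: "csubspace G" "edim G < oo" "!!y. y : V ==> EX x:V. EX g:G. y = app t x + g & norm x <= k * norm y"
 using on unfolding onto_on_def by blast
let ?G = "G + rg f"
have rf: "csubspace (rg f)" by (intro csubspace_im csubspace_UNIV)
have sG: "csubspace ?G" by (rule csubspace_plus[OF G(1) rf])
have fG: "edim ?G < oo" using f edim_plus_finite[OF G(1) rf G(2)] by (simp add: finrank_def)
define K where "K = max k (1 + norm t * k + norm f * k)"
have "V <= app (t + e + f) ` V + ?G"
proof (rule approx_onto_plus[where k=K])
 show "0 <= K" using k by (simp add: K_def)
 fix y assume y: "y : V"
 obtain x g where x: "x : V" "g : G" "y = app t x + g" "norm x <= k * norm y" using G(3)[OF y] by blast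
 let ?g = "g - app f x"
 have gG: "?g : ?G" using set_plus_intro[OF x(2), of "- app f x"] rangeI[of "app f" "- x"] by (simp add: app_simps)
 have err: "y - (app (t + e + f) x + ?g) = - app e x" using x(3) by (simp add: app_simps)
 have "norm (app e x) <= d * norm x" by (rule e(1)[OF x(1)])
 also have "... <= norm y / 2"
 proof (cases "d >= 0")
  case True
  have "d * norm x <= d * (k * norm y)" using x(4) True by (intro mult_left_mono)
  also have "... <= 1/2 * norm y" using mult_right_mono[OF e(2), of "norm y"] by (simp add: mult.assoc)
  finally show ?thesis by simp
 next
  case False
  hence "d * norm x <= 0" by (simp add: mult_nonpos_nonneg)
  thus ?thesis using norm_ge_zero[of y] by linarith
 qed
 finally have small: "norm (y - (app (t + e + f) x + ?g)) <= norm y / 2" by (simp add: err)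
 have xK: "norm x <= K * norm y"
  using x(4) mult_right_mono[of k K "norm y"] by (simp add: K_def)
 have "norm ?g <= norm g + norm (app f x)" by (rule norm_triangle_ineq4)
 also have "norm g <= norm y + norm (app t x)"
 proof -
  have "g = y - app t x" using x(3) by simp
  thus ?thesis using norm_triangle_ineq4 by blast
 qed
 also have "norm (app t x) <= norm t * (k * norm y)"
  using norm_app[of t x] mult_left_mono[OF x(4) norm_ge_zero[of t]] by linarith
 also have "norm (app f x) <= norm f * (k * norm y)"
  using norm_app[of f x] mult_left_mono[OF x(4) norm_ge_zero[of f]] by linarith
 finally have "norm ?g <= (1 + norm t * k + norm f * k) * norm y" by (simp add: algebra_simps)
 also have "... <= K * norm y" unfolding K_def by (intro mult_right_mono) auto
 finally have gK: "norm ?g <= K * norm y" .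
 have "y - (app (t + e + f) x + ?g) : V" unfolding err using x(1) eV csubspace_neg[OF V'(1)] by blast
 thus "EX x:V. EX g:?G. norm x <= K * norm y & norm g <= K * norm y &
   y - (app (t + e + f) x + g) : V & norm (y - (app (t + e + f) x + g)) <= norm y / 2"
  using x(1) gG xK gK small by blast
qed (use V' sG findim_closed[OF fG] bounded_linear_app in auto)
hence "ecodim V (app (t + e + f) ` V) <= edim ?G"
 using V' sG tV by (intro ecodim_le_edim_supplement csubspace_im)
thus ?thesis using fG unfolding beta_def by (rule finite_le)
qed

lemma onto_small_perturb:
assumes V: "ccsubspace V" and tV: "app t ` V = V"
obtains d where "d > 0" "!!e. norm e < d ==> app e ` V <= V ==> V <= app (t + e) ` V"
proof -
note V' = ccsubspaceD[OF V]
obtain k where k: "k > 0" "!!y. y : V ==> EX x:V. app t x = y & norm x <= k * norm y"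
 using open_mapping[OF bounded_linear_app csubspace_imp_subspace[OF V'(1)] V'(2), of t] tV V'(2) by metis
have "V <= app (t + e) ` V" if e: "norm e < 1 / (2 * k)" "app e ` V <= V" for e
proof
 fix y assume y: "y : V"
 have "EX x:V. app (t + e) x = y & norm x <= 2 * k * norm y"
 proof (rule approx_onto[OF bounded_linear_app csubspace_imp_subspace[OF V'(1)] V'(2) _ _ y])
  fix y assume y: "y : V"
  obtain x where x: "x : V" "app t x = y" "norm x <= k * norm y" using k(2)[OF y] by blast
  have err: "y - app (t + e) x = - app e x" using x by (simp add: app_simps)
  have "norm (app e x) <= norm e * norm x" by (rule norm_app)
  also have "... <= 1 / (2 * k) * (k * norm y)" using e(1) x(3) k(1) by (intro mult_mono) auto
  finally have "norm (y - app (t + e) x) <= norm y / 2" using k(1) by (simp add: err)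
  moreover have "y - app (t + e) x : V" unfolding err using x(1) e(2) csubspace_neg[OF V'(1)] by blast
  ultimately show "EX x:V. norm x <= k * norm y & y - app (t + e) x : V & norm (y - app (t + e) x) <= norm y / 2"
   using x by blast
 qed (use k(1) in simp)
 thus "y : app (t + e) ` V" by blast
qed
thus thesis using that[of "1 / (2 * k)"] k(1) by simp
qed

section \<open>Stability of the index\<close>

definition fredholm_on :: "'a::complex_banach set => 'a cop => bool" where
"fredholm_on V t <-> alpha V (app t) < oo & beta V (app t) < oo"

lemma enat_index_arith:
fixes a b a' b' c d :: enat
assumes "c + a = d + b" "c + a' = d + b'" "c < oo" "d < oo" "b < oo" "b' < oo"
shows "a < oo" "a' < oo" "a + b' = a' + b"
proof -
obtain c0 d0 b0 b0' where e: "c = enat c0" "d = enat d0" "b = enat b0" "b' = enat b0'"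
 using assms(3-6) by auto
show "a < oo" using assms(1) e by (cases a) auto
show "a' < oo" using assms(2) e by (cases a') auto
show "a + b' = a' + b" using assms(1,2) e by (cases a; cases a') auto
qed

text \<open>If \<open>W\<close> is a closed complement of the kernel and \<open>G\<close> one of the range, then
  \<open>(x, g) \<mapsto> t x + g\<close> is an isomorphism of \<open>W \<times> G\<close> onto \<open>V\<close>, and it remains one when \<open>t\<close> is
  perturbed a little; so the codimension of \<open>t W\<close>, and with it the index, does not change.\<close>

lemma index_stable:
fixes t :: "'a::complex_banach cop"
assumes V: "ccsubspace V" and tV: "app t ` V <= V" and fr: "fredholm_on V t"
obtains d where "d > 0" "!!e. norm e < d ==> app e ` V <= V ==>
 fredholm_on V (t + e) & alpha V (app t) + beta V (app (t + e)) = alpha V (app (t + e)) + beta V (app t)"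
proof -
note V' = ccsubspaceD[OF V]
let ?N = "ker V t"
have N: "csubspace ?N" by (rule csubspace_kernel_on[OF clinear_app V'(1)])
have fa: "edim ?N < oo" using fr unfolding fredholm_on_def alpha_def by blast
have fb: "ecodim V (app t ` V) < oo" using fr unfolding fredholm_on_def beta_def by blast
obtain W where W: "closed W" "direct_sum ?N W V"
 using closed_complement[OF V' N fa Collect_subset] by blast
note W' = direct_sumD[OF W(2)]
have "app t ` V = app t ` ?N + app t ` W"
 using W'(6) clinear_image_plus[OF clinear_app] by metis
moreover have "app t ` ?N = {0}" using csubspace_0[OF N] by (auto intro: image_eqI[of _ _ 0])
ultimately have "app t ` V = {0} + app t ` W" by (simp only:)
hence tW: "app t ` V = app t ` W" by (simp add: set_plus_def)
obtain G where G: "direct_sum (app t ` V) G V" "edim G < oo"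
 using ecodim_finite_supplement[OF V'(1) csubspace_im[OF V'(1)] tV fb] by blast
note G' = direct_sumD[OF G(1)]
have sum: "app t ` W + G = V" using G'(6) tW by simp
obtain k where k: "k > 0" "!!y. y : V ==> EX x:W. EX g:G. y = app t x + g & norm x <= k * norm y & norm g <= k * norm y"
 using open_mapping_plus[OF bounded_linear_app W'(2) W(1) G'(2) findim_closed[OF G(2)], of t] V'(2)
 unfolding sum by blast
have low: "norm x <= k * norm (app t x + g)" if x: "x : W" "g : G" for x g
proof -
 have "app t x + g : V" using x tW sum by (metis imageI set_plus_intro)
 then obtain x' g' where x': "x' : W" "g' : G" "app t x + g = app t x' + g'" "norm x' <= k * norm (app t x + g)"
  using k(2) by metis
 have "app t (x - x') = g' - g" using x'(3) by (simp add: app_diff algebra_simps)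
 moreover have "app t (x - x') : app t ` V" using x x' W'(5) V'(1) by (intro imageI csubspace_diff) auto
 moreover have "g' - g : G" using x x' by (intro csubspace_diff G'(2))
 ultimately have z: "app t (x - x') = 0" using direct_sum_Int[OF G(1)] by metis
 moreover have xW: "x - x' : W" using x x' by (intro csubspace_diff W'(2))
 ultimately have "x - x' : ?N" using W'(5) by blast
 hence "x - x' = 0" using xW by (rule direct_sum_Int[OF W(2)])
 thus ?thesis using x'(4) by simp
qed
have main: "fredholm_on V (t + e) & alpha V (app t) + beta V (app (t + e)) = alpha V (app (t + e)) + beta V (app t)"
 if e: "norm e < 1 / (2 * k)" "app e ` V <= V" for e
proof -
 have teV: "app (t + e) ` V <= V" using tV e(2) V'(1) by (auto simp: app_simps intro!: csubspace_add)
 have ek: "norm e * k < 1/2" using e(1) k(1) by (simp add: field_simps)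
 have inj: "x = 0" if x: "x : W" "g : G" "app (t + e) x + g = 0" for x g
 proof -
  have "app t x + g = - app e x" using x(3) by (simp add: app_simps eq_neg_iff_add_eq_0 algebra_simps)
  hence "norm x <= k * norm (app e x)" using low[OF x(1,2)] by simp
  also have "... <= k * (norm e * norm x)" using k(1) by (intro mult_left_mono norm_app) auto
  finally have "norm x <= (norm e * k) * norm x" by (simp add: mult_ac)
  moreover have "(norm e * k) * norm x <= 1/2 * norm x" using ek by (intro mult_right_mono) auto
  ultimately have "norm x <= 1/2 * norm x" by (rule order_trans)
  thus "x = 0" by simp
 qed
 have ds: "direct_sum (app (t + e) ` W) G V"
 proof (rule direct_sumI)
  show "csubspace (app (t + e) ` W)" "csubspace G" using W' G' csubspace_im by auto
  show "y = 0" if y: "y : app (t + e) ` W" "y : G" for y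
  proof -
   obtain x where x: "x : W" "y = app (t + e) x" using y by blast
   have "x = 0" using inj[OF x(1) csubspace_neg[OF G'(2) y(2)]] x(2) by simp
   thus ?thesis using x by simp
  qed
  show "app (t + e) ` W + G = V"
  proof
   show "app (t + e) ` W + G <= V"
    using teV W'(5) G'(5) V'(1) by (intro plus_least) auto
   show "V <= app (t + e) ` W + G"
   proof (rule approx_onto_plus[where k=k])
    fix y assume y: "y : V"
    obtain x g where x: "x : W" "g : G" "y = app t x + g" "norm x <= k * norm y" "norm g <= k * norm y"
     using k(2)[OF y] by blast
    have err: "y - (app (t + e) x + g) = - app e x" using x(3) by (simp add: app_simps)
    have "norm (app e x) <= norm e * (k * norm y)"
     using norm_app[of e x] mult_left_mono[OF x(4) norm_ge_zero[of e]] by linarith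
    also have "... <= 1/2 * norm y" using mult_right_mono[of "norm e * k" "1/2" "norm y"] ek by (simp add: mult.assoc)
    finally have "norm (y - (app (t + e) x + g)) <= norm y / 2" by (simp add: err)
    moreover have "y - (app (t + e) x + g) : V"
     unfolding err using e(2) x(1) W'(5) csubspace_neg[OF V'(1)] by blast
    ultimately show "EX x:W. EX g:G. norm x <= k * norm y & norm g <= k * norm y &
      y - (app (t + e) x + g) : V & norm (y - (app (t + e) x + g)) <= norm y / 2"
     using x by blast
   qed (use W W' G' k(1) findim_closed[OF G(2)] bounded_linear_app in auto)
  qed
 qed
 have c: "ecodim V (app t ` W) = edim G" using ecodim_eq[OF G(1)] tW by simp
 have c': "ecodim V (app (t + e) ` W) = edim G" by (rule ecodim_eq[OF ds])
 have "x = 0" if "x : W" "app t x = 0" for x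
  using that W'(5) by (intro direct_sum_Int[OF W(2)]) auto
 hence i: "edim G + alpha V (app t) = ecodim V W + beta V (app t)"
  using index_via_injective_part[OF clinear_app V'(1) tV W'(2,5)] c by simp
 have "x = 0" if "x : W" "app (t + e) x = 0" for x
  using that inj[of x 0] csubspace_0[OF G'(2)] by simp
 hence i': "edim G + alpha V (app (t + e)) = ecodim V W + beta V (app (t + e))"
  using index_via_injective_part[OF clinear_app V'(1) teV W'(2,5)] c' by simp
 have "ecodim V (app (t + e) ` V) <= ecodim V (app (t + e) ` W)"
  using V' teV W' by (intro ecodim_mono2 csubspace_im image_mono) auto
 hence b': "beta V (app (t + e)) < oo" using G(2) unfolding beta_def c' by (rule finite_le)
 have b: "beta V (app t) < oo" using fr unfolding fredholm_on_def by blast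
 have dW: "direct_sum W ?N V" using W(2) by (simp add: direct_sum_alt Int_commute add.commute)
 have d: "ecodim V W < oo" using fa unfolding ecodim_eq[OF dW] .
 from enat_index_arith[OF i i' G(2) d b b'] b' show ?thesis by (simp only: fredholm_on_def simp_thms)
qed
show thesis by (rule that[of "1 / (2 * k)"]) (use k(1) main in auto)
qed

text \<open>The difference of the indices is locally constant along the segment from \<open>t\<close> to \<open>t + r\<close>.\<close>

lemma index_path:
fixes t :: "'a::complex_banach cop"
assumes V: "ccsubspace V" and tV: "app t ` V <= V" and rV: "app r ` V <= V"
 and fr: "!!s. fredholm_on V (t + s *: r)"
shows "alpha V (app t) + beta V (app (t + r)) = alpha V (app (t + r)) + beta V (app t)"
proof -
note V' = ccsubspaceD[OF V]
define a where "a s = the_enat (alpha V (app (t + complex_of_real s *: r)))" for s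
define b where "b s = the_enat (beta V (app (t + complex_of_real s *: r)))" for s
have ab: "alpha V (app (t + complex_of_real s *: r)) = enat (a s)" "beta V (app (t + complex_of_real s *: r)) = enat (b s)" for s
 using fr[of "complex_of_real s"] unfolding a_def b_def fredholm_on_def by auto
have "int (a 0) - int (b 0) = int (a 1) - int (b 1)"
proof (rule connected_local_const[of "UNIV :: real set" 0 1 "%s. int (a s) - int (b s)"])
 show "ALL s:UNIV. \<forall>\<^sub>F s' in at s within UNIV. int (a s) - int (b s) = int (a s') - int (b s')"
 proof
  fix s :: real
  have sV: "app (t + complex_of_real s *: r) ` V <= V"
   using tV rV V'(1) by (auto simp: app_simps intro!: csubspace_add csubspace_scale)
  obtain d where d: "d > 0" "!!e. norm e < d ==> app e ` V <= V ==>
    alpha V (app (t + complex_of_real s *: r)) + beta V (app (t + complex_of_real s *: r + e)) =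
    alpha V (app (t + complex_of_real s *: r + e)) + beta V (app (t + complex_of_real s *: r))"
   using index_stable[OF V sV fr] by metis
  have "int (a s) - int (b s) = int (a s') - int (b s')" if s': "dist s' s < d / (norm r + 1)" for s'
  proof -
   let ?e = "complex_of_real (s' - s) *: r"
   have "norm ?e = \<bar>s' - s\<bar> * norm r" by (simp add: norm_scaleC del: of_real_diff)
   also have "... <= \<bar>s' - s\<bar> * (norm r + 1)" by (intro mult_left_mono) auto
   also have "... < d"
    using s' pos_less_divide_eq[of "norm r + 1" "\<bar>s' - s\<bar>" d] by (simp add: dist_real_def add_nonneg_pos)
   finally have n1: "norm ?e < d" .
   have n2: "app ?e ` V <= V" using rV V'(1) by (auto simp: app_simps intro!: csubspace_scale)
   have n3: "t + complex_of_real s *: r + ?e = t + complex_of_real s' *: r"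
    by (simp add: scaleC_diff_left)
   have "enat (a s) + enat (b s') = enat (a s') + enat (b s)" using d(2)[OF n1 n2] unfolding n3 ab .
   hence "a s + b s' = a s' + b s" by simp
   thus ?thesis by linarith
  qed
  thus "\<forall>\<^sub>F s' in at s within UNIV. int (a s) - int (b s) = int (a s') - int (b s')"
   unfolding eventually_at using d(1) by (intro exI[of _ "d / (norm r + 1)"]) (auto simp: add_nonneg_pos)
 qed
qed auto
hence "a 0 + b 1 = a 1 + b 0" by simp
thus ?thesis using ab[of 0] ab[of 1] by simp
qed

section \<open>Ascent, descent and eigenvalues nearby\<close>

definition fin_asc :: "'a::complex_banach set => 'a cop => bool" where
"fin_asc V t <-> (EX n. ALL x:app (t ^ n) ` V. app t x = 0 --> x = 0)"

definition fin_desc :: "'a::complex_banach set => 'a cop => bool" where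
"fin_desc V t <-> (EX n. app (t ^ Suc n) ` V = app (t ^ n) ` V)"

definition browder :: "'a::complex_banach cop => bool" where
"browder t <-> fredholm_on UNIV t & fin_asc UNIV t & fin_desc UNIV t"

lemma decreasing_findim_stable:
assumes "!!n. csubspace (M n)" "!!n. M (Suc n) <= M n" "edim (M 0) < oo"
obtains k where "!!n. n >= k ==> M n = M k"
proof -
have anti: "M n <= M m" if "m <= n" for m n
 using lift_Suc_antimono_le[of M, OF assms(2) that] .
have fin: "edim (M n) < oo" for n
 by (rule finite_le[OF edim_mono[OF assms(1,1) anti] assms(3)]) simp
let ?S = "range (%n. edim (M n))"
have "(LEAST e. e : ?S) : ?S" by (rule LeastI[of "%e. e : ?S" "edim (M 0)"]) simp
then obtain k where "(LEAST e. e : ?S) = edim (M k)" by blast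
hence k: "edim (M k) <= edim (M n)" for n
 using Least_le[of "%e. e : ?S" "edim (M n)"] by simp
have "M n = M k" if n: "n >= k" for n
proof -
 have z: "{0} <= M n" using csubspace_0[OF assms(1)] by simp
 have "edim (M k) = ecodim (M k) (M n) + edim (M n)"
  using ecodim_chain[OF assms(1,1) csubspace_zero z anti[OF n]]
   ecodim_zero[OF assms(1)] by simp
 hence "ecodim (M k) (M n) = 0"
  using k[of n] fin[of n] fin[of k] by (cases "edim (M n)"; cases "edim (M k)"; cases "ecodim (M k) (M n)") (auto simp: zero_enat_def)
 thus ?thesis using ecodim_eq_0[OF assms(1,1) anti[OF n]] by simp
qed
thus thesis using that by blast
qed

lemma power_image_antimono:
assumes "app t ` V <= V" "m <= n" shows "app (t ^ n) ` V <= app (t ^ m) ` V"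
proof -
have "t ^ n = t ^ m * t ^ (n - m)" using assms(2) by (simp add: power_add[symmetric])
thus ?thesis using power_image_subset[OF assms(1), of "n - m"] by (auto simp: app_mult_image)
qed

lemma power_image_comm: "app t ` app (t ^ n) ` V = app (t ^ Suc n) ` V" "app (t ^ n) ` app t ` V = app (t ^ Suc n) ` V"
by (simp_all only: app_mult_image[symmetric] power_Suc[symmetric] power_Suc2[symmetric])

text \<open>As \<open>N(t)\<close> has finite dimension, the spaces \<open>N(t) \<inter> R(t^n)\<close> become stationary; therefore a point of the
  hyperrange has a preimage that lies in all the ranges.\<close>

lemma hyperrange:
fixes t :: "'a::complex_banach cop"
assumes "below_on UNIV t c" "c > 0"
defines "Y == \<Inter>n. rg (t ^ n)"
shows "ccsubspace Y" "app t ` Y = Y" "!!z x. z ~= 0 ==> app t x = z *: x ==> x : Y"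
 "EX n. {x : rg (t ^ n). app t x = 0} = ker Y t"
proof -
have "EX c>0. below_on UNIV (t ^ n) c" for n
 using below_on_power[OF assms(1) ccsubspace_UNIV] assms(2) by (intro exI[of _ "c ^ n"]) auto
hence cl: "closed (rg (t ^ n))" for n using below_on_iff[OF ccsubspace_UNIV] by blast
have sub: "csubspace (rg (t ^ n))" for n by (intro csubspace_im csubspace_UNIV)
show Yc: "ccsubspace Y"
 unfolding ccsubspace_def Y_def using cl sub by (auto intro: complex_vector.subspace_Int)
let ?M = "%n. {x : rg (t ^ n). app t x = 0}"
have anti: "rg (t ^ n) <= rg (t ^ m)" if "m <= n" for m n
 using power_image_antimono[OF subset_UNIV that] .
have "edim (?M 0) < oo"
proof -
 have "alpha UNIV (app t) < oo" using below_on_iff[OF ccsubspace_UNIV] assms by blast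
 moreover have "?M 0 = ker UNIV t" by (auto simp: app_one intro: image_eqI[of _ _ "_"])
 ultimately show ?thesis unfolding alpha_def by simp
qed
moreover have "csubspace (?M n)" for n by (rule csubspace_kernel_on[OF clinear_app sub])
moreover have "?M (Suc n) <= ?M n" for n
proof -
 have "n <= Suc n" by simp
 from anti[OF this] show ?thesis by blast
qed
ultimately obtain k where k: "!!n. n >= k ==> ?M n = ?M k"
 using decreasing_findim_stable[of ?M] by blast
have kY: "x : Y" if x: "x : ?M k" for x
 unfolding Y_def
proof
 fix n
 have "x : ?M (max k n)" using x k[of "max k n"] by simp
 thus "x : rg (t ^ n)" using anti[of n "max k n"] by auto
qed
show "EX n. {x : rg (t ^ n). app t x = 0} = ker Y t"
 using kY by (intro exI[of _ k]) (auto simp: Y_def)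
show "app t ` Y = Y"
proof
 show "app t ` Y <= Y"
 proof
  fix y assume "y : app t ` Y"
  then obtain x where x: "x : Y" "y = app t x" by blast
  have "y : rg (t ^ n)" for n
  proof -
   have "x : rg (t ^ n)" using x by (simp add: Y_def)
   hence "y : app t ` rg (t ^ n)" using x(2) by blast
   hence "y : rg (t ^ Suc n)" by (simp only: power_image_comm)
   thus ?thesis using anti[of n "Suc n"] by auto
  qed
  thus "y : Y" by (simp add: Y_def)
 qed
 show "Y <= app t ` Y"
 proof
  fix y assume y: "y : Y"
  have ex: "EX x:rg (t ^ n). y = app t x" for n
  proof -
   have "y : rg (t ^ Suc n)" using y unfolding Y_def by blast
   hence "y : app t ` rg (t ^ n)" by (simp only: power_image_comm)
   thus ?thesis by blast
  qed
  obtain x where x: "x : rg (t ^ k)" "y = app t x" using ex by blast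
  have "x : rg (t ^ n)" for n
  proof -
   let ?m = "max k n"
   obtain x' where x': "x' : rg (t ^ ?m)" "y = app t x'" using ex by blast
   have "x' : rg (t ^ k)" using x'(1) anti[of k ?m] by auto
   hence "x - x' : ?M k" using x x' csubspace_diff[OF sub] by (simp add: app_diff)
   hence "x - x' : ?M ?m" using k[of ?m] by simp
   hence "(x - x') + x' : rg (t ^ ?m)" using x'(1) by (intro csubspace_add[OF sub]) auto
   thus ?thesis using anti[of n ?m] by auto
  qed
  thus "y : app t ` Y" using x(2) by (auto simp: Y_def)
 qed
qed
show "x : Y" if z: "z ~= 0" "app t x = z *: x" for z x
proof -
 have p: "app (t ^ n) x = z ^ n *: x" for n
  by (induction n) (simp_all add: app_one app_power_Suc(1) app_scaleC z(2) scaleC_scaleC mult.commute del: power_Suc, simp add: mult.commute)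
 have "x : rg (t ^ n)" for n
 proof (rule image_eqI)
  show "x = app (t ^ n) (inverse (z ^ n) *: x)" using z(1) by (simp add: app_scaleC p scaleC_scaleC)
 qed simp
 thus ?thesis by (simp add: Y_def)
qed
qed

lemma fin_asc_no_eigenvalues:
fixes t :: "'a::complex_banach cop"
assumes "below_on UNIV t c" "c > 0" "fin_asc UNIV t"
obtains d where "d > 0" "!!z x. 0 < cmod z ==> cmod z < d ==> app t x = z *: x ==> x = 0"
proof -
note H = hyperrange[OF assms(1,2)]
let ?Y = "\<Inter>n. rg (t ^ n)"
obtain n where n: "!!x. x : rg (t ^ n) ==> app t x = 0 ==> x = 0"
 using assms(3) unfolding fin_asc_def by blast
have inj: "x = 0" if "x : ?Y" "app t x = 0" for x using that n by blast
have "closed (app t ` ?Y)" using H(1,2) by (simp only: ccsubspaceD)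
then obtain b where b: "b > 0" "!!x. x : ?Y ==> b * norm x <= norm (app t x)"
 using below_of_inj_closed[OF H(1) _ inj] by blast
show thesis
proof (rule that[OF b(1)])
 fix z x assume z: "0 < cmod z" "cmod z < b" "app t x = z *: x"
 have "x : ?Y" using z by (intro H(3)[of z]) auto
 hence "b * norm x <= cmod z * norm x" using b(2)[of x] z(3) by (simp add: norm_scaleC)
 hence "(b - cmod z) * norm x <= 0" by (simp add: algebra_simps)
 thus "x = 0" using z(2) by (simp add: mult_le_0_iff)
qed
qed

lemma minus_scale_maps: "csubspace V ==> app (- (z *: 1)) ` V <= V"
by (auto simp: app_simps intro!: csubspace_neg csubspace_scale)

lemma infinite_asc_eigenvalues:
fixes t :: "'a::complex_banach cop"
assumes "below_on UNIV t c" "c > 0" "~ fin_asc UNIV t"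
obtains d where "d > 0" "!!z. cmod z < d ==> EX x. x ~= 0 & app t x = z *: x"
proof -
note H = hyperrange[OF assms(1,2)]
let ?Y = "\<Inter>n. rg (t ^ n)"
note Y = ccsubspaceD[OF H(1)]
have tY: "app t ` ?Y <= ?Y" using H(2) by simp
obtain n where n: "{x : rg (t ^ n). app t x = 0} = ker ?Y t" using H(4) by blast
obtain u where u: "u : rg (t ^ n)" "app t u = 0" "u ~= 0"
 using assms(3) unfolding fin_asc_def by blast
hence uY: "u : (ker ?Y t)" using n by blast
have "EX c>0. below_on ?Y t c"
 using below_on_subset[OF assms(1) csubspace_UNIV H(1)] assms(2) by blast
hence a: "alpha ?Y (app t) < oo" using below_on_iff[OF H(1)] by blast
have b: "beta ?Y (app t) = 0" unfolding beta_def H(2) by (rule ecodim_self[OF Y(1)])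
have a0: "alpha ?Y (app t) ~= 0"
 unfolding alpha_def using edim_eq_0[OF csubspace_kernel_on[OF clinear_app Y(1), of t]] uY u(3) by blast
have "fredholm_on ?Y t" using a b by (simp add: fredholm_on_def)
then obtain d where d: "d > 0" "!!e. norm e < d ==> app e ` ?Y <= ?Y ==>
  alpha ?Y (app t) + beta ?Y (app (t + e)) = alpha ?Y (app (t + e)) + beta ?Y (app t)"
 using index_stable[OF H(1) tY] by metis
show thesis
proof (rule that[OF d(1)])
 fix z assume z: "cmod z < d"
 let ?e = "- (z *: 1) :: 'a cop"
 have "norm ?e <= cmod z" using mult_left_mono[OF norm_one_le, of "cmod z"] by (simp add: norm_scaleC)
 hence "alpha ?Y (app (t + ?e)) ~= 0"
  using d(2)[of ?e] minus_scale_maps[OF Y(1)] z a0 b by auto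
 hence "ker ?Y (t + ?e) ~= {0}" unfolding alpha_def using edim_zero by metis
 moreover have "0 : (ker ?Y (t + ?e))" using csubspace_0[OF Y(1)] by simp
 ultimately obtain x where "x ~= 0" "app (t + ?e) x = 0" by blast
 thus "EX x. x ~= 0 & app t x = z *: x" by (auto simp: app_simps)
qed
qed

lemma power_minus_scalar_factor:
fixes t :: "'a::complex_banach cop"
shows "EX s. t ^ n - z ^ n *: 1 = (t -. z) * s"
proof (induction n)
case (Suc n)
then obtain s where s: "t ^ n - z ^ n *: 1 = (t -. z) * s" by blast
have "t ^ Suc n - z ^ Suc n *: 1 = (t ^ n - z ^ n *: 1) * t + z ^ n *: (t -. z)"
 by (simp add: left_diff_distrib power_commutes scaleC_diff_right scaleC_scaleC mult.commute)
also have "... = (t -. z) * (s * t + z ^ n *: 1)" unfolding s by (simp add: distrib_left mult.assoc)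
finally show ?case by blast
qed (auto intro: exI[of _ 0])

lemma fin_desc_onto_nearby:
fixes t :: "'a::complex_banach cop"
assumes "beta UNIV (app t) < oo" "fin_desc UNIV t"
obtains d where "d > 0" "!!z. 0 < cmod z ==> cmod z < d ==> surj (app (t -. z))"
proof -
obtain p where p: "rg (t ^ Suc p) = rg (t ^ p)" using assms(2) unfolding fin_desc_def by blast
let ?W = "rg (t ^ p)"
obtain k where k: "k > 0" "onto_on UNIV t k" using onto_on_of_beta[OF ccsubspace_UNIV _ assms(1)] by blast
have "beta UNIV (app (t ^ p)) < oo"
 using k by (intro beta_of_onto_on[OF _ _ onto_on_power]) auto
hence "closed ?W"
 unfolding beta_def
 by (intro finite_codim_range_closed[OF bounded_linear_app clinear_app, of UNIV UNIV]) auto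
hence W: "ccsubspace ?W"
 unfolding ccsubspace_def by (simp add: csubspace_im)
have tW: "app t ` ?W = ?W" unfolding power_image_comm p ..
obtain d where d: "d > 0" "!!e. norm e < d ==> app e ` ?W <= ?W ==> ?W <= app (t + e) ` ?W"
 using onto_small_perturb[OF W tW] by blast
show thesis
proof (rule that[OF d(1)])
 fix z assume z: "0 < cmod z" "cmod z < d"
 let ?e = "- (z *: 1) :: 'a cop"
 have "norm ?e <= cmod z" using mult_left_mono[OF norm_one_le, of "cmod z"] by (simp add: norm_scaleC)
 hence "?W <= app (t + ?e) ` ?W"
  using z by (intro d(2) minus_scale_maps ccsubspaceD(1)[OF W]) auto
 hence Ws: "?W <= rg (t -. z)" by auto
 obtain s where s: "t ^ p - z ^ p *: 1 = (t -. z) * s" using power_minus_scalar_factor by blast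
 have sr: "csubspace (rg (t -. z))" by (intro csubspace_im csubspace_UNIV)
 have "x : rg (t -. z)" for x
 proof -
  have "app (t ^ p) x - app (t -. z) (app s x) = z ^ p *: x"
   using arg_cong[OF s, of "%u. app u x"] by (simp add: app_simps1 app_mult app_scaleC_left app_one algebra_simps)
  moreover have "app (t ^ p) x - app (t -. z) (app s x) : rg (t -. z)"
   using Ws by (intro csubspace_diff[OF sr]) auto
  ultimately have "inverse (z ^ p) *: (z ^ p *: x) : rg (t -. z)"
   using csubspace_scale[OF sr] by metis
  thus ?thesis using z(1) by (simp add: scaleC_scaleC)
 qed
 thus "surj (app (t -. z))" by blast
qed
qed

section \<open>Riesz operators\<close>

lemma fredholm_UNIV_iff:
"fredholm_on UNIV t <-> (EX c>0. below_on UNIV t c) & beta UNIV (app t) < oo"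
proof -
have "closed (rg t)" if "beta UNIV (app t) < oo"
 using that unfolding beta_def
 by (intro finite_codim_range_closed[OF bounded_linear_app clinear_app, of UNIV UNIV]) auto
thus ?thesis unfolding fredholm_on_def below_on_iff[OF ccsubspace_UNIV] by blast
qed

lemma fredholm_finrank:
fixes t :: "'a::complex_banach cop"
assumes "fredholm_on UNIV t" "finrank f" shows "fredholm_on UNIV (t + f)"
proof -
obtain c where c: "c > 0" "below_on UNIV t c" using assms(1) fredholm_UNIV_iff by blast
have "below_on UNIV (t + f) (1 * c - 0)"
 by (rule below_on_perturb[OF c(2) ccsubspace_UNIV assms(2)]) (simp_all add: app_simps)
hence 1: "EX c>0. below_on UNIV (t + f) c" using c(1) by auto
have "beta UNIV (app t) < oo" using assms(1) fredholm_UNIV_iff by blast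
then obtain k where k: "k > 0" "onto_on UNIV t k" by (rule onto_on_of_beta[OF ccsubspace_UNIV subset_UNIV])
have "beta UNIV (app (t + 0 + f)) < oo"
 by (rule onto_on_perturb[OF k(2) ccsubspace_UNIV less_imp_le[OF k(1)] assms(2), of 0 0])
  (simp_all add: app_simps)
thus ?thesis using 1 unfolding fredholm_UNIV_iff by simp
qed

lemma kernel_zero_alpha: "(!!x. app t x = 0 ==> x = 0) ==> alpha UNIV (app t) = 0"
proof -
assume "!!x. app t x = 0 ==> x = 0"
hence "ker UNIV t = {0}" by auto
thus ?thesis unfolding alpha_def by simp
qed

lemma surj_beta: "surj (app t) ==> beta UNIV (app t) = 0"
unfolding beta_def by (simp add: ecodim_self)

lemma invertible_browder:
assumes "inv_op t" shows "browder t"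
proof -
have b: "bij (app t)" using assms inv_op_iff_bij by blast
have i: "x = 0" if "app t x = 0" for x using b that by (metis app_0 bij_is_inj injD)
have "fredholm_on UNIV t"
 unfolding fredholm_on_def by (simp add: kernel_zero_alpha[OF i] surj_beta[OF bij_is_surj[OF b]])
moreover have "fin_asc UNIV t" unfolding fin_asc_def using i by blast
moreover have "fin_desc UNIV t"
 unfolding fin_desc_def using bij_is_surj[OF b] by (intro exI[of _ 0]) (simp add: app_one)
ultimately show ?thesis by (simp add: browder_def)
qed

lemma browder_invertible_nearby:
fixes t :: "'a::complex_banach cop"
assumes "browder t"
obtains d where "d > 0" "!!z. 0 < cmod z ==> cmod z < d ==> inv_op (t -. z)"
proof -
have fr: "fredholm_on UNIV t" "fin_asc UNIV t" "fin_desc UNIV t" using assms by (simp_all add: browder_def)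
obtain c where c: "c > 0" "below_on UNIV t c" using fr(1) fredholm_UNIV_iff by blast
obtain d where d: "d > 0" "!!z x. 0 < cmod z ==> cmod z < d ==> app t x = z *: x ==> x = 0"
 using fin_asc_no_eigenvalues[OF c(2,1) fr(2)] by blast
have b: "beta UNIV (app t) < oo" using fr(1) by (simp only: fredholm_on_def)
obtain d' where d': "d' > 0" "!!z. 0 < cmod z ==> cmod z < d' ==> surj (app (t -. z))"
 using fin_desc_onto_nearby[OF b fr(3)] by blast
show thesis
proof (rule that[of "min d d'"])
 fix z assume z: "0 < cmod z" "cmod z < min d d'"
 have "inj (app (t -. z))"
 proof (rule injI)
  fix x y assume "app (t -. z) x = app (t -. z) y"
  hence "app t (x - y) = z *: (x - y)"
   by (simp add: app_simps scaleC_diff_right algebra_simps)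
  hence "x - y = 0" using z by (intro d(2)[of z]) auto
  thus "x = y" by simp
 qed
 thus "inv_op (t -. z)"
  unfolding inv_op_iff_bij using d'(2)[of z] z by (intro bijI) auto
qed (use d d' in simp)
qed

text \<open>A Fredholm operator that is a limit of invertible operators \<open>t - w\<close> is Browder. The ascent is
  finite, since otherwise all small \<open>w\<close> are eigenvalues. On \<open>Y = R(t^p)\<close>, where \<open>p\<close> bounds the
  ascent, \<open>t\<close> is injective and its index is that of the invertible \<open>t - w\<close>, so \<open>t Y = Y\<close>.\<close>

lemma browder_of_invertible_nearby:
fixes t :: "'a::complex_banach cop"
assumes fr: "fredholm_on UNIV t"
 and near: "!!d. d > 0 ==> EX w. cmod w < d & inv_op (t -. w)"
shows "browder t"
proof -
obtain c where c: "c > 0" "below_on UNIV t c" using fr fredholm_UNIV_iff by blast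
have asc: "fin_asc UNIV t"
proof (rule ccontr)
 assume "~ fin_asc UNIV t"
 then obtain d where d: "d > 0" "!!z. cmod z < d ==> EX x. x ~= 0 & app t x = z *: x"
  by (rule infinite_asc_eigenvalues[OF c(2,1)]) (rule that)
 obtain w where w: "cmod w < d" "inv_op (t -. w)" using near[OF d(1)] by blast
 obtain x where x: "x ~= 0" "app t x = w *: x" using d(2)[OF w(1)] by blast
 have "app (t -. w) x = app (t -. w) 0" using x(2) by (simp add: app_simps)
 thus False using w(2) x(1) unfolding inv_op_iff_bij by (metis bij_is_inj injD)
qed
then obtain p where p: "!!x. x : rg (t ^ p) ==> app t x = 0 ==> x = 0" unfolding fin_asc_def by blast
let ?Y = "rg (t ^ p)"
have b: "beta UNIV (app t) < oo" using fr by (simp only: fredholm_on_def)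
then obtain k where k: "k > 0" "onto_on UNIV t k" by (rule onto_on_of_beta[OF ccsubspace_UNIV subset_UNIV])
have bp: "ecodim UNIV ?Y < oo"
 using beta_of_onto_on[OF _ _ onto_on_power[OF k(2)]] k(1) unfolding beta_def by simp
have "closed ?Y"
 using bp by (intro finite_codim_range_closed[OF bounded_linear_app clinear_app, of UNIV UNIV]) auto
hence Y: "ccsubspace ?Y" unfolding ccsubspace_def by (simp add: csubspace_im)
note Ys = ccsubspaceD(1)[OF Y]
have "app t ` ?Y = app (t ^ Suc p) ` UNIV" by (rule power_image_comm)
also have "... <= ?Y" by (rule power_image_antimono) auto
finally have tY: "app t ` ?Y <= ?Y" .
have "ker ?Y t = {0}" using p csubspace_0[OF Ys] by auto
hence aY: "alpha ?Y (app t) = 0" unfolding alpha_def by simp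
obtain e where "beta UNIV (app t) = beta ?Y (app t) + e"
 using index_restrict[OF clinear_app csubspace_UNIV subset_UNIV Ys subset_UNIV tY bp] by blast
hence "beta ?Y (app t) <= beta UNIV (app t)" by simp
hence bY: "beta ?Y (app t) < oo" using b by (rule finite_le)
have "fredholm_on ?Y t" using aY bY by (simp add: fredholm_on_def)
then obtain d where d: "d > 0" "!!e. norm e < d ==> app e ` ?Y <= ?Y ==>
  alpha ?Y (app t) + beta ?Y (app (t + e)) = alpha ?Y (app (t + e)) + beta ?Y (app t)"
 using index_stable[OF Y tY] by metis
obtain w where w: "cmod w < d" "inv_op (t -. w)" using near[OF d(1)] by blast
let ?e = "- (w *: 1) :: 'a cop" and ?u = "t -. w"
have bij: "bij (app ?u)" using w(2) by (simp add: inv_op_iff_bij)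
have inj: "x = 0" if "app ?u x = 0" for x using bij that by (metis app_0 bij_is_inj injD)
have eY: "app ?e ` ?Y <= ?Y" by (rule minus_scale_maps[OF Ys])
have uY: "app ?u ` ?Y <= ?Y"
 using tY Ys by (auto simp: app_simps intro!: csubspace_diff csubspace_scale)
have e0: "ecodim (rg ?u) (app ?u ` ?Y) = ecodim UNIV (?Y + (ker UNIV ?u))"
 by (rule ecodim_image[OF clinear_app csubspace_UNIV Ys subset_UNIV])
have z: "ker UNIV ?u = {0}" using inj by auto
have y0: "?Y + {0} = ?Y" by (simp add: set_plus_def)
have e1: "ecodim UNIV (app ?u ` ?Y) = ecodim UNIV ?Y"
 using e0 unfolding z y0 bij_is_surj[OF bij] .
have "ecodim UNIV (app ?u ` ?Y) = ecodim UNIV ?Y + ecodim ?Y (app ?u ` ?Y)"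
 by (rule ecodim_chain[OF csubspace_UNIV Ys csubspace_im[OF Ys] uY subset_UNIV])
hence "ecodim ?Y (app ?u ` ?Y) = 0"
 using e1 bp by (cases "ecodim UNIV ?Y"; cases "ecodim ?Y (app ?u ` ?Y)") (auto simp: zero_enat_def)
hence bu: "beta ?Y (app ?u) = 0" by (simp add: beta_def)
have "ker ?Y ?u = {0}" using inj csubspace_0[OF Ys] by auto
hence au: "alpha ?Y (app ?u) = 0" unfolding alpha_def by simp
have "norm ?e <= cmod w" using mult_left_mono[OF norm_one_le, of "cmod w"] by (simp add: norm_scaleC)
hence ne: "norm ?e < d" using w(1) by simp
have te: "t + ?e = ?u" by simp
have "beta ?Y (app t) = 0"
 using d(2)[OF ne eY] unfolding te au bu aY by simp
hence "app t ` ?Y = ?Y"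
 unfolding beta_def using ecodim_eq_0[OF Ys csubspace_im[OF Ys] tY] by simp
hence "app (t ^ Suc p) ` UNIV = app (t ^ p) ` UNIV" by (simp only: power_image_comm)
hence "fin_desc UNIV t" unfolding fin_desc_def by blast
thus ?thesis using fr asc by (simp add: browder_def)
qed

definition riesz :: "'a::complex_banach cop => bool" where
"riesz R <-> (ALL z. z ~= 0 --> fredholm_on UNIV (R -. z))"

lemma shift_shift: "R -. z -. w = R - (z + w) *: (1 :: 'a::complex_banach cop)"
by (simp add: scaleC_add_left diff_diff_eq)

lemma invertible_large:
fixes R :: "'a::complex_banach cop"
assumes "cmod z > norm R" shows "inv_op (R -. z)"
proof -
have z: "z ~= 0" using assms by auto
have "norm (inverse z *: R) < 1" using assms z by (simp add: norm_scaleC norm_inverse norm_divide field_simps)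
hence "inv_op (1 - inverse z *: R)" by (rule inv_op_one_minus)
thus ?thesis using one_minus_scale[of "inverse z" R] z by simp
qed

text \<open>Being Browder is an open and closed condition on \<open>z \<noteq> 0\<close>, because both the Browder and the
  non-Browder points are recognised by the invertibility of the operators nearby.\<close>

lemma riesz_browder:
fixes R :: "'a::complex_banach cop"
assumes "riesz R" "z ~= 0" shows "browder (R -. z)"
proof -
let ?B = "%z. browder (R -. z)" and ?A = "- {0} :: complex set"
have "ALL z:?A. \<forall>\<^sub>F w in at z within ?A. ?B z = ?B w"
proof
 fix z :: complex assume z: "z : ?A"
 have "EX d>0. ALL w. dist w z < d --> w ~= z --> ?B z = ?B w"
 proof (cases "?B z")
  case True
  obtain d where d: "d > 0" "!!w. 0 < cmod w ==> cmod w < d ==> inv_op (R -. z -. w)"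
   using browder_invertible_nearby[OF True] by blast
  have "?B w" if w: "dist w z < d" "w ~= z" for w
  proof -
   have "inv_op (R -. z -. (w - z))" using w by (intro d(2)) (auto simp: dist_norm)
   thus ?thesis unfolding shift_shift by (intro invertible_browder) simp
  qed
  thus ?thesis using True d(1) by blast
 next
  case False
  have fr: "fredholm_on UNIV (R -. z)" using assms(1) z by (simp add: riesz_def)
  obtain d where d: "d > 0" "!!w. cmod w < d ==> ~ inv_op (R -. z -. w)"
   using browder_of_invertible_nearby[OF fr] False by blast
  have "~ ?B w" if w: "dist w z < d" "w ~= z" for w
  proof
   assume "?B w"
   then obtain d' where d': "d' > 0" "!!v. 0 < cmod v ==> cmod v < d' ==> inv_op (R -. w -. v)"
    using browder_invertible_nearby by blast
   define r where "r = min d' (d - dist w z) / 2"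
   have r: "0 < r" "r < d'" "dist w z + r < d" using d'(1) w(1) by (auto simp: r_def min_def field_simps)
   let ?v = "complex_of_real r"
   have "inv_op (R -. w - ?v *: 1)" using r by (intro d'(2)) auto
   hence "inv_op (R -. z -. (w - z + ?v))" unfolding shift_shift by simp
   moreover have "cmod (w - z + ?v) < d"
    using norm_triangle_ineq[of "w - z" ?v] r by (simp add: dist_norm)
   ultimately show False using d(2) by blast
  qed
  thus ?thesis using False d(1) by blast
 qed
 thus "\<forall>\<^sub>F w in at z within ?A. ?B z = ?B w"
  unfolding eventually_at by blast
qed
moreover have "connected ?A" by (rule connected_punctured_universe) simp
moreover have "complex_of_real (norm R + 1) : ?A"
 using norm_ge_zero[of R] by (simp only: Compl_iff singleton_iff of_real_eq_0_iff)
ultimately have "?B z = ?B (complex_of_real (norm R + 1))"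
 using assms(2) by (intro connected_local_const[of ?A z _ ?B]) auto
moreover have "inv_op (R - complex_of_real (norm R + 1) *: 1)"
 by (rule invertible_large, subst norm_of_real) simp
ultimately show ?thesis using invertible_browder by blast
qed

lemma riesz_spectrum_finite:
fixes R :: "'a::complex_banach cop"
assumes "riesz R" "e > 0"
shows "finite {z. e <= cmod z & ~ inv_op (R -. z)}" (is "finite ?S")
proof (rule ccontr)
assume inf: "infinite ?S"
have "?S <= cball 0 (norm R)"
 using invertible_large[of R] by (auto simp: not_less[symmetric])
then obtain z where z: "z islimpt ?S"
 using Heine_Borel_imp_Bolzano_Weierstrass[OF compact_cball inf] by blast
have "closed {z :: complex. e <= cmod z}" by (intro closed_Collect_le continuous_intros)
hence "e <= cmod z" using islimpt_subset[OF z, of "{z. e <= cmod z}"] by (auto simp: closed_limpt)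
hence "z ~= 0" using assms(2) by auto
then obtain d where d: "d > 0" "!!w. 0 < cmod w ==> cmod w < d ==> inv_op (R -. z -. w)"
 using browder_invertible_nearby[OF riesz_browder[OF assms(1)]] by blast
obtain y where y: "y : ?S" "y ~= z" "dist y z < d" using z d(1) unfolding islimpt_approachable by blast
have "inv_op (R -. z -. (y - z))" using y by (intro d(2)) (auto simp: dist_norm)
thus False using y(1) unfolding shift_shift by simp
qed

lemma projection_exists:
fixes M N :: "'a::complex_banach set"
assumes "closed M" "closed N" "direct_sum M N UNIV"
obtains P where "!!x. app P x : N" "!!x. x - app P x : M" "!!x. x : N ==> app P x = x" "!!x. x : M ==> app P x = 0"
proof -
note D = direct_sumD[OF assms(3)]
have i: "(%x :: 'a. x) ` M = M" by simp
obtain k where k: "k > 0" "!!y. EX x:M. EX g:N. y = x + g & norm x <= k * norm y & norm g <= k * norm y"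
 using open_mapping_plus[OF bounded_linear_ident D(1) assms(1) D(2) assms(2)] D(6) by (auto simp: i)
have uniq: "g = g'" if "g : N" "g' : N" "y - g : M" "y - g' : M" for g g' y
proof -
 have "g - g' : M" using csubspace_diff[OF D(1) that(4,3)] by simp
 moreover have "g - g' : N" using that by (intro csubspace_diff D(2))
 ultimately have "g - g' = 0" by (rule direct_sum_Int[OF assms(3)])
 thus ?thesis by simp
qed
have "ALL y. EX g. g : N & y - g : M & norm g <= k * norm y"
proof
 fix y
 obtain x g where "x : M" "g : N" "y = x + g" "norm g <= k * norm y" using k(2)[of y] by blast
 thus "EX g. g : N & y - g : M & norm g <= k * norm y" by (intro exI[of _ g]) simp
qed
then obtain p where p: "!!y. p y : N" "!!y. y - p y : M" "!!y. norm (p y) <= k * norm y" by metis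
have bc: "bounded_clinear p"
proof (rule bounded_clinearI[OF _ _ p(3)])
 fix x y
 have "(x - p x) + (y - p y) : M" by (intro csubspace_add[OF D(1)] p)
 thus "p (x + y) = p x + p y"
  by (intro uniq[of _ _ "x + y"] p csubspace_add[OF D(2)]) (simp add: algebra_simps)
next
 fix c x
 have "c *: (x - p x) : M" by (intro csubspace_scale[OF D(1)] p)
 thus "p (c *: x) = c *: p x"
  by (intro uniq[of _ _ "c *: x"] p csubspace_scale[OF D(2)]) (simp add: scaleC_diff_right)
qed
have "p x = x" if "x : N" for x
 using that by (intro uniq[of _ _ x] p) (auto simp: csubspace_0[OF D(1)])
moreover have "p x = 0" if "x : M" for x
 using that by (intro uniq[of _ _ x] p) (auto simp: csubspace_0[OF D(2)])
ultimately show thesis using that[of "Cop p"] p by (simp add: app_Cop[OF bc])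
qed

lemma alpha_power_finite:
fixes t :: "'a::complex_banach cop"
assumes "below_on UNIV t c" "c > 0" shows "edim {x. app (t ^ n) x = 0} < oo" "closed (rg (t ^ n))"
proof -
have "EX c>0. below_on UNIV (t ^ n) c"
 using below_on_power[OF assms(1) ccsubspace_UNIV] assms(2) by (intro exI[of _ "c ^ n"]) auto
thus "edim {x. app (t ^ n) x = 0} < oo" "closed (rg (t ^ n))"
 using below_on_iff[OF ccsubspace_UNIV, of "t ^ n"] unfolding alpha_def by simp_all
qed

text \<open>The classical splitting for an operator of finite ascent and descent.\<close>

lemma asc_desc_split:
fixes t :: "'a::complex_banach cop"
assumes "fin_asc UNIV t" "fin_desc UNIV t"
obtains p where "p >= 1" "direct_sum {x. app (t ^ p) x = 0} (rg (t ^ p)) UNIV"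
 "app t ` rg (t ^ p) = rg (t ^ p)"
 "!!x. x : rg (t ^ p) ==> app t x = 0 ==> x = 0"
proof -
obtain a where a: "!!x. x : rg (t ^ a) ==> app t x = 0 ==> x = 0" using assms(1) unfolding fin_asc_def by blast
obtain b where b: "rg (t ^ Suc b) = rg (t ^ b)" using assms(2) unfolding fin_desc_def by blast
have b': "rg (t ^ (b + k)) = rg (t ^ b)" for k
proof (induction k)
 case (Suc k)
 have "rg (t ^ Suc (b + k)) = app t ` rg (t ^ (b + k))" by (rule power_image_comm(1)[symmetric])
 also have "... = rg (t ^ Suc b)" unfolding Suc by (rule power_image_comm)
 finally show ?case using b by simp
qed simp
define p where "p = Suc (a + b)"
let ?W = "rg (t ^ p)"
have Wb: "?W = rg (t ^ b)" using b'[of "Suc a"] by (simp add: p_def add.commute)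
have stab: "rg (t ^ (p + k)) = ?W" for k
 using b'[of "Suc a + k"] unfolding Wb by (simp add: p_def add_ac)
have inj: "x = 0" if "x : ?W" "app t x = 0" for x
proof -
 have "x : rg (t ^ a)" using that(1) power_image_antimono[of t UNIV a p] by (auto simp: p_def)
 thus ?thesis using a that(2) by blast
qed
have tW: "app t ` ?W = ?W"
 using stab[of 1] by (simp add: power_image_comm del: power_Suc)
have injp: "x = 0" if "x : ?W" "app (t ^ n) x = 0" for x n
 using that
proof (induction n)
 case (Suc n)
 have a: "app t (app (t ^ n) x) = 0" using Suc.prems(2) by (simp add: app_power_Suc(1) del: power_Suc)
 have b: "app (t ^ n) x : ?W"
  using Suc.prems(1) power_image_subset[of t ?W n] tW by blast
 have "app (t ^ n) x = 0" by (rule inj[OF b a])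
 thus ?case using Suc by blast
qed (simp add: app_one)
have "direct_sum {x. app (t ^ p) x = 0} ?W UNIV"
proof (rule direct_sumI)
 show "csubspace {x. app (t ^ p) x = 0}"
  using csubspace_kernel_on[OF clinear_app csubspace_UNIV, of "t ^ p"] by simp
 show "csubspace ?W" by (intro csubspace_im csubspace_UNIV)
 show "x = 0" if "x : {x. app (t ^ p) x = 0}" "x : ?W" for x using that injp by blast
 show "{x. app (t ^ p) x = 0} + ?W = UNIV"
 proof (intro equalityI subset_UNIV subsetI)
  fix x
  have "app (t ^ p) x : rg (t ^ (p + p))" using stab[of p] by blast
  then obtain y where y: "app (t ^ p) x = app (t ^ p) (app (t ^ p) y)" by (auto simp: power_add app_mult)
  have "(x - app (t ^ p) y) + app (t ^ p) y : {x. app (t ^ p) x = 0} + ?W"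
   using y by (intro set_plus_intro) (auto simp: app_diff)
  thus "x : {x. app (t ^ p) x = 0} + ?W" by simp
 qed
qed
thus thesis using that[of p] tW inj by (simp add: p_def)
qed

lemma riesz_finrank:
fixes R :: "'a::complex_banach cop"
assumes "riesz R" "finrank f" shows "riesz (R + f)"
unfolding riesz_def
proof (intro allI impI)
fix z :: complex assume "z ~= 0"
hence "fredholm_on UNIV (R -. z + f)" using assms by (intro fredholm_finrank) (auto simp: riesz_def)
thus "fredholm_on UNIV (R + f -. z)" by (simp add: algebra_simps)
qed

lemma block_invertible:
fixes P :: "'a::complex_banach cop"
assumes "y * x = 1 - P" "x * y = 1 - P" "y * P = 0" "x * P = 0" "P * y = 0" "P * x = 0" "P * P = P" "z ~= 0"
shows "inv_op (y - z *: P)"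
unfolding inv_op_def
using assms by (intro exI[of _ "x - inverse z *: P"]) (simp add: right_diff_distrib left_diff_distrib scaleC_scaleC)

text \<open>A nonzero spectral point of a Riesz operator is removed by a finite-rank change: replace the
  operator by \<open>0\<close> on the generalized eigenspace.\<close>

lemma riesz_remove_point:
fixes R :: "'a::complex_banach cop"
assumes "riesz R" "z0 ~= 0"
obtains f where "finrank f" "inv_op (R - f -. z0)"
 "!!z. z ~= 0 ==> inv_op (R -. z) ==> inv_op (R - f -. z)"
proof -
let ?t = "R -. z0"
have br: "fredholm_on UNIV ?t" "fin_asc UNIV ?t" "fin_desc UNIV ?t"
 using riesz_browder[OF assms] by (simp_all add: browder_def)
obtain p where p: "direct_sum {x. app (?t ^ p) x = 0} (rg (?t ^ p)) UNIV"
 "app ?t ` rg (?t ^ p) = rg (?t ^ p)"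
 "!!x. x : rg (?t ^ p) ==> app ?t x = 0 ==> x = 0"
 using asc_desc_split[OF br(2,3)] by metis
let ?N = "{x. app (?t ^ p) x = 0}" and ?W = "rg (?t ^ p)"
note D = direct_sumD[OF p(1)]
obtain c where c: "c > 0" "below_on UNIV ?t c" using br(1) fredholm_UNIV_iff by blast
have N: "edim ?N < oo" "closed ?W" using alpha_power_finite[OF c(2,1)] by auto
have ds: "direct_sum ?W ?N UNIV" using p(1) by (simp add: direct_sum_alt Int_commute add.commute)
obtain P where P: "!!x. app P x : ?N" "!!x. x - app P x : ?W" "!!x. x : ?N ==> app P x = x" "!!x. x : ?W ==> app P x = 0"
 by (rule projection_exists[OF N(2) findim_closed[OF N(1)] ds]) (rule that)
have comm: "R * P = P * R"
proof (rule cop_eqI)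
 fix x
 have tN: "app ?t y : ?N" if "y : ?N" for y
 proof -
  have "app (?t ^ p) (app ?t y) = app ?t (app (?t ^ p) y)" by (metis app_power_Suc)
  thus ?thesis using that by simp
 qed
 have "app P (app ?t x) = app P (app ?t (app P x)) + app P (app ?t (x - app P x))"
  by (simp only: app_add[symmetric]) simp
 also have "app P (app ?t (app P x)) = app ?t (app P x)" by (intro P(3) tN P(1))
 also have "app P (app ?t (x - app P x)) = 0" using p(2) P(2) by (intro P(4)) blast
 finally show "app (R * P) x = app (P * R) x" by (simp add: app_simps)
qed
let ?f = "R * P"
have "rg P <= ?N" using P(1) by blast
hence "finrank P"
 unfolding finrank_def
 by (rule edim_subset_finite[OF D(1) csubspace_im[OF csubspace_UNIV] _ N(1)])
hence f: "finrank ?f" by (rule finrank_mult_left)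
have PP: "P * P = P" by (rule cop_eqI, unfold app_mult) (rule P(3)[OF P(1)])
show thesis
proof (rule that[OF f])
 have block: "inv_op (R - ?f -. z)"
  if z: "z ~= 0" and onto: "?W <= app (R -. z) ` ?W"
   and inj: "!!x. x : ?W ==> app (R -. z) x = 0 ==> x = 0" for z
  unfolding inv_op_iff_bij
 proof (rule bijI)
  let ?u = "R - ?f -. z"
  have "P * ?f = P * R" using comm PP by (metis mult.assoc)
  hence "P * ?u = - (z *: P)" by (simp add: right_diff_distrib)
  from arg_cong[OF this, of "%u. app u _"] have uP: "app P (app ?u x) = - (z *: app P x)" for x
   by (simp only: app_simps1 app_mult app_scaleC_left)
  have uW: "app ?u x = app (R -. z) x" if "x : ?W" for x using P(4)[OF that] by (simp add: app_simps)
  have uN: "app ?u x = - (z *: x)" if "x : ?N" for x using P(3)[OF that] by (simp add: app_simps)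
  show "inj (app ?u)"
  proof (rule injI)
   fix x y assume e: "app ?u x = app ?u y"
   define v where "v = x - y"
   have u0: "app ?u v = 0" using e by (simp add: v_def app_diff)
   hence "app P v = 0" using uP[of v] z by simp
   hence "v : ?W" using P(2)[of v] by simp
   hence "v = 0" using u0 uW inj by simp
   thus "x = y" by (simp add: v_def)
  qed
  show "surj (app ?u)" unfolding surj_def
  proof
   fix y
   obtain w where w: "w : ?W" "y - app P y = app (R -. z) w" using subsetD[OF onto P(2)] by (rule imageE)
   have "app ?u (w + (- inverse z) *: app P y) = app ?u w + (- inverse z) *: app ?u (app P y)"
    by (simp only: app_add app_scaleC)
   also have "... = y" using uW[OF w(1)] uN[OF P(1)] w(2)[symmetric] z by (simp add: scaleC_scaleC)
   finally show "EX x. y = app ?u x" by metis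
  qed
 qed
 show "inv_op (R - ?f -. z0)"
  by (rule block[OF assms(2) _ p(3)]) (use p(2) in "simp_all only: subset_refl")
 fix z assume z: "z ~= 0" "inv_op (R -. z)"
 then obtain s where s: "s * (R -. z) = 1" "(R -. z) * s = 1" unfolding inv_op_def by blast
 have "P * (R -. z) = (R -. z) * P" using comm by (simp add: right_diff_distrib left_diff_distrib)
 hence sP: "P * s = s * P" by (rule inverse_commutes[OF s])
 show "inv_op (R - ?f -. z)"
 proof (rule block[OF z(1) subsetI])
  fix y assume "y : ?W"
  hence "app P (app s y) = 0" using P(4) sP by (metis app_mult app_0)
  hence "app s y : ?W" using P(2)[of "app s y"] by simp
  moreover have "y = app (R -. z) (app s y)" using s(2) by (metis app_mult app_one)
  ultimately show "y : app (R -. z) ` ?W" by (rule rev_image_eqI)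
 next
  show "x = 0" if "app (R -. z) x = 0" for x using that s(1) by (metis app_mult app_one app_0)
 qed
qed
qed

lemma riesz_split:
fixes R :: "'a::complex_banach cop"
assumes "riesz R" "e > 0"
obtains f where "finrank f" "!!z. e <= cmod z ==> inv_op (R - f -. z)"
proof -
have "EX f. finrank f & (ALL z. e <= cmod z --> inv_op (R - f -. z))"
 using assms(1)
proof (induction "card {z. e <= cmod z & ~ inv_op (R -. z)}" arbitrary: R rule: less_induct)
 case (less R)
 let ?S = "%R :: 'a cop. {z. e <= cmod z & ~ inv_op (R -. z)}"
 show ?case
 proof (cases "?S R = {}")
  case True
  thus ?thesis by (intro exI[of _ 0]) auto
 next
  case False
  then obtain z0 where z0: "z0 : ?S R" by blast
  hence "z0 ~= 0" using assms(2) by auto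
  obtain f where f: "finrank f" "inv_op (R - f -. z0)"
   "!!z. z ~= 0 ==> inv_op (R -. z) ==> inv_op (R - f -. z)"
   using riesz_remove_point[OF less.prems \<open>z0 ~= 0\<close>] by blast
  have "?S (R - f) <= ?S R"
  proof
   fix z assume z: "z : ?S (R - f)"
   hence "z ~= 0" using assms(2) by auto
   from f(3)[OF this] show "z : ?S R" using z by blast
  qed
  moreover have "z0 \<notin> ?S (R - f)" using f(2) by simp
  ultimately have "card (?S (R - f)) < card (?S R)"
   using z0 riesz_spectrum_finite[OF less.prems assms(2)] by (intro psubset_card_mono psubsetI) blast+
  moreover have "riesz (R - f)" using riesz_finrank[OF less.prems finrank_minus[OF f(1)]] by simp
  ultimately obtain g where "finrank g" "ALL z. e <= cmod z --> inv_op (R - f - g -. z)"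
   using less.hyps by blast
  thus ?thesis using finrank_add[OF f(1)] by (intro exI[of _ "f + g"]) (simp add: diff_diff_eq)
 qed
qed
thus thesis using that by blast
qed

text \<open>A finite-rank change moves the spectrum into the disc of radius \<open>e\<close>, and the powers of the two operators
  differ by finite rank.\<close>

lemma riesz_power:
fixes R :: "'a::complex_banach cop"
assumes "riesz R" "e > 0"
obtains C where "C > 0" "!!n. EX f. finrank f & norm (R ^ n - f) <= C * e ^ n"
proof -
obtain g where g: "finrank g" "!!z. e <= cmod z ==> inv_op (R - g -. z)"
 using riesz_split[OF assms] by blast
obtain n where n: "norm ((R - g) ^ n) <= e ^ n / 2" "n >= 1" using spectral_radius[OF assms(2) g(2)] by blast
have "norm ((R - g) ^ n) <= e ^ n" using n(1) assms(2) by (smt (verit) field_sum_of_halves zero_less_power)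
then obtain C where C: "C > 0" "!!k. norm ((R - g) ^ k) <= C * e ^ k"
 using geometric_bound[OF assms(2) n(2)] by blast
have fr: "finrank (R ^ k - (R - g) ^ k)" for k
proof (induction k)
 case (Suc k)
 have "R ^ Suc k - (R - g) ^ Suc k = R * (R ^ k - (R - g) ^ k) + g * (R - g) ^ k"
  by (simp add: right_diff_distrib left_diff_distrib)
 thus ?case using finrank_add[OF finrank_mult_left[OF Suc] finrank_mult_right[OF g(1)]] by metis
qed simp
show thesis
proof (rule that[OF C(1)])
 fix k
 show "EX f. finrank f & norm (R ^ k - f) <= C * e ^ k"
  using fr[of k] C(2)[of k] by (intro exI[of _ "R ^ k - (R - g) ^ k"]) simp
qed
qed

section \<open>Perturbations that commute up to a common kernel or range\<close>

text \<open>The relation is also considered on invariant subspaces: the ranges of powers of \<open>T - l\<close> for the B-classes, and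
  the subspace to which the case \<open>CT = CR = 0\<close> is reduced there.\<close>

definition left_comm_on :: "'a::complex_banach set => 'a cop => 'a cop => bool" where
"left_comm_on V T R <-> (ALL x:V. app (T * (T * R - R * T)) x = 0 & app (R * (T * R - R * T)) x = 0)"

definition right_comm :: "'a::complex_banach cop => 'a cop => bool" where
"right_comm T R <-> (T * R - R * T) * T = 0 & (T * R - R * T) * R = 0"

definition semi_comm :: "'a::complex_banach cop => 'a cop => bool" where
"semi_comm T R <-> left_comm_on UNIV T R | right_comm T R"

lemma left_comm_on_add:
assumes "left_comm_on V T R" shows "left_comm_on V (T + R) (- R)"
proof -
have c: "(T + R) * (- R) - (- R) * (T + R) = - (T * R - R * T)" by (simp add: algebra_simps)
have e: "app ((T + R) * (- c)) x = - (app (T * c) x + app (R * c) x)" "app ((- R) * (- c)) x = app (R * c) x" for c x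
 by (simp_all add: app_simps1 app_mult app_minus)
show ?thesis using assms unfolding left_comm_on_def c e by simp
qed

lemma left_comm_on_scale:
assumes "left_comm_on V T R" shows "left_comm_on V T (c *: R)"
proof -
have "T * (c *: R) - (c *: R) * T = c *: (T * R - R * T)"
 by (simp add: scaleC_diff_right)
moreover have "app (T * (c *: d)) x = c *: app (T * d) x" "app ((c *: R) * (c *: d)) x = c *: c *: app (R * d) x" for d x
 by (simp_all add: app_scaleC_left app_mult app_scaleC)
ultimately show ?thesis using assms unfolding left_comm_on_def by simp
qed

lemma right_comm_add:
assumes "right_comm T R" shows "right_comm (T + R) (- R)"
proof -
have c: "(T + R) * (- R) - (- R) * (T + R) = - (T * R - R * T)" by (simp add: algebra_simps)
show ?thesis using assms unfolding right_comm_def c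
 by (simp only: distrib_left mult_minus_left mult_minus_right) simp
qed

lemma right_comm_scale:
assumes "right_comm T R" shows "right_comm T (c *: R)"
proof -
have "T * (c *: R) - (c *: R) * T = c *: (T * R - R * T)"
 by (simp add: scaleC_diff_right)
thus ?thesis using assms unfolding right_comm_def by simp
qed

lemma semi_comm_add: "semi_comm T R ==> semi_comm (T + R) (- R)"
and semi_comm_scale: "semi_comm T R ==> semi_comm T (c *: R)"
unfolding semi_comm_def
using left_comm_on_add right_comm_add left_comm_on_scale right_comm_scale by blast+

definition preserved_by :: "'a::complex_banach cop => 'a cop => 'a cop => bool" where
"preserved_by T R q <-> (ALL V. csubspace V --> app T ` V <= V --> app R ` V <= V --> app q ` V <= V)"

lemma preserved_byD:
"preserved_by T R q ==> csubspace V ==> app T ` V <= V ==> app R ` V <= V ==> x : V ==> app q x : V"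
unfolding preserved_by_def by blast

lemma preserved_by_basic:
"preserved_by T R T" "preserved_by T R R" "preserved_by T R 0" "preserved_by T R 1"
by (auto simp: preserved_by_def app_simps csubspace_0)

lemma preserved_by_add: "preserved_by T R p ==> preserved_by T R q ==> preserved_by T R (p + q)"
and preserved_by_diff: "preserved_by T R p ==> preserved_by T R q ==> preserved_by T R (p - q)"
and preserved_by_mult: "preserved_by T R p ==> preserved_by T R q ==> preserved_by T R (p * q)"
and preserved_by_scale: "preserved_by T R p ==> preserved_by T R (c *: p)"
and preserved_by_minus: "preserved_by T R p ==> preserved_by T R (- p)"
unfolding preserved_by_def image_subset_iff
by (simp_all add: app_simps1 app_mult app_scaleC_left csubspace_add csubspace_diff csubspace_scale csubspace_neg)

lemma preserved_by_power: "preserved_by T R p ==> preserved_by T R (p ^ n)"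
by (induction n) (simp_all add: preserved_by_basic preserved_by_mult)

lemmas preserved_by_intros = preserved_by_basic preserved_by_add preserved_by_diff preserved_by_mult
preserved_by_scale preserved_by_minus preserved_by_power

text \<open>The quotients of \<open>a^n - (-r)^n\<close> by \<open>a + r\<close>, on the left and on the right. If \<open>a\<close> and \<open>r\<close>
  commute, the division leaves no remainder.\<close>

primrec left_quot :: "'a::complex_banach cop => 'a cop => nat => 'a cop" where
"left_quot a r 0 = 0"
| "left_quot a r (Suc n) = a ^ n - left_quot a r n * r"

primrec right_quot :: "'a::complex_banach cop => 'a cop => nat => 'a cop" where
"right_quot a r 0 = 0"
| "right_quot a r (Suc n) = a ^ n - r * right_quot a r n"

definition left_rem :: "'a::complex_banach cop => 'a cop => nat => 'a cop" where
"left_rem a r n = left_quot a r n * (a + r) - (a ^ n - (- r) ^ n)"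

definition right_rem :: "'a::complex_banach cop => 'a cop => nat => 'a cop" where
"right_rem a r n = (a + r) * right_quot a r n - (a ^ n - (- r) ^ n)"

lemma left_rem_Suc:
"left_rem a r (Suc n) = left_quot a r n * (a * r - r * a) - left_rem a r n * r"
by (simp only: left_rem_def left_quot.simps power_Suc2) (simp add: algebra_simps)

lemma right_rem_Suc:
"right_rem a r (Suc n) = - ((a * r - r * a) * right_quot a r n) - r * right_rem a r n"
by (simp only: right_rem_def right_quot.simps power_Suc) (simp add: algebra_simps power_commutes)

lemma rem_0 [simp]: "left_rem a r 0 = 0" "right_rem a r 0 = 0"
by (simp_all add: left_rem_def right_rem_def)

locale shifted =
fixes T R :: "'a::complex_banach cop" and l :: complex
begin

abbreviation "A == T -. l"
abbreviation "C == T * R - R * T"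
abbreviation "QL == left_quot A R"
abbreviation "QR == right_quot A R"
abbreviation "DL == left_rem A R"
abbreviation "DR == right_rem A R"
abbreviation "B n == A ^ n - (- R) ^ n"

lemma C_A: "A * R - R * A = C"
by (simp add: right_diff_distrib left_diff_distrib)

lemma preserved_A: "preserved_by T R A"
by (intro preserved_by_intros)

lemma preserved_quot: "preserved_by T R (QL n)" "preserved_by T R (QR n)"
by (induction n) (auto intro!: preserved_by_intros preserved_A)

lemma preserved_rem: "preserved_by T R (DL n)" "preserved_by T R (DR n)"
unfolding left_rem_def right_rem_def by (intro preserved_by_intros preserved_A preserved_quot)+

lemma A_kernel: "app T x = 0 ==> app (A ^ n) x = (- l) ^ n *: x"
by (induction n) (simp_all only: power_Suc app_mult app_one power_0 scaleC_scaleC,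
 simp_all add: app_simps scaleC_scaleC)

lemma R_power_kernel: "app R x = 0 ==> n >= 1 ==> app ((- R) ^ n) x = 0"
by (cases n) (simp_all only: power_Suc2 app_mult, simp_all add: app_simps)

lemma left_rems:
assumes V: "csubspace V" "app T ` V <= V" "app R ` V <= V" and lc: "left_comm_on V T R" and x: "x : V"
shows "app T (app (DL n) x) = 0" "app R (app (DL n) x) = 0" "app T (app (DR n) x) = 0" "app R (app (DR n) x) = 0"
proof -
define K where "K = C"
have K: "A * R - R * A = K" by (simp only: C_A K_def)
have C0: "app T (app K x) = 0" "app R (app K x) = 0" if "x : V" for x
 using lc that unfolding left_comm_on_def app_mult K_def by simp_all
have qc: "EX c. ALL x:V. app (QL n) (app K x) = c *: app K x" for n
proof (cases n)
 case 0
 thus ?thesis by (intro exI[of _ 0]) (simp add: app_simps)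
next
 case (Suc m)
 have "app (QL n) (app K x) = (- l) ^ m *: app K x" if "x : V" for x
  unfolding Suc left_quot.simps app_simps1 app_mult C0(2)[OF that] A_kernel[OF C0(1)[OF that]] by simp
 thus ?thesis by blast
qed
have "ALL x:V. app T (app (DL n) x) = 0 & app R (app (DL n) x) = 0"
proof (induction n)
 case (Suc n)
 obtain c where c: "!!x. x : V ==> app (QL n) (app K x) = c *: app K x" using qc by blast
 show ?case
 proof
  fix x assume x: "x : V"
  hence Rx: "app R x : V" using V(3) by blast
  have "app (DL (Suc n)) x = c *: app K x - app (DL n) (app R x)"
   unfolding left_rem_Suc K using c[OF x] by (simp add: app_simps1(3) app_mult)
  thus "app T (app (DL (Suc n)) x) = 0 & app R (app (DL (Suc n)) x) = 0"
   using Suc Rx C0[OF x] by (simp add: app_diff app_scaleC)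
 qed
qed (simp add: app_simps)
thus "app T (app (DL n) x) = 0" "app R (app (DL n) x) = 0" using x by blast+
have "ALL x:V. app T (app (DR n) x) = 0 & app R (app (DR n) x) = 0"
proof (induction n)
 case (Suc n)
 show ?case
 proof
  fix x assume x: "x : V"
  hence q: "app (QR n) x : V" using preserved_quot(2) V by (intro preserved_byD)
  have "app (DR (Suc n)) x = - app K (app (QR n) x) - app R (app (DR n) x)"
   unfolding right_rem_Suc K by (simp add: app_simps1(3,4) app_mult)
  thus "app T (app (DR (Suc n)) x) = 0 & app R (app (DR (Suc n)) x) = 0"
   using Suc x C0[OF q] by (simp add: app_diff app_minus)
 qed
qed (simp add: app_simps)
thus "app T (app (DR n) x) = 0" "app R (app (DR n) x) = 0" using x by blast+
qed

lemma QL_eq: "app (QL n) (app (A + R) x) = app (B n) x + app (DL n) x"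
proof -
have "QL n * (A + R) = B n + DL n" by (simp add: left_rem_def)
from arg_cong[OF this, of "%u. app u x"] show ?thesis by (simp only: app_mult app_simps1(2))
qed

lemma QR_eq: "app (A + R) (app (QR n) x) = app (B n) x + app (DR n) x"
proof -
have "(A + R) * QR n = B n + DR n" by (simp add: right_rem_def)
from arg_cong[OF this, of "%u. app u x"] show ?thesis by (simp only: app_mult app_simps1(2))
qed

end

locale nonzero_shifted = shifted +
assumes l0: "l ~= 0"
begin

text \<open>In the left case the remainder takes values in the common kernel of \<open>T\<close> and \<open>R\<close>, where \<open>A\<close>
  and \<open>A + R\<close> act as the nonzero scalar \<open>- l\<close>; it can thus be absorbed into a factor.\<close>

lemma left_factor:
assumes V: "csubspace V" "app T ` V <= V" "app R ` V <= V" and lc: "left_comm_on V T R" and n: "n >= 1"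
obtains D Q where "preserved_by T R D" "!!x. x : V ==> app T (app D x) = 0" "!!x. x : V ==> app R (app D x) = 0"
 "!!x. x : V ==> app (QL n) (app (A + R) x) = app (B n) (x + app D x)"
 "preserved_by T R Q" "!!x. x : V ==> app (A + R) (app Q x) = app (B n) x"
proof -
let ?D = "inverse ((- l) ^ n) *: DL n" and ?Q = "QR n + inverse l *: DR n"
note rem = left_rems[OF V lc]
have ln: "(- l) ^ n ~= 0" using l0 by simp
show thesis
proof (rule that[of ?D ?Q])
 show "preserved_by T R ?D" "preserved_by T R ?Q"
  by (intro preserved_by_intros preserved_rem preserved_quot)+
 show "app T (app ?D x) = 0" "app R (app ?D x) = 0" if "x : V" for x
  using rem(1,2)[OF that, of n] by (simp_all add: app_scaleC_left app_scaleC)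
 show "app (QL n) (app (A + R) x) = app (B n) (x + app ?D x)" if "x : V" for x
 proof -
  have "app (B n) (app (DL n) x) = (- l) ^ n *: app (DL n) x"
   using A_kernel[OF rem(1)[OF that, of n]] R_power_kernel[OF rem(2)[OF that, of n] n] by (simp add: app_simps1(3))
  hence "app (B n) (app ?D x) = app (DL n) x"
   unfolding app_scaleC_left app_scaleC using ln by (simp add: scaleC_scaleC)
  thus ?thesis using QL_eq[of n x] by (simp only: app_add)
 qed
 show "app (A + R) (app ?Q x) = app (B n) x" if "x : V" for x
 proof -
  have "app (A + R) (app (DR n) x) = - (l *: app (DR n) x)"
   using rem(3,4)[OF that, of n] by (simp add: app_simps)
  hence "app (A + R) (app (inverse l *: DR n) x) = - app (DR n) x"
   unfolding app_scaleC_left app_scaleC using l0 by (simp add: scaleC_scaleC)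
  thus ?thesis using QR_eq[of n x] by (simp add: app_simps1(2) app_add)
 qed
qed
qed

lemma right_factor:
assumes rc: "right_comm T R" and n: "n >= 1"
obtains D Q where "D * T = 0" "D * R = 0" "(A + R) * QR n = (1 + D) * B n" "Q * (A + R) = B n"
proof -
define K where "K = C"
have K: "A * R - R * A = K" by (simp only: C_A K_def)
have C0: "K * T = 0" "K * R = 0" using rc by (simp_all only: right_comm_def K_def)
have CA: "K * A ^ m = (- l) ^ m *: K" for m
proof (induction m)
 case (Suc m)
 have "K * A ^ Suc m = (K * A ^ m) * A" by (simp only: power_Suc2 mult.assoc)
 also have "... = (- l) ^ m *: (K * T) - ((- l) ^ m * l) *: K"
  unfolding Suc by (simp add: right_diff_distrib scaleC_scaleC mult.commute scaleC_diff_right)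
 also have "... = (- l) ^ Suc m *: K" unfolding C0 by (simp add: mult.commute)
 finally show ?case .
qed simp
have qc: "EX c. K * QR m = c *: K" for m
proof (cases m)
 case 0
 thus ?thesis by (intro exI[of _ 0]) simp
next
 case (Suc k)
 have "K * QR m = K * A ^ k - (K * R) * QR k" unfolding Suc by (simp only: right_quot.simps right_diff_distrib mult.assoc)
 thus ?thesis using C0 CA by auto
qed
have L: "DL m * T = 0 & DL m * R = 0" for m
proof (induction m)
 case (Suc m)
 hence "DL (Suc m) = QL m * K" unfolding left_rem_Suc K by simp
 thus ?case using C0 by (simp only: mult.assoc mult_zero_right simp_thms)
qed simp
have Rr: "DR m * T = 0 & DR m * R = 0" for m
proof (induction m)
 case (Suc m)
 obtain c where "K * QR m = c *: K" using qc by blast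
 hence D: "DR (Suc m) = - (c *: K) - R * DR m" unfolding right_rem_Suc K by simp
 have "DR (Suc m) * T = - (c *: (K * T)) - R * (DR m * T)" "DR (Suc m) * R = - (c *: (K * R)) - R * (DR m * R)"
  unfolding D by (simp_all only: left_diff_distrib mult_minus_left scaleC_mult_left mult.assoc)
 thus ?case using C0 Suc by simp
qed simp
let ?D = "inverse ((- l) ^ n) *: DR n" and ?Q = "QL n + inverse l *: DL n"
have ln: "(- l) ^ n ~= 0" using l0 by simp
have DA: "DR n * A ^ m = (- l) ^ m *: DR n" for m
proof (induction m)
 case (Suc m)
 have "DR n * A ^ Suc m = (DR n * A ^ m) * A" by (simp only: power_Suc2 mult.assoc)
 also have "... = (- l) ^ m *: (DR n * T) - ((- l) ^ m * l) *: DR n"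
  unfolding Suc by (simp add: right_diff_distrib scaleC_scaleC mult.commute scaleC_diff_right)
 also have "... = (- l) ^ Suc m *: DR n" using Rr by (simp add: mult.commute)
 finally show ?case .
qed simp
have DRn: "DR n * (- R) ^ n = 0"
proof -
 obtain k where "n = Suc k" using n by (cases n) auto
 hence "DR n * (- R) ^ n = - (DR n * R) * (- R) ^ k" by (simp add: mult.assoc)
 thus ?thesis using Rr by simp
qed
show thesis
proof (rule that[of ?D ?Q])
 show "?D * T = 0" "?D * R = 0" using Rr[of n] by simp_all
 have "?D * B n = DR n"
  unfolding scaleC_mult_left right_diff_distrib DA DRn using ln by (simp add: scaleC_scaleC)
 thus "(A + R) * QR n = (1 + ?D) * B n" by (simp add: right_rem_def distrib_right)
 have "DL n * (A + R) = - (l *: DL n)"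
  using L[of n] by (simp add: distrib_left right_diff_distrib)
 hence "(inverse l *: DL n) * (A + R) = - DL n"
  unfolding scaleC_mult_left using l0 by (simp add: scaleC_scaleC)
 moreover have "QL n * (A + R) = B n + DL n" by (simp add: left_rem_def)
 ultimately show "?Q * (A + R) = B n" by (simp add: distrib_right)
qed
qed

lemma below_left:
assumes V: "ccsubspace V" "app T ` V <= V" "app R ` V <= V" and lc: "left_comm_on V T R" and n: "n >= 1"
 and b: "below_on V (B n) c" "c > 0"
shows "EX c>0. below_on V (A + R) c"
proof -
note V' = ccsubspaceD[OF V(1)]
obtain D where D: "preserved_by T R D" "!!x. x : V ==> app T (app D x) = 0" "!!x. x : V ==> app R (app D x) = 0"
 "!!x. x : V ==> app (QL n) (app (A + R) x) = app (B n) (x + app D x)"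
 using left_factor[OF V'(1) V(2,3) lc n] by metis
have DV: "app (1 + D) ` V <= V"
 using preserved_byD[OF preserved_by_add[OF preserved_by_basic(4) D(1)] V'(1) V(2,3)] by blast
obtain U where U: "ccsubspace U" "U <= V" "ecodim V U < oo"
 "!!x. x : U ==> c * norm (app (1 + D) x) <= norm (app (B n) (app (1 + D) x))"
 by (rule below_on_preimage[OF b(1) V(1) V(1) DV]) (rule that)
let ?q = "norm (QL n)" and ?e = "norm (T + R)"
have "norm x <= ((?e * ?q / c + 1) / cmod l) * norm (app (A + R) x)" if x: "x : U" for x
proof -
 have xV: "x : V" using x U(2) by blast
 have "c * norm (app (1 + D) x) <= norm (app (QL n) (app (A + R) x))"
  using U(4)[OF x] D(4)[OF xV] by (simp add: app_simps1(2) app_one)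
 also have "... <= ?q * norm (app (A + R) x)" by (rule norm_app)
 finally have 1: "norm (app (1 + D) x) <= ?q * norm (app (A + R) x) / c" using b(2) by (simp add: field_simps)
 have "app (T + R) (app (1 + D) x) = app (T + R) x"
  using D(2,3)[OF xV] by (simp add: app_simps1(2) app_one app_add)
 hence "norm (app (T + R) x) <= ?e * norm (app (1 + D) x)" using norm_app by metis
 also have "... <= ?e * (?q * norm (app (A + R) x) / c)" by (rule mult_left_mono[OF 1]) simp
 finally have 2: "norm (app (T + R) x) <= ?e * ?q / c * norm (app (A + R) x)" by simp
 have "l *: x = app (T + R) x - app (A + R) x" by (simp add: app_simps)
 hence "cmod l * norm x <= norm (app (T + R) x) + norm (app (A + R) x)"
  using norm_triangle_ineq4 by (metis norm_scaleC)
 hence "cmod l * norm x <= (?e * ?q / c + 1) * norm (app (A + R) x)" using 2 by (simp add: distrib_right)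
 thus ?thesis using l0 by (simp add: field_simps)
qed
moreover define K where "K = (?e * ?q / c + 1) / cmod l"
ultimately have K: "norm x <= K * norm (app (A + R) x)" if "x : U" for x using that by blast
have K0: "K > 0" unfolding K_def using b(2) l0 by (intro divide_pos_pos add_nonneg_pos) auto
have "below_on V (A + R) (1 / K)"
 using K K0 by (intro below_onI[OF U(1-3)]) (simp add: field_simps)
thus ?thesis using K0 by (intro exI[of _ "1 / K"]) simp
qed

lemma beta_left:
assumes V: "csubspace V" "app T ` V <= V" "app R ` V <= V" and lc: "left_comm_on V T R" and n: "n >= 1"
 and b: "beta V (app (B n)) < oo"
shows "beta V (app (A + R)) < oo"
proof -
obtain Q where Q: "preserved_by T R Q" "!!x. x : V ==> app (A + R) (app Q x) = app (B n) x"
 by (rule left_factor[OF V lc n]) (rule that)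
have "app (B n) ` V <= app (A + R) ` V"
proof
 fix y assume "y : app (B n) ` V"
 then obtain x where x: "x : V" "y = app (B n) x" by blast
 thus "y : app (A + R) ` V"
  using Q(2)[OF x(1)] preserved_byD[OF Q(1) V x(1)] by (metis imageI)
qed
moreover have "app (A + R) ` V <= V"
 using preserved_byD[OF preserved_by_add[OF preserved_A preserved_by_basic(2)] V] by blast
ultimately have "ecodim V (app (A + R) ` V) <= ecodim V (app (B n) ` V)"
 using V(1) by (intro ecodim_mono2 csubspace_im)
thus ?thesis using b unfolding beta_def by (rule finite_le)
qed

lemma beta_right:
assumes rc: "right_comm T R" and n: "n >= 1" and b: "beta UNIV (app (B n)) < oo"
shows "beta UNIV (app (A + R)) < oo"
proof -
obtain D where D: "D * T = 0" "D * R = 0" "(A + R) * QR n = (1 + D) * B n"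
 by (rule right_factor[OF rc n]) (rule that)
have sB: "csubspace (rg (B n))" by (intro csubspace_im csubspace_UNIV)
obtain G where G: "direct_sum (rg (B n)) G UNIV" "edim G < oo"
 using ecodim_finite_supplement[OF csubspace_UNIV sB subset_UNIV] b unfolding beta_def by blast
let ?S = "rg (A + R)" and ?H = "app (1 + D) ` G"
have sS: "csubspace ?S" by (intro csubspace_im csubspace_UNIV)
have sG: "csubspace G" using direct_sumD[OF G(1)] by blast
have sH: "csubspace ?H" by (rule csubspace_im[OF sG])
have sum: "csubspace (?S + ?H)" by (rule csubspace_plus[OF sS sH])
have 1: "app (1 + D) x : ?S + ?H" for x
proof -
 have "x : rg (B n) + G" using direct_sumD(6)[OF G(1)] by simp
 then obtain u g where u: "g : G" "x = app (B n) u + g" by (auto elim!: set_plus_elim)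
 have "app (1 + D) (app (B n) u) = app (A + R) (app (QR n) u)"
  using arg_cong[OF D(3), of "%v. app v u"] by (simp only: app_mult)
 hence "app (1 + D) x = app (A + R) (app (QR n) u) + app (1 + D) g" unfolding u(2) app_add by simp
 thus ?thesis using u(1) by (simp only:) (intro set_plus_intro, auto)
qed
have "x : ?S + ?H" for x
proof -
 have "D * (T + R) = 0" using D(1,2) by (simp add: distrib_left)
 from arg_cong[OF this, of "%v. app v x"] have "app D (app (T + R) x) = 0"
  by (simp only: app_mult app_simps1(1))
 hence "app (1 + D) (app (T + R) x) = app (T + R) x"
  by (simp only: app_simps1(2)[of 1 D] app_one) simp
 hence "app (T + R) x : ?S + ?H" using 1 by metis
 moreover have "app (A + R) x : ?S + ?H" using subset_plus(1)[OF sH, of ?S] by blast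
 ultimately have "app (T + R) x - app (A + R) x : ?S + ?H" by (rule csubspace_diff[OF sum])
 moreover have "app (T + R) x - app (A + R) x = l *: x" by (simp add: app_simps)
 ultimately have "inverse l *: (l *: x) : ?S + ?H" using csubspace_scale[OF sum] by metis
 thus ?thesis using l0 by (simp add: scaleC_scaleC)
qed
hence "ecodim UNIV ?S <= edim ?H"
 using sS sH by (intro ecodim_le_edim_supplement) auto
moreover have "edim ?H < oo" by (rule finite_le[OF edim_image_le[OF clinear_app sG] G(2)])
ultimately show ?thesis unfolding beta_def by (rule finite_le)
qed

end

text \<open>On a subspace of finite codimension \<open>A^n\<close> is bounded below by \<open>c^n\<close>, while \<open>R^n\<close> is bounded by a
  multiple of \<open>(c/2)^n\<close> there.\<close>

lemma below_on_riesz_power: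
fixes A R :: "'a::complex_banach cop"
assumes V: "ccsubspace V" "app A ` V <= V" and b: "below_on V A c" "c > 0" and R: "riesz R"
obtains n d where "n >= 1" "d > 0" "below_on V (A ^ n - (- R) ^ n) d"
proof -
obtain K where K: "K > 0" "!!n. EX f. finrank f & norm (R ^ n - f) <= K * (c / 2) ^ n"
 using riesz_power[OF R, of "c / 2"] b(2) by auto
obtain n0 where n0: "K < 2 ^ n0" using real_arch_pow[of 2 K] by auto
define n where "n = Suc n0"
have n: "K * (c / 2) ^ n < c ^ n"
proof -
 have "K < 2 ^ n0" by (rule n0)
 also have "(2 :: real) ^ n0 <= 2 ^ n" unfolding n_def by simp
 finally have "K < 2 ^ n" .
 hence "K * c ^ n < 2 ^ n * c ^ n" using b(2) by (intro mult_strict_right_mono) auto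
 thus ?thesis by (simp add: power_divide field_simps)
qed
obtain f where f: "finrank f" "norm (R ^ n - f) <= K * (c / 2) ^ n" using K(2) by blast
have neg: "(- R) ^ n = (- 1) ^ n *: R ^ n" using scaleC_power[of "- 1" R n] by simp
have "below_on V (A ^ n - (- R) ^ n) (1 * c ^ n - norm (R ^ n - f))"
proof (rule below_on_perturb[OF below_on_power[OF b(1) V less_imp_le[OF b(2)]] V(1) f(1)])
 fix x assume x: "app f x = 0"
 have "app (A ^ n) x = app (A ^ n - (- R) ^ n) x + (- 1) ^ n *: app (R ^ n) x"
  by (simp add: neg app_simps1 app_scaleC_left)
 hence "norm (app (A ^ n) x) <= norm (app (A ^ n - (- R) ^ n) x) + norm ((- 1) ^ n *: app (R ^ n) x)"
  using norm_triangle_ineq by metis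
 also have "norm ((- 1) ^ n *: app (R ^ n) x) = norm (app (R ^ n - f) x)"
  using x by (simp add: norm_scaleC norm_power app_simps1)
 also have "... <= norm (R ^ n - f) * norm x" by (rule norm_app)
 finally show "1 * norm (app (A ^ n) x) <= norm (app (A ^ n - (- R) ^ n) x) + norm (R ^ n - f) * norm x" by simp
qed simp
thus thesis using that[of n "1 * c ^ n - norm (R ^ n - f)"] n f(2) by (simp add: n_def)
qed

lemma beta_riesz_power:
fixes A R :: "'a::complex_banach cop"
assumes b: "beta UNIV (app A) < oo" and R: "riesz R"
obtains n where "n >= 1" "beta UNIV (app (A ^ n - (- R) ^ n)) < oo"
proof -
obtain k where k: "k > 0" "onto_on UNIV A k" by (rule onto_on_of_beta[OF ccsubspace_UNIV subset_UNIV b])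
obtain K where K: "K > 0" "!!n. EX f. finrank f & norm (R ^ n - f) <= K * (1 / (2 * k)) ^ n"
 using riesz_power[OF R, of "1 / (2 * k)"] k(1) by auto
obtain n0 where n0: "2 * K < 2 ^ n0" using real_arch_pow[of 2 "2 * K"] by auto
define n where "n = Suc n0"
have n: "K * (1 / (2 * k)) ^ n * k ^ n <= 1 / 2"
proof -
 have "2 * K <= 2 ^ n0" using n0 by simp
 also have "(2 :: real) ^ n0 <= 2 ^ n" unfolding n_def by simp
 finally have "2 * K <= 2 ^ n" .
 thus ?thesis using k(1) by (simp add: power_divide power_mult_distrib field_simps)
qed
obtain f where f: "finrank f" "norm (R ^ n - f) <= K * (1 / (2 * k)) ^ n" using K(2) by blast
have neg: "(- R) ^ n = (- 1) ^ n *: R ^ n" using scaleC_power[of "- 1" R n] by simp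
let ?e = "- ((- 1) ^ n *: (R ^ n - f))" and ?f = "- ((- 1) ^ n *: f)"
have eq: "A ^ n + ?e + ?f = A ^ n - (- R) ^ n"
 unfolding neg by (simp add: scaleC_diff_right)
have "beta UNIV (app (A ^ n + ?e + ?f)) < oo"
proof (rule onto_on_perturb[where f="?f" and e="?e" and d="norm (R ^ n - f)",
   OF onto_on_power[OF k(2) less_imp_le[OF k(1)]] ccsubspace_UNIV])
 show "norm (app ?e x) <= norm (R ^ n - f) * norm x" for x
  using norm_app[of ?e x] by (simp add: norm_scaleC norm_power)
 show "norm (R ^ n - f) * k ^ n <= 1 / 2"
 proof -
  have "norm (R ^ n - f) * k ^ n <= K * (1 / (2 * k)) ^ n * k ^ n"
   using k(1) by (intro mult_right_mono[OF f(2)]) simp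
  thus ?thesis using n by (rule order_trans)
 qed
 show "finrank ?f" using f(1) by (intro finrank_minus finrank_scale)
qed (use k(1) in auto)
thus thesis using that[of n] unfolding eq by (simp add: n_def)
qed

text \<open>For large \<open>n\<close> the operator \<open>A^n - (- R)^n\<close> is semi-Fredholm; its factor \<open>A + R\<close> inherits this.\<close>

lemma upper_semi_comm_riesz:
assumes "semi_comm T R" "riesz R" "l ~= 0" "below_on UNIV (T -. l) c" "c > 0"
shows "EX c>0. below_on UNIV (T + R -. l) c"
proof -
interpret nonzero_shifted T R l by standard (rule assms(3))
obtain n d where n: "n >= 1" "d > 0" "below_on UNIV (B n) d"
 by (rule below_on_riesz_power[OF ccsubspace_UNIV subset_UNIV assms(4,5,2)])
have eq: "T + R -. l = A + R" by simp
show ?thesis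
 using assms(1) unfolding semi_comm_def eq
proof
 assume "left_comm_on UNIV T R"
 thus "EX c>0. below_on UNIV (A + R) c"
  by (intro below_left[OF ccsubspace_UNIV subset_UNIV subset_UNIV _ n(1,3,2)])
next
 assume "right_comm T R"
 then obtain Q where "Q * (A + R) = B n" by (rule right_factor[OF _ n(1)]) (rule that)
 thus "EX c>0. below_on UNIV (A + R) c" using below_on_factor[of UNIV Q "A + R" d] n by simp
qed
qed

lemma lower_semi_comm_riesz:
assumes "semi_comm T R" "riesz R" "l ~= 0" "beta UNIV (app (T -. l)) < oo"
shows "beta UNIV (app (T + R -. l)) < oo"
proof -
interpret nonzero_shifted T R l by standard (rule assms(3))
obtain n where n: "n >= 1" "beta UNIV (app (B n)) < oo"
 by (rule beta_riesz_power[OF assms(4,2)])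
have eq: "T + R -. l = A + R" by simp
show ?thesis
 using assms(1) unfolding semi_comm_def eq
proof
 assume "left_comm_on UNIV T R"
 thus "beta UNIV (app (A + R)) < oo"
  by (intro beta_left[OF csubspace_UNIV subset_UNIV subset_UNIV _ n])
next
 assume "right_comm T R"
 thus "beta UNIV (app (A + R)) < oo" by (rule beta_right[OF _ n])
qed
qed

lemma riesz_zero: "riesz (0 :: 'a::complex_banach cop)"
unfolding riesz_def
proof (intro allI impI)
fix z :: complex assume "z ~= 0"
hence "inv_op ((- z) *: (1 :: 'a cop))" by (subst inv_op_scaleC) auto
thus "fredholm_on UNIV (0 - z *: (1 :: 'a cop))" using invertible_browder unfolding browder_def by fastforce
qed

lemma riesz_scale: "riesz R ==> riesz (c *: R)"
proof (cases "c = 0")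
case True
thus ?thesis using riesz_zero by simp
next
case False
assume R: "riesz R"
have "fredholm_on UNIV (c *: R -. z)" if "z ~= 0" for z
proof -
 let ?u = "R -. (z / c)"
 have fr: "fredholm_on UNIV ?u" using R that False by (simp add: riesz_def)
 have eq: "c *: R -. z = c *: ?u" using False by (simp add: scaleC_diff_right scaleC_scaleC)
 have k: "ker UNIV (c *: ?u) = ker UNIV ?u" using False by (simp add: app_scaleC_left)
 have "rg (c *: ?u) = rg ?u"
 proof (intro equalityI image_subsetI)
  fix x
  show "app (c *: ?u) x : rg ?u" by (metis app_scaleC app_scaleC_left rangeI)
  have "app (c *: ?u) (inverse c *: x) = app ?u x" using False by (simp only: app_scaleC app_scaleC_left scaleC_scaleC) simp
  thus "app ?u x : rg (c *: ?u)" by (metis rangeI)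
 qed
 thus ?thesis using fr unfolding eq fredholm_on_def alpha_def beta_def k by simp
qed
thus ?thesis by (simp add: riesz_def)
qed

lemma riesz_minus: "riesz R ==> riesz (- R)"
using riesz_scale[of R "- 1"] by simp

text \<open>Multiples of \<open>R\<close> satisfy the same hypotheses, which gives the path for the index.\<close>

lemma fredholm_semi_comm_riesz:
assumes "semi_comm T R" "riesz R" "l ~= 0" "fredholm_on UNIV (T -. l)"
shows "fredholm_on UNIV (T + R -. l)"
 "alpha UNIV (app (T -. l)) + beta UNIV (app (T + R -. l)) =
  alpha UNIV (app (T + R -. l)) + beta UNIV (app (T -. l))"
proof -
have path: "fredholm_on UNIV (T -. l + s *: R)" for s
proof -
 note h = semi_comm_scale[OF assms(1), of s] riesz_scale[OF assms(2), of s] assms(3)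
 have eq: "T -. l + s *: R = T + s *: R -. l" by simp
 obtain c where c: "c > 0" "below_on UNIV (T -. l) c" using assms(4) fredholm_UNIV_iff by blast
 have "beta UNIV (app (T -. l)) < oo" using assms(4) fredholm_UNIV_iff by blast
 thus ?thesis
  unfolding eq fredholm_UNIV_iff using upper_semi_comm_riesz[OF h c(2,1)] lower_semi_comm_riesz[OF h] by blast
qed
have eq: "T -. l + R = T + R -. l" by simp
show "fredholm_on UNIV (T + R -. l)" using path[of 1] unfolding eq[symmetric] by simp
show "alpha UNIV (app (T -. l)) + beta UNIV (app (T + R -. l)) =
  alpha UNIV (app (T + R -. l)) + beta UNIV (app (T -. l))"
 using index_path[OF ccsubspace_UNIV subset_UNIV subset_UNIV path] unfolding eq .
qed

section \<open>Finite ascent and descent under Riesz perturbations\<close>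

lemma browder_inj_invertible:
assumes "browder t" "!!x. app t x = 0 ==> x = 0" shows "inv_op t"
proof -
have pw: "x = 0" if "app (t ^ n) x = 0" for n x
 using that by (induction n) (auto simp: app_one app_mult dest: assms(2))
obtain n where n: "rg (t ^ Suc n) = rg (t ^ n)" using assms(1) unfolding browder_def fin_desc_def by blast
have "EX y. x = app t y" for x
proof -
 obtain y where "app (t ^ n) x = app (t ^ Suc n) y" using n by (metis rangeE rangeI)
 hence "app (t ^ n) (x - app t y) = 0" by (simp only: power_Suc2 app_mult app_diff) simp
 from pw[OF this] show ?thesis by (intro exI[of _ y]) simp
qed
moreover have "inj (app t)"
proof (rule injI)
 fix x y assume "app t x = app t y"
 hence "app t (x - y) = 0" by (simp add: app_diff)
 from assms(2)[OF this] show "x = y" by simp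
qed
ultimately show ?thesis unfolding inv_op_iff_bij bij_def surj_def by blast
qed

text \<open>Composed with a projection onto \<open>V\<close>, \<open>t\<close> is a finite-rank operator. If \<open>t\<close> had no eigenvalue
  on \<open>V\<close>, this operator would be quasi-nilpotent; but it is bounded below on \<open>V\<close>.\<close>

lemma eigenvector_exists:
fixes t :: "'a::complex_banach cop"
assumes V: "csubspace V" "edim V < oo" "V ~= {0}" and tV: "app t ` V <= V"
obtains x z where "x : V" "x ~= 0" "app t x = z *: x"
proof (rule ccontr)
assume nt: "~ thesis"
have inj: "x = 0" if "x : V" "app t x = z *: x" for x z using that nt \<open>!!x z. [|x : V; x ~= 0; app t x = z *: x|] ==> thesis\<close> by blast
have cV: "ccsubspace V" using V findim_closed unfolding ccsubspace_def by blast
have cl: "closed (app t ` V)" by (rule findim_closed[OF finite_le[OF edim_image_le[OF clinear_app V(1)] V(2)]])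
have inj0: "x = 0" if "x : V" "app t x = 0" for x using inj[of x 0] that by simp
obtain c where c: "c > 0" "!!x. x : V ==> c * norm x <= norm (app t x)"
 by (rule below_of_inj_closed[OF cV cl]) (erule (1) inj0, rule that)
obtain W where W: "closed W" "direct_sum V W UNIV" using closed_complement_UNIV[OF V(2)] by blast
have ds: "direct_sum W V UNIV" using W(2) by (simp add: direct_sum_alt Int_commute add.commute)
obtain P where P: "!!x. app P x : V" "!!x. x : V ==> app P x = x"
 by (rule projection_exists[OF W(1) ccsubspaceD(2)[OF cV] ds]) (rule that)
have "finrank P"
 unfolding finrank_def
 by (rule edim_subset_finite[OF V(1) csubspace_im[OF csubspace_UNIV] _ V(2)]) (use P(1) in blast)
hence "riesz (t * P)" using riesz_finrank[OF riesz_zero finrank_mult_left] by simp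
have "inv_op (t * P -. z)" if z: "cmod z >= c / 2" for z
proof (rule browder_inj_invertible[OF riesz_browder[OF \<open>riesz (t * P)\<close>]])
 show z0: "z ~= 0" using z c(1) by auto
 fix v assume "app (t * P -. z) v = 0"
 hence v: "app t (app P v) = z *: v" by (simp add: app_simps)
 have "inverse z *: app t (app P v) : V" using P(1) tV V(1) by (intro csubspace_scale) auto
 hence vV: "v : V" unfolding v using z0 by (simp add: scaleC_scaleC)
 thus "v = 0" using v P(2) by (intro inj[of v z]) simp_all
qed
then obtain n where n: "norm ((t * P) ^ n) <= (c / 2) ^ n / 2" "n >= 1"
 using spectral_radius[of "c / 2" "t * P"] c(1) by auto
obtain x where x: "x : V" "x ~= 0" using V(3) csubspace_0[OF V(1)] by auto
have "app ((t * P) ^ m) x : V & c ^ m * norm x <= norm (app ((t * P) ^ m) x)" for m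
proof (induction m)
 case (Suc m)
 let ?y = "app ((t * P) ^ m) x"
 have y: "?y : V" using Suc by blast
 have eq: "app ((t * P) ^ Suc m) x = app t ?y" using P(2)[OF y] by (simp add: app_mult)
 have "c * (c ^ m * norm x) <= c * norm ?y" using Suc c(1) by (intro mult_left_mono) auto
 also have "... <= norm (app t ?y)" by (rule c(2)[OF y])
 finally show ?case using y tV unfolding eq by (auto simp: mult.assoc)
qed (simp add: app_one x)
hence "c ^ n * norm x <= norm ((t * P) ^ n) * norm x" using norm_app order_trans by blast
also have "... <= ((c / 2) ^ n / 2) * norm x" by (rule mult_right_mono[OF n(1)]) simp
finally have "c ^ n <= (c / 2) ^ n / 2" using x(2) by simp
moreover have "(c / 2) ^ n <= c ^ n" using c(1) by (intro power_mono) auto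
moreover have "c ^ n > 0" using c(1) by simp
ultimately show False by linarith
qed

lemma eigenvectors_independent:
fixes u :: "'a::complex_banach cop"
assumes S: "infinite S" and y: "!!m. m : S ==> y m : V" "!!m. m : S ==> y m ~= 0"
 "!!m. m : S ==> app u (y m) = m *: y m" and V: "csubspace V" "edim V < oo"
shows False
proof -
have kill: "EX p. ALL m:S. app p (y m) = (\<Prod>i\<in>F. m - i) *: y m" if "finite F" for F
 using that
proof induction
 case empty
 show ?case by (intro exI[of _ 1]) (simp add: app_one)
next
 case (insert i F)
 then obtain p where p: "!!m. m : S ==> app p (y m) = (\<Prod>i\<in>F. m - i) *: y m" by blast
 have "app (p * (u -. i)) (y m) = (\<Prod>i\<in>insert i F. m - i) *: y m" if m: "m : S" for m
 proof -
  have "app (u -. i) (y m) = (m - i) *: y m"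
   using y(3)[OF m] by (simp add: app_simps scaleC_diff_left)
  thus ?thesis using p[OF m] insert.hyps by (simp add: app_mult app_scaleC scaleC_scaleC mult.commute)
 qed
 thus ?case by blast
qed
obtain D where D: "finite D" "cspan D = V" using V(2) edim_finite_iff by blast
obtain F where F: "F <= S" "finite F" "card F = Suc (card D)"
 using infinite_arbitrarily_large[OF S] by blast
have "inj_on y F"
proof (rule inj_onI)
 fix m n assume mn: "m : F" "n : F" "y m = y n"
 hence "m *: y m = n *: y m" using y(3) F(1) by (metis subsetD)
 thus "m = n" using y(2)[of m] mn(1) F(1) by auto
qed
hence card: "card (y ` F) = Suc (card D)" using F by (simp add: card_image)
have "cindependent (y ` F)"
 unfolding complex_vector.dependent_def
proof
 assume "EX a:y ` F. a : cspan (y ` F - {a})"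
 then obtain m where m: "m : F" "y m : cspan (y ` F - {y m})" by blast
 obtain p where p: "!!k. k : S ==> app p (y k) = (\<Prod>i\<in>F - {m}. k - i) *: y k" using kill[of "F - {m}"] F(2) by blast
 have "y ` F - {y m} <= {x. app p x = 0}"
 proof
  fix x assume "x : y ` F - {y m}"
  then obtain k where k: "k : F" "k ~= m" "x = y k" by blast
  have "(\<Prod>i\<in>F - {m}. k - i) = 0" using k F(2) by (intro prod_zero) auto
  thus "x : {x. app p x = 0}" using p[of k] k F(1) by auto
 qed
 hence "cspan (y ` F - {y m}) <= {x. app p x = 0}"
  using csubspace_kernel_on[OF clinear_app csubspace_UNIV, of p]
  by (intro complex_vector.span_minimal) simp_all
 hence "app p (y m) = 0" using m(2) by blast
 moreover have "m : S" using m F by blast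
 moreover have "(\<Prod>i\<in>F - {m}. m - i) ~= 0" using F(2) by (simp add: prod_zero_iff)
 ultimately show False using p[of m] y(2)[of m] by simp
qed
moreover have "y ` F <= cspan D" using y(1) F(1) D(2) by blast
ultimately have "card (y ` F) <= card D" using complex_vector.independent_span_bound[OF D(1)] by blast
thus False using card by simp
qed

text \<open>An eigenvector of \<open>T + R\<close> to \<open>m \<noteq> 0\<close> produces eigenvectors of \<open>T\<close> and of \<open>R\<close> to values
  that add up to \<open>m\<close>: on \<open>N(T + R - m)\<close> the operator \<open>R + C / m\<close>, \<open>C = TR - RT\<close>, acts and has
  an eigenvector, and \<open>C\<close> disappears after one more application of \<open>T\<close> or \<open>R\<close>.\<close>

lemma split_eigenvalue:
fixes T R :: "'a::complex_banach cop"
assumes sc: "semi_comm T R" and m: "m ~= 0" and fin: "edim {x. app (T + R) x = m *: x} < oo"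
 and ex: "EX x. x ~= 0 & app (T + R) x = m *: x"
obtains n where "n ~= m ==> EX x. x ~= 0 & app T x = (m - n) *: x"
 "n ~= 0 ==> EX y. y ~= 0 & app R y = n *: y & app (R * (T + R)) y = (m * n) *: y"
proof -
let ?E = "T + R" and ?N = "{x. app (T + R) x = m *: x}"
define C where "C = T * R - R * T"
have C0: "app T (app C x) = 0 & app R (app C x) = 0" if x: "x : ?N" for x
 using sc unfolding semi_comm_def
proof
 assume "left_comm_on UNIV T R"
 thus ?thesis unfolding left_comm_on_def C_def app_mult by simp
next
 assume "right_comm T R"
 hence "C * T = 0" "C * R = 0" unfolding right_comm_def C_def by simp_all
 hence "C * (T + R) = 0" by (simp add: distrib_left)
 from arg_cong[OF this, of "%v. app v x"] have "app C (app (T + R) x) = 0" by (simp only: app_mult app_simps1(1))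
 hence "m *: app C x = 0" using x by (simp add: app_scaleC)
 thus ?thesis using m by simp
qed
have EC: "app ?E (app C x) = 0" if "x : ?N" for x using C0[OF that] by (simp add: app_simps1(2))
have ER: "app ?E (app R x) = app R (app ?E x) + app C x" for x
 unfolding C_def by (simp add: app_simps)
have sN: "csubspace ?N"
 by (simp add: csubspace_def app_add app_scaleC scaleC_add_right scaleC_scaleC mult.commute)
let ?R = "R + inverse m *: C"
have RN: "app ?R ` ?N <= ?N"
proof
 fix y assume "y : app ?R ` ?N"
 then obtain x where x: "x : ?N" "y = app R x + inverse m *: app C x" by (auto simp: app_simps1(2) app_scaleC_left)
 have "app ?E y = app R (app ?E x) + app C x"
  unfolding x(2) app_add[of ?E] app_scaleC ER EC[OF x(1)] by simp
 also have "... = m *: y" using x m by (simp add: app_scaleC scaleC_add_right scaleC_scaleC)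
 finally show "y : ?N" by simp
qed
have "?N ~= {0}" using ex by blast
then obtain x n where x: "x : ?N" "x ~= 0" "app ?R x = n *: x"
 by (rule eigenvector_exists[OF sN fin _ RN]) (rule that)
have Ex: "app ?E x = m *: x" using x(1) by simp
have Rx: "app R x = n *: x - inverse m *: app C x"
 using x(3) by (simp add: app_simps1(2) app_scaleC_left algebra_simps)
have Tx: "app T x = (m - n) *: x + inverse m *: app C x"
 using Ex Rx by (simp add: app_simps1(2) scaleC_diff_left algebra_simps)
show thesis
proof (rule that)
 assume n: "n ~= m"
 have "app T x ~= 0"
 proof
  assume "app T x = 0"
  hence "app ?E ((m - n) *: x + inverse m *: app C x) = 0" using Tx by simp
  hence "(m - n) *: m *: x = 0" unfolding app_add[of ?E] app_scaleC EC[OF x(1)] Ex by simp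
  thus False using n m x(2) by simp
 qed
 moreover have "app T (app T x) = (m - n) *: app T x"
  using arg_cong[OF Tx, of "app T"] C0[OF x(1)] by (simp add: app_add app_scaleC)
 ultimately show "EX x. x ~= 0 & app T x = (m - n) *: x" by blast
next
 assume n: "n ~= 0"
 have "app R x ~= 0"
 proof
  assume "app R x = 0"
  hence "app ?E (n *: x - inverse m *: app C x) = 0" using Rx by simp
  hence "n *: m *: x = 0" unfolding app_diff[of ?E] app_scaleC EC[OF x(1)] Ex by simp
  thus False using n m x(2) by simp
 qed
 moreover have RR: "app R (app R x) = n *: app R x"
  using arg_cong[OF Rx, of "app R"] C0[OF x(1)] by (simp add: app_diff app_scaleC)
 moreover have "app (R * ?E) (app R x) = (m * n) *: app R x"
  unfolding app_mult ER Ex app_add app_scaleC RR using C0[OF x(1)] by (simp add: scaleC_scaleC)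
 ultimately show "EX y. y ~= 0 & app R y = n *: y & app (R * ?E) y = (m * n) *: y" by blast
qed
qed

text \<open>If the ascent of \<open>T + R - l\<close> were infinite, every \<open>m\<close> near \<open>l\<close> would be an eigenvalue of
  \<open>T + R\<close>. Splitting these, only finitely many \<open>m\<close> can have a part in \<open>R\<close> that is not small, so
  \<open>T\<close> has eigenvalues close to \<open>l\<close> but different from it, contradicting its finite ascent.\<close>

lemma fin_asc_perturb:
fixes T R :: "'a::complex_banach cop"
assumes sc: "semi_comm T R" and l: "l ~= 0"
 and Rfin: "!!e. e > 0 ==> finite {n. e <= cmod n & (EX x. x ~= 0 & app R x = n *: x)}"
 and Rdim: "!!n. n ~= 0 ==> edim {x. app R x = n *: x} < oo"
 and T: "below_on UNIV (T -. l) c" "c > 0" "fin_asc UNIV (T -. l)"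
 and E: "below_on UNIV (T + R -. l) b" "b > 0"
shows "fin_asc UNIV (T + R -. l)"
proof (rule ccontr)
assume "~ fin_asc UNIV (T + R -. l)"
then obtain d1 where d1: "d1 > 0" "!!z. cmod z < d1 ==> EX x. x ~= 0 & app (T + R -. l) x = z *: x"
 by (rule infinite_asc_eigenvalues[OF E]) (rule that)
obtain d2 where d2: "d2 > 0" "!!z x. 0 < cmod z ==> cmod z < d2 ==> app (T -. l) x = z *: x ==> x = 0"
 by (rule fin_asc_no_eigenvalues[OF T]) (rule that)
define d where "d = Min {d1, d2, b / 2, cmod l}"
have d: "d > 0" "d <= d1" "d <= d2" "d <= b / 2" "d <= cmod l"
 using d1(1) d2(1) E(2) l by (auto simp: d_def)
define M where "M = {m. d / 4 < cmod (m - l) & cmod (m - l) < d / 2}"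
have "infinite M"
proof -
 have "(%s. l + complex_of_real s) ` {d / 4<..<d / 2} <= M" using d(1) by (auto simp: M_def)
 moreover have "infinite ((%s. l + complex_of_real s) ` {d / 4<..<d / 2})"
  using d(1) by (subst finite_image_iff) (auto simp: inj_on_def)
 ultimately show ?thesis using finite_subset by blast
qed
have Em: "EX x. x ~= 0 & app (T + R) x = m *: x" if m: "cmod (m - l) < d" for m
proof -
 obtain x where x: "x ~= 0" "app (T + R -. l) x = (m - l) *: x" using d1(2)[of "m - l"] m d(2) by auto
 hence "app (T + R) x = m *: x" by (simp add: app_simps scaleC_diff_left)
 thus ?thesis using x by blast
qed
have Efin: "edim {x. app (T + R) x = m *: x} < oo" if m: "cmod (m - l) < d" for m
proof -
 have "below_on UNIV (T + R -. m) (1 * b - b / 2)"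
 proof (rule below_on_perturb[OF E(1) ccsubspace_UNIV finrank_zero])
  fix x
  have "app (T + R -. l) x = app (T + R -. m) x + (m - l) *: x"
   by (simp add: app_simps scaleC_diff_left)
  hence "norm (app (T + R -. l) x) <= norm (app (T + R -. m) x) + cmod (m - l) * norm x"
   using norm_triangle_ineq norm_scaleC by metis
  also have "cmod (m - l) * norm x <= b / 2 * norm x" using m d(4) by (intro mult_right_mono) auto
  finally show "1 * norm (app (T + R -. l) x) <= norm (app (T + R -. m) x) + b / 2 * norm x" by simp
 qed simp
 hence "alpha UNIV (app (T + R -. m)) < oo"
  using below_on_iff[OF ccsubspace_UNIV, of "T + R -. m"] E(2) by auto
 moreover have "ker UNIV (T + R -. m) = {x. app (T + R) x = m *: x}" by (auto simp: app_simps)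
 ultimately show ?thesis unfolding alpha_def by simp
qed
have "EX n. d / 4 <= cmod n & (EX y. y ~= 0 & app R y = n *: y & app (R * (T + R)) y = (m * n) *: y)"
 if mM: "m : M" for m
proof -
 have ml: "cmod (m - l) < d" "d / 4 < cmod (m - l)" "cmod (m - l) < d / 2" using mM d(1) by (auto simp: M_def)
 have m0: "m ~= 0"
 proof
  assume "m = 0"
  hence "cmod l < d" using ml(1) by simp
  thus False using d(5) by simp
 qed
 obtain n where n: "n ~= m ==> EX x. x ~= 0 & app T x = (m - n) *: x"
  "n ~= 0 ==> EX y. y ~= 0 & app R y = n *: y & app (R * (T + R)) y = (m * n) *: y"
  by (rule split_eigenvalue[OF sc m0 Efin[OF ml(1)] Em[OF ml(1)]]) (rule that)
 have nd: "d / 4 <= cmod n"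
 proof (rule ccontr)
  assume "~ d / 4 <= cmod n"
  hence nd: "cmod n < d / 4" by simp
  have "cmod (m - l) <= cmod (m - n - l) + cmod n"
   using norm_triangle_ineq[of "m - n - l" n] by (simp add: algebra_simps)
  hence 1: "0 < cmod (m - n - l)" using ml(2) nd by linarith
  have "cmod (m - n - l) <= cmod (m - l) + cmod n"
   using norm_triangle_ineq4[of "m - l" n] by (simp add: algebra_simps)
  hence 2: "cmod (m - n - l) < d" using ml(3) nd d(1) by linarith
  have "n ~= m"
  proof
   assume "n = m"
   hence "cmod l < d" using 2 by simp
   thus False using d(5) by simp
  qed
  then obtain x where x: "x ~= 0" "app T x = (m - n) *: x" using n(1) by blast
  have "app (T -. l) x = (m - n - l) *: x"
   using x(2) by (simp add: app_simps scaleC_diff_left)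
  hence "x = 0" using 1 2 d(3) by (intro d2(2)[of "m - n - l"]) auto
  thus False using x(1) by simp
 qed
 hence "n ~= 0" using d(1) by auto
 thus ?thesis using n(2) nd by blast
qed
then obtain g where g: "!!m. m : M ==> d / 4 <= cmod (g m)"
 "!!m. m : M ==> EX y. y ~= 0 & app R y = g m *: y & app (R * (T + R)) y = (m * g m) *: y"
 by metis
have "g ` M <= {n. d / 4 <= cmod n & (EX x. x ~= 0 & app R x = n *: x)}" using g by blast
hence "finite (g ` M)" using Rfin[of "d / 4"] d(1) finite_subset by simp
then obtain m0 where m0: "m0 : M" "infinite {m : M. g m = g m0}"
 using pigeonhole_infinite[OF \<open>infinite M\<close>] by blast
let ?n = "g m0" and ?S = "{m : M. g m = g m0}"
have n0: "?n ~= 0" using g(1)[OF m0(1)] d(1) by auto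
have inj: "inj_on (%m. m * ?n) ?S" using n0 by (auto simp: inj_on_def)
have "EX y. y ~= 0 & app R y = ?n *: y & app (R * (T + R)) y = k *: y" if "k : (%m. m * ?n) ` ?S" for k
 using that g(2) by force
then obtain y where y: "!!k. k : (%m. m * ?n) ` ?S ==> y k ~= 0 & app R (y k) = ?n *: y k & app (R * (T + R)) (y k) = k *: y k"
 by metis
show False
proof (rule eigenvectors_independent[of "(%m. m * ?n) ` ?S" y "{x. app R x = ?n *: x}" "R * (T + R)"])
 show "infinite ((%m. m * ?n) ` ?S)" using m0(2) finite_image_iff[OF inj] by blast
 show "csubspace {x. app R x = ?n *: x}"
  by (simp add: csubspace_def app_add app_scaleC scaleC_add_right scaleC_scaleC mult.commute)
qed (use y Rdim[OF n0] in auto)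
qed

section \<open>The dual space\<close>

text \<open>The dual is a complex Banach space as well, so that adjoints are operators in the sense used so far.\<close>

typedef (overloaded) 'a cdual = "{f :: 'a::complex_banach \<Rightarrow>\<^sub>L complex. ALL c x. f (c *: x) = c * f x}"
morphisms bfun Dual by (rule exI[of _ 0]) simp

setup_lifting type_definition_cdual

lift_definition ev :: "'a::complex_banach cdual => 'a => complex" is blinfun_apply .

lemma dual_eqI: "(!!x. ev f x = ev g x) ==> f = g"
by transfer (rule blinfun_eqI)

lemma ev_add: "ev f (x + y) = ev f x + ev f y"
and ev_scaleC: "ev f (c *: x) = c * ev f x"
by (transfer, simp add: blinfun.add_right)+

instantiation cdual :: (complex_banach) real_normed_vector
begin
lift_definition zero_cdual :: "'a cdual" is 0 by simp
lift_definition plus_cdual :: "'a cdual => 'a cdual => 'a cdual" is "(+)" by (simp add: blinfun.add_left distrib_left)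
lift_definition minus_cdual :: "'a cdual => 'a cdual => 'a cdual" is "(-)" by (simp add: blinfun.diff_left right_diff_distrib)
lift_definition uminus_cdual :: "'a cdual => 'a cdual" is uminus by (simp add: blinfun.minus_left)
lift_definition scaleR_cdual :: "real => 'a cdual => 'a cdual" is scaleR by (simp add: blinfun.scaleR_left)
lift_definition norm_cdual :: "'a cdual => real" is norm .
definition "dist f g = norm (f - g :: 'a cdual)"
definition "sgn (f :: 'a cdual) = inverse (norm f) *\<^sub>R f"
definition "uniformity = (INF e\<in>{0<..}. principal {(x, y :: 'a cdual). dist x y < e})"
definition "open S = (ALL x:S. \<forall>\<^sub>F (x', y) in uniformity. x' = x --> (y :: 'a cdual) : S)"

instance
by standard (rule dist_cdual_def sgn_cdual_def uniformity_cdual_def open_cdual_def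
 | transfer, simp add: algebra_simps norm_triangle_ineq)+
end

lemma norm_ev: "cmod (ev f x) <= norm f * norm x"
by transfer (rule norm_blinfun)

lemma norm_dual_le: "0 <= b ==> (!!x. cmod (ev f x) <= b * norm x) ==> norm f <= b"
by transfer (rule norm_blinfun_bound)

instantiation cdual :: (complex_banach) complex_banach
begin
lift_definition scaleC_cdual :: "complex => 'a cdual => 'a cdual" is "%c f. Blinfun (%x. c * blinfun_apply f x)"
by (subst (1 2) bounded_linear_Blinfun_apply) (simp_all add: bounded_linear_const_mult blinfun.bounded_linear_right)

lemma ev_simps:
"ev 0 x = 0" "ev (f + g) x = ev f x + ev g x" "ev (f - g) x = ev f x - ev g x"
"ev (- f) x = - ev f x" "ev (r *\<^sub>R f) x = r *\<^sub>R ev f x" "ev (c *: f) x = c * ev f x"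
by (transfer, simp add: blinfun.add_left blinfun.diff_left blinfun.minus_left blinfun.scaleR_left
 bounded_linear_Blinfun_apply bounded_linear_const_mult blinfun.bounded_linear_right)+

instance
proof
fix f g :: "'a cdual" and a :: real and c d :: complex
show "c *: (f + g) = c *: f + c *: g" "(c + d) *: f = c *: f + d *: f" "c *: d *: f = (c * d) *: f"
 "a *\<^sub>R f = complex_of_real a *: f"
 by (auto intro!: dual_eqI simp: ev_simps algebra_simps scaleR_conv_of_real)
have "norm (c *: f) <= cmod c * norm f" for c and f :: "'a cdual"
 using mult_left_mono[OF norm_ev[of f], of "cmod c"]
 by (intro norm_dual_le) (simp_all add: ev_simps norm_mult mult.assoc)
thus "norm (c *: f) = cmod c * norm f"
 by (rule norm_eq_scaleC) (auto intro!: dual_eqI simp: ev_simps)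
next
fix X :: "nat => 'a cdual" assume X: "Cauchy X"
have d: "dist f g = dist (bfun f) (bfun g)" for f g :: "'a cdual"
 unfolding dist_cdual_def dist_norm by transfer simp
have "Cauchy (%n. bfun (X n))" using X unfolding Cauchy_def d .
then obtain L where L: "(%n. bfun (X n)) \<longlonglongrightarrow> L" using Cauchy_convergent convergent_def by blast
have pt: "(%n. bfun (X n) x) \<longlonglongrightarrow> L x" for x
 using L by (rule bounded_linear.tendsto[OF blinfun.bounded_linear_left])
have "L (c *: x) = c * L x" for c x
 by (rule LIMSEQ_unique[OF pt]) (use tendsto_mult_left[OF pt[of x], of c] bfun[of "X _"] in simp)
hence "bfun (Dual L) = L" by (simp add: Dual_inverse)
hence "X \<longlonglongrightarrow> Dual L" using L unfolding tendsto_iff d by simp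
thus "convergent X" by (auto simp: convergent_def)
qed
end

lemma separating_functional:
assumes "csubspace M" "closed M" "x0 \<notin> M"
obtains f where "!!x. x : M ==> ev f x = 0" "ev f x0 = 1"
proof -
obtain g where g: "bounded_linear g" "!!c x. g (c *: x) = c * g x" "!!x. x : M ==> g x = 0" "g x0 = 1"
 by (rule hahn_banach_separation[OF assms]) (rule that)
have "ev (Dual (Blinfun g)) = g"
 unfolding ev.rep_eq by (subst Dual_inverse) (simp_all add: bounded_linear_Blinfun_apply[OF g(1)] g(2))
thus thesis using that[of "Dual (Blinfun g)"] g by simp
qed

section \<open>Adjoints\<close>

lift_definition compose_op :: "'a::complex_banach cdual => 'a cop => 'a cdual" is "(o\<^sub>L)" by simp

definition adj :: "'a::complex_banach cop => 'a cdual cop" where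
"adj t = Cop (%f. compose_op f t)"

lemma ev_adj: "ev (app (adj t) f) x = ev f (app t x)"
proof -
have e: "ev (compose_op f t) x = ev f (app t x)" for f x by transfer simp
have "bounded_clinear (%f. compose_op f t)"
proof (rule bounded_clinearI)
 show "norm (compose_op f t) <= norm t * norm f" for f
  by transfer (metis norm_blinfun_compose mult.commute)
qed (auto intro!: dual_eqI simp: e ev_simps)
thus ?thesis unfolding adj_def by (simp add: app_Cop e)
qed

lemma adj_simps: "adj (s * t) = adj t * adj s" "adj (s + t) = adj s + adj t" "adj (s - t) = adj s - adj t"
"adj (c *: t) = c *: adj t" "adj 1 = 1" "adj 0 = 0"
by (auto intro!: cop_eqI dual_eqI
 simp: ev_adj app_mult app_simps1 app_scaleC_left app_one ev_add ev_scaleC ev_simps)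
 (metis add_diff_cancel ev_add diff_add_cancel, metis ev_scaleC complex_vector.scale_zero_left mult_zero_left)

lemma adj_power: "adj (t ^ n) = adj t ^ n"
by (induction n) (simp_all add: adj_simps power_commutes)

lemma semi_comm_adj:
assumes "semi_comm T R" shows "semi_comm (adj T) (adj R)"
proof -
define K where "K = - (T * R - R * T)"
have c: "adj T * adj R - adj R * adj T = adj K" by (simp add: K_def adj_simps)
show ?thesis using assms unfolding semi_comm_def
proof
 assume "left_comm_on UNIV T R"
 hence "T * (T * R - R * T) = 0" "R * (T * R - R * T) = 0"
  unfolding left_comm_on_def by (auto intro!: cop_eqI simp: app_simps1(1))
 hence "T * K = 0" "R * K = 0"
  unfolding K_def mult_minus_right by simp_all
 hence "right_comm (adj T) (adj R)"
  unfolding right_comm_def c unfolding adj_simps(1)[symmetric] by (simp add: adj_simps(6))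
 thus "left_comm_on UNIV (adj T) (adj R) | right_comm (adj T) (adj R)" ..
next
 assume "right_comm T R"
 hence "K * T = 0" "K * R = 0"
  unfolding right_comm_def K_def minus_mult_left[symmetric] by simp_all
 hence "left_comm_on UNIV (adj T) (adj R)"
  unfolding left_comm_on_def c unfolding adj_simps(1)[symmetric] by (simp add: adj_simps(6) app_simps1)
 thus "left_comm_on UNIV (adj T) (adj R) | right_comm (adj T) (adj R)" ..
qed
qed

text \<open>One linear condition for each element of a finite spanning set.\<close>

lemma annihilator_finite_codim:
assumes "edim G < oo"
shows "ccsubspace {f. ALL g:G. ev f g = 0} & ecodim UNIV {f. ALL g:G. ev f g = 0} < oo"
proof -
obtain B where B: "finite B" "cspan B = G" using assms edim_finite_iff by blast
have point: "ccsubspace {f. ev f b = 0} & ecodim UNIV {f. ev f b = 0} < oo" for b :: 'a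
proof (cases "EX h. ev h b ~= 0")
 case False
 hence "{f. ev f b = 0} = UNIV" by auto
 thus ?thesis using ccsubspace_UNIV by (simp add: ecodim_self csubspace_UNIV)
next
 case True
 then obtain h where h: "ev h b ~= 0" by blast
 have "bounded_clinear (%f. ev f b *: h)"
  by (rule bounded_clinearI[where K="norm b * norm h"])
   (simp_all add: ev_simps scaleC_add_left scaleC_scaleC norm_scaleC,
    metis norm_ev mult_right_mono norm_ge_zero mult.assoc mult.commute)
 hence k: "app (Cop (%f. ev f b *: h)) = (%f. ev f b *: h)" by (rule app_Cop)
 have h0: "h ~= 0" using h by (auto simp: ev_simps)
 have ker: "{f. ev f b = 0} = {f. app (Cop (%f. ev f b *: h)) f = 0}" unfolding k using h0 by auto
 have "rg (Cop (%f. ev f b *: h)) <= cspan {h}"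
  unfolding k by (auto intro: complex_vector.span_scale complex_vector.span_base)
 hence "finrank (Cop (%f. ev f b *: h))"
  unfolding finrank_def using edim_finite_iff
  by (intro edim_subset_finite[OF complex_vector.subspace_span csubspace_im[OF csubspace_UNIV]]) blast+
 thus ?thesis using ccsubspace_kernel[OF ccsubspace_UNIV, of "Cop (%f. ev f b *: h)"] finrank_kernel[OF _ csubspace_UNIV]
  unfolding ker by simp
qed
have "ccsubspace {f. ALL b:B. ev f b = 0} & ecodim UNIV {f. ALL b:B. ev f b = 0} < oo"
 using B(1)
proof induction
 case empty
 thus ?case using ccsubspace_UNIV by (simp add: ecodim_self csubspace_UNIV)
next
 case (insert b B)
 have eq: "{f. ALL b:insert b B. ev f b = 0} = {f. ev f b = 0} Int {f. ALL b:B. ev f b = 0}" by auto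
 note p = point[of b] and IH = insert.IH
 show ?case unfolding eq
  by (intro conjI ccsubspace_Int ecodim_Int_finite[OF csubspace_UNIV]
   conjunct1[OF p] conjunct1[OF IH] conjunct2[OF p] conjunct2[OF IH]
   ccsubspaceD(1)[OF conjunct1[OF p]] ccsubspaceD(1)[OF conjunct1[OF IH]] subset_UNIV)
qed
moreover have "{f. ALL b:B. ev f b = 0} = {f. ALL g:G. ev f g = 0}"
proof (intro Collect_cong iffI ballI)
 fix f g assume f: "ALL b:B. ev f b = 0" and g: "g : G"
 have "cspan B <= {x. ev f x = 0}"
 proof (rule complex_vector.span_minimal)
  show "csubspace {x. ev f x = 0}"
   using ev_scaleC[of f 0 0] by (simp add: csubspace_def ev_add ev_scaleC)
 qed (use f in auto)
 thus "ev f g = 0" using g B(2) by blast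
next
 fix f b assume "ALL g:G. ev f g = 0" "b : B"
 thus "ev f b = 0" using B(2) complex_vector.span_base by blast
qed
ultimately show ?thesis by simp
qed

text \<open>If every \<open>y\<close> is \<open>t x + g\<close> with \<open>g\<close> in a finite-dimensional \<open>G\<close> and \<open>norm x \<le> k norm y\<close>, then a
  functional \<open>f\<close> that vanishes on \<open>G\<close> has norm at most \<open>k\<close> times that of \<open>f \<circ> t\<close>.\<close>

lemma adj_below:
assumes "beta UNIV (app t) < oo"
obtains c where "c > 0" "below_on UNIV (adj t) c"
proof -
obtain k where k: "k > 0" "onto_on UNIV t k"
 using onto_on_of_beta[OF ccsubspace_UNIV subset_UNIV assms] by blast
obtain G where G: "edim G < oo" "!!y. EX x. EX g:G. y = app t x + g & norm x <= k * norm y"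
 using k(2) unfolding onto_on_def by auto
let ?V = "{f. ALL g:G. ev f g = 0}"
have "below_on UNIV (adj t) (1 / k)"
proof (rule below_onI)
 fix f assume f: "f : ?V"
 have "norm f <= k * norm (app (adj t) f)"
 proof (rule norm_dual_le)
  fix y
  obtain x g where x: "g : G" "y = app t x + g" "norm x <= k * norm y" using G(2) by blast
  have "ev f y = ev (app (adj t) f) x" using f x(1) by (simp add: x(2) ev_add ev_adj)
  hence "cmod (ev f y) <= norm (app (adj t) f) * norm x" using norm_ev by metis
  also have "... <= norm (app (adj t) f) * (k * norm y)" by (rule mult_left_mono[OF x(3)]) simp
  finally show "cmod (ev f y) <= k * norm (app (adj t) f) * norm y" by (simp add: mult_ac)
 qed (use k(1) in simp)
 thus "1 / k * norm f <= norm (app (adj t) f)" using k(1) by (simp add: field_simps)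
qed (use annihilator_finite_codim[OF G(1)] in auto)
thus thesis using that[of "1 / k"] k(1) by simp
qed

lemma fin_asc_adj:
assumes "fin_desc UNIV t" shows "fin_asc UNIV (adj t)"
proof -
obtain n where n: "rg (t ^ Suc n) = rg (t ^ n)" using assms unfolding fin_desc_def by blast
have "f = 0" if f: "f : rg (adj t ^ n)" and z: "app (adj t) f = 0" for f
proof -
 obtain g where g: "f = app (adj (t ^ n)) g" using f by (auto simp: adj_power)
 have "ev f x = 0" for x
 proof -
  obtain y where "app (t ^ n) x = app (t ^ Suc n) y" using n by (metis rangeE rangeI)
  hence "ev f x = ev (app (adj t) f) y"
   unfolding g ev_adj by (simp only: power_Suc2 app_mult)
  thus ?thesis using z by (simp add: ev_simps)
 qed
 thus ?thesis by (intro dual_eqI) (simp add: ev_simps)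
qed
thus ?thesis unfolding fin_asc_def by blast
qed

text \<open>If the descent were infinite, a functional that separates a point of \<open>R(t^n)\<close> from the closed
  subspace \<open>R(t^(n + 1))\<close> would give a kernel vector of the adjoint in the range of its \<open>n\<close>-th power.\<close>

lemma fin_desc_of_adj:
fixes t :: "'a::complex_banach cop"
assumes "fin_asc UNIV (adj t)" "beta UNIV (app t) < oo" shows "fin_desc UNIV t"
proof -
obtain n where n: "!!f. f : rg (adj t ^ n) ==> app (adj t) f = 0 ==> f = 0"
 using assms(1) unfolding fin_asc_def by blast
obtain k where k: "k > 0" "onto_on UNIV t k"
 using onto_on_of_beta[OF ccsubspace_UNIV subset_UNIV assms(2)] by blast
have "onto_on UNIV (t ^ Suc n) (k ^ Suc n)" using onto_on_power[OF k(2)] k(1) by (simp del: power_Suc)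
hence "beta UNIV (app (t ^ Suc n)) < oo"
 by (rule beta_of_onto_on[OF csubspace_UNIV subset_UNIV])
hence cl: "closed (rg (t ^ Suc n))"
 unfolding beta_def
 by (intro finite_codim_range_closed[OF bounded_linear_app clinear_app _ _ csubspace_UNIV])
  (simp_all add: csubspace_UNIV)
have "x : rg (t ^ Suc n)" if x: "x : rg (t ^ n)" for x
proof (rule ccontr)
 assume nx: "x \<notin> rg (t ^ Suc n)"
 obtain g where g: "!!x. x : rg (t ^ Suc n) ==> ev g x = 0" "ev g x = 1"
  by (rule separating_functional[OF csubspace_im[OF csubspace_UNIV] cl nx]) (rule that)
 have "app (adj t) (app (adj (t ^ n)) g) = 0"
 proof (rule dual_eqI)
  fix y
  have "ev g (app (t ^ Suc n) y) = 0" using g(1) by blast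
  thus "ev (app (adj t) (app (adj (t ^ n)) g)) y = ev 0 y"
   by (simp only: ev_adj power_Suc2 app_mult ev_simps)
 qed
 hence "app (adj (t ^ n)) g = 0" using n by (simp add: adj_power)
 moreover obtain y where "x = app (t ^ n) y" using x by blast
 ultimately have "ev g x = 0" by (metis ev_adj ev_simps(1))
 thus False using g(2) by simp
qed
moreover have "rg (t ^ Suc n) <= rg (t ^ n)" by (auto simp: power_Suc2 app_mult simp del: power_Suc)
ultimately show ?thesis unfolding fin_desc_def by blast
qed

section \<open>Browder operators under semi-commuting Riesz perturbations\<close>

lemma fin_asc_semi_comm_riesz:
fixes T R :: "'a::complex_banach cop"
assumes sc: "semi_comm T R" and R: "riesz R" and l: "l ~= 0"
 and T: "below_on UNIV (T -. l) c" "c > 0" "fin_asc UNIV (T -. l)"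
shows "fin_asc UNIV (T + R -. l)"
proof -
obtain b where b: "b > 0" "below_on UNIV (T + R -. l) b"
 using upper_semi_comm_riesz[OF sc R l T(1,2)] by (elim exE conjE) (rule that)
show ?thesis
proof (rule fin_asc_perturb[OF sc l _ _ T b(2,1)])
 fix e :: real assume e: "e > 0"
 have "{n. e <= cmod n & (EX x. x ~= 0 & app R x = n *: x)} <= {z. e <= cmod z & ~ inv_op (R -. z)}"
 proof
  fix n assume "n : {n. e <= cmod n & (EX x. x ~= 0 & app R x = n *: x)}"
  then obtain x where x: "e <= cmod n" "x ~= 0" "app R x = n *: x" by blast
  have "app (R -. n) x = app (R -. n) 0" using x(3) by (simp add: app_simps)
  hence "~ bij (app (R -. n))" using x(2) unfolding bij_def inj_def by blast
  thus "n : {z. e <= cmod z & ~ inv_op (R -. z)}"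
   using x(1) unfolding inv_op_iff_bij by blast
 qed
 thus "finite {n. e <= cmod n & (EX x. x ~= 0 & app R x = n *: x)}"
  using riesz_spectrum_finite[OF R e] by (rule finite_subset)
next
 fix n :: complex assume "n ~= 0"
 hence "alpha UNIV (app (R -. n)) < oo" using R unfolding riesz_def fredholm_on_def by blast
 moreover have "ker UNIV (R -. n) = {x. app R x = n *: x}" by (auto simp: app_simps)
 ultimately show "edim {x. app R x = n *: x} < oo" unfolding alpha_def by simp
qed
qed

text \<open>Apply \<open>fin_asc_perturb\<close> to the adjoints. Its hypotheses on \<open>R\<close> concern eigenvalues only, which for
  the adjoint of \<open>R\<close> are spectral values of \<open>R\<close>.\<close>

lemma fin_desc_semi_comm_riesz:
fixes T R :: "'a::complex_banach cop"
assumes sc: "semi_comm T R" and R: "riesz R" and l: "l ~= 0"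
 and T: "beta UNIV (app (T -. l)) < oo" "fin_desc UNIV (T -. l)"
shows "fin_desc UNIV (T + R -. l)"
proof (rule fin_desc_of_adj)
have s: "adj (U -. m) = adj U -. m" for U :: "'a cop" and m by (simp add: adj_simps)
show bE: "beta UNIV (app (T + R -. l)) < oo" by (rule lower_semi_comm_riesz[OF sc R l T(1)])
obtain c where c: "c > 0" "below_on UNIV (adj (T -. l)) c" by (rule adj_below[OF T(1)]) (rule that)
obtain b where b: "b > 0" "below_on UNIV (adj (T + R -. l)) b" by (rule adj_below[OF bE]) (rule that)
have "fin_asc UNIV (adj T + adj R -. l)"
proof (rule fin_asc_perturb[OF semi_comm_adj[OF sc] l])
 fix e :: real assume e: "e > 0"
 have "{n. e <= cmod n & (EX f. f ~= 0 & app (adj R) f = n *: f)} <= {z. e <= cmod z & ~ inv_op (R -. z)}"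
 proof
  fix n assume "n : {n. e <= cmod n & (EX f. f ~= 0 & app (adj R) f = n *: f)}"
  then obtain f where f: "e <= cmod n" "f ~= 0" "app (adj R) f = n *: f" by blast
  have "app (adj (R -. n)) f = 0" unfolding s using f(3) by (simp add: app_simps)
  hence z: "ev f (app (R -. n) x) = 0" for x by (metis ev_adj ev_simps(1))
  have "~ surj (app (R -. n))"
  proof
   assume "surj (app (R -. n))"
   hence "ev f y = ev 0 y" for y using z by (metis surjE ev_simps(1))
   thus False using f(2) dual_eqI by blast
  qed
  thus "n : {z. e <= cmod z & ~ inv_op (R -. z)}"
   using f(1) unfolding inv_op_iff_bij bij_def by blast
 qed
 thus "finite {n. e <= cmod n & (EX f. f ~= 0 & app (adj R) f = n *: f)}"
  using riesz_spectrum_finite[OF R e] by (rule finite_subset)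
next
 fix n :: complex assume "n ~= 0"
 hence "beta UNIV (app (R -. n)) < oo" using R unfolding riesz_def fredholm_on_def by blast
 then obtain c where c: "c > 0" "below_on UNIV (adj (R -. n)) c" by (rule adj_below) (rule that)
 hence "alpha UNIV (app (adj (R -. n))) < oo"
  using below_on_iff[OF ccsubspace_UNIV] by blast
 moreover have "{f : UNIV. app (adj (R -. n)) f = 0} = {f. app (adj R) f = n *: f}"
  unfolding s by (auto simp: app_simps)
 ultimately show "edim {f. app (adj R) f = n *: f} < oo" unfolding alpha_def by simp
next
 show "below_on UNIV (adj T -. l) c" "below_on UNIV (adj T + adj R -. l) b"
  using b c by (simp_all add: adj_simps)
 show "fin_asc UNIV (adj T -. l)" using fin_asc_adj[OF T(2)] unfolding s .
qed (use b c in simp_all)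
thus "fin_asc UNIV (adj (T + R -. l))" by (simp add: adj_simps)
qed

lemma browder_semi_comm_riesz:
assumes "semi_comm T R" "riesz R" "l ~= 0" "browder (T -. l)"
shows "browder (T + R -. l)"
proof -
have b: "fredholm_on UNIV (T -. l)" "fin_asc UNIV (T -. l)" "fin_desc UNIV (T -. l)"
 using assms(4) unfolding browder_def by simp_all
obtain c where "c > 0" "below_on UNIV (T -. l) c"
 using b(1) unfolding fredholm_UNIV_iff by blast
thus ?thesis
 unfolding browder_def
 using fredholm_semi_comm_riesz(1)[OF assms(1-3) b(1)] b fin_asc_semi_comm_riesz[OF assms(1-3)]
  fin_desc_semi_comm_riesz[OF assms(1-3)] unfolding fredholm_on_def by blast
qed

section \<open>Semi-B-Fredholm operators via one power\<close>

abbreviation pran :: "'a::complex_banach set => 'a cop => nat => 'a set" where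
"pran V t n == app (t ^ n) ` V"

abbreviation "alpha_pow V t n == alpha (pran V t n) (app t)"
abbreviation "beta_pow V t n == beta (pran V t n) (app t)"

text \<open>Conditions at a single exponent are easier to transfer than the least exponents \<open>p_e\<close>, \<open>q_e\<close> and \<open>m_deg\<close>: they
  persist to larger exponents, so several can be met at once, and they return to the least one
  (\<open>ubf_at_least\<close>, \<open>lbf_at_least\<close>).\<close>

definition ubf_at :: "'a::complex_banach set => 'a cop => nat => bool" where
"ubf_at V t n <-> alpha_pow V t n < oo & closed (pran V t n) & closed (pran V t (Suc n))"

definition lbf_at :: "'a::complex_banach set => 'a cop => nat => bool" where
"lbf_at V t n <-> beta_pow V t n < oo & closed (pran V t n)"

lemma INF_Least:
assumes "P n" shows "(INF n\<in>{n. P n}. enat n) = enat (LEAST n. P n)"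
proof (rule antisym)
show "(INF n\<in>{n. P n}. enat n) <= enat (LEAST n. P n)"
 using LeastI[of P, OF assms] by (intro INF_lower) simp
qed (auto intro!: INF_greatest Least_le)

lemma INF_finite: "(INF n\<in>{n. P n}. enat n) < oo <-> (EX n. P n)"
proof
assume "(INF n\<in>{n. P n}. enat n) < oo"
hence "{n. P n} ~= {}" by (metis image_empty Inf_empty top_enat_def less_irrefl)
thus "EX n. P n" by blast
qed (auto simp: INF_Least)

lemma zeroth: "pran V t 0 = V"
by (simp add: app_one)

lemma ubf_lbf_at_min:
"ubf_at V t n ==> min (alpha_pow V t n) (beta_pow V t n) < oo"
"lbf_at V t n ==> min (alpha_pow V t n) (beta_pow V t n) < oo"
unfolding ubf_at_def lbf_at_def min_less_iff_disj by blast+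

lemma fin_asc_iff_kernel:
assumes "csubspace V"
shows "fin_asc V t <-> (EX n. {x:V. app (t ^ n) x = 0} = {x:V. app (t ^ Suc n) x = 0})"
proof -
have "(ALL x:pran V t n. app t x = 0 --> x = 0) <-> {x:V. app (t ^ n) x = 0} = {x:V. app (t ^ Suc n) x = 0}" for n
 by (auto simp: app_mult)
thus ?thesis unfolding fin_asc_def by simp
qed

lemma ascent_finite_iff: "csubspace V ==> ascent V (app t) < oo <-> fin_asc V t"
unfolding ascent_def INF_finite fin_asc_iff_kernel app_power by simp

lemma descent_finite_iff: "descent V (app t) < oo <-> fin_desc V t"
unfolding descent_def INF_finite fin_desc_def app_power by (rule ex_cong1) (rule eq_commute)

lemma pow_range_add: "pran (pran V t m) t n = pran V t (n + m)"
by (simp add: app_mult_image[symmetric] power_add)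

context
fixes V :: "'a::complex_banach set" and t :: "'a cop"
assumes V: "csubspace V" and tV: "app t ` V <= V"
begin

lemma pow_range_facts:
"csubspace (pran V t n)" "app t ` pran V t n = pran V t (Suc n)"
"pran V t (Suc n) <= pran V t n" "pran V t n <= V"
"m <= n ==> pran V t n <= pran V t m"
proof -
show "csubspace (pran V t n)" by (rule csubspace_im[OF V])
show "app t ` pran V t n = pran V t (Suc n)" by (rule power_image_comm)
show "pran V t n <= V" by (rule power_image_subset[OF tV])
show "pran V t (Suc n) <= pran V t n" by (rule power_image_antimono[OF tV]) simp
show "pran V t n <= pran V t m" if "m <= n" using that by (rule power_image_antimono[OF tV])
qed

text \<open>By \<open>index_step\<close> kernel and cokernel shrink by the same dimension from one range to the next; so the
  index can be read off at any exponent from the degree \<open>m\<close> on.\<close>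

lemma index_tail:
assumes "min (alpha_pow V t m) (beta_pow V t m) < oo" "m <= n"
shows "EX e<oo. alpha_pow V t m = alpha_pow V t n + e &
 beta_pow V t m = beta_pow V t n + e"
using assms(2)
proof (induction rule: dec_induct)
case base
show ?case by (intro exI[of _ 0]) simp
next
case (step n)
then obtain e where e: "e < oo" "alpha_pow V t m = alpha_pow V t n + e"
 "beta_pow V t m = beta_pow V t n + e" by blast
note r = pow_range_facts
have "app t ` pran V t n <= pran V t n" using r(2,3) by simp
from index_step[OF clinear_app r(1) this] obtain d where d:
 "alpha_pow V t n = alpha_pow V t (Suc n) + d"
 "beta_pow V t n = beta_pow V t (Suc n) + d"
 "d <= alpha_pow V t n" "d <= beta_pow V t n" unfolding r(2) by blast
have "d <= alpha_pow V t m" "d <= beta_pow V t m"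
 unfolding e(2,3) using d(3,4) by (auto intro: add_increasing2)
hence "d < oo" using assms(1) by (intro finite_le[of d "min (alpha_pow V t m) (beta_pow V t m)"]) simp_all
hence "d + e < oo" using e(1) by (cases d; cases e) simp_all
thus ?case unfolding e(2,3) d(1,2) by (intro exI[of _ "d + e"]) (simp add: add.assoc)
qed

lemma alpha_decreasing: "m <= n ==> alpha_pow V t n <= alpha_pow V t m"
unfolding alpha_def using pow_range_facts(5)
by (intro edim_mono csubspace_kernel_on[OF clinear_app pow_range_facts(1)]) blast

lemma beta_decreasing: "m <= n ==> beta_pow V t n <= beta_pow V t m"
proof (induction rule: dec_induct)
case (step n)
note r = pow_range_facts
have "app t ` pran V t n <= pran V t n" using r(2,3) by simp
from index_step[OF clinear_app r(1) this] have
 "beta_pow V t (Suc n) <= beta_pow V t n" unfolding r(2) by (elim exE conjE) simp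
thus ?case using step.IH by (rule order_trans)
qed simp

lemma m_range_eq:
assumes "min (alpha_pow V t n) (beta_pow V t n) < oo"
obtains m where "m <= n" "m_deg V (app t) = enat m" "m_range V (app t) = pran V t m"
 "min (alpha_pow V t m) (beta_pow V t m) < oo"
proof -
let ?P = "%n. min (alpha_pow V t n) (beta_pow V t n) < oo"
have d: "m_deg V (app t) = enat (LEAST n. ?P n)"
 unfolding m_deg_def app_power[symmetric] by (rule INF_Least[of ?P, OF assms])
show thesis
 by (rule that[of "LEAST n. ?P n"])
  (use d Least_le[of ?P, OF assms] LeastI[of ?P, OF assms] in "simp_all only: m_range_def app_power the_enat.simps")
qed

lemma ind_sign:
assumes "min (alpha_pow V t n) (beta_pow V t n) < oo"
shows "ind V (app t) <= 0 <-> alpha_pow V t n <= beta_pow V t n"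
 "ind V (app t) >= 0 <-> beta_pow V t n <= alpha_pow V t n"
 "ind V (app t) = 0 <-> alpha_pow V t n = beta_pow V t n"
proof -
obtain m where m: "m <= n" "m_range V (app t) = pran V t m"
 "min (alpha_pow V t m) (beta_pow V t m) < oo"
 by (rule m_range_eq[OF assms]) (rule that)
obtain e where e: "e < oo" "alpha_pow V t m = alpha_pow V t n + e"
 "beta_pow V t m = beta_pow V t n + e"
 using index_tail[OF m(3,1)] by blast
define a b where "a = alpha_pow V t n" and "b = beta_pow V t n"
have i: "ind V (app t) = ereal_of_enat (a + e) - ereal_of_enat (b + e)"
 unfolding ind_def m(2) e(2,3) a_def b_def ..
have f: "min a b < oo" using assms unfolding a_def b_def .
obtain k where k: "e = enat k" using e(1) by (cases e) simp_all
show "ind V (app t) <= 0 <-> alpha_pow V t n <= beta_pow V t n"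
 "ind V (app t) >= 0 <-> beta_pow V t n <= alpha_pow V t n"
 "ind V (app t) = 0 <-> alpha_pow V t n = beta_pow V t n"
 unfolding i a_def[symmetric] b_def[symmetric] k using f by (cases a; cases b; simp)+
qed

lemma fin_asc_pow_range: "fin_asc (pran V t m) t <-> fin_asc V t"
proof
assume "fin_asc (pran V t m) t"
thus "fin_asc V t" unfolding fin_asc_def pow_range_add by blast
next
assume "fin_asc V t"
then obtain n where "ALL x:pran V t n. app t x = 0 --> x = 0" unfolding fin_asc_def by blast
hence "ALL x:pran V t (n + m). app t x = 0 --> x = 0" using pow_range_facts(5)[of n "n + m"] by auto
thus "fin_asc (pran V t m) t" unfolding fin_asc_def pow_range_add by blast
qed

lemma fin_desc_pow_range: "fin_desc (pran V t m) t <-> fin_desc V t"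
proof
assume "fin_desc (pran V t m) t"
thus "fin_desc V t" unfolding fin_desc_def pow_range_add add_Suc by blast
next
assume "fin_desc V t"
then obtain n where n: "pran V t (Suc n) = pran V t n" unfolding fin_desc_def by blast
have "pran V t (Suc (m + n)) = pran V t (m + n)"
 using n pow_range_add[of t m "Suc n" V] pow_range_add[of t m n V] by (metis add_Suc_right)
thus "fin_desc (pran V t m) t" unfolding fin_desc_def pow_range_add by (metis add.commute add_Suc_right)
qed

text \<open>The classical argument: once both chains are stationary, \<open>t\<close> is bijective on \<open>R(t^n)\<close>, and then neither chain
  can become stationary later than the other.\<close>

lemma ascent_eq_descent:
assumes a: "fin_asc V t" and d: "fin_desc V t"
shows "ascent V (app t) = descent V (app t)"
 and "EX n. alpha_pow V t n = 0 & beta_pow V t n = 0"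
proof -
note sV = V and r = pow_range_facts
let ?P = "%n. ALL x:pran V t n. app t x = 0 --> x = 0"
let ?S = "%n. pran V t (Suc n) = pran V t n"
obtain p where p: "?P p" using a unfolding fin_asc_def by blast
obtain q where q: "?S q" using d unfolding fin_desc_def by blast
have stable: "pran V t (j + k) = pran V t k" if "?S k" for j k
proof (induction j)
 case (Suc j)
 have "pran V t (Suc j + k) = app t ` pran V t (j + k)" by (simp only: add_Suc r(2))
 also have "... = pran V t k" by (simp only: Suc r(2) that)
 finally show ?case .
qed simp
have PS: "?S k" if k: "?P k" for k
proof (rule subset_antisym[OF r(3) subsetI])
 have pw: "x = 0" if "x : pran V t k" "app (t ^ j) x = 0" for x j
  using that
 proof (induction j arbitrary: x)
  case (Suc j)
  have "app t x : pran V t k" using Suc.prems(1) r(2,3)[of k] by blast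
  moreover have "app (t ^ j) (app t x) = 0" using Suc.prems(2) by (simp only: power_Suc2 app_mult)
  ultimately have "app t x = 0" by (rule Suc.IH)
  thus ?case using Suc.prems(1) k by blast
 qed (simp add: app_one)
 fix x assume x: "x : pran V t k"
 have "pran (pran V t k) t q = pran (pran V t (Suc k)) t q"
  using stable[OF q, of k] stable[OF q, of "Suc k"] by (simp only: pow_range_add add.commute[of q])
 hence "app (t ^ q) x : pran (pran V t (Suc k)) t q" using x by blast
 then obtain z where z: "z : pran V t (Suc k)" "app (t ^ q) x = app (t ^ q) z" by blast
 have "x - z : pran V t k" using x z(1) r(3)[of k] by (intro complex_vector.subspace_diff[OF r(1)]) blast+
 moreover have "app (t ^ q) (x - z) = 0" using z(2) by (simp only: app_diff) simp
 ultimately have "x - z = 0" by (rule pw)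
 thus "x : pran V t (Suc k)" using z(1) by simp
qed
have SP: "?P k" if k: "?S k" for k
 using stable[OF k, of p] r(5)[of p "p + k"] p by auto
have "ascent V (app t) = (INF n\<in>{n. ?P n}. enat n)"
proof -
 have "?P n <-> {x:V. app (t ^ n) x = 0} = {x:V. app (t ^ Suc n) x = 0}" for n
  by (auto simp: app_mult)
 thus ?thesis unfolding ascent_def app_power[symmetric] by simp
qed
moreover have "?P n <-> pran V t n = pran V t (Suc n)" for n
proof
 show "pran V t n = pran V t (Suc n)" if "?P n" by (rule PS[OF that, symmetric])
 show "?P n" if "pran V t n = pran V t (Suc n)" by (rule SP[OF that[symmetric]])
qed
ultimately show "ascent V (app t) = descent V (app t)" unfolding descent_def app_power[symmetric] by simp
have "{x : pran V t p. app t x = 0} = {0}" using p complex_vector.subspace_0[OF r(1)] by auto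
hence "alpha_pow V t p = 0" unfolding alpha_def by simp
moreover have "beta_pow V t p = 0" unfolding beta_def r(2) PS[OF p] by (rule ecodim_self[OF r(1)])
ultimately show "EX n. alpha_pow V t n = 0 & beta_pow V t n = 0" by blast
qed

end

context
fixes V :: "'a::complex_banach set" and t :: "'a cop"
assumes V: "ccsubspace V" and tV: "app t ` V <= V"
begin

text \<open>The preimage of the closed \<open>R(t^(n + 1))\<close> is \<open>R(t^n) + N(t)\<close>. As \<open>R(t^n) \<inter> N(t)\<close> has finite
  dimension, \<open>N(t)\<close> can be replaced by a closed subspace that meets \<open>R(t^n)\<close> trivially; an operator range with a
  closed supplement is closed.\<close>

lemma ubf_at_closedI: "alpha_pow V t n < oo ==> closed (pran V t (Suc n)) ==> ubf_at V t n"
unfolding ubf_at_def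
proof (intro conjI)
assume a: "alpha_pow V t n < oo" and cl: "closed (pran V t (Suc n))"
let ?W = "{x : V. app t x : pran V t (Suc n)}" and ?N = "ker V t"
note r = pow_range_facts[OF ccsubspaceD(1)[OF V] tV]
have W: "ccsubspace ?W"
 using cl r(1)[of "Suc n"] by (intro ccsubspace_vimage_on V) (simp add: ccsubspace_def)
have N: "ccsubspace ?N" by (rule ccsubspace_kernel[OF V])
let ?Z = "{x : pran V t n. app t x = 0}"
have Z: "csubspace ?Z" by (rule csubspace_kernel_on[OF clinear_app r(1)])
have ZN: "?Z <= ?N" using r(4)[of n] by blast
obtain G where G: "closed G" "direct_sum ?Z G ?N"
 by (rule closed_complement[OF ccsubspaceD[OF N] Z _ ZN]) (use a in "simp add: alpha_def", rule that)
note G' = direct_sumD[OF G(2)]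
have sum: "pran V t n + G = ?W"
proof (rule subset_antisym)
 show "pran V t n + G <= ?W"
 proof (rule plus_least[OF ccsubspaceD(1)[OF W]])
  show "pran V t n <= ?W" using r(2)[of n] r(4)[of n] by blast
  show "G <= ?W" using G'(5) complex_vector.subspace_0[OF r(1)[of "Suc n"]] by auto
 qed
 show "?W <= pran V t n + G"
 proof
  fix x assume x: "x : ?W"
  then obtain y where y: "y : pran V t n" "app t x = app t y" using r(2)[of n] by blast
  have "x - y : ?N" using x y r(4)[of n] complex_vector.subspace_diff[OF ccsubspaceD(1)[OF V]] by (auto simp: app_diff)
  then obtain z g where zg: "z : ?Z" "g : G" "x - y = z + g" using G'(6) by (metis (no_types, lifting) set_plus_elim)
  have "x = (y + z) + g" using zg(3) by (simp add: algebra_simps)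
  moreover have "y + z : pran V t n" using y(1) zg(1) complex_vector.subspace_add[OF r(1)] by blast
  ultimately show "x : pran V t n + G" using zg(2) by (auto intro: set_plus_intro)
 qed
qed
show "closed (pran V t n)"
proof (rule range_closed[OF bounded_linear_app ccsubspaceD[OF V] G'(2) G(1)])
 show "closed (pran V t n + G)" unfolding sum by (rule ccsubspaceD(2)[OF W])
 fix x assume x: "x : pran V t n" "x : G"
 hence "x : ?Z" using G'(5) by blast
 thus "x = 0" using direct_sum_Int[OF G(2)] x(2) by blast
qed
qed

lemma ubf_at_mono: assumes "ubf_at V t m" "m <= n" shows "ubf_at V t n"
using assms(2)
proof (induction rule: dec_induct)
case base
show ?case by (rule assms(1))
next
case (step n)
note r = pow_range_facts[OF ccsubspaceD(1)[OF V] tV] and a = step.IH[unfolded ubf_at_def]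
have c: "ccsubspace (pran V t k)" if "k = n | k = Suc n" for k
 using a r(1) that unfolding ccsubspace_def by blast
have "EX c>0. below_on (pran V t n) t c" using a unfolding below_on_iff[OF c[OF disjI1[OF refl]]] r(2) by blast
hence "EX c>0. below_on (pran V t (Suc n)) t c"
 using below_on_subset[OF _ r(1) c[OF disjI2[OF refl]] r(3)] by blast
thus ?case using a c[of "Suc n"] unfolding ubf_at_def below_on_iff[OF c[OF disjI2[OF refl]]] r(2) by simp
qed

lemma lbf_at_mono: assumes "lbf_at V t m" "m <= n" shows "lbf_at V t n"
using assms(2)
proof (induction rule: dec_induct)
case base
show ?case by (rule assms(1))
next
case (step n)
note r = pow_range_facts[OF ccsubspaceD(1)[OF V] tV] and a = step.IH[unfolded lbf_at_def]
have "closed (app t ` pran V t n)"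
 using a r(1,2,3) unfolding beta_def
 by (intro finite_codim_range_closed[OF bounded_linear_app clinear_app r(1) _ r(1)[of n]]) simp_all
moreover have "beta_pow V t (Suc n) < oo"
 by (rule finite_le[OF beta_decreasing[OF ccsubspaceD(1)[OF V] tV le_SucI[OF order_refl]] conjunct1[OF a]])
ultimately show ?case unfolding lbf_at_def r(2) by simp
qed

lemma ubf_at_least:
assumes "ubf_at V t n" "alpha_pow V t m < oo" shows "ubf_at V t m"
proof (cases "n <= m")
case True
thus ?thesis by (rule ubf_at_mono[OF assms(1)])
next
case False
hence "m <= n" by simp
thus ?thesis using assms(1)
proof (induction rule: inc_induct)
 case (step k)
 hence "closed (pran V t (Suc k))" by (simp add: ubf_at_def)
 moreover have "alpha_pow V t k < oo" by (rule finite_le[OF alpha_decreasing[OF ccsubspaceD(1)[OF V] tV step.hyps(1)] assms(2)])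
 ultimately show ?case by (intro ubf_at_closedI)
qed
qed

lemma lbf_at_least:
assumes "lbf_at V t n" "beta_pow V t m < oo" shows "lbf_at V t m"
proof (cases "n <= m")
case True
thus ?thesis by (rule lbf_at_mono[OF assms(1)])
next
case False
hence "m <= n" by simp
thus ?thesis using assms(1)
proof (induction rule: inc_induct)
 case (step k)
 note r = pow_range_facts[OF ccsubspaceD(1)[OF V] tV]
 have b: "beta_pow V t k < oo" by (rule finite_le[OF beta_decreasing[OF ccsubspaceD(1)[OF V] tV step.hyps(1)] assms(2)])
 then obtain G where G: "direct_sum (pran V t (Suc k)) G (pran V t k)" "edim G < oo"
  unfolding beta_def r(2) by (rule ecodim_finite_supplement[OF r(1) r(1) r(3)]) (rule that)
 have "closed (pran V t (Suc k) + G)"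
  using step.IH step.prems r(1) G(2) unfolding lbf_at_def by (intro closed_plus_findim) blast+
 thus ?case using b unfolding lbf_at_def direct_sumD(6)[OF G(1)] by blast
qed
qed

lemma upper_semi_B_Fredholm_iff: "upper_semi_B_Fredholm V (app t) <-> (EX n. ubf_at V t n)"
proof -
let ?P = "%n. alpha_pow V t n < oo"
have p: "p_e V (app t) = (INF n\<in>{n. ?P n}. enat n)" unfolding p_e_def app_power ..
show ?thesis
proof
 assume a: "upper_semi_B_Fredholm V (app t)"
 then obtain n where n: "?P n" unfolding upper_semi_B_Fredholm_def p INF_finite by blast
 have "closed (pran V t (Suc (LEAST n. ?P n)))"
  using a unfolding upper_semi_B_Fredholm_def p INF_Least[of ?P, OF n] by (simp only: app_power[symmetric] the_enat.simps Suc_eq_plus1)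
 hence "ubf_at V t (LEAST n. ?P n)" using LeastI[of ?P, OF n] by (intro ubf_at_closedI)
 thus "EX n. ubf_at V t n" ..
next
 assume "EX n. ubf_at V t n"
 then obtain n where n: "ubf_at V t n" ..
 hence Pn: "?P n" unfolding ubf_at_def by blast
 have "ubf_at V t (LEAST n. ?P n)" by (rule ubf_at_least[OF n LeastI[of ?P, OF Pn]])
 thus "upper_semi_B_Fredholm V (app t)"
  unfolding upper_semi_B_Fredholm_def p INF_Least[of ?P, OF Pn] ubf_at_def
  by (simp only: app_power[symmetric] the_enat.simps Suc_eq_plus1 enat_ord_simps simp_thms enat.distinct)
qed
qed

lemma lower_semi_B_Fredholm_iff: "lower_semi_B_Fredholm V (app t) <-> (EX n. lbf_at V t n)"
proof -
let ?P = "%n. beta_pow V t n < oo"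
have p: "q_e V (app t) = (INF n\<in>{n. ?P n}. enat n)" unfolding q_e_def app_power ..
show ?thesis
proof
 assume a: "lower_semi_B_Fredholm V (app t)"
 then obtain n where n: "?P n" unfolding lower_semi_B_Fredholm_def p INF_finite by blast
 have "closed (pran V t (LEAST n. ?P n))"
  using a unfolding lower_semi_B_Fredholm_def p INF_Least[of ?P, OF n] by (simp only: app_power[symmetric] the_enat.simps Suc_eq_plus1)
 hence "lbf_at V t (LEAST n. ?P n)" using LeastI[of ?P, OF n] unfolding lbf_at_def by blast
 thus "EX n. lbf_at V t n" ..
next
 assume "EX n. lbf_at V t n"
 then obtain n where n: "lbf_at V t n" ..
 hence Pn: "?P n" unfolding lbf_at_def by blast
 have "lbf_at V t (LEAST n. ?P n)" by (rule lbf_at_least[OF n LeastI[of ?P, OF Pn]])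
 thus "lower_semi_B_Fredholm V (app t)"
  unfolding lower_semi_B_Fredholm_def p INF_Least[of ?P, OF Pn] lbf_at_def by (simp add: app_power)
qed
qed

lemma upper_semi_B_Weyl_iff: "upper_semi_B_Weyl V (app t) <->
 (EX n. ubf_at V t n & alpha_pow V t n <= beta_pow V t n)"
proof -
have "ind V (app t) <= 0 <-> alpha_pow V t n <= beta_pow V t n" if "ubf_at V t n" for n
 by (rule ind_sign(1)[OF ccsubspaceD(1)[OF V] tV]) (rule ubf_lbf_at_min(1)[OF that])
thus ?thesis unfolding upper_semi_B_Weyl_def upper_semi_B_Fredholm_iff by blast
qed

lemma lower_semi_B_Weyl_iff: "lower_semi_B_Weyl V (app t) <->
 (EX n. lbf_at V t n & beta_pow V t n <= alpha_pow V t n)"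
proof -
have "ind V (app t) >= 0 <-> beta_pow V t n <= alpha_pow V t n" if "lbf_at V t n" for n
 by (rule ind_sign(2)[OF ccsubspaceD(1)[OF V] tV]) (rule ubf_lbf_at_min(2)[OF that])
thus ?thesis unfolding lower_semi_B_Weyl_def lower_semi_B_Fredholm_iff by blast
qed

lemma B_Fredholm_iff: "B_Fredholm V (app t) <-> (EX n. ubf_at V t n & lbf_at V t n)"
proof -
have "EX n. ubf_at V t n & lbf_at V t n" if "ubf_at V t m" "lbf_at V t k" for m k
 using ubf_at_mono[OF that(1), of "max m k"] lbf_at_mono[OF that(2), of "max m k"] by auto
thus ?thesis unfolding B_Fredholm_def upper_semi_B_Fredholm_iff lower_semi_B_Fredholm_iff by blast
qed

lemma B_Weyl_iff: "B_Weyl V (app t) <->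
 (EX n. ubf_at V t n & lbf_at V t n & alpha_pow V t n = beta_pow V t n)"
proof -
have "ind V (app t) = 0 <-> alpha_pow V t n = beta_pow V t n" if "ubf_at V t n" for n
 by (rule ind_sign(3)[OF ccsubspaceD(1)[OF V] tV]) (rule ubf_lbf_at_min(1)[OF that])
thus ?thesis unfolding B_Weyl_def B_Fredholm_iff by blast
qed

lemma left_Drazin_iff: "left_Drazin V (app t) <-> (EX n. ubf_at V t n) & fin_asc V t"
proof -
have "ascent (m_range V (app t)) (app t) < oo <-> fin_asc V t" if u: "ubf_at V t n" for n
proof -
 obtain m where "m_range V (app t) = pran V t m"
  by (rule m_range_eq[OF ccsubspaceD(1)[OF V] tV, of n]) (rule ubf_lbf_at_min(1)[OF u], rule that)
 thus ?thesis using ascent_finite_iff[OF pow_range_facts(1)[OF ccsubspaceD(1)[OF V] tV]] fin_asc_pow_range[OF ccsubspaceD(1)[OF V] tV] by simp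
qed
thus ?thesis unfolding left_Drazin_def upper_semi_B_Fredholm_iff by blast
qed

lemma right_Drazin_iff: "right_Drazin V (app t) <-> (EX n. lbf_at V t n) & fin_desc V t"
proof -
have "descent (m_range V (app t)) (app t) < oo <-> fin_desc V t" if u: "lbf_at V t n" for n
proof -
 obtain m where "m_range V (app t) = pran V t m"
  by (rule m_range_eq[OF ccsubspaceD(1)[OF V] tV, of n]) (rule ubf_lbf_at_min(2)[OF u], rule that)
 thus ?thesis by (simp only: descent_finite_iff fin_desc_pow_range[OF ccsubspaceD(1)[OF V] tV])
qed
thus ?thesis unfolding right_Drazin_def lower_semi_B_Fredholm_iff by blast
qed

end

lemma Drazin_iff:
assumes V: "ccsubspace V" and tV: "app t ` V <= V"
shows "Drazin V (app t) <-> fin_asc V t & fin_desc V t"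
proof
note sV = ccsubspaceD(1)[OF V]
assume D: "Drazin V (app t)"
hence "m_deg V (app t) < oo" unfolding Drazin_def by blast
then obtain n where "min (alpha_pow V t n) (beta_pow V t n) < oo"
 unfolding m_deg_def INF_finite app_power[symmetric] by blast
then obtain m where "m_range V (app t) = pran V t m" by (rule m_range_eq[OF sV tV]) (rule that)
hence "ascent (pran V t m) (app t) < oo" "descent (pran V t m) (app t) < oo"
 using D unfolding Drazin_def by metis+
thus "fin_asc V t & fin_desc V t"
 by (simp only: ascent_finite_iff[OF pow_range_facts(1)[OF sV tV]] descent_finite_iff
  fin_asc_pow_range[OF sV tV] fin_desc_pow_range[OF sV tV])
next
note sV = ccsubspaceD(1)[OF V]
assume ad: "fin_asc V t & fin_desc V t"
obtain n where n: "alpha_pow V t n = 0" using ascent_eq_descent(2)[OF sV tV] ad by blast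
have "min (alpha_pow V t n) (beta_pow V t n) < oo" unfolding n by simp
then obtain m where m: "m_deg V (app t) = enat m" "m_range V (app t) = pran V t m"
 by (rule m_range_eq[OF sV tV]) (rule that)
note r = pow_range_facts[OF sV tV]
have "app t ` pran V t m <= pran V t m" using r(2,3) by simp
from ascent_eq_descent(1)[OF r(1) this]
have "ascent (pran V t m) (app t) = descent (pran V t m) (app t)"
 using ad by (simp only: fin_asc_pow_range[OF sV tV] fin_desc_pow_range[OF sV tV])
moreover have "descent (pran V t m) (app t) < oo"
 using ad by (simp only: descent_finite_iff fin_desc_pow_range[OF sV tV])
ultimately show "Drazin V (app t)" unfolding Drazin_def m by simp
qed

section \<open>The nine classes of Fredholm type\<close>

context
fixes V :: "'a::complex_banach set" and t :: "'a cop"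
assumes V: "ccsubspace V" and tV: "app t ` V <= V"
begin

lemma m_deg_0_iff: "m_deg V (app t) = 0 <-> min (alpha V (app t)) (beta V (app t)) < oo"
proof
let ?P = "%n. min (alpha_pow V t n) (beta_pow V t n) < oo"
have m: "m_deg V (app t) = (INF n\<in>{n. ?P n}. enat n)" unfolding m_deg_def app_power ..
{
 assume z: "m_deg V (app t) = 0"
 hence "(INF n\<in>{n. ?P n}. enat n) < oo" unfolding m by simp
 then obtain n where n: "?P n" unfolding INF_finite ..
 have "(LEAST n. ?P n) = 0" using z unfolding m INF_Least[of ?P, OF n] zero_enat_def by (simp only: enat.inject)
 thus "min (alpha V (app t)) (beta V (app t)) < oo" using LeastI[of ?P, OF n] by (simp only: zeroth)
next
 assume "min (alpha V (app t)) (beta V (app t)) < oo"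
 hence P0: "?P 0" by (simp only: zeroth)
 show "m_deg V (app t) = 0"
  unfolding m INF_Least[of ?P, OF P0] zero_enat_def enat.inject by (rule Least_eq_0[of ?P, OF P0])
}
qed

lemma ubf_at_0_iff: "ubf_at V t 0 <-> (EX n. ubf_at V t n) & m_deg V (app t) = 0"
proof
assume u: "ubf_at V t 0"
thus "(EX n. ubf_at V t n) & m_deg V (app t) = 0"
 using ubf_lbf_at_min(1)[OF u] unfolding zeroth m_deg_0_iff by blast
next
assume a: "(EX n. ubf_at V t n) & m_deg V (app t) = 0"
then obtain n where n: "ubf_at V t n" by blast
have "min (alpha_pow V t 0) (beta_pow V t 0) < oo"
 using a unfolding zeroth m_deg_0_iff by blast
then obtain e where e: "e < oo" "alpha_pow V t 0 = alpha_pow V t n + e"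
 using index_tail[OF ccsubspaceD(1)[OF V] tV _ le0[of n]] by blast
have "alpha_pow V t 0 < oo"
 using e n unfolding ubf_at_def by (auto simp del: power_0)
thus "ubf_at V t 0" by (rule ubf_at_least[OF V tV n])
qed

lemma lbf_at_0_iff: "lbf_at V t 0 <-> (EX n. lbf_at V t n) & m_deg V (app t) = 0"
proof
assume u: "lbf_at V t 0"
thus "(EX n. lbf_at V t n) & m_deg V (app t) = 0"
 using ubf_lbf_at_min(2)[OF u] unfolding zeroth m_deg_0_iff by blast
next
assume a: "(EX n. lbf_at V t n) & m_deg V (app t) = 0"
then obtain n where n: "lbf_at V t n" by blast
have "min (alpha_pow V t 0) (beta_pow V t 0) < oo"
 using a unfolding zeroth m_deg_0_iff by blast
then obtain e where e: "e < oo" "beta_pow V t 0 = beta_pow V t n + e"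
 using index_tail[OF ccsubspaceD(1)[OF V] tV _ le0[of n]] by blast
have "beta_pow V t 0 < oo"
 using e n unfolding lbf_at_def by (auto simp del: power_0)
thus "lbf_at V t 0" by (rule lbf_at_least[OF V tV n])
qed

lemma ubf_lbf_at_0: "ubf_at V t 0 & lbf_at V t 0 <-> fredholm_on V t"
proof
assume "ubf_at V t 0 & lbf_at V t 0"
thus "fredholm_on V t" unfolding ubf_at_def lbf_at_def fredholm_on_def zeroth by blast
next
assume f: "fredholm_on V t"
note V' = ccsubspaceD[OF V]
have "closed (app t ` V)"
 using f unfolding fredholm_on_def beta_def
 by (intro finite_codim_range_closed[OF bounded_linear_app clinear_app V' V' tV]) blast
hence "closed (pran V t (Suc 0))" by simp
thus "ubf_at V t 0 & lbf_at V t 0"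
 using f V'(2) unfolding ubf_at_def lbf_at_def fredholm_on_def zeroth by blast
qed

lemma semi_Fredholm_iff:
"upper_semi_Fredholm V (app t) <-> ubf_at V t 0"
"lower_semi_Fredholm V (app t) <-> lbf_at V t 0"
"Fredholm V (app t) <-> fredholm_on V t"
unfolding upper_semi_Fredholm_def lower_semi_Fredholm_def Fredholm_def B_Fredholm_def ubf_lbf_at_0[symmetric]
 upper_semi_B_Fredholm_iff[OF V tV] lower_semi_B_Fredholm_iff[OF V tV] ubf_at_0_iff lbf_at_0_iff
by blast+

lemma semi_Weyl_iff:
"upper_semi_Weyl V (app t) <-> ubf_at V t 0 & alpha V (app t) <= beta V (app t)"
"lower_semi_Weyl V (app t) <-> lbf_at V t 0 & beta V (app t) <= alpha V (app t)"
"Weyl V (app t) <-> fredholm_on V t & alpha V (app t) = beta V (app t)"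
proof -
have i: "ind V (app t) <= 0 <-> alpha V (app t) <= beta V (app t)"
 "ind V (app t) >= 0 <-> beta V (app t) <= alpha V (app t)"
 "ind V (app t) = 0 <-> alpha V (app t) = beta V (app t)" if "m_deg V (app t) = 0"
 using ind_sign[OF ccsubspaceD(1)[OF V] tV, of 0] that unfolding m_deg_0_iff zeroth by blast+
show "upper_semi_Weyl V (app t) <-> ubf_at V t 0 & alpha V (app t) <= beta V (app t)"
 unfolding upper_semi_Weyl_def upper_semi_B_Weyl_def upper_semi_B_Fredholm_iff[OF V tV] ubf_at_0_iff
 using i(1) by blast
show "lower_semi_Weyl V (app t) <-> lbf_at V t 0 & beta V (app t) <= alpha V (app t)"
 unfolding lower_semi_Weyl_def lower_semi_B_Weyl_def lower_semi_B_Fredholm_iff[OF V tV] lbf_at_0_iff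
 using i(2) by blast
show "Weyl V (app t) <-> fredholm_on V t & alpha V (app t) = beta V (app t)"
 unfolding Weyl_def B_Weyl_def semi_Fredholm_iff(3)[symmetric] Fredholm_def using i(3) by blast
qed

lemma semi_Browder_iff:
"upper_semi_Browder V (app t) <-> ubf_at V t 0 & fin_asc V t"
"lower_semi_Browder V (app t) <-> lbf_at V t 0 & fin_desc V t"
"Browder V (app t) <-> fredholm_on V t & fin_asc V t & fin_desc V t"
proof -
show "upper_semi_Browder V (app t) <-> ubf_at V t 0 & fin_asc V t"
 unfolding upper_semi_Browder_def left_Drazin_iff[OF V tV] ubf_at_0_iff by blast
show "lower_semi_Browder V (app t) <-> lbf_at V t 0 & fin_desc V t"
 unfolding lower_semi_Browder_def right_Drazin_iff[OF V tV] lbf_at_0_iff by blast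
have "fredholm_on V t <-> m_deg V (app t) = 0" if ad: "fin_asc V t" "fin_desc V t"
proof -
 obtain n where n: "alpha_pow V t n = 0" "beta_pow V t n = 0"
  using ascent_eq_descent(2)[OF ccsubspaceD(1)[OF V] tV ad] by blast
 show ?thesis
  using index_tail[OF ccsubspaceD(1)[OF V] tV _ le0[of n]]
  unfolding m_deg_0_iff fredholm_on_def zeroth n by (auto simp: min_less_iff_disj)
qed
thus "Browder V (app t) <-> fredholm_on V t & fin_asc V t & fin_desc V t"
 unfolding Browder_def Drazin_iff[OF V tV] by blast
qed

end

lemma ubf_at_0_UNIV: "ubf_at UNIV t 0 <-> (EX c>0. below_on UNIV t c)"
unfolding below_on_iff[OF ccsubspace_UNIV] ubf_at_def by (simp add: app_one)

lemma lbf_at_0_UNIV: "lbf_at UNIV t 0 <-> beta UNIV (app t) < oo"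
unfolding lbf_at_def by (simp add: app_one)

lemmas Fredholm_UNIV_iffs =
semi_Fredholm_iff[OF ccsubspace_UNIV subset_UNIV, unfolded ubf_at_0_UNIV lbf_at_0_UNIV]
semi_Weyl_iff[OF ccsubspace_UNIV subset_UNIV, unfolded ubf_at_0_UNIV lbf_at_0_UNIV]
semi_Browder_iff[OF ccsubspace_UNIV subset_UNIV, unfolded ubf_at_0_UNIV lbf_at_0_UNIV]

text \<open>One set, because at zero it only matters that all these classes lie between Browder and semi-Fredholm.\<close>

definition fredholm_classes :: "(('a::complex_banach => 'a) => bool) set" where
"fredholm_classes = {Fredholm UNIV, upper_semi_Fredholm UNIV, lower_semi_Fredholm UNIV,
  Weyl UNIV, upper_semi_Weyl UNIV, lower_semi_Weyl UNIV,
  Browder UNIV, upper_semi_Browder UNIV, lower_semi_Browder UNIV}"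

lemma fredholm_classes_between:
fixes t :: "'a::complex_banach cop"
assumes "K : fredholm_classes"
shows "K (app t) ==> ubf_at UNIV t 0 | lbf_at UNIV t 0" "browder t ==> K (app t)"
proof -
have eq: "alpha UNIV (app t) = beta UNIV (app t)" if "browder t"
proof -
 have b: "fredholm_on UNIV t" "fin_asc UNIV t" "fin_desc UNIV t" using that unfolding browder_def by blast+
 obtain n where n: "alpha_pow UNIV t n = 0" "beta_pow UNIV t n = 0"
  using ascent_eq_descent(2)[OF csubspace_UNIV subset_UNIV b(2,3)] by blast
 show ?thesis
  using index_tail[OF csubspace_UNIV subset_UNIV _ le0[of n], of t] b(1)
  unfolding fredholm_on_def zeroth n by (auto simp: min_less_iff_disj)
qed
show "K (app t) ==> ubf_at UNIV t 0 | lbf_at UNIV t 0" "browder t ==> K (app t)"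
 using assms eq unfolding fredholm_classes_def browder_def ubf_at_0_UNIV lbf_at_0_UNIV
 by (auto simp only: insert_iff empty_iff Fredholm_UNIV_iffs fredholm_UNIV_iff order_refl)
qed

text \<open>For the semi-Weyl classes the index matters only if the dimension that may be infinite is finite for
  \<open>T + R - l\<close>; then both operators are Fredholm, by symmetry, and have the same index.\<close>

lemma fredholm_classes_semi_comm_riesz:
fixes T R :: "'a::complex_banach cop"
assumes K: "K : fredholm_classes" and sc: "semi_comm T R" and R: "riesz R" and l: "l ~= 0"
 and KT: "K (app (T -. l))"
shows "K (app (T + R -. l))"
proof -
let ?A = "T -. l" and ?S = "T + R -. l"
have u: "EX c>0. below_on UNIV ?S c" if "EX c>0. below_on UNIV ?A c"
 using that upper_semi_comm_riesz[OF sc R l] by (elim exE conjE)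
have d: "beta UNIV (app ?S) < oo" if "beta UNIV (app ?A) < oo"
 by (rule lower_semi_comm_riesz[OF sc R l that])
have fr: "fredholm_on UNIV ?S" if "fredholm_on UNIV ?A"
 by (rule fredholm_semi_comm_riesz(1)[OF sc R l that])
have fr': "fredholm_on UNIV ?A" if "fredholm_on UNIV ?S"
proof -
 have "fredholm_on UNIV ((T + R) + (- R) -. l)"
  by (rule fredholm_semi_comm_riesz(1)[OF semi_comm_add[OF sc] riesz_minus[OF R] l that])
 thus ?thesis by simp
qed
have ie: "alpha UNIV (app ?A) <= beta UNIV (app ?A) <-> alpha UNIV (app ?S) <= beta UNIV (app ?S)"
 "beta UNIV (app ?A) <= alpha UNIV (app ?A) <-> beta UNIV (app ?S) <= alpha UNIV (app ?S)"
 if f: "fredholm_on UNIV ?A"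
 using fredholm_semi_comm_riesz(2)[OF sc R l f] f fr[OF f] unfolding fredholm_on_def
 by (cases "alpha UNIV (app ?A)"; cases "beta UNIV (app ?A)"; cases "alpha UNIV (app ?S)"; cases "beta UNIV (app ?S)"; force)+
have w: "fredholm_on UNIV ?S & alpha UNIV (app ?S) = beta UNIV (app ?S)"
 if "fredholm_on UNIV ?A & alpha UNIV (app ?A) = beta UNIV (app ?A)"
 using that ie fr by (metis order_eq_iff)
have uw: "(EX c>0. below_on UNIV ?S c) & alpha UNIV (app ?S) <= beta UNIV (app ?S)"
 if a: "(EX c>0. below_on UNIV ?A c) & alpha UNIV (app ?A) <= beta UNIV (app ?A)"
proof (cases "beta UNIV (app ?S) < oo")
 case True
 hence "fredholm_on UNIV ?S" using u[OF conjunct1[OF a]] unfolding fredholm_UNIV_iff by blast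
 thus ?thesis using ie(1)[OF fr'] a u by blast
next
 case False
 hence "beta UNIV (app ?S) = oo" by simp
 thus ?thesis using u[OF conjunct1[OF a]] by simp
qed
have lw: "beta UNIV (app ?S) < oo & beta UNIV (app ?S) <= alpha UNIV (app ?S)"
 if a: "beta UNIV (app ?A) < oo & beta UNIV (app ?A) <= alpha UNIV (app ?A)"
proof (cases "alpha UNIV (app ?S) < oo")
 case True
 hence "fredholm_on UNIV ?S" using d[OF conjunct1[OF a]] unfolding fredholm_on_def by blast
 thus ?thesis using ie(2)[OF fr'] a d by blast
next
 case False
 hence "alpha UNIV (app ?S) = oo" by simp
 thus ?thesis using d[OF conjunct1[OF a]] by simp
qed
have b: "browder ?S" if "browder ?A" by (rule browder_semi_comm_riesz[OF sc R l that])
have ub: "(EX c>0. below_on UNIV ?S c) & fin_asc UNIV ?S" if "(EX c>0. below_on UNIV ?A c) & fin_asc UNIV ?A"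
 using that u fin_asc_semi_comm_riesz[OF sc R l] by blast
have lb: "beta UNIV (app ?S) < oo & fin_desc UNIV ?S" if "beta UNIV (app ?A) < oo & fin_desc UNIV ?A"
 using that d fin_desc_semi_comm_riesz[OF sc R l] by blast
note iff = Fredholm_UNIV_iffs
note cases = iff(1)[THEN iffD2, OF u[OF iff(1)[THEN iffD1]]] iff(2)[THEN iffD2, OF d[OF iff(2)[THEN iffD1]]]
 iff(3)[THEN iffD2, OF fr[OF iff(3)[THEN iffD1]]] iff(4)[THEN iffD2, OF uw[OF iff(4)[THEN iffD1]]]
 iff(5)[THEN iffD2, OF lw[OF iff(5)[THEN iffD1]]] iff(6)[THEN iffD2, OF w[OF iff(6)[THEN iffD1]]]
 iff(7)[THEN iffD2, OF ub[OF iff(7)[THEN iffD1]]] iff(8)[THEN iffD2, OF lb[OF iff(8)[THEN iffD1]]]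
 iff(9)[folded browder_def, THEN iffD2, OF b[OF iff(9)[folded browder_def, THEN iffD1]]]
show ?thesis using K KT unfolding fredholm_classes_def
 by (elim insertE emptyE; hypsubst) (erule cases)+
qed

section \<open>Quasi-nilpotent perturbations\<close>

definition quasinil :: "'a::complex_banach cop => bool" where
"quasinil R <-> (ALL z. z ~= 0 --> inv_op (R -. z))"

lemma quasinil_riesz: "quasinil R ==> riesz R"
unfolding quasinil_def riesz_def using invertible_browder browder_def by blast

lemma quasinil_minus: "quasinil R ==> quasinil (- R)"
unfolding quasinil_def
proof (intro allI impI)
fix z :: complex assume R: "ALL z. z ~= 0 --> inv_op (R -. z)" and z: "z ~= 0"
have "inv_op (R -. (- z))" by (rule R[rule_format]) (use z in simp)
hence "inv_op ((- 1) *: (R -. (- z)))" by (subst inv_op_scaleC) simp_all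
thus "inv_op (- R -. z)" by simp
qed

lemma below_kernel_mod_findim:
fixes t :: "'a::complex_banach cop"
shows "(EX c>0. ALL x. c * norm x <= norm (app t x)) <-> (EX c>0. below_on UNIV t c) & (ALL x. app t x = 0 --> x = 0)"
proof
assume "EX c>0. ALL x. c * norm x <= norm (app t x)"
then obtain c where c: "c > 0" "!!x. c * norm x <= norm (app t x)" by blast
have "below_on UNIV t c" using c by (intro below_onI[OF ccsubspace_UNIV]) (auto simp: csubspace_UNIV)
moreover have "x = 0" if "app t x = 0" for x using c(2)[of x] c(1) that by (simp add: mult_le_0_iff)
ultimately show "(EX c>0. below_on UNIV t c) & (ALL x. app t x = 0 --> x = 0)" using c(1) by blast
next
assume a: "(EX c>0. below_on UNIV t c) & (ALL x. app t x = 0 --> x = 0)"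
hence cl: "closed (rg t)" using below_on_iff[OF ccsubspace_UNIV] by blast
obtain c where "c > 0" "!!x. x : UNIV ==> c * norm x <= norm (app t x)"
 by (rule below_of_inj_closed[OF ccsubspace_UNIV cl]) (use a in blast, rule that)
thus "EX c>0. ALL x. c * norm x <= norm (app t x)" by blast
qed

text \<open>Beyond the semi-Fredholm property only injectivity has to be seen. It holds for \<open>A^n - (- R)^n\<close>,
  since the powers of \<open>R\<close> are smaller than the lower bounds \<open>c^n\<close> of \<open>A^n\<close>, and is inherited by a right factor.\<close>

lemma bounded_below_semi_comm:
fixes T R :: "'a::complex_banach cop"
assumes sc: "semi_comm T R" and R: "quasinil R" and l: "l ~= 0"
 and b: "EX c>0. ALL x. c * norm x <= norm (app (T -. l) x)"
shows "EX c>0. ALL x. c * norm x <= norm (app (T + R -. l) x)"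
unfolding below_kernel_mod_findim
proof (intro conjI allI impI)
interpret nonzero_shifted T R l by standard (rule l)
obtain c where c: "c > 0" "!!x. c * norm x <= norm (app A x)" using b by blast
have "EX c>0. below_on UNIV A c" using b below_kernel_mod_findim by blast
thus "EX c>0. below_on UNIV (T + R -. l) c"
 using upper_semi_comm_riesz[OF sc quasinil_riesz[OF R] l] by (elim exE conjE)
obtain n where n: "norm ((- R) ^ n) <= c ^ n / 2" "n >= 1"
 using spectral_radius[OF c(1), of "- R"] quasinil_minus[OF R] c(1) unfolding quasinil_def
 by (metis norm_zero not_le)
have An: "c ^ k * norm x <= norm (app (A ^ k) x)" for k x
proof (induction k arbitrary: x)
 case (Suc k)
 have "c ^ Suc k * norm x = c ^ k * (c * norm x)" by simp
 also have "... <= c ^ k * norm (app A x)" using c by (intro mult_left_mono) auto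
 also have "... <= norm (app (A ^ Suc k) x)" using Suc[of "app A x"] by (simp only: power_Suc2 app_mult)
 finally show ?case .
qed (simp add: app_one)
have B0: "x = 0" if "app (B n) x = 0" for x
proof -
 have "app (A ^ n) x = app ((- R) ^ n) x" using that by (simp add: app_simps1(3))
 hence "c ^ n * norm x <= norm (app ((- R) ^ n) x)" using An[of n x] by simp
 also have "... <= c ^ n / 2 * norm x" by (rule order_trans[OF norm_app mult_right_mono[OF n(1)]]) simp
 finally have "c ^ n * norm x <= 0" by (simp add: mult.commute)
 thus ?thesis using zero_less_power[OF c(1), of n] by (auto simp: mult_le_0_iff)
qed
fix x assume "app (T + R -. l) x = 0"
moreover have "T + R -. l = A + R" by simp
ultimately have x: "app (A + R) x = 0" by simp
show "x = 0" using sc unfolding semi_comm_def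
proof
 assume lc: "left_comm_on UNIV T R"
 obtain D where D: "!!x. x : UNIV ==> app T (app D x) = 0" "!!x. x : UNIV ==> app R (app D x) = 0"
  "!!x. x : UNIV ==> app (QL n) (app (A + R) x) = app (B n) (x + app D x)"
  by (rule left_factor[OF csubspace_UNIV subset_UNIV subset_UNIV lc n(2)]) (rule that)
 have "x + app D x = 0" using D(3)[of x] x B0 by simp
 hence "x = app D (- x)" by (simp add: app_minus eq_neg_iff_add_eq_0)
 hence "app T x = 0" "app R x = 0" using D(1,2)[of "- x"] by simp_all
 thus "x = 0" using x l by (simp add: app_simps)
next
 assume "right_comm T R"
 then obtain Q where "Q * (A + R) = B n" by (rule right_factor[OF _ n(2)]) (rule that)
 hence "app (B n) x = app Q (app (A + R) x)" by (simp only: app_mult[symmetric])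
 thus "x = 0" using B0 x by simp
qed
qed

lemma surj_iff_adj:
fixes t :: "'a::complex_banach cop"
shows "surj (app t) <-> beta UNIV (app t) < oo & (ALL f. app (adj t) f = 0 --> f = 0)"
proof
assume s: "surj (app t)"
have "f = 0" if f: "app (adj t) f = 0" for f
proof (rule dual_eqI)
 fix y
 obtain x where "y = app t x" using s by (rule surjE)
 thus "ev f y = ev 0 y" using f by (metis ev_adj ev_simps(1))
qed
thus "beta UNIV (app t) < oo & (ALL f. app (adj t) f = 0 --> f = 0)" using surj_beta[OF s] by simp
next
assume a: "beta UNIV (app t) < oo & (ALL f. app (adj t) f = 0 --> f = 0)"
hence cl: "closed (rg t)"
 unfolding beta_def
 by (intro finite_codim_range_closed[OF bounded_linear_app clinear_app _ _ csubspace_UNIV])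
  (simp_all add: csubspace_UNIV)
show "surj (app t)"
proof (rule ccontr)
 assume "~ surj (app t)"
 then obtain y where y: "y \<notin> rg t" by blast
 obtain f where f: "!!x. x : rg t ==> ev f x = 0" "ev f y = 1"
  by (rule separating_functional[OF csubspace_im[OF csubspace_UNIV] cl y]) (rule that)
 have "app (adj t) f = 0" by (rule dual_eqI) (use f(1) in "simp add: ev_adj ev_simps")
 thus False using a f(2) by (auto simp: ev_simps)
qed
qed

lemma surj_semi_comm:
fixes T R :: "'a::complex_banach cop"
assumes sc: "semi_comm T R" and R: "quasinil R" and l: "l ~= 0" and s: "surj (app (T -. l))"
shows "surj (app (T + R -. l))"
proof -
have sh: "adj (U -. m) = adj U -. m" for U :: "'a cop" and m by (simp add: adj_simps)
have b: "beta UNIV (app (T -. l)) < oo" and i: "ALL f. app (adj (T -. l)) f = 0 --> f = 0"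
 using s unfolding surj_iff_adj by blast+
obtain c where "c > 0" "below_on UNIV (adj (T -. l)) c" by (rule adj_below[OF b]) (rule that)
hence "EX c>0. ALL f. c * norm f <= norm (app (adj T -. l) f)"
 using i unfolding below_kernel_mod_findim sh by blast
moreover have "quasinil (adj R)"
 unfolding quasinil_def
proof (intro allI impI)
 fix z :: complex assume "z ~= 0"
 then obtain s where "s * (R -. z) = 1" "(R -. z) * s = 1"
  using R unfolding quasinil_def inv_op_def by blast
 hence "adj (R -. z) * adj s = 1" "adj s * adj (R -. z) = 1"
  unfolding adj_simps(1)[symmetric] by (simp_all only: adj_simps(5))
 thus "inv_op (adj R -. z)" unfolding sh inv_op_def by blast
qed
ultimately have "EX c>0. ALL f. c * norm f <= norm (app (adj T + adj R -. l) f)"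
 using bounded_below_semi_comm[OF semi_comm_adj[OF sc] _ l] by blast
hence "ALL f. app (adj T + adj R -. l) f = 0 --> f = 0"
 unfolding below_kernel_mod_findim by blast
thus ?thesis
 unfolding surj_iff_adj sh adj_simps(2) using lower_semi_comm_riesz[OF sc quasinil_riesz[OF R] l b] by blast
qed

lemma commuting_quot:
assumes "a * r = r * a"
shows "left_quot a r n * (a + r) = a ^ n - (- r) ^ n" "(a + r) * right_quot a r n = a ^ n - (- r) ^ n"
proof -
have "left_rem a r n = 0" "right_rem a r n = 0"
 by (induction n) (simp_all add: left_rem_Suc right_rem_Suc assms)
thus "left_quot a r n * (a + r) = a ^ n - (- r) ^ n" "(a + r) * right_quot a r n = a ^ n - (- r) ^ n"
 by (simp_all add: left_rem_def right_rem_def)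
qed

lemma invertible_commuting_sum:
assumes c: "a * r = r * a" and i: "inv_op (a ^ n - (- r) ^ n)"
shows "inv_op (a + r)"
unfolding inv_op_iff_bij
proof (rule bijI)
note q = commuting_quot[OF c, of n] and b = i[unfolded inv_op_iff_bij]
show "inj (app (a + r))"
proof (rule injI)
 fix x y assume "app (a + r) x = app (a + r) y"
 hence "app (a ^ n - (- r) ^ n) x = app (a ^ n - (- r) ^ n) y" by (simp only: q(1)[symmetric] app_mult)
 thus "x = y" using b by (simp add: bij_def inj_eq)
qed
show "surj (app (a + r))"
 unfolding surj_def
proof
 fix y
 obtain x where "y = app (a ^ n - (- r) ^ n) x" using b by (metis bij_pointE)
 thus "EX x. y = app (a + r) x" by (metis q(2) app_mult)
qed
qed

lemma invertible_small_power:
fixes a :: "'a::complex_banach cop"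
assumes z: "z ~= 0" and n: "norm (a ^ n) < cmod z ^ n" shows "inv_op (a -. z)"
proof -
let ?w = "inverse (z ^ n)"
have "norm (?w *: a ^ n) < 1"
 using n z by (simp add: norm_scaleC norm_inverse norm_power divide_less_eq flip: divide_inverse_commute)
hence "inv_op (1 - ?w *: a ^ n)" by (rule inv_op_one_minus)
hence "inv_op ((- (z ^ n)) *: (1 - ?w *: a ^ n))" using z by (subst inv_op_scaleC) simp_all
moreover have "(- (z ^ n)) *: (1 - ?w *: a ^ n) = a ^ n - (- ((- z) *: 1)) ^ n"
 using z scaleC_power[of z "1 :: 'a cop" n] by (simp add: scaleC_diff_right scaleC_scaleC)
ultimately have "inv_op (a + (- z) *: 1)"
 by (intro invertible_commuting_sum[of a "(- z) *: 1" n]) simp_all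
thus ?thesis by simp
qed

text \<open>At the point zero: if \<open>T\<close> is invertible, \<open>TC = 0\<close> or \<open>CT = 0\<close> forces \<open>C = 0\<close>, so \<open>T\<close> and \<open>R\<close>
  commute and the division leaves no remainder.\<close>

lemma invertible_semi_comm:
fixes T R :: "'a::complex_banach cop"
assumes sc: "semi_comm T R" and R: "quasinil R" and i: "inv_op T"
shows "inv_op (T + R)"
proof -
obtain s where s: "s * T = 1" "T * s = 1" using i unfolding inv_op_def by blast
have "T * R - R * T = 0" using sc unfolding semi_comm_def
proof
 assume "left_comm_on UNIV T R"
 hence "T * (T * R - R * T) = 0" unfolding left_comm_on_def by (auto intro!: cop_eqI simp: app_simps1(1))
 hence "s * T * (T * R - R * T) = 0" unfolding mult.assoc by simp
 thus ?thesis using s by simp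
next
 assume "right_comm T R"
 hence "(T * R - R * T) * T * s = 0" unfolding right_comm_def by simp
 thus ?thesis using s by (simp add: mult.assoc)
qed
hence c: "T * R = R * T" by simp
define e where "e = 1 / (norm s + 1)"
have e: "e > 0" "norm s * e < 1" unfolding e_def by (simp_all add: add_nonneg_pos)
obtain n where n: "norm ((- R) ^ n) <= e ^ n / 2"
 using spectral_radius[OF e(1), of "- R"] quasinil_minus[OF R] e(1) unfolding quasinil_def
 by (metis norm_zero not_le)
have sn: "T ^ n * s ^ n = 1" for n
proof (induction n)
 case (Suc n)
 have "T ^ Suc n * s ^ Suc n = T * (T ^ n * s ^ n) * s" by (simp only: power_Suc power_commutes[of s] mult.assoc)
 thus ?case using Suc s by simp
qed simp
have "norm (s ^ n * (- R) ^ n) <= norm s ^ n * (e ^ n / 2)"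
 by (rule order_trans[OF norm_mult_ineq mult_mono[OF norm_power_cop n]]) simp_all
also have "... = (norm s * e) ^ n / 2" by (simp add: power_mult_distrib)
also have "... < 1" using power_le_one[of "norm s * e" n] e by simp
finally have "inv_op (1 - s ^ n * (- R) ^ n)" by (rule inv_op_one_minus)
moreover have "inv_op (T ^ n)" by (induction n) (simp_all add: inv_op_mult i)
ultimately have "inv_op (T ^ n * (1 - s ^ n * (- R) ^ n))" by (intro inv_op_mult)
moreover have "T ^ n * (1 - s ^ n * (- R) ^ n) = T ^ n - (- R) ^ n"
 by (simp add: right_diff_distrib mult.assoc[symmetric] sn)
ultimately show ?thesis using invertible_commuting_sum[OF c] by metis
qed

section \<open>Splitting off the invertible part\<close>

text \<open>The space is the sum of the ranges of \<open>P\<close> and \<open>1 - P\<close>, and \<open>W\<close> inverts \<open>T\<close> on the latter. The part of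
  \<open>T\<close> on the range of \<open>P\<close> is represented by \<open>T P\<close>, an operator on the whole space with the same behaviour
  apart from zero.\<close>

definition split_op :: "'a::complex_banach cop => 'a cop => 'a cop => bool" where
"split_op T P W <-> P * P = P & T * P = P * T & W * P = 0 & P * W = 0 & T * W = 1 - P & W * T = 1 - P"

text \<open>The factor \<open>U\<close> is \<open>1\<close> on the range of \<open>P\<close> and \<open>- (T - z) / z\<close> on that of \<open>1 - P\<close>, where \<open>T\<close> is
  invertible and small shifts keep it so.\<close>

lemma split_op_nearby:
fixes T P W :: "'a::complex_banach cop"
assumes "split_op T P W"
obtains d where "d > 0" "!!z. 0 < cmod z ==> cmod z < d ==>
 EX U. inv_op U & T -. z = (T * P -. z) * U & (T * P -. z) * U = U * (T * P -. z)"
proof -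
note s = assms[unfolded split_op_def]
define Q where "Q = 1 - P"
have q: "P * Q = 0" "Q * P = 0" "Q * Q = Q" "Q * T = T * Q" "W * T = Q" "T * W = Q" "Q * W = W" "W * Q = W"
 "P * P = P" "P * W = 0" "W * P = 0" "P * T = T * P" "P + Q = 1"
 using s by (simp_all add: Q_def right_diff_distrib left_diff_distrib)
have qa: "x * y * c = z * c" if "x * y = z" for x y z c :: "'a cop" using that by simp
note q' = q(1-12) q(1-12)[THEN qa, unfolded mult.assoc mult_zero_left]
have "EX U. inv_op U & T -. z = (T * P -. z) * U & (T * P -. z) * U = U * (T * P -. z)"
 if z: "0 < cmod z" "cmod z < 1 / (norm W + 1)" for z
proof -
 have z0: "z ~= 0" using z by auto
 have "cmod z * (norm W + 1) < 1" using z(2) by (simp add: pos_less_divide_eq add_nonneg_pos)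
 hence "norm (z *: W) < 1" using z(1) unfolding distrib_left norm_scaleC by linarith
 hence i1: "inv_op (1 - z *: W)" by (rule inv_op_one_minus)
 have "(P - z *: Q) * (P - inverse z *: Q) = P + Q" "(P - inverse z *: Q) * (P - z *: Q) = P + Q"
  "(P + W) * (P + T * Q) = P + Q" "(P + T * Q) * (P + W) = P + Q"
  using z0 by (simp_all add: algebra_simps q' scaleC_scaleC mult.assoc)
 hence i2: "inv_op (P - inverse z *: Q)" "inv_op (P + T * Q)"
  unfolding inv_op_def q(13) by blast+
 let ?U = "(P - inverse z *: Q) * (1 - z *: W) * (P + T * Q)"
 have "(T * P -. z) * ?U = T * (P + Q) - z *: (P + Q)" "?U * (T * P -. z) = T * (P + Q) - z *: (P + Q)"
  using z0 by (simp_all add: algebra_simps q' scaleC_scaleC mult.assoc scaleC_add_right scaleC_diff_right)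
 moreover have "inv_op ?U" by (intro inv_op_mult i1 i2)
 ultimately show ?thesis unfolding q(13) by (intro exI[of _ ?U]) simp
qed
thus thesis using that[of "1 / (norm W + 1)"] by (simp add: add_nonneg_pos)
qed

lemma browder_mult_invertible:
assumes s: "browder s" and u: "inv_op u" and c: "s * u = u * s"
shows "browder (s * u)"
proof -
have b: "bij (app u)" using u inv_op_iff_bij by blast
have k: "app (s * u) x = 0 <-> app s x = 0" for x
 unfolding c app_mult using b by (metis app_0 bij_def inj_eq)
have r: "rg (v * u ^ n) = rg v" for v n
proof (induction n)
 case (Suc n)
 have "rg (v * u ^ Suc n) = app (v * u ^ n) ` rg u"
  by (simp only: power_Suc2 mult.assoc[symmetric] app_mult_image)
 thus ?case using b Suc by (simp add: bij_is_surj)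
qed simp
have pw: "(s * u) ^ n = s ^ n * u ^ n" for n
proof (induction n)
 case (Suc n)
 have "(s * u) ^ Suc n = s * (u * s ^ n) * u ^ n" by (simp only: power_Suc Suc mult.assoc)
 also have "u * s ^ n = s ^ n * u" by (rule power_commute_elems[OF c[symmetric]])
 finally show ?case by (simp only: power_Suc mult.assoc)
qed simp
have r1: "rg (s * u) = rg s" using r[of s 1] by simp
show ?thesis
 using s unfolding browder_def fredholm_on_def alpha_def beta_def fin_asc_def fin_desc_def pw r r1 k by blast
qed

lemma fredholm_on_projection_range:
fixes T P :: "'a::complex_banach cop"
assumes PP: "P * P = P" and TP: "T * P = P * T" and f: "fredholm_on UNIV (T -. z)"
shows "fredholm_on (rg P) (T -. z)"
proof -
let ?S = "T -. z" and ?N = "rg P"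
have N: "csubspace ?N" by (intro csubspace_im csubspace_UNIV)
have "alpha ?N (app ?S) <= alpha UNIV (app ?S)"
 unfolding alpha_def by (intro edim_mono csubspace_kernel_on[OF clinear_app] N csubspace_UNIV) blast
moreover have "P * ?S = ?S * P" using TP by (simp add: right_diff_distrib left_diff_distrib)
hence "app P ` rg ?S = app ?S ` ?N" by (metis app_mult_image)
hence "beta ?N (app ?S) <= beta UNIV (app ?S)"
 unfolding beta_def
 using ecodim_image_le[OF clinear_app[of P] csubspace_UNIV csubspace_im[OF csubspace_UNIV] subset_UNIV, of ?S]
 by simp
ultimately show ?thesis using f finite_le unfolding fredholm_on_def by blast
qed

text \<open>On the range of \<open>1 - P\<close> the operator \<open>T P - z\<close> is the invertible scalar \<open>- z\<close>.\<close>

lemma fredholm_projection_iff: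
fixes T P :: "'a::complex_banach cop"
assumes PP: "P * P = P" and TP: "T * P = P * T" and z: "z ~= 0"
shows "fredholm_on UNIV (T * P -. z) <-> fredholm_on (rg P) (T -. z)"
proof -
let ?S = "T -. z" and ?F = "T * P -. z" and ?N = "rg P"
have P: "app P (app P x) = app P x" for x by (simp only: app_mult[symmetric] PP)
have on: "app ?F x = app ?S x" if "x : ?N" for x using that P by (auto simp: app_simps)
have N: "csubspace ?N" by (intro csubspace_im csubspace_UNIV)
show ?thesis
proof
 assume "fredholm_on UNIV ?F"
 moreover have "(T * P) * P = P * (T * P)" by (metis TP mult.assoc)
 ultimately have "fredholm_on ?N ?F" by (intro fredholm_on_projection_range PP)
 moreover have "app ?F ` ?N = app ?S ` ?N" by (rule image_cong[OF refl on])
 moreover have "ker ?N ?F = ker ?N ?S" using on by auto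
 ultimately show "fredholm_on ?N ?S" unfolding fredholm_on_def alpha_def beta_def by simp
next
 assume f: "fredholm_on ?N ?S"
 have "ker UNIV ?F <= ker ?N ?S"
 proof
  fix x assume x: "x : (ker UNIV ?F)"
  hence "app (P * T) (app P x) = z *: x" unfolding TP[symmetric] by (simp add: app_simps P)
  hence "app P (inverse z *: app T (app P x)) = x" using z by (simp add: app_mult app_scaleC scaleC_scaleC)
  hence "x : ?N" by (metis rangeI)
  thus "x : (ker ?N ?S)" using x on by simp
 qed
 hence "alpha UNIV (app ?F) <= alpha ?N (app ?S)"
  unfolding alpha_def by (intro edim_mono csubspace_kernel_on[OF clinear_app] N csubspace_UNIV)
 hence a: "alpha UNIV (app ?F) < oo" by (rule finite_le) (use f in "simp only: fredholm_on_def")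
 have "P * ?S = ?S * P" using TP by (simp add: right_diff_distrib left_diff_distrib)
 hence SN: "app ?S ` ?N <= ?N" by (metis app_mult_image image_mono subset_UNIV)
 obtain G where G: "direct_sum (app ?S ` ?N) G ?N" "edim G < oo"
  using ecodim_finite_supplement[OF N csubspace_im[OF N] SN] f unfolding beta_def fredholm_on_def by blast
 note D = direct_sumD[OF G(1)]
 have "x : rg ?F + G" for x
 proof -
  have "app P x : app ?S ` ?N + G" unfolding D(6) by simp
  then obtain y g where y: "y : ?N" "g : G" "app P x = app ?S y + g" by (auto elim!: set_plus_elim)
  have "app ?F (inverse z *: (x - app P x)) = - (x - app P x)"
   using z by (simp only: app_scaleC app_simps1 app_mult app_scaleC_left app_one app_diff[of P] P)
    (simp add: scaleC_scaleC scaleC_diff_right)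
  hence "x = app ?F (y - inverse z *: (x - app P x)) + g" using on[OF y(1)] y(3) by (simp add: app_diff)
  thus ?thesis using y(2) by (metis rangeI set_plus_intro)
 qed
 hence "beta UNIV (app ?F) <= edim G"
  unfolding beta_def by (intro ecodim_le_edim_supplement csubspace_UNIV csubspace_im D(2)) auto
 thus "fredholm_on UNIV ?F" using a finite_le[OF _ G(2)] unfolding fredholm_on_def by blast
qed
qed

lemma riesz_split_op:
fixes T P W :: "'a::complex_banach cop"
assumes sp: "split_op T P W" and inv: "!!z. cmod z >= r ==> inv_op (T * P -. z)"
 and fr: "!!z. 0 < cmod z ==> cmod z < r ==> fredholm_on UNIV (T -. z)"
shows "riesz (T * P)"
unfolding riesz_def
proof (intro allI impI)
have s: "P * P = P" "T * P = P * T" using sp unfolding split_op_def by blast+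
fix z :: complex assume z: "z ~= 0"
show "fredholm_on UNIV (T * P -. z)"
proof (cases "cmod z < r")
 case False
 thus ?thesis using inv[of z] invertible_browder browder_def by fastforce
next
 case True
 thus ?thesis using fredholm_on_projection_range[OF s fr] z unfolding fredholm_projection_iff[OF s z] by simp
qed
qed

lemma quasinil_split_op:
fixes T P W :: "'a::complex_banach cop"
assumes sp: "split_op T P W"
 and inv: "!!z. cmod z >= r ==> inv_op (T * P -. z)"
 and i: "!!z. 0 < cmod z ==> cmod z < r ==> inv_op (T -. z)"
shows "quasinil (T * P)"
unfolding quasinil_def
proof (intro allI impI)
note s = sp[unfolded split_op_def]
fix z :: complex assume z: "z ~= 0"
show "inv_op (T * P -. z)"
proof (cases "cmod z < r")
 case False
 thus ?thesis using inv[of z] by simp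
next
 case True
 then obtain u where u: "u * (T -. z) = 1" "(T -. z) * u = 1" using i z unfolding inv_op_def by force
 have c: "P * (T -. z) = (T -. z) * P" using s by (simp add: right_diff_distrib left_diff_distrib)
 have Pu: "P * u = u * P" by (rule inverse_commutes[OF u c])
 define A where "A = T -. z"
 have "(u * P) * (A * P) = P" "(A * P) * (u * P) = P"
  using u s c Pu unfolding A_def[symmetric] by (metis mult.assoc mult_1_left mult_1_right)+
 hence "inv_op (A * P - z *: (1 - P))"
  using s Pu c unfolding A_def[symmetric]
  by (intro block_invertible[of _ "u * P"]) (simp_all add: right_diff_distrib left_diff_distrib z mult.assoc mult.assoc[symmetric, of P])
 moreover have "A * P - z *: (1 - P) = T * P -. z"
  unfolding A_def by (simp add: left_diff_distrib scaleC_diff_right)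
 ultimately show ?thesis by simp
qed
qed

lemma split_op_exists:
fixes T :: "'a::complex_banach cop"
assumes r: "r > 0" and inv: "!!z. cmod z = r ==> inv_op (T -. z)"
obtains P W where "split_op T P W" "!!z. cmod z >= r ==> inv_op (T * P -. z)"
proof -
obtain P W n where s: "P * P = P" "T * P = P * T" "W * P = 0" "T * W = 1 - P" "W * T = 1 - P"
 "norm (T ^ n * P) <= r ^ n / 2" "n >= 1" by (rule spectral_split[OF assms]) (assumption, rule that)
have "(W * T) * W = W * (T * W)" by (rule mult.assoc)
hence PW: "P * W = 0" unfolding s(4,5) by (simp add: left_diff_distrib right_diff_distrib s(3))
have pw: "(T * P) ^ k * P = T ^ k * P" for k
proof (induction k)
 case (Suc k)
 have "(T * P) ^ Suc k * P = T * (P * (T ^ k * P))" by (simp only: power_Suc mult.assoc Suc)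
 also have "P * (T ^ k * P) = T ^ k * P"
  using power_commute_elems[OF s(2)[symmetric], of k] s(1) by (metis mult.assoc)
 finally show ?case by (simp only: power_Suc mult.assoc)
qed simp
have "(T * P) ^ n = T ^ n * P"
proof -
 obtain m where m: "n = Suc m" using s(7) by (cases n) auto
 have "(T * P) ^ n * P = (T * P) ^ n" unfolding m power_Suc2 by (simp only: mult.assoc s(1))
 thus ?thesis unfolding pw ..
qed
hence np: "norm ((T * P) ^ n) <= r ^ n / 2" using s(6) by simp
show thesis
proof (rule that)
 show "split_op T P W" unfolding split_op_def using s PW by blast
 fix z assume z: "cmod z >= r"
 have "r ^ n <= cmod z ^ n" "r ^ n > 0" using z r by (simp_all add: power_mono)
 hence "norm ((T * P) ^ n) < cmod z ^ n" using np by linarith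
 thus "inv_op (T * P -. z)" using z r by (intro invertible_small_power) auto
qed
qed

section \<open>Generalized Drazin and Drazin-Riesz invertibility\<close>

lemma quasinil_iff: "quasi_nilpotent (app R) <-> quasinil R"
and sigma_iff: "z : \<sigma> (app R) <-> ~ inv_op (R -. z)"
proof -
have inv: "invertible_on UNIV (app t) <-> inv_op t" for t :: "'a cop"
proof
 assume "invertible_on UNIV (app t)"
 then obtain S where S: "bounded_clinear S" "!!x. S (app t x) = x & app t (S x) = x"
  unfolding invertible_on_def bounded_clinear_on_UNIV by blast
 hence "Cop S * t = 1" "t * Cop S = 1" by (auto intro!: cop_eqI simp: app_mult app_one app_Cop)
 thus "inv_op t" unfolding inv_op_def by blast
next
 assume "inv_op t"
 then obtain s where s: "s * t = 1" "t * s = 1" unfolding inv_op_def by blast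
 hence "app s (app t x) = x & app t (app s x) = x" for x by (simp add: app_mult[symmetric] app_one)
 thus "invertible_on UNIV (app t)"
  unfolding invertible_on_def bounded_clinear_on_UNIV by (intro exI[of _ "app s"]) simp
qed
show s: "z : \<sigma> (app R) <-> ~ inv_op (R -. z)" for z
 unfolding \<sigma>_def spectrum_of_def op_shift_app inv by simp
show "quasi_nilpotent (app R) <-> quasinil R"
 unfolding quasi_nilpotent_def quasinil_def subset_iff s by blast
qed

lemma minus_scalar_maps:
assumes "csubspace V" "app t ` V <= V" shows "app (t -. z) ` V <= V"
proof (rule image_subsetI)
fix x assume x: "x : V"
hence "app t x : V" using assms(2) by blast
thus "app (t -. z) x : V"
 using csubspace_diff[OF assms(1) _ csubspace_scale[OF assms(1) x]] by (simp add: app_simps)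
qed

lemma riesz_on_iff:
assumes "ccsubspace V" "app t ` V <= V"
shows "Riesz V (app t) <-> (ALL z. z ~= 0 --> fredholm_on V (t -. z))"
proof -
have "app (t -. z) ` V <= V" for z
 by (rule minus_scalar_maps[OF ccsubspaceD(1)[OF assms(1)] assms(2)])
thus ?thesis unfolding Riesz_def op_shift_app using semi_Fredholm_iff(3)[OF assms(1)] by blast
qed

lemma riesz_iff: "Riesz UNIV (app t) <-> riesz t"
unfolding riesz_on_iff[OF ccsubspace_UNIV subset_UNIV] riesz_def ..

abbreviation "GDRI == gen_Drazin_Riesz_invertible"

text \<open>The projection along the invertible part is bounded by the open mapping theorem.\<close>

lemma GDRI_split:
fixes T :: "'a::complex_banach cop"
assumes "GDRI (app T)"
obtains P W where "split_op T P W" "riesz (T * P)"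
proof -
obtain M N where MN: "closed M" "closed N" "app T ` M <= M" "app T ` N <= N" "direct_sum M N UNIV"
 "invertible_on M (app T)" "Riesz N (app T)"
 using assms unfolding gen_Drazin_Riesz_invertible_def Red_def by blast
note D = direct_sumD[OF MN(5)]
obtain P where P: "!!x. app P x : N" "!!x. x - app P x : M" "!!x. x : N ==> app P x = x" "!!x. x : M ==> app P x = 0"
 by (rule projection_exists[OF MN(1,2,5)]) (rule that)
obtain S where S: "bounded_clinear_on M S" "!!x. x : M ==> S (app T x) = x & app T (S x) = x"
 using MN(6) unfolding invertible_on_def by blast
have Sm: "S x : M" "S (x + y) = S x + S y" "S (c *: x) = c *: S x" if "x : M" "y : M" for x y c
 using S(1) that unfolding bounded_clinear_on_def by blast+
obtain K where K: "!!x. x : M ==> norm (S x) <= K * norm x" using S(1) unfolding bounded_clinear_on_def by blast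
have bc: "bounded_clinear (%x. S (x - app P x))"
proof (rule bounded_clinearI)
 show "S (x + y - app P (x + y)) = S (x - app P x) + S (y - app P y)" for x y
  using Sm(2)[OF P(2) P(2), of x y] by (simp add: app_add algebra_simps)
 show "S (c *: x - app P (c *: x)) = c *: S (x - app P x)" for c x
  using Sm(3)[OF P(2) P(2), of c x] by (simp add: app_scaleC scaleC_diff_right)
 fix x
 have "norm (S (x - app P x)) <= \<bar>K\<bar> * norm (x - app P x)"
  by (rule order_trans[OF K[OF P(2)] mult_right_mono]) auto
 also have "... <= \<bar>K\<bar> * ((1 + norm P) * norm x)"
  using norm_triangle_ineq4[of x "app P x"] norm_app[of P x] by (intro mult_left_mono) (auto simp: distrib_right)
 finally show "norm (S (x - app P x)) <= (\<bar>K\<bar> * (1 + norm P)) * norm x" by simp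
qed
define W where "W = Cop (%x. S (x - app P x))"
have W: "app W x = S (x - app P x)" for x unfolding W_def app_Cop[OF bc] ..
have S0: "S 0 = 0" using Sm(2)[OF csubspace_0[OF D(1)] csubspace_0[OF D(1)]] by simp
have PT: "app P (app T x) = app T (app P x)" for x
proof -
 have "app P (app T (x - app P x)) = 0" using MN(3) P(2) by (intro P(4)) blast
 moreover have "app P (app T (app P x)) = app T (app P x)" using MN(4) P(1) by (intro P(3)) blast
 ultimately show ?thesis by (simp add: app_diff)
qed
have sp: "split_op T P W"
 unfolding split_op_def
 by (intro conjI cop_eqI; unfold app_mult W app_simps1 app_one)
  (simp_all add: P(3)[OF P(1)] S0 P(4)[OF Sm(1)[OF P(2) P(2)]] S(2)[OF P(2)] PT app_diff[symmetric])
have "N = rg P" using P(1,3) by (metis (no_types, lifting) image_subsetI rangeI subsetI subset_antisym)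
moreover have "ccsubspace N" using D MN(2) unfolding ccsubspace_def by blast
moreover have s: "P * P = P" "T * P = P * T" using sp unfolding split_op_def by blast+
ultimately have "riesz (T * P)"
 using MN(7) riesz_on_iff[OF _ MN(4)] fredholm_projection_iff[OF s] unfolding riesz_def by simp
thus thesis by (rule that[OF sp])
qed

lemma split_GDRI:
fixes T :: "'a::complex_banach cop"
assumes sp: "split_op T P W" and R: "riesz (T * P)"
shows "GDRI (app T)"
proof -
note s = sp[unfolded split_op_def]
have PP: "app P (app P x) = app P x" and PT: "app P (app T x) = app T (app P x)" and PW: "app P (app W x) = 0"
 and TW: "app T (app W x) = x - app P x" and WT: "app W (app T x) = x - app P x" for x
 using s app_one app_simps1 app_mult by metis+
let ?M = "ker UNIV P" and ?N = "ker UNIV (1 - P)"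
have M: "ccsubspace ?M" and N: "ccsubspace ?N"
 using ccsubspace_kernel[OF ccsubspace_UNIV] by blast+
have Nx: "x : ?N <-> app P x = x" for x by (auto simp: app_simps1(3) app_one)
have ds: "direct_sum ?M ?N UNIV"
proof (rule direct_sumI)
 show "?M + ?N = UNIV"
 proof (intro equalityI subset_UNIV subsetI)
  fix x
  have "(x - app P x) + app P x : ?M + ?N" using PP Nx by (intro set_plus_intro) (auto simp: app_diff)
  thus "x : ?M + ?N" by simp
 qed
qed (use M N Nx ccsubspaceD(1) in auto)
have TM: "app T ` ?M <= ?M" and TN: "app T ` ?N <= ?N" using PT Nx by auto
have "invertible_on ?M (app T)"
 unfolding invertible_on_def bounded_clinear_on_def
proof (intro exI[of _ "app W"] conjI)
 show "EX K. ALL x:?M. norm (app W x) <= K * norm x" using norm_app by blast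
qed (use PW TW WT in "auto simp: app_add app_scaleC")
moreover have "?N = rg P"
proof (intro equalityI subsetI)
 show "x : rg P" if "x : ?N" for x using that Nx by (metis rangeI)
qed (use PP Nx in auto)
hence "Riesz ?N (app T)"
 using R s fredholm_projection_iff[of P T] unfolding riesz_on_iff[OF N TN] riesz_def by simp
ultimately show ?thesis
 unfolding gen_Drazin_Riesz_invertible_def Red_def using M N TM TN ds ccsubspaceD(2) by blast
qed

lemma gen_Drazin_split:
fixes T :: "'a::complex_banach cop"
shows "gen_Drazin_invertible (app T) <-> (EX P W. split_op T P W & quasinil (T * P))"
proof
assume "gen_Drazin_invertible (app T)"
then obtain S where S: "S : comm (app T)" "S \<circ> S \<circ> app T = S" "quasi_nilpotent (%x. app T x - app T (app T (S x)))"
 unfolding gen_Drazin_invertible_def by blast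
define W where "W = Cop S"
have W: "app W = S" using S(1) unfolding W_def comm_def by (simp add: app_Cop)
have TW: "T * W = W * T" and WW: "W * (W * T) = W"
 using S(1,2) unfolding comm_def by (auto intro!: cop_eqI simp: app_mult W fun_eq_iff)
have "app (T * (1 - T * W)) = (%x. app T x - app T (app T (S x)))"
 by (rule ext) (simp add: app_simps W app_diff)
hence "quasinil (T * (1 - T * W))" using S(3) quasinil_iff by metis
moreover have "split_op T (1 - T * W) W"
proof -
 have 1: "W * (T * W) = W" "T * W * W = W" using WW TW by (metis mult.assoc)+
 have 2: "T * W * (T * W) = T * W" using 1 by (metis mult.assoc)
 have 3: "T * (T * W) = (T * W) * T" using TW by (metis mult.assoc)
 show ?thesis unfolding split_op_def using 1 2 3 TW by (simp add: right_diff_distrib left_diff_distrib)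
qed
ultimately show "EX P W. split_op T P W & quasinil (T * P)" by blast
next
assume "EX P W. split_op T P W & quasinil (T * P)"
then obtain P W where s: "split_op T P W" "quasinil (T * P)" by blast
note s' = s(1)[unfolded split_op_def]
have c: "T * W = W * T" "W * W * T = W" "T - T * (T * W) = T * P"
 using s' by (simp_all add: mult.assoc right_diff_distrib)
have "app W : comm (app T)" using arg_cong[OF c(1), of app] unfolding comm_def by (auto simp: fun_eq_iff app_mult[symmetric])
moreover have "app W \<circ> app W \<circ> app T = app W" using arg_cong[OF c(2), of app] by (auto simp: fun_eq_iff app_mult[symmetric] mult.assoc)
moreover have "(%x. app T x - app T (app T (app W x))) = app (T * P)"
 unfolding c(3)[symmetric] by (auto simp: app_simps1 app_mult)
ultimately show "gen_Drazin_invertible (app T)"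
 unfolding gen_Drazin_invertible_def using s(2) quasinil_iff by metis
qed

text \<open>If \<open>T\<close> splits, then for small \<open>z \<noteq> 0\<close> the operator \<open>T - z\<close> is \<open>T P - z\<close> up to a commuting
  invertible factor. Conversely, spectral points at which \<open>T - z\<close> is Browder are isolated, so an annulus around
  zero contains finitely many of them; a circle in it that avoids them has a spectral projection.\<close>

lemma GDRI_iff_browder_nearby:
fixes T :: "'a::complex_banach cop"
shows "GDRI (app T) <-> (EX d>0. ALL z. 0 < cmod z --> cmod z < d --> browder (T -. z))"
proof
assume "GDRI (app T)"
then obtain P W where s: "split_op T P W" "riesz (T * P)" by (rule GDRI_split)
obtain d where d: "d > 0" "!!z. 0 < cmod z ==> cmod z < d ==>
 EX U. inv_op U & T -. z = (T * P -. z) * U & (T * P -. z) * U = U * (T * P -. z)"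
 by (rule split_op_nearby[OF s(1)]) (rule that)
have "browder (T -. z)" if z: "0 < cmod z" "cmod z < d" for z
 using d(2)[OF z] browder_mult_invertible[OF riesz_browder[OF s(2), of z]] z(1) by auto
thus "EX d>0. ALL z. 0 < cmod z --> cmod z < d --> browder (T -. z)" using d(1) by blast
next
assume "EX d>0. ALL z. 0 < cmod z --> cmod z < d --> browder (T -. z)"
then obtain d where d: "d > 0" "!!z. 0 < cmod z ==> cmod z < d ==> browder (T -. z)" by blast
let ?A = "{z :: complex. d / 3 <= cmod z & cmod z <= d / 2}"
let ?S = "{z : ?A. ~ inv_op (T -. z)}"
have clA: "closed ?A" by (intro closed_Collect_conj closed_Collect_le continuous_intros)
moreover have "bounded ?A" by (rule bounded_subset[OF bounded_cball[of 0 "d / 2"]]) auto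
ultimately have cA: "compact ?A" using compact_eq_bounded_closed by blast
have "finite ?S"
proof (rule ccontr)
 assume "infinite ?S"
 then obtain z where z: "z islimpt ?S" using Heine_Borel_imp_Bolzano_Weierstrass[OF cA, of ?S] by blast
 hence "z : ?A" using islimpt_subset[OF z, of ?A] clA unfolding closed_limpt by blast
 hence "browder (T -. z)" using d by (intro d(2)) auto
 then obtain e where e: "e > 0" "!!w. 0 < cmod w ==> cmod w < e ==> inv_op (T -. z -. w)"
  by (rule browder_invertible_nearby) (rule that)
 obtain y where y: "y : ?S" "y ~= z" "dist y z < e" using z e(1) unfolding islimpt_approachable by blast
 have "inv_op (T -. z -. (y - z))" using y by (intro e(2)) (auto simp: dist_norm)
 thus False using y(1) unfolding shift_shift by simp
qed
hence "infinite ({d / 3<..<d / 2} - cmod ` ?S)" using d(1) by (intro Diff_infinite_finite) auto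
then obtain r where "r : {d / 3<..<d / 2} - cmod ` ?S" using infinite_imp_nonempty by blast
hence r: "d / 3 < r" "r < d / 2" "r \<notin> cmod ` ?S" by auto
have r0: "r > 0" using r d(1) by simp
have inv: "inv_op (T -. z)" if "cmod z = r" for z using r that by force
obtain P W where s: "split_op T P W" "!!z. cmod z >= r ==> inv_op (T * P -. z)"
 by (rule split_op_exists[OF r0 inv]) (assumption, rule that)
have "riesz (T * P)"
proof (rule riesz_split_op[OF s])
 show "fredholm_on UNIV (T -. z)" if "0 < cmod z" "cmod z < r" for z
  using d(2)[OF that(1)] that(2) r(2) d(1) unfolding browder_def by simp
qed
thus "GDRI (app T)" by (rule split_GDRI[OF s(1)])
qed

lemma gen_Drazin_iff_invertible_nearby:
fixes T :: "'a::complex_banach cop"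
shows "gen_Drazin_invertible (app T) <-> (EX d>0. ALL z. 0 < cmod z --> cmod z < d --> inv_op (T -. z))"
proof
assume "gen_Drazin_invertible (app T)"
then obtain P W where s: "split_op T P W" "quasinil (T * P)" unfolding gen_Drazin_split by blast
obtain d where d: "d > 0" "!!z. 0 < cmod z ==> cmod z < d ==>
 EX U. inv_op U & T -. z = (T * P -. z) * U & (T * P -. z) * U = U * (T * P -. z)"
 by (rule split_op_nearby[OF s(1)]) (rule that)
have "inv_op (T -. z)" if z: "0 < cmod z" "cmod z < d" for z
 using d(2)[OF z] s(2) z(1) inv_op_mult unfolding quasinil_def by fastforce
thus "EX d>0. ALL z. 0 < cmod z --> cmod z < d --> inv_op (T -. z)" using d(1) by blast
next
assume "EX d>0. ALL z. 0 < cmod z --> cmod z < d --> inv_op (T -. z)"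
then obtain d where d: "d > 0" "!!z. 0 < cmod z ==> cmod z < d ==> inv_op (T -. z)" by blast
have r0: "d / 2 > 0" and inv: "inv_op (T -. z)" if "cmod z = d / 2" for z using d that by auto
have r0: "d / 2 > 0" using d(1) by simp
obtain P W where s: "split_op T P W" "!!z. cmod z >= d / 2 ==> inv_op (T * P -. z)"
 by (rule split_op_exists[OF r0 inv]) (assumption, rule that)
have "quasinil (T * P)"
 by (rule quasinil_split_op[OF s]) (use d in auto)
thus "gen_Drazin_invertible (app T)" unfolding gen_Drazin_split using s(1) by blast
qed

section \<open>The point zero\<close>

lemma findim_ball_in_compact:
fixes B :: "'a::complex_banach set"
assumes "finite B"
shows "EX K. compact K & {x : cspan B. norm x <= r} <= K"
using assms
proof (induction B arbitrary: r)
case empty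
show ?case by (intro exI[of _ "{0}"]) auto
next
case (insert b B)
show ?case
proof (cases "b : cspan B")
 case True
 thus ?thesis using insert.IH[of r] by (simp add: complex_vector.span_redundant)
next
 case False
 have F: "csubspace (cspan B)" "closed (cspan B)"
  using findim_closed edim_finite_iff insert.hyps(1) by (simp, blast)
 define d where "d = infdist b (cspan B)"
 have d: "d > 0"
  using False F infdist_nonneg[of b "cspan B"] in_closed_iff_infdist_zero[OF F(2)] csubspace_0[OF F(1)]
  unfolding d_def by fastforce
 obtain K where K: "compact K" "{x : cspan B. norm x <= r + r / d * norm b} <= K" using insert.IH by blast
 let ?L = "(%c. c *: b) ` cball 0 (r / d)"
 have "bounded_linear (%c. c *: b)"
  by (rule bounded_linear_intro[of _ "norm b"])
   (simp_all add: scaleC_add_left norm_scaleC scaleR_scaleC scaleC_scaleC scaleR_conv_of_real)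
 hence "compact ?L" by (intro compact_continuous_image linear_continuous_on compact_cball)
 hence "compact {x + y |x y. x : K & y : ?L}" using K(1) compact_sums by blast
 moreover have "{x : cspan (insert b B). norm x <= r} <= {x + y |x y. x : K & y : ?L}"
 proof
  fix x assume x: "x : {x : cspan (insert b B). norm x <= r}"
  then obtain c where c: "x - c *: b : cspan B" using complex_vector.span_breakdown_eq by blast
  have cd: "cmod c * d <= norm x"
  proof (cases "c = 0")
   case False
   have "- (inverse c *: (x - c *: b)) : cspan B" by (intro csubspace_neg[OF F(1)] csubspace_scale[OF F(1)] c)
   hence "d <= dist b (- (inverse c *: (x - c *: b)))" unfolding d_def by (rule infdist_le)
   also have "... = norm (inverse c *: x)"
    using False by (simp add: dist_norm scaleC_diff_right scaleC_scaleC)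
   finally have "d <= inverse (cmod c) * norm x" by (simp only: norm_scaleC norm_inverse)
   hence "cmod c * d <= cmod c * (inverse (cmod c) * norm x)" by (rule mult_left_mono) simp
   thus ?thesis using False by (simp add: mult.assoc[symmetric])
  qed simp
  hence cr: "cmod c <= r / d" using x d by (simp add: pos_le_divide_eq)
  have "norm (x - c *: b) <= norm x + cmod c * norm b" using norm_triangle_ineq4[of x "c *: b"] by (simp add: norm_scaleC)
  also have "... <= r + r / d * norm b" using x cr by (intro add_mono mult_right_mono) auto
  finally have "x - c *: b : K" using c K(2) by blast
  moreover have "c *: b : ?L" using cr by (intro imageI) simp
  ultimately show "x : {x + y |x y. x : K & y : ?L}"
   by (intro CollectI exI[of _ "x - c *: b"] exI[of _ "c *: b"]) simp
 qed
 ultimately show ?thesis by blast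
qed
qed

text \<open>Riesz's compactness argument: the unit sphere of \<open>Y\<close> stays close to a compact set, so finitely many
  vectors of \<open>Y\<close> span a subspace \<open>F\<close> that meets every \<open>y\<close> up to half its norm. Applied to \<open>y - f\<close>, this says that
  the distance from \<open>y\<close> to \<open>F\<close> is at most half of itself.\<close>

lemma near_findim:
assumes Y: "csubspace Y" and H: "edim H < oo"
 and near: "!!y. y : Y ==> EX h:H. norm (y - h) <= norm y / 8"
shows "edim Y < oo"
proof -
obtain B where B: "finite B" "cspan B = H" using H edim_finite_iff by blast
obtain K where K: "compact K" "{x : H. norm x <= 2} <= K" using findim_ball_in_compact[OF B(1)] B(2) by blast
obtain A where A: "finite A" "K <= (\<Union>a\<in>A. ball a (1 / 8))"
 using K(1) unfolding compact_eq_totally_bounded by (meson zero_less_divide_1_iff zero_less_numeral)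
let ?near = "%a y. y : Y & norm (y - a) <= 1 / 4"
define S where "S = (%a. SOME y. ?near a y) ` {a : A. EX y. ?near a y}"
define F where "F = cspan S"
have "finite S" unfolding S_def using A(1) by simp
have some: "?near a (SOME y. ?near a y)" if "?near a y" for a y by (rule someI[of "?near a", OF that])
have fF: "edim F < oo" unfolding F_def edim_finite_iff using \<open>finite S\<close> by blast
have F: "csubspace F" "closed F" "F <= Y" "F ~= {}"
proof -
 show "csubspace F" "F ~= {}" unfolding F_def using csubspace_0 by (auto intro: complex_vector.span_zero)
 show "closed F" by (rule findim_closed[OF fF])
 show "F <= Y" unfolding F_def S_def using some by (intro complex_vector.span_minimal Y) blast
qed
have unit: "EX f:F. norm (y - f) <= 1 / 2" if y: "y : Y" "norm y = 1" for y
proof -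
 obtain h where h: "h : H" "norm (y - h) <= 1 / 8" using near[OF y(1)] y(2) by auto
 have "norm h <= norm y + norm (y - h)" using norm_triangle_ineq4[of y "y - h"] by simp
 hence "h : K" using h y K(2) by auto
 then obtain a where a: "a : A" "dist a h < 1 / 8" using A(2) by auto
 have "norm (y - a) <= norm (y - h) + norm (h - a)" using norm_triangle_ineq[of "y - h" "h - a"] by simp
 hence ya: "?near a y" using y(1) h(2) a(2) by (simp add: dist_norm norm_minus_commute)
 define f where "f = (SOME y. ?near a y)"
 have f: "?near a f" unfolding f_def by (rule some[OF ya])
 have "f : F" unfolding F_def S_def f_def using a(1) ya by (intro complex_vector.span_base imageI CollectI) blast
 moreover have "norm (y - f) <= norm (y - a) + norm (f - a)" using norm_triangle_ineq4[of "y - a" "f - a"] by simp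
 ultimately show ?thesis using ya f by (intro bexI[of _ f]) auto
qed
have half: "EX g:F. norm (y - g) <= norm y / 2" if y: "y : Y" for y
proof (cases "y = 0")
 case True
 thus ?thesis using csubspace_0[OF F(1)] by (intro bexI[of _ 0]) simp_all
next
 case False
 let ?c = "complex_of_real (inverse (norm y))"
 have "norm (?c *: y) = 1" using False by (simp add: norm_scaleC norm_inverse)
 then obtain f where f: "f : F" "norm (?c *: y - f) <= 1 / 2" using unit[OF csubspace_scale[OF Y y]] by blast
 have "y - complex_of_real (norm y) *: f = complex_of_real (norm y) *: (?c *: y - f)"
  using False by (simp add: scaleC_diff_right scaleC_scaleC flip: of_real_mult)
 hence "norm (y - complex_of_real (norm y) *: f) <= norm y / 2"
  using mult_left_mono[OF f(2), of "norm y"] by (simp add: norm_scaleC)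
 thus ?thesis using csubspace_scale[OF F(1) f(1)] by blast
qed
have "Y <= F"
proof
 fix y assume y: "y : Y"
 have "2 * infdist y F <= dist y f" if f: "f : F" for f
 proof -
  have "y - f : Y" using f F(3) y by (intro csubspace_diff[OF Y]) auto
  from half[OF this] obtain g where g: "g : F" "norm (y - f - g) <= norm (y - f) / 2" by blast
  have "infdist y F <= dist y (f + g)" by (rule infdist_le[OF csubspace_add[OF F(1) f g(1)]])
  thus ?thesis using g(2) by (simp add: dist_norm diff_diff_eq)
 qed
 hence "2 * infdist y F <= (INF f\<in>F. dist y f)" using F(4) by (intro cINF_greatest)
 hence "infdist y F = 0" using infdist_nonneg[of y F] F(4) by (simp add: infdist_def)
 thus "y : F" using in_closed_iff_infdist_zero[OF F(2,4)] by blast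
qed
thus ?thesis by (rule edim_subset_finite[OF F(1) Y _ fF])
qed

text \<open>On a finite-dimensional space the ranges become stationary, and a surjective operator is injective.\<close>

lemma findim_core:
fixes T :: "'a::complex_banach cop"
assumes N: "csubspace N" "app T ` N <= N" and fin: "edim (pran N T n) < oo"
obtains k where "pran N T (Suc k) = pran N T k" "!!x. x : pran N T k ==> app T x = 0 ==> x = 0"
proof -
note r = pow_range_facts[OF N]
let ?M = "%j. pran N T (j + n)"
have dec: "?M (Suc j) <= ?M j" for j unfolding add_Suc by (rule r(3))
have "edim (?M 0) < oo" using fin by simp
then obtain k where k: "!!j. j >= k ==> ?M j = ?M k"
 using decreasing_findim_stable[of ?M, OF r(1) dec] by metis
let ?Z = "pran N T (k + n)"
have Z: "csubspace ?Z" "app T ` ?Z = ?Z" using r(1) k[of "Suc k"] unfolding r(2) add_Suc by simp_all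
have "edim ?Z < oo" by (rule edim_subset_finite[OF r(1) Z(1) _ fin]) (rule r(5), simp)
hence "ecodim ?Z {0} < oo" using ecodim_zero[OF Z(1)] by simp
then obtain e where e: "alpha ?Z (app T) = alpha {0} (app T) + e" "beta ?Z (app T) = beta {0} (app T) + e"
 using index_restrict[OF clinear_app Z(1) _ csubspace_zero, of T] Z(2) csubspace_0[OF Z(1)] by auto
have "beta ?Z (app T) = 0" unfolding beta_def Z(2) by (rule ecodim_self[OF Z(1)])
hence "e = 0" using e(2) by simp
moreover have "{x : {0}. app T x = 0} = {0}" by auto
hence "alpha {0} (app T) = 0" unfolding alpha_def by simp
ultimately have "edim (ker ?Z T) = 0" using e(1) by (simp add: alpha_def)
hence "ker ?Z T = {0}" by (rule edim_eq_0[OF csubspace_kernel_on[OF clinear_app Z(1)]])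
hence "x = 0" if "x : ?Z" "app T x = 0" for x using that by blast
thus thesis using that[of "k + n"] Z(2) unfolding r(2) by blast
qed

context
fixes T P W :: "'a::complex_banach cop"
assumes sp: "split_op T P W"
begin

lemma split_op_apply:
"app P (app P x) = app P x" "app P (app T x) = app T (app P x)" "app T (app W x) = x - app P x"
"app W (app T x) = x - app P x"
using sp[unfolded split_op_def] app_one app_simps1 app_mult by metis+

lemma split_op_range: "app T ` rg P <= rg P"
proof (intro image_subsetI)
fix x assume "x : rg P"
then obtain y where "x = app P y" by blast
hence "app T x = app P (app T y)" by (simp add: split_op_apply(2))
thus "app T x : rg P" by blast
qed

lemma split_op_power: "app P (app (T ^ n) x) = app (T ^ n) (app P x)"
and split_op_power_on: "app P x = x ==> app ((T * P) ^ n) x = app (T ^ n) x"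
proof (induction n)
case (Suc n)
{
 case 1
 show ?case using Suc(1) by (simp add: app_mult split_op_apply)
next
 case 2
 have "app P (app (T ^ n) x) = app (T ^ n) x" using Suc(1) 2 by simp
 thus ?case using Suc(2)[OF 2] by (simp add: app_mult)
}
qed (simp_all add: app_one)

lemma asc_desc_of_findim:
assumes fin: "edim (pran (rg P) T n) < oo" shows "fin_asc UNIV T & fin_desc UNIV T"
proof -
let ?N = "rg P"
have N: "csubspace ?N" "app T ` ?N <= ?N"
 using csubspace_im[OF csubspace_UNIV] split_op_range by blast+
obtain k where k: "pran ?N T (Suc k) = pran ?N T k" "!!x. x : pran ?N T k ==> app T x = 0 ==> x = 0"
 by (rule findim_core[OF N fin]) (rule that)
have "x = 0" if x: "x : pran UNIV T k" "app T x = 0" for x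
proof -
 have "x = app P x" using split_op_apply(4)[of x] x(2) by simp
 moreover obtain y where "x = app (T ^ k) y" using x(1) by blast
 ultimately have "x = app (T ^ k) (app P y)" by (simp add: split_op_power)
 thus ?thesis using k(2) x(2) by blast
qed
moreover have "pran UNIV T k <= pran UNIV T (Suc k)"
proof
 fix x assume "x : pran UNIV T k"
 then obtain y where y: "x = app (T ^ k) y" by blast
 have "app (T ^ k) (app P y) : pran ?N T (Suc k)" unfolding k(1) by blast
 then obtain v where v: "app (T ^ k) (app P y) = app (T ^ Suc k) v" by blast
 have "x = app (T ^ k) (app P y) + app (T ^ k) (app T (app W y))"
  unfolding y split_op_apply(3) app_diff by simp
 hence "x = app (T ^ Suc k) (v + app W y)" unfolding v app_add by (simp only: power_Suc2 app_mult)
 thus "x : pran UNIV T (Suc k)" by blast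
qed
moreover have "pran UNIV T (Suc k) <= pran UNIV T k" by (rule power_image_antimono) simp_all
ultimately show ?thesis unfolding fin_asc_def fin_desc_def by blast
qed

lemma split_range_closed:
assumes "closed (pran UNIV T n)"
shows "ccsubspace (pran (rg P) T n)" "app T ` pran (rg P) T n <= pran (rg P) T n"
 "x : pran (rg P) T n ==> app P x = x" "app P ` pran UNIV T k = pran (rg P) T k"
proof -
let ?Z = "pran (rg P) T n"
show eq: "app P ` pran UNIV T k = pran (rg P) T k" for k
 by (simp add: image_image split_op_power)
have V: "ccsubspace (pran UNIV T n)"
 using assms csubspace_im[OF csubspace_UNIV] unfolding ccsubspace_def by blast
show fx: "app P x = x" if "x : ?Z" for x using that by (auto simp: split_op_power split_op_apply)
have "?Z = {x : pran UNIV T n. app (1 - P) x = 0}"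
proof (intro equalityI subsetI)
 fix x assume "x : {x : pran UNIV T n. app (1 - P) x = 0}"
 thus "x : ?Z" unfolding eq[symmetric] by (force simp: app_simps1 app_one)
next
 fix x assume x: "x : ?Z"
 hence "x : pran UNIV T n" by blast
 thus "x : {x : pran UNIV T n. app (1 - P) x = 0}" using fx[OF x] by (simp add: app_simps1(3) app_one)
qed
thus "ccsubspace ?Z" using ccsubspace_kernel[OF V] by simp
show "app T ` ?Z <= ?Z" unfolding power_image_comm by (rule power_image_antimono[OF split_op_range]) simp
qed

text \<open>On the closed subspace \<open>T^n N\<close> of the Riesz part the operator \<open>T\<close> is bounded below up to finite
  dimensions, and its powers are small up to finite rank; both can only be true in finite dimension.\<close>

lemma split_ubf_findim:
assumes R: "riesz (T * P)" and u: "ubf_at UNIV T n"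
shows "edim (pran (rg P) T n) < oo"
proof -
let ?Z = "pran (rg P) T n" let ?V = "pran UNIV T n"
have cl: "closed ?V" using u unfolding ubf_at_def by blast
note Z = split_range_closed[OF cl]
have V: "ccsubspace ?V"
 using cl csubspace_im[OF csubspace_UNIV] unfolding ccsubspace_def by blast
have "EX c>0. below_on ?V T c" using u unfolding ubf_at_def below_on_iff[OF V] power_image_comm by blast
then obtain c where c: "c > 0" "below_on ?V T c" by blast
have bZ: "below_on ?Z T c" by (rule below_on_subset[OF c(2) ccsubspaceD(1)[OF V] Z(1)]) auto
obtain K where K: "K > 0" "!!k. EX f. finrank f & norm ((T * P) ^ k - f) <= K * (c / 2) ^ k"
 by (rule riesz_power[OF R, of "c / 2"]) (use c(1) in simp, rule that)
obtain k where k: "K < 2 ^ k" using real_arch_pow[of 2 K] by auto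
obtain f where f: "finrank f" "norm ((T * P) ^ k - f) <= K * (c / 2) ^ k" using K(2) by blast
show ?thesis
proof (rule below_on_findim[OF below_on_power[OF bZ Z(1,2) less_imp_le[OF c(1)]] Z(1) f(1)])
 show "K * (c / 2) ^ k < c ^ k" using k c(1) by (simp add: power_divide field_simps)
 fix x assume x: "x : ?Z" "app f x = 0"
 have "norm (app ((T * P) ^ k - f) x) <= norm ((T * P) ^ k - f) * norm x" by (rule norm_app)
 also have "... <= K * (c / 2) ^ k * norm x" by (rule mult_right_mono[OF f(2)]) simp
 finally show "norm (app (T ^ k) x) <= K * (c / 2) ^ k * norm x"
  using x split_op_power_on[OF Z(3)[OF x(1)]] by (simp add: app_simps1)
qed
qed

text \<open>Up to a finite-dimensional space, \<open>T^j\<close> maps \<open>T^n N\<close> onto itself with controlled preimages; but it is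
  also close to an operator of finite rank. Hence \<open>T^n N\<close> is close to a finite-dimensional space.\<close>

lemma split_lbf_findim:
assumes R: "riesz (T * P)" and u: "lbf_at UNIV T n"
shows "edim (pran (rg P) T n) < oo"
proof -
let ?Z = "pran (rg P) T n" let ?V = "pran UNIV T n"
have cl: "closed ?V" and b: "beta ?V (app T) < oo" using u unfolding lbf_at_def by blast+
note Z = split_range_closed[OF cl]
note r = pow_range_facts[OF csubspace_UNIV subset_UNIV, where t=T]
have "ecodim (app P ` ?V) (app P ` pran UNIV T (Suc n)) <= ecodim ?V (pran UNIV T (Suc n))"
 by (rule ecodim_image_le[OF clinear_app r(1) r(1) r(3)])
hence "ecodim ?Z (app T ` ?Z) <= ecodim ?V (app T ` ?V)" unfolding Z(4) power_image_comm .
hence "beta ?Z (app T) < oo" using b unfolding beta_def by (rule finite_le)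
then obtain k where k: "k > 0" "onto_on ?Z T k" by (rule onto_on_of_beta[OF Z(1,2)])
obtain K where K: "K > 0" "!!j. EX f. finrank f & norm ((T * P) ^ j - f) <= K * (1 / (2 * k)) ^ j"
 by (rule riesz_power[OF R, of "1 / (2 * k)"]) (use k(1) in simp, rule that)
obtain j where j: "8 * K < 2 ^ j" using real_arch_pow[of 2 "8 * K"] by auto
obtain f where f: "finrank f" "norm ((T * P) ^ j - f) <= K * (1 / (2 * k)) ^ j" using K(2) by blast
have "onto_on ?Z (T ^ j) (k ^ j)" using k by (intro onto_on_power ccsubspaceD(1)[OF Z(1)]) auto
then obtain G where G: "csubspace G" "edim G < oo" "!!y. y : ?Z ==> EX x:?Z. EX g:G. y = app (T ^ j) x + g & norm x <= k ^ j * norm y"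
 unfolding onto_on_def by blast
have sf: "csubspace (rg f)" by (intro csubspace_im csubspace_UNIV)
show ?thesis
proof (rule near_findim[OF ccsubspaceD(1)[OF Z(1)]])
 show "edim (rg f + G) < oo" using f(1) G sf unfolding finrank_def by (intro edim_plus_finite)
 fix y assume "y : ?Z"
 then obtain x g where x: "x : ?Z" "g : G" "y = app (T ^ j) x + g" "norm x <= k ^ j * norm y" using G(3) by blast
 have "y - (app f x + g) = app ((T * P) ^ j - f) x"
  using x(3) split_op_power_on[OF Z(3)[OF x(1)]] by (simp add: app_simps1)
 hence "norm (y - (app f x + g)) <= norm ((T * P) ^ j - f) * norm x" by (simp only: norm_app)
 also have "... <= (K * (1 / (2 * k)) ^ j) * (k ^ j * norm y)"
  by (rule mult_mono[OF f(2) x(4)]) (use K(1) k(1) in simp_all)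
 also have "... = K / 2 ^ j * norm y" using k(1) by (simp add: power_divide power_mult_distrib)
 also have "... <= norm y / 8" using mult_right_mono[of "8 * K" "2 ^ j" "norm y"] j by (simp add: field_simps)
 finally show "EX h:rg f + G. norm (y - h) <= norm y / 8" using x(2) by (auto intro!: set_plus_intro bexI)
qed
qed

end

lemma GDRI_semi_B_Fredholm:
fixes T :: "'a::complex_banach cop"
assumes "GDRI (app T)" "ubf_at UNIV T n | lbf_at UNIV T n"
shows "fin_asc UNIV T & fin_desc UNIV T"
proof -
obtain P W where s: "split_op T P W" "riesz (T * P)" by (rule GDRI_split[OF assms(1)])
show ?thesis
 using asc_desc_of_findim[OF s(1)] split_ubf_findim[OF s] split_lbf_findim[OF s] assms(2) by blast
qed

lemma GDRI_semi_Fredholm: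
fixes T :: "'a::complex_banach cop"
assumes "GDRI (app T)" "ubf_at UNIV T 0 | lbf_at UNIV T 0"
shows "browder T"
proof -
have ad: "fin_asc UNIV T" "fin_desc UNIV T" using GDRI_semi_B_Fredholm[OF assms] by blast+
obtain n where n: "alpha_pow UNIV T n = 0" "beta_pow UNIV T n = 0"
 using ascent_eq_descent(2)[OF csubspace_UNIV subset_UNIV ad] by blast
have "min (alpha_pow UNIV T 0) (beta_pow UNIV T 0) < oo"
 using assms(2) ubf_lbf_at_min by blast
from index_tail[OF csubspace_UNIV subset_UNIV this le0[of n]]
have "fredholm_on UNIV T" unfolding fredholm_on_def zeroth n by auto
thus ?thesis using ad unfolding browder_def by blast
qed

text \<open>The commutator \<open>C\<close> maps into \<open>N(T)\<close> or vanishes on \<open>R(T)\<close>, so it has finite rank, and with it the remainder of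
  the division of \<open>T^n - (- R)^n\<close> by \<open>T + R\<close>. Hence \<open>T + R\<close> is upper semi-Fredholm, and the rest follows from its
  decomposition.\<close>

lemma browder_semi_comm_riesz_0:
fixes T R :: "'a::complex_banach cop"
assumes sc: "semi_comm T R" and R: "riesz R" and T: "browder T" and E: "GDRI (app (T + R))"
shows "browder (T + R)"
proof -
define C where "C = T * R - R * T"
have f: "edim {x. app T x = 0} < oo" "ecodim UNIV (rg T) < oo"
 using T unfolding browder_def fredholm_on_def alpha_def beta_def by simp_all
have sR: "csubspace (rg t)" for t :: "'a cop" by (intro csubspace_im csubspace_UNIV)
have fC: "finrank C" using sc unfolding semi_comm_def
proof
 assume "left_comm_on UNIV T R"
 hence "rg C <= {x. app T x = 0}" unfolding left_comm_on_def C_def by (auto simp only: app_mult)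
 thus "finrank C" unfolding finrank_def
  using csubspace_kernel_on[OF clinear_app csubspace_UNIV, of T]
  by (intro edim_subset_finite[OF _ sR _ f(1)]) simp_all
next
 assume "right_comm T R"
 hence CT: "C * T = 0" unfolding right_comm_def C_def by blast
 obtain G where G: "direct_sum (rg T) G UNIV" "edim G < oo"
  by (rule ecodim_finite_supplement[OF csubspace_UNIV sR subset_UNIV f(2)])
 note D = direct_sumD[OF G(1)]
 have "rg C <= app C ` G"
 proof (rule image_subsetI)
  fix x
  have "x : rg T + G" unfolding D(6) by simp
  then obtain y g where y: "g : G" "x = app T y + g" by (auto elim!: set_plus_elim)
  have "app C (app T y) = 0" using arg_cong[OF CT, of "%u. app u y"] by (simp only: app_mult app_simps1)
  thus "app C x : app C ` G" using y by (simp add: app_add)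
 qed
 thus "finrank C" unfolding finrank_def
  by (rule edim_subset_finite[OF csubspace_im[OF D(2)] sR])
   (rule finite_le[OF edim_image_le[OF clinear_app D(2)] G(2)])
qed
have rem: "finrank (left_rem T R n)" for n
proof (induction n)
 case (Suc n)
 show ?case unfolding left_rem_Suc C_def[symmetric]
  by (intro finrank_diff finrank_mult_left finrank_mult_right fC Suc)
qed simp
obtain c where c: "c > 0" "below_on UNIV T c" using T unfolding browder_def fredholm_UNIV_iff by blast
obtain n d where n: "d > 0" "below_on UNIV (T ^ n - (- R) ^ n) d"
 by (rule below_on_riesz_power[OF ccsubspace_UNIV subset_UNIV c(2,1) R]) (rule that)
have "below_on UNIV (left_quot T R n * (T + R)) (1 * d - 0)"
proof (rule below_on_perturb[OF n(2) ccsubspace_UNIV rem[of n]])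
 fix x assume "app (left_rem T R n) x = 0"
 thus "1 * norm (app (T ^ n - (- R) ^ n) x) <= norm (app (left_quot T R n * (T + R)) x) + 0 * norm x"
  unfolding left_rem_def app_simps1(3)[of "_ * _"] by simp
qed simp
hence "EX c>0. below_on UNIV (T + R) c" using below_on_factor[of UNIV "left_quot T R n" "T + R" d] n(1) by simp
hence "ubf_at UNIV (T + R) 0" unfolding ubf_at_0_UNIV .
thus ?thesis using GDRI_semi_Fredholm[OF E] by blast
qed

section \<open>Nilpotent perturbations\<close>

text \<open>In the case \<open>CT = CR = 0\<close> the kernel of \<open>C\<close> contains both ranges, and \<open>C\<close> is zero on it; in the other case
  the whole space will do.\<close>

lemma semi_comm_reduce:
fixes T R :: "'a::complex_banach cop"
assumes "semi_comm T R"
obtains Y where "ccsubspace Y" "left_comm_on Y T R" "!!x. app T x : Y" "!!x. app R x : Y"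
using assms unfolding semi_comm_def
proof
assume "left_comm_on UNIV T R"
thus thesis by (intro that[of UNIV]) simp_all
next
assume rc: "right_comm T R"
define C where "C = T * R - R * T"
have C: "C * T = 0" "C * R = 0" using rc unfolding right_comm_def C_def by simp_all
have z: "app C (app T x) = 0" "app C (app R x) = 0" for x
 using C by (metis app_mult app_simps1(1))+
show thesis
proof (rule that)
 show "ccsubspace (ker UNIV C)" by (rule ccsubspace_kernel[OF ccsubspace_UNIV])
 show "left_comm_on (ker UNIV C) T R" unfolding left_comm_on_def C_def[symmetric] by (simp add: app_mult)
qed (simp_all add: z)
qed

lemma power_zero_above: "app (R ^ d) x = 0 ==> d <= n ==> app (R ^ n) x = 0"
using app_mult[of "R ^ (n - d)" "R ^ d" x] by (simp add: power_add[symmetric])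

text \<open>Expand \<open>(A + R)^k\<close>. Moving the factors \<open>R\<close> to the right produces terms with a commutator \<open>C\<close>, which is killed by
  further factors \<open>R\<close> on its left and otherwise stands after a power of \<open>A\<close>.\<close>

lemma power_of_sum_mem:
fixes A R :: "'a::complex_banach cop"
assumes V: "csubspace V" "app A ` V <= V" "app R ` V <= V"
 and RC: "!!y. y : V ==> app R (app (A * R - R * A) y) = 0"
 and Z: "csubspace Z" "!!a y. y : V ==> app (A ^ a) (app (A * R - R * A) y) : Z"
 and x: "x : V" "!!a b. a + b = k ==> app (A ^ a) (app (R ^ b) x) : Z"
shows "app ((A + R) ^ k) x : Z"
using x
proof (induction k arbitrary: x)
case 0
from 0(2)[of 0 0] show ?case by (simp add: app_one)
next
case (Suc k)
define C where "C = A * R - R * A"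
have RA: "app R (app A y) = app A (app R y) - app C y" for y unfolding C_def by (simp add: app_simps1 app_mult)
have swap: "EX y:V. app (R ^ b) (app A x) = app A (app (R ^ b) x) - app C y" if "x : V" for b x
 using that
proof (induction b arbitrary: x)
 case 0
 thus ?case using csubspace_0[OF V(1)] by (intro bexI[of _ 0]) (simp_all add: app_one)
next
 case (Suc b)
 have Rx: "app R x : V" using Suc.prems V(3) by blast
 obtain y where y: "y : V" "app (R ^ b) (app A (app R x)) = app A (app (R ^ b) (app R x)) - app C y"
  using Suc.IH[OF Rx] by blast
 have e: "app (R ^ Suc b) (app A x) = app A (app (R ^ Suc b) x) - (app C y + app (R ^ b) (app C x))"
  unfolding power_Suc2 app_mult RA app_diff y(2) by (simp add: algebra_simps)
 show ?case
 proof (cases b)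
  case 0
  thus ?thesis using e csubspace_add[OF V(1) y(1) Suc.prems] by (intro bexI[of _ "y + x"]) (simp_all add: app_one app_add)
 next
  case (Suc c)
  hence "app (R ^ b) (app C x) = 0" using RC[OF Suc.prems] by (simp only: power_Suc2 app_mult C_def) simp
  thus ?thesis using e y(1) by (intro bexI[of _ y]) simp_all
 qed
qed
let ?x = "app A x + app R x"
have xV: "?x : V" using Suc.prems(1) V by (intro csubspace_add) auto
have "app (A ^ a) (app (R ^ b) ?x) : Z" if ab: "a + b = k" for a b
proof -
 obtain y where y: "y : V" "app (R ^ b) (app A x) = app A (app (R ^ b) x) - app C y" using swap[OF Suc.prems(1)] by blast
 have "app (A ^ a) (app (R ^ b) ?x) =
   app (A ^ Suc a) (app (R ^ b) x) - app (A ^ a) (app C y) + app (A ^ a) (app (R ^ Suc b) x)"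
  unfolding app_add y(2) app_diff by (simp only: power_Suc2 app_mult)
 also have "... : Z"
  using Suc.prems(2)[of "Suc a" b] Suc.prems(2)[of a "Suc b"] Z(2)[OF y(1), of a] ab
  unfolding C_def by (intro csubspace_add[OF Z(1)] csubspace_diff[OF Z(1)]) auto
 finally show ?thesis .
qed
from Suc.IH[OF xV this] show ?case by (simp only: power_Suc2 app_mult app_simps1(2))
qed

lemma fin_asc_desc_subspace:
assumes Y: "csubspace Y" "!!x. app T x : Y"
shows "fin_asc UNIV T <-> fin_asc Y T" "fin_desc UNIV T <-> fin_desc Y T"
proof -
have TY: "app T ` Y <= Y" using Y(2) by blast
have 1: "pran UNIV T (Suc n) <= pran Y T n" for n
 using Y(2) by (auto simp only: power_Suc2 app_mult)
have 2: "pran Y T n <= pran UNIV T n" for n by blast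
have stable: "pran V T (j + n) = pran V T n" if "pran V T (Suc n) = pran V T n" for V n j
proof (induction j)
 case (Suc j)
 have "pran V T (Suc j + n) = app T ` pran V T (j + n)" by (simp only: add_Suc power_image_comm)
 thus ?case using that unfolding Suc power_image_comm by simp
qed simp
show "fin_asc UNIV T <-> fin_asc Y T"
proof
 assume "fin_asc UNIV T"
 then obtain n where "ALL x:pran UNIV T n. app T x = 0 --> x = 0" unfolding fin_asc_def ..
 thus "fin_asc Y T" unfolding fin_asc_def by (intro exI[of _ n] ballI) (rule bspec, assumption, rule subsetD[OF 2])
next
 assume "fin_asc Y T"
 then obtain n where "ALL x:pran Y T n. app T x = 0 --> x = 0" unfolding fin_asc_def ..
 thus "fin_asc UNIV T" unfolding fin_asc_def by (intro exI[of _ "Suc n"] ballI) (rule bspec, assumption, rule subsetD[OF 1])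
qed
show "fin_desc UNIV T <-> fin_desc Y T"
proof
 assume "fin_desc UNIV T"
 then obtain n where n: "pran UNIV T (Suc n) = pran UNIV T n" unfolding fin_desc_def by blast
 have "pran Y T n <= pran UNIV T n" by blast
 also have "... = pran UNIV T (Suc (Suc n))" using stable[OF n, of 2] by simp
 also have "... <= pran Y T (Suc n)" by (rule 1)
 finally have "pran Y T (Suc n) = pran Y T n" using power_image_antimono[OF TY, of n "Suc n"] by auto
 thus "fin_desc Y T" unfolding fin_desc_def by blast
next
 assume "fin_desc Y T"
 then obtain n where n: "pran Y T (Suc n) = pran Y T n" unfolding fin_desc_def by blast
 have "pran UNIV T (Suc n) <= pran Y T n" by (rule 1)
 also have "... = pran Y T (Suc (Suc n))" using stable[OF n, of 2] by simp
 also have "... <= pran UNIV T (Suc (Suc n))" by (rule 2)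
 finally have "pran UNIV T (Suc (Suc n)) = pran UNIV T (Suc n)"
  using power_image_antimono[of T UNIV "Suc n" "Suc (Suc n)"] by auto
 thus "fin_desc UNIV T" unfolding fin_desc_def by blast
qed
qed

text \<open>Here \<open>l = 0\<close> is admitted: the comparison of \<open>A = T - l\<close> with \<open>S = A + R\<close> modulo the common
  kernel of \<open>T\<close> and \<open>R\<close> is the same at zero and away from it.\<close>

locale nilpotent_shift = shifted +
fixes d :: nat and Y :: "'a::complex_banach set"
assumes cY: "ccsubspace Y" and TY: "app T ` Y <= Y" and RY: "app R ` Y <= Y"
 and lc: "left_comm_on Y T R" and Rd: "R ^ d = 0"
begin

abbreviation "S == A + R"
abbreviation "common_ker == {x : (ker Y T). app R x = 0}"

lemma sY: "csubspace Y" by (rule ccsubspaceD(1)[OF cY])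

lemma AY: "app A ` Y <= Y" by (rule minus_scalar_maps[OF sY TY])

lemma SY: "app S ` Y <= Y"
using AY RY csubspace_add[OF sY] by (auto simp only: app_simps1(2) image_subset_iff)

lemma neg_Rd: "(- R) ^ d = 0"
using scaleC_power[of "- 1" R d] Rd by simp

lemma nilpotent_shift_add: "nilpotent_shift (T + R) (- R) d Y"
proof (unfold_locales)
show "ccsubspace Y" by (rule cY)
show "app (T + R) ` Y <= Y" using TY RY csubspace_add[OF sY] by (auto simp only: app_simps1(2) image_subset_iff)
show "app (- R) ` Y <= Y" using RY csubspace_neg[OF sY] by (auto simp only: app_simps1(4) image_subset_iff)
show "left_comm_on Y (T + R) (- R)" by (rule left_comm_on_add[OF lc])
show "(- R) ^ d = 0" by (rule neg_Rd)
qed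

lemma nilpotent_shift_scale: "nilpotent_shift T (s *: R) d Y"
proof (unfold_locales)
show "app (s *: R) ` Y <= Y" using RY csubspace_scale[OF sY] by (auto simp only: app_scaleC_left image_subset_iff)
show "left_comm_on Y T (s *: R)" by (rule left_comm_on_scale[OF lc])
show "(s *: R) ^ d = 0" using Rd by (simp add: scaleC_power)
qed (rule cY TY)+

lemma sum_shifts: "T + R -. l = S" "S + (- R) = A"
by simp_all

lemma ker_sub: "csubspace common_ker"
by (intro csubspace_kernel_on[OF clinear_app] sY)

lemma ker_pow: "x : common_ker ==> app (A ^ j) x = (- l) ^ j *: x" "x : common_ker ==> app (S ^ j) x = (- l) ^ j *: x"
using A_kernel[of x j] shifted.A_kernel[of "T + R" x l j]
by (simp_all add: sum_shifts(1) app_simps1(2))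

lemma ker_pow_mem: assumes "x : common_ker"
shows "app (A ^ j) x : common_ker" "app (S ^ j) x : common_ker"
unfolding ker_pow[OF assms] using csubspace_scale[OF ker_sub assms] by blast+

lemma C_ker: "x : Y ==> app C x : common_ker"
proof -
assume x: "x : Y"
have "app C x : Y" using x TY RY csubspace_diff[OF sY] by (simp only: app_simps1(3) app_mult) blast
thus ?thesis using lc x unfolding left_comm_on_def by (simp only: app_mult) blast
qed

lemma AR_swap: "x : Y ==> app (A ^ n) (app R x) - app R (app (A ^ n) x) : common_ker"
proof (induction n)
case 0
thus ?case using csubspace_0[OF ker_sub] by (simp add: app_one)
next
case (Suc n)
have y: "app (A ^ n) x : Y" using power_image_subset[OF AY] Suc.prems by blast
have AR: "app A (app R z) = app R (app A z) + app C z" for z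
 using arg_cong[OF C_A, of "%u. app u z"] by (simp only: app_simps1(3) app_mult) (simp add: algebra_simps)
have "app (A ^ Suc n) (app R x) - app R (app (A ^ Suc n) x) =
  app A (app (A ^ n) (app R x) - app R (app (A ^ n) x)) + app C (app (A ^ n) x)"
 unfolding app_diff AR by (simp only: power_Suc app_mult) simp
also have "... : common_ker"
 using ker_pow_mem(1)[OF Suc.IH[OF Suc.prems], of 1] C_ker[OF y] by (intro csubspace_add[OF ker_sub]) (simp_all only: power_one_right)
finally show ?case .
qed

lemma AS_swap: "x : Y ==> app (A ^ n) (app (S ^ k) x) - app (S ^ k) (app (A ^ n) x) : common_ker"
proof (induction k)
case 0
thus ?case using csubspace_0[OF ker_sub] by (simp add: app_one)
next
case (Suc k)
define y where "y = app (S ^ k) x"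
have y: "y : Y" using power_image_subset[OF SY] Suc.prems unfolding y_def by blast
have "app (A ^ n) (app A y) = app A (app (A ^ n) y)" by (simp only: app_mult[symmetric] power_commutes)
hence e: "app (A ^ n) (app S y) - app S (app (A ^ n) y) = app (A ^ n) (app R y) - app R (app (A ^ n) y)"
 by (simp only: app_simps1(2) app_add) simp
have "app (A ^ n) (app (S ^ Suc k) x) - app (S ^ Suc k) (app (A ^ n) x) =
  (app (A ^ n) (app S y) - app S (app (A ^ n) y)) + app S (app (A ^ n) y - app (S ^ k) (app (A ^ n) x))"
 unfolding app_diff[of S] y_def by (simp only: power_Suc app_mult) simp
also have "... : common_ker"
 unfolding e using AR_swap[OF y] ker_pow_mem(2)[OF Suc.IH[OF Suc.prems], of 1] unfolding y_def
 by (intro csubspace_add[OF ker_sub]) (simp_all only: power_one_right)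
finally show ?case .
qed

text \<open>In the expansion of \<open>(A + R)^(n + d) x\<close> every term has at least \<open>d\<close> factors \<open>R\<close>, and is zero, or more than \<open>n\<close>
  factors \<open>A\<close>. The same count gives \<open>range_transfer\<close>.\<close>

lemma kernel_transfer:
assumes x: "x : Y" "app (A ^ n) x : common_ker" shows "app (S ^ (n + d)) x : common_ker"
proof (rule power_of_sum_mem[OF sY AY RY _ ker_sub _ x(1)])
show "app R (app (A * R - R * A) y) = 0" if "y : Y" for y unfolding C_A using C_ker[OF that] by blast
show "app (A ^ a) (app (A * R - R * A) y) : common_ker" if "y : Y" for a y
 unfolding C_A by (rule ker_pow_mem(1)[OF C_ker[OF that]])
let ?N = "{x : Y. app (A ^ n) x : common_ker}"
have inv: "app R ` ?N <= ?N"
proof (rule image_subsetI)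
 fix z assume z: "z : ?N"
 hence "app R (app (A ^ n) z) = 0" by blast
 hence "app (A ^ n) (app R z) : common_ker" using AR_swap[of z n] z by simp
 thus "app R z : ?N" using z RY by blast
qed
fix a b assume ab: "a + b = n + d"
show "app (A ^ a) (app (R ^ b) x) : common_ker"
proof (cases "d <= b")
 case True
 have "app (R ^ b) x = 0" by (rule power_zero_above[OF _ True]) (simp add: Rd app_simps1)
 thus ?thesis using csubspace_0[OF ker_sub] by simp
next
 case False
 hence i: "a = (a - n) + n" using ab by linarith
 have "app (R ^ b) x : ?N" using power_image_subset[OF inv] x by blast
 hence "app (A ^ (a - n + n)) (app (R ^ b) x) : common_ker" unfolding power_add app_mult using ker_pow_mem(1) by blast
 thus ?thesis using i by simp
qed
qed

lemma range_transfer: "n + d <= m ==> pran Y S m <= pran Y A n + common_ker"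
proof (rule image_subsetI)
let ?Z = "pran Y A n + common_ker"
fix x assume m: "n + d <= m" and x: "x : Y"
have sR: "csubspace (pran Y A n)" by (rule csubspace_im[OF sY])
have Z: "csubspace ?Z" by (rule csubspace_plus[OF sR ker_sub])
have KZ: "z : ?Z" if "z : common_ker" for z using set_plus_intro[OF csubspace_0[OF sR] that] by simp
show "app (S ^ m) x : ?Z"
proof (rule power_of_sum_mem[OF sY AY RY _ Z _ x])
 show "app R (app (A * R - R * A) y) = 0" if "y : Y" for y unfolding C_A using C_ker[OF that] by blast
 show "app (A ^ a) (app (A * R - R * A) y) : ?Z" if "y : Y" for a y
  unfolding C_A by (rule KZ[OF ker_pow_mem(1)[OF C_ker[OF that]]])
 fix a b assume ab: "a + b = m"
 show "app (A ^ a) (app (R ^ b) x) : ?Z"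
 proof (cases "d <= b")
  case True
  have "app (R ^ b) x = 0" by (rule power_zero_above[OF _ True]) (simp add: Rd app_simps1)
  thus ?thesis using csubspace_0[OF Z] by simp
 next
  case False
  have "app (R ^ b) x : Y" by (rule subsetD[OF power_image_subset[OF RY] imageI[OF x]])
  moreover have "n <= a" using False ab m by simp
  ultimately have "app (A ^ a) (app (R ^ b) x) : pran Y A n" by (intro subsetD[OF power_image_antimono[OF AY] imageI])
  from set_plus_intro[OF this csubspace_0[OF ker_sub]] show ?thesis by simp
 qed
qed
qed

lemma back_transfer:
"x : Y ==> app (S ^ n) x : common_ker ==> app (A ^ (n + d)) x : common_ker"
"n + d <= m ==> pran Y A m <= pran Y S n + common_ker"
proof -
interpret N: nilpotent_shift "T + R" "- R" l d Y by (rule nilpotent_shift_add)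
have k: "N.common_ker = common_ker" by (auto simp: app_simps1)
show "x : Y ==> app (S ^ n) x : common_ker ==> app (A ^ (n + d)) x : common_ker"
 "n + d <= m ==> pran Y A m <= pran Y S n + common_ker"
 using N.kernel_transfer[unfolded k sum_shifts] N.range_transfer[unfolded k sum_shifts] by blast+
qed

text \<open>A vector \<open>x = S^(n + d + 1) y\<close> in the kernel of \<open>S\<close> is carried to \<open>A\<close>, where finite ascent lowers the exponent
  to \<open>n\<close>, and back. So \<open>S^(n + d) y\<close> is in the common kernel, on which \<open>S\<close> is \<open>- l\<close>.\<close>

lemma fin_asc_transfer:
assumes a: "fin_asc Y A" shows "fin_asc Y S"
proof -
obtain n where n: "!!x. x : pran Y A n ==> app A x = 0 ==> x = 0" using a unfolding fin_asc_def by blast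
have st: "app (A ^ n) x = 0" if "x : Y" "app (A ^ (i + n)) x = 0" for i x
 using that
proof (induction i)
 case (Suc i)
 have "app (A ^ (i + n)) x : pran Y A n" using Suc.prems(1) power_image_antimono[OF AY, of n "i + n"] by auto
 moreover have "app A (app (A ^ (i + n)) x) = 0" using Suc.prems(2) by (simp only: add_Suc power_Suc app_mult)
 ultimately show ?case using Suc n by blast
qed simp
have down: "app (A ^ n) x : common_ker" if x: "x : Y" "app (A ^ (i + n)) x : common_ker" for i x
proof (cases "l = 0")
 case True
 have "app (A ^ (Suc i + n)) x = - l *: app (A ^ (i + n)) x"
  using ker_pow(1)[OF x(2), of 1] by (simp add: app_mult)
 hence "app (A ^ n) x = 0" using True st[OF x(1), of "Suc i"] by simp
 thus ?thesis using csubspace_0[OF ker_sub] by simp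
next
 case False
 define z where "z = inverse ((- l) ^ (i + n)) *: app (A ^ (i + n)) x"
 have z: "z : common_ker" unfolding z_def by (rule csubspace_scale[OF ker_sub x(2)])
 have "app (A ^ (i + n)) z = app (A ^ (i + n)) x" unfolding ker_pow(1)[OF z] using False by (simp add: z_def scaleC_scaleC)
 hence "app (A ^ n) (x - z) = 0" using z x(1) by (intro st[of _ i] csubspace_diff[OF sY]) (simp_all add: app_diff)
 thus ?thesis using ker_pow_mem(1)[OF z, of n] by (simp add: app_diff)
qed
have "x = 0" if x: "x : pran Y S (Suc (n + d))" "app S x = 0" for x
proof -
 obtain y where y: "y : Y" "x = app (S ^ Suc (n + d)) y" using x(1) by blast
 have "app (S ^ Suc (Suc (n + d))) y : common_ker"
  using x(2) csubspace_0[OF ker_sub] unfolding y(2) by (simp only: power_Suc[of S "Suc (n + d)"] app_mult)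
 hence "app (A ^ (Suc (Suc (n + d)) + d)) y : common_ker" by (rule back_transfer(1)[OF y(1)])
 moreover have e: "Suc (Suc (n + d)) + d = Suc (Suc (d + d)) + n" by simp
 ultimately have "app (A ^ n) y : common_ker" unfolding e by (intro down[OF y(1)])
 hence k: "app (S ^ (n + d)) y : common_ker" by (rule kernel_transfer[OF y(1)])
 have xs: "x = - l *: app (S ^ (n + d)) y" using ker_pow(2)[OF k, of 1] unfolding y(2) by (simp add: app_mult)
 have "- l *: x = 0" using ker_pow(2)[OF csubspace_scale[OF ker_sub k, of "- l"], of 1] x(2) unfolding xs by simp
 thus "x = 0" using xs by auto
qed
thus ?thesis unfolding fin_asc_def by blast
qed

lemma fin_desc_transfer:
assumes a: "fin_desc Y A" shows "fin_desc Y S"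
proof -
obtain q where q: "pran Y A (Suc q) = pran Y A q" using a unfolding fin_desc_def by blast
have st: "pran Y A (j + q) = pran Y A q" for j
proof (induction j)
 case (Suc j)
 have "pran Y A (Suc j + q) = app A ` pran Y A (j + q)" by (simp only: add_Suc power_image_comm)
 thus ?case using q unfolding Suc power_image_comm by simp
qed simp
let ?m = "q + d"
have SK: "app S z : pran Y S j" if z: "z : common_ker" for z j
proof (cases "l = 0")
 case True
 thus ?thesis using ker_pow(2)[OF z, of 1] csubspace_0[OF csubspace_im[OF sY]] by simp
next
 case False
 let ?z = "inverse ((- l) ^ j) *: (- l) *: z"
 have k: "?z : common_ker" by (intro csubspace_scale[OF ker_sub] z)
 have "app S z = app (S ^ j) ?z" using ker_pow(2)[OF z, of 1] False unfolding ker_pow(2)[OF k] by (simp add: scaleC_scaleC)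
 thus ?thesis using k by blast
qed
have "pran Y S (Suc ?m) <= pran Y S (Suc (Suc ?m))"
proof (rule image_subsetI)
 fix y assume y: "y : Y"
 have "pran Y S ?m <= pran Y A ((Suc ?m + d) + q) + common_ker" unfolding st by (rule range_transfer) simp
 also have "... <= (pran Y S (Suc ?m) + common_ker) + common_ker" by (intro set_plus_mono2 back_transfer(2) subset_refl) simp
 finally have "app (S ^ ?m) y : (pran Y S (Suc ?m) + common_ker) + common_ker" using imageI[OF y] by (rule subsetD)
 then obtain v k' where v: "app (S ^ ?m) y = v + k'" "v : pran Y S (Suc ?m) + common_ker" "k' : common_ker" by (rule set_plus_elim)
 from v(2) obtain w k where w: "v = w + k" "w : pran Y S (Suc ?m)" "k : common_ker" by (rule set_plus_elim)
 from w(2) obtain u where "u : Y" "w = app (S ^ Suc ?m) u" by (rule imageE)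
 hence u: "u : Y" "k : common_ker" "k' : common_ker" "app (S ^ ?m) y = app (S ^ Suc ?m) u + k + k'" using v w by simp_all
 have "app (S ^ Suc ?m) y = app (S ^ Suc (Suc ?m)) u + app S k + app S k'"
  by (simp only: power_Suc[of S ?m] power_Suc[of S "Suc ?m"] app_mult[of S] u(4)) (simp only: app_add)
 also have "... : pran Y S (Suc (Suc ?m))" by (intro csubspace_add[OF csubspace_im[OF sY]] imageI SK u(1-3))
 finally show "app (S ^ Suc ?m) y : pran Y S (Suc (Suc ?m))" .
qed
hence "pran Y S (Suc (Suc ?m)) = pran Y S (Suc ?m)" by (intro subset_antisym[OF power_image_antimono[OF SY]]) simp_all
thus ?thesis unfolding fin_desc_def by blast
qed

end

lemma asc_desc_nilpotent:
fixes T R :: "'a::complex_banach cop"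
assumes sc: "semi_comm T R" and R: "R ^ d = 0" and T: "fin_asc UNIV T" "fin_desc UNIV T"
shows "fin_asc UNIV (T + R) & fin_desc UNIV (T + R)"
proof -
obtain Y where Y: "ccsubspace Y" "left_comm_on Y T R" "!!x. app T x : Y" "!!x. app R x : Y"
 by (rule semi_comm_reduce[OF sc]) (rule that)
note sY = ccsubspaceD(1)[OF Y(1)]
interpret nilpotent_shift T R 0 d Y by unfold_locales (use Y R in auto)
have E: "app (T + R) x : Y" for x unfolding app_simps1(2) by (intro csubspace_add[OF sY] Y)
show ?thesis
 using T fin_asc_transfer fin_desc_transfer
 unfolding fin_asc_desc_subspace[OF sY Y(3)] fin_asc_desc_subspace[OF sY E] by simp
qed

text \<open>If \<open>l \<noteq> 0\<close>, the common kernel lies in the ranges of all powers of \<open>A\<close> and \<open>S\<close>, which makes the comparison of ranges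
  exact.\<close>

locale nonzero_nilpotent_shift = nilpotent_shift + nonzero_shifted
begin

lemma ker_preimage: assumes x: "x : common_ker"
obtains y where "y : common_ker" "app (A ^ j) y = x" "app (S ^ j) y = x"
proof -
have y: "inverse ((- l) ^ j) *: x : common_ker" by (rule csubspace_scale[OF ker_sub x])
show thesis by (rule that[OF y]) (use l0 in "simp_all add: ker_pow[OF y] scaleC_scaleC")
qed

lemma ker_in_ranges: assumes x: "x : common_ker"
shows "x : pran Y A j" "x : pran Y S j"
using ker_preimage[OF x, of j] by (metis (no_types, lifting) imageI mem_Collect_eq)+

lemma S_range_sub: "n + d <= m ==> pran Y S m <= pran Y A n"
by (rule subset_trans[OF range_transfer plus_least[OF csubspace_im[OF sY] order_refl]], assumption)
 (rule subsetI, rule ker_in_ranges(1))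

lemma nonzero_nilpotent_shift_scale: "nonzero_nilpotent_shift T (s *: R) l d Y"
by (intro nonzero_nilpotent_shift.intro nilpotent_shift_scale nonzero_shifted_axioms)

lemma A_range_invariant:
shows "csubspace (pran Y A n)" "pran Y A n <= Y" "app T ` pran Y A n <= pran Y A n" "app R ` pran Y A n <= pran Y A n"
 "app A ` pran Y A n <= pran Y A n" "app S ` pran Y A n <= pran Y A n"
 "left_comm_on (pran Y A n) T R"
proof -
let ?V = "pran Y A n"
note r = pow_range_facts[OF sY AY]
show sV: "csubspace ?V" and VY: "?V <= Y" by (rule r(1), rule r(4))
show AV: "app A ` ?V <= ?V" using r(2,3) by simp
have T: "app T x = app A x + l *: x" for x by (simp add: app_simps)
show "app T ` ?V <= ?V"
 unfolding image_subset_iff T by (intro ballI csubspace_add[OF sV] csubspace_scale[OF sV] subsetD[OF AV imageI])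
show RV: "app R ` ?V <= ?V"
proof (rule image_subsetI)
 fix v assume "v : ?V"
 then obtain x where x: "x : Y" "v = app (A ^ n) x" by blast
 have "app (A ^ n) (app R x) : ?V" using RY x(1) by blast
 from csubspace_diff[OF sV this ker_in_ranges(1)[OF AR_swap[OF x(1), of n]]] show "app R v : ?V"
  unfolding x(2) diff_diff_eq2 by (simp only: add_diff_cancel_left')
qed
show "app S ` ?V <= ?V"
 unfolding image_subset_iff app_simps1(2) by (intro ballI csubspace_add[OF sV] subsetD[OF AV imageI] subsetD[OF RV imageI])
show "left_comm_on ?V T R" using lc VY unfolding left_comm_on_def by blast
qed

lemma B_eq: "B (Suc d) = A ^ Suc d"
using neg_Rd by simp

lemma below_S:
assumes V: "ccsubspace (pran Y A n)" and b: "below_on (pran Y A n) A c" "c > 0"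
shows "EX c>0. below_on (pran Y A n) S c"
proof (rule below_left[OF V A_range_invariant(3,4,7)])
show "below_on (pran Y A n) (B (Suc d)) (c ^ Suc d)"
 unfolding B_eq by (rule below_on_power[OF b(1) V A_range_invariant(5)]) (use b(2) in simp)
qed (use b(2) in simp_all)

lemma beta_S:
assumes V: "ccsubspace (pran Y A n)" and b: "beta_pow Y A n < oo"
shows "beta (pran Y A n) (app S) < oo"
proof (rule beta_left[OF A_range_invariant(1,3,4,7)])
obtain k where k: "k > 0" "onto_on (pran Y A n) A k" by (rule onto_on_of_beta[OF V A_range_invariant(5) b])
have "onto_on (pran Y A n) (A ^ Suc d) (k ^ Suc d)" using k by (intro onto_on_power A_range_invariant(1)) auto
thus "beta (pran Y A n) (app (B (Suc d))) < oo"
 unfolding B_eq by (intro beta_of_onto_on[OF A_range_invariant(1) power_image_subset[OF A_range_invariant(5)]])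
qed simp

text \<open>On \<open>V = A^n Y\<close> both \<open>A\<close> and \<open>S\<close> are upper semi-Fredholm, and \<open>U = S^k Y\<close> is contained in \<open>V\<close> for \<open>k \<ge> n + d\<close>. A
  vector \<open>x\<close> of \<open>V\<close> with \<open>A^n x\<close> in the closed \<open>S^k V\<close> differs from an element of \<open>U\<close> by a vector of
  \<open>V\<close> in the finite-dimensional kernel of \<open>A^n\<close>; so \<open>U\<close> has finite codimension in a closed subspace.\<close>

lemma ubf_transfer:
assumes u: "ubf_at Y A n" shows "ubf_at Y S (n + d)"
proof -
let ?V = "pran Y A n"
note I = A_range_invariant and r = pow_range_facts[OF sY SY]
have V: "ccsubspace ?V" using u I(1) unfolding ubf_at_def ccsubspace_def by blast
have "EX c>0. below_on ?V A c" using u unfolding below_on_iff[OF V] ubf_at_def power_image_comm by blast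
then obtain c b where c: "c > 0" "below_on ?V A c" and b: "b > 0" "below_on ?V S b" using below_S[OF V] by blast
have aS: "alpha ?V (app S) < oo" using b below_on_iff[OF V] by blast
have "below_on ?V (A ^ n) (c ^ n)" using c by (intro below_on_power V I(5)) auto
hence fF: "edim (ker ?V (A ^ n)) < oo"
 using below_on_iff[OF V, of "A ^ n"] c(1) unfolding alpha_def by (metis zero_less_power)
have cS: "closed (pran ?V S k)" for k
 using below_on_power[OF b(2) V I(6), of k] b(1) below_on_iff[OF V, of "S ^ k"] by (metis less_imp_le zero_less_power)
have cl: "closed (pran Y S k)" if k: "n + d <= k" for k
proof -
 let ?U = "pran Y S k" and ?F = "ker ?V (A ^ n)" and ?P = "{x : Y. app (A ^ n) x : pran ?V S k}"
 have UV: "?U <= ?V" by (rule S_range_sub[OF k])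
 have sSV: "csubspace (pran ?V S k)" by (rule csubspace_im[OF I(1)])
 have KSV: "x : pran ?V S k" if x: "x : common_ker" for x
 proof -
  obtain y where y: "y : common_ker" "app (S ^ k) y = x" by (rule ker_preimage[OF x]) (rule that)
  thus ?thesis using ker_in_ranges(1)[OF y(1)] by blast
 qed
 have cP: "ccsubspace ?P" using cS sSV by (intro ccsubspace_vimage_on cY) (simp add: ccsubspace_def)
 have UP: "?U <= ?P"
 proof (rule image_subsetI)
  fix x assume x: "x : Y"
  have "app (S ^ k) (app (A ^ n) x) : pran ?V S k" using x by blast
  from csubspace_add[OF sSV this KSV[OF AS_swap[OF x, of n k]]]
  have "app (A ^ n) (app (S ^ k) x) : pran ?V S k" by (simp only: add_diff_eq add_diff_cancel_left')
  thus "app (S ^ k) x : ?P" using power_image_subset[OF SY, of k] x by auto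
 qed
 have M: "ccsubspace (?P Int ?V)" by (rule ccsubspace_Int[OF cP V])
 have UM: "?U <= ?P Int ?V" by (rule Int_greatest[OF UP UV])
 have sub: "?P Int ?V <= ?U + ?F"
 proof
  fix x assume "x : ?P Int ?V"
  hence x: "x : Y" "x : ?V" "app (A ^ n) x : pran ?V S k" by blast+
  then obtain y where y: "y : Y" "app (A ^ n) x = app (S ^ k) (app (A ^ n) y)" by blast
  have "- (app (A ^ n) (app (S ^ k) y) - app (S ^ k) (app (A ^ n) y)) : common_ker"
   by (rule csubspace_neg[OF ker_sub AS_swap[OF y(1)]])
  then obtain z where z: "z : common_ker" "app (A ^ n) z = - (app (A ^ n) (app (S ^ k) y) - app (S ^ k) (app (A ^ n) y))"
   by (rule ker_preimage) (rule that)
  let ?s = "app (S ^ k) y + z"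
  have s: "?s : ?U" using y(1) ker_in_ranges(2)[OF z(1)] by (intro csubspace_add[OF r(1)]) auto
  have "app (A ^ n) (x - ?s) = 0" unfolding app_diff app_add z(2) y(2) by simp
  moreover have "x - ?s : ?V" using x(2) s UV by (intro csubspace_diff[OF I(1)]) auto
  ultimately have "x - ?s : ?F" by blast
  from set_plus_intro[OF s this] show "x : ?U + ?F" by simp
 qed
 have sF: "csubspace ?F" by (rule csubspace_kernel_on[OF clinear_app I(1)])
 have "ecodim (?P Int ?V) ?U <= edim ?F"
  by (rule ecodim_le_edim_supplement[OF ccsubspaceD(1)[OF M] r(1) sF UM sub])
 hence fin: "ecodim (?P Int ?V) ?U < oo" using fF by (rule finite_le)
 show ?thesis
  by (rule finite_codim_range_closed[OF bounded_linear_app clinear_app sY ccsubspaceD(2)[OF cY] ccsubspaceD[OF M] UM fin])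
qed
have "{x : pran Y S (n + d). app S x = 0} <= ker ?V S" using S_range_sub[of n "n + d"] by blast
hence "alpha_pow Y S (n + d) <= alpha ?V (app S)"
 unfolding alpha_def by (intro edim_mono csubspace_kernel_on[OF clinear_app] r(1) I(1))
hence "alpha_pow Y S (n + d) < oo" using aS by (rule finite_le)
thus ?thesis unfolding ubf_at_def using cl[of "n + d"] cl[of "Suc (n + d)"] by simp
qed

text \<open>\<open>S^j V \<subseteq> S^j Y \<subseteq> V\<close> for \<open>V = A^n Y\<close> and \<open>j \<ge> n + d\<close>, and \<open>S^j V\<close> has finite codimension in \<open>V\<close>.\<close>

lemma lbf_sandwich:
assumes u: "lbf_at Y A n"
shows "beta (pran Y A n) (app S) < oo" "ecodim (pran Y A n) (pran Y S (n + d)) < oo" "lbf_at Y S (n + d)"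
proof -
let ?V = "pran Y A n" and ?U = "pran Y S (n + d)"
note I = A_range_invariant and r = pow_range_facts[OF sY SY]
have V: "ccsubspace ?V" and b: "beta ?V (app A) < oo" using u I(1) unfolding lbf_at_def ccsubspace_def by blast+
show bS: "beta ?V (app S) < oo" by (rule beta_S[OF V b])
obtain k where k: "k > 0" "onto_on ?V S k" by (rule onto_on_of_beta[OF V I(6) bS])
have c: "ecodim ?V (pran ?V S j) < oo" for j
 using beta_of_onto_on[OF I(1) power_image_subset[OF I(6)] onto_on_power[OF k(2) less_imp_le[OF k(1)] I(1)], of j]
 unfolding beta_def .
have sub: "pran ?V S j <= pran Y S j" for j using I(2) by blast
have sV: "csubspace (pran ?V S j)" for j by (rule csubspace_im[OF I(1)])
have UV: "pran Y S j <= ?V" if "n + d <= j" for j by (rule S_range_sub[OF that])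
have fin: "ecodim ?V (pran Y S j) < oo" if "n + d <= j" for j
 by (rule finite_le[OF ecodim_mono2[OF I(1) r(1) sV sub UV[OF that]] c])
show "ecodim ?V ?U < oo" by (rule fin) simp
have "closed ?U"
 by (rule finite_codim_range_closed[OF bounded_linear_app clinear_app sY ccsubspaceD(2)[OF cY] ccsubspaceD[OF V] UV fin]) simp_all
moreover have "ecodim ?U (pran Y S (Suc (n + d))) <= ecodim ?V (pran Y S (Suc (n + d)))"
 by (rule ecodim_mono1[OF I(1) r(1) r(1) r(3) UV]) simp
hence "beta ?U (app S) < oo" unfolding beta_def r(2) by (rule finite_le) (rule fin, simp)
ultimately show "lbf_at Y S (n + d)" unfolding lbf_at_def by blast
qed

text \<open>On \<open>V = A^n Y\<close> the path \<open>A + s R\<close> consists of Fredholm operators, and \<open>S^(n + d) Y\<close> has finite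
  codimension in \<open>V\<close>, so that the index of \<open>S\<close> may be taken on either space.\<close>

lemma index_transfer:
assumes u: "ubf_at Y A n" "lbf_at Y A n"
shows "alpha_pow Y A n + beta_pow Y S (n + d) =
 alpha_pow Y S (n + d) + beta_pow Y A n"
proof -
let ?V = "pran Y A n" and ?U = "pran Y S (n + d)"
note I = A_range_invariant and r = pow_range_facts[OF sY SY]
have V: "ccsubspace ?V" using u I(1) unfolding ubf_at_def ccsubspace_def by blast
have b: "beta ?V (app A) < oo" using u(2) unfolding lbf_at_def by blast
have "EX c>0. below_on ?V A c" using u(1) unfolding below_on_iff[OF V] ubf_at_def power_image_comm by blast
then obtain c where c: "c > 0" "below_on ?V A c" by blast
have path: "fredholm_on ?V (A + s *: R)" for s
proof -
 interpret s: nonzero_nilpotent_shift T "s *: R" l d Y by (rule nonzero_nilpotent_shift_scale)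
 show ?thesis using s.below_S[OF V c(2,1)] s.beta_S[OF V b] below_on_iff[OF V] unfolding fredholm_on_def by blast
qed
have p: "alpha ?V (app A) + beta ?V (app S) = alpha ?V (app S) + beta ?V (app A)"
 by (rule index_path[OF V I(5,4) path])
have f: "fredholm_on ?V S" using path[of 1] by simp
obtain e where e: "e < oo" "alpha ?V (app S) = alpha ?U (app S) + e" "beta ?V (app S) = beta ?U (app S) + e"
 using index_restrict[OF clinear_app I(1) I(6) r(1) S_range_sub[OF order_refl] _ lbf_sandwich(2)[OF u(2)]] r(2,3) by auto
show ?thesis using p e by (cases e) (auto simp: add.commute add.left_commute[of _ "enat _"])
qed

end

section \<open>The nine classes of B-Fredholm type\<close>

context
fixes T :: "'a::complex_banach cop" and l :: complex and Y :: "'a set"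
assumes l: "l ~= 0" and cY: "ccsubspace Y" and TY: "!!x. app T x : Y"
begin

lemma shift_maps_range_space: "app (T -. l) ` Y <= Y"
by (rule minus_scalar_maps[OF ccsubspaceD(1)[OF cY]]) (use TY in blast)

lemma shift_power_mod: "app ((T -. l) ^ j) x - (- l) ^ j *: x : Y"
proof (induction j)
case 0
thus ?case using csubspace_0[OF ccsubspaceD(1)[OF cY]] by (simp add: app_one)
next
case (Suc j)
let ?A = "T -. l"
have "app (?A ^ Suc j) x - (- l) ^ Suc j *: x = app ?A (app (?A ^ j) x - (- l) ^ j *: x) + (- l) ^ j *: app T x"
 unfolding app_diff power_Suc app_mult app_scaleC
 by (simp add: app_simps scaleC_diff_right scaleC_scaleC mult.commute)
also have "... : Y"
 by (intro csubspace_add[OF ccsubspaceD(1)[OF cY]] csubspace_scale[OF ccsubspaceD(1)[OF cY]] TY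
  subsetD[OF shift_maps_range_space imageI] Suc)
finally show ?case .
qed

lemma pow_range_Int: "pran UNIV (T -. l) j Int Y = pran Y (T -. l) j"
proof (intro equalityI subsetI)
note sY = ccsubspaceD(1)[OF cY]
fix y assume "y : pran UNIV (T -. l) j Int Y"
then obtain x where x: "y = app ((T -. l) ^ j) x" "y : Y" by blast
have "inverse ((- l) ^ j) *: (y - (app ((T -. l) ^ j) x - (- l) ^ j *: x)) : Y"
 by (intro csubspace_scale[OF sY] csubspace_diff[OF sY] x(2) shift_power_mod)
hence "x : Y" unfolding x(1) using l by (simp add: scaleC_scaleC)
thus "y : pran Y (T -. l) j" using x(1) by blast
qed (use power_image_subset[OF shift_maps_range_space] in blast)

text \<open>Modulo \<open>Y\<close> the powers of \<open>T - l\<close> are nonzero scalars, since \<open>Y\<close> contains the range of \<open>T\<close>: kernels lie in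
  \<open>Y\<close>, and ranges differ from their parts in \<open>Y\<close> by one fixed supplement.\<close>

lemma class_range_space:
fixes n :: nat
defines "A == T -. l"
shows "closed (pran UNIV A n) <-> closed (pran Y A n)"
 and "{x : pran UNIV A n. app A x = 0} = {x : pran Y A n. app A x = 0}"
 and "beta_pow UNIV A n = beta_pow Y A n"
proof -
note sY = ccsubspaceD(1)[OF cY]
have I: "pran UNIV A j Int Y = pran Y A j" for j unfolding A_def by (rule pow_range_Int)
have AY: "app A ` Y <= Y" unfolding A_def by (rule shift_maps_range_space)
note r = pow_range_facts[OF sY AY] and u = pow_range_facts[OF csubspace_UNIV subset_UNIV, where t=A]
let ?c = "inverse ((- l) ^ n)"
show "closed (pran UNIV A n) <-> closed (pran Y A n)"
proof
 assume "closed (pran UNIV A n)"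
 thus "closed (pran Y A n)" unfolding I[symmetric] using ccsubspaceD(2)[OF cY] by (rule closed_Int)
next
 assume cl: "closed (pran Y A n)"
 have "pran UNIV A n = {x : UNIV. app (1 - ?c *: A ^ n) x : pran Y A n}"
 proof (intro set_eqI iffI CollectI conjI UNIV_I)
  fix x
  have e: "app (1 - ?c *: A ^ n) x = x - app (A ^ n) (?c *: x)" by (simp add: app_simps1 app_one app_scaleC_left app_scaleC)
  have "app (A ^ n) (?c *: x) - (- l) ^ n *: ?c *: x : Y" unfolding A_def by (rule shift_power_mod)
  hence "app (A ^ n) (?c *: x) - x : Y" using l by (simp add: scaleC_scaleC)
  from csubspace_neg[OF sY this] have y: "app (1 - ?c *: A ^ n) x : Y" unfolding e by simp
  {
   assume "x : pran UNIV A n"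
   hence "x - app (A ^ n) (?c *: x) : pran UNIV A n" by (rule csubspace_diff[OF u(1)]) (rule rangeI)
   thus "app (1 - ?c *: A ^ n) x : pran Y A n" unfolding I[symmetric] e[symmetric] using y by blast
  next
   assume "x : {x : UNIV. app (1 - ?c *: A ^ n) x : pran Y A n}"
   hence "app (1 - ?c *: A ^ n) x : pran Y A n" by blast
   hence "x - app (A ^ n) (?c *: x) : pran UNIV A n" unfolding e by blast
   from csubspace_add[OF u(1) this rangeI, of "?c *: x"] show "x : pran UNIV A n"
    by (simp only: diff_add_cancel)
  }
 qed
 moreover have "ccsubspace {x : UNIV. app (1 - ?c *: A ^ n) x : pran Y A n}"
  using cl r(1) by (intro ccsubspace_vimage_on ccsubspace_UNIV) (simp add: ccsubspace_def)
 ultimately show "closed (pran UNIV A n)" using ccsubspaceD(2) by simp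
qed
show "{x : pran UNIV A n. app A x = 0} = {x : pran Y A n. app A x = 0}"
proof (intro equalityI subsetI)
 fix x assume x: "x : {x : pran UNIV A n. app A x = 0}"
 hence "app T x = l *: x" unfolding A_def by (simp add: app_simps)
 hence "inverse l *: l *: x : Y" using csubspace_scale[OF sY TY[of x]] by metis
 hence "x : Y" using l by (simp add: scaleC_scaleC)
 thus "x : {x : pran Y A n. app A x = 0}" using x unfolding I[symmetric] by blast
qed blast
have "pran UNIV A n = pran Y A n + pran UNIV A (Suc n)"
proof (rule subset_antisym)
 show "pran Y A n + pran UNIV A (Suc n) <= pran UNIV A n"
  by (rule plus_least[OF u(1) _ u(3)]) blast
 show "pran UNIV A n <= pran Y A n + pran UNIV A (Suc n)"
 proof
  fix x assume "x : pran UNIV A n"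
  then obtain v where v: "x = app (A ^ n) v" by blast
  have "v = inverse l *: app T v - app A (inverse l *: v)"
   using l unfolding A_def app_scaleC by (simp add: app_simps scaleC_diff_right scaleC_scaleC)
  hence "x = app (A ^ n) (inverse l *: app T v) + app (A ^ Suc n) (- (inverse l *: v))"
   unfolding v by (simp only: power_Suc2 app_mult app_minus) (metis app_diff diff_conv_add_uminus)
  moreover have "inverse l *: app T v : Y" by (rule csubspace_scale[OF sY TY])
  ultimately show "x : pran Y A n + pran UNIV A (Suc n)" by (auto intro!: set_plus_intro)
 qed
qed
hence "beta_pow UNIV A n = ecodim (pran Y A n + pran UNIV A (Suc n)) (pran UNIV A (Suc n))"
 unfolding beta_def u(2) by simp
also have "... = ecodim (pran Y A n) (pran Y A n Int pran UNIV A (Suc n))"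
 by (rule ecodim_plus[OF r(1) u(1)])
also have "pran Y A n Int pran UNIV A (Suc n) = pran Y A (Suc n)"
 using I[of "Suc n"] r(3)[of n] r(4)[of n] by blast
finally show "beta_pow UNIV A n = beta_pow Y A n" unfolding beta_def r(2) .
qed

end

definition b_classes :: "(('a::complex_banach => 'a) => bool) set" where
"b_classes = {B_Fredholm UNIV, upper_semi_B_Fredholm UNIV, lower_semi_B_Fredholm UNIV,
  B_Weyl UNIV, upper_semi_B_Weyl UNIV, lower_semi_B_Weyl UNIV,
  Drazin UNIV, left_Drazin UNIV, right_Drazin UNIV}"

lemmas B_class_iffs = B_Fredholm_iff[OF ccsubspace_UNIV subset_UNIV]
upper_semi_B_Fredholm_iff[OF ccsubspace_UNIV subset_UNIV] lower_semi_B_Fredholm_iff[OF ccsubspace_UNIV subset_UNIV]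
B_Weyl_iff[OF ccsubspace_UNIV subset_UNIV]
upper_semi_B_Weyl_iff[OF ccsubspace_UNIV subset_UNIV] lower_semi_B_Weyl_iff[OF ccsubspace_UNIV subset_UNIV]
Drazin_iff[OF ccsubspace_UNIV subset_UNIV]
left_Drazin_iff[OF ccsubspace_UNIV subset_UNIV] right_Drazin_iff[OF ccsubspace_UNIV subset_UNIV]

lemma b_classes_between:
fixes t :: "'a::complex_banach cop"
assumes "K : b_classes"
shows "K (app t) ==> EX n. ubf_at UNIV t n | lbf_at UNIV t n" "fin_asc UNIV t ==> fin_desc UNIV t ==> K (app t)"
proof -
have d: "EX p. ubf_at UNIV t p & lbf_at UNIV t p & alpha_pow UNIV t p = beta_pow UNIV t p"
 if ad: "fin_asc UNIV t" "fin_desc UNIV t"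
proof -
 obtain p where p: "direct_sum {x. app (t ^ p) x = 0} (rg (t ^ p)) UNIV"
  "app t ` rg (t ^ p) = rg (t ^ p)" "!!x. x : rg (t ^ p) ==> app t x = 0 ==> x = 0"
  by (rule asc_desc_split[OF ad]) (rule that)
 let ?W = "rg (t ^ p)" and ?N = "{x. app (t ^ p) x = 0}"
 note D = direct_sumD[OF p(1)]
 have N: "closed ?N" using ccsubspaceD(2)[OF ccsubspace_kernel[OF ccsubspace_UNIV, of "t ^ p"]] by simp
 have cl: "closed ?W"
 proof (rule range_closed[OF bounded_linear_app csubspace_UNIV closed_UNIV D(1) N])
  show "x = 0" if "x : ?W" "x : ?N" for x by (rule direct_sum_Int[OF p(1) that(2,1)])
  have "?W + ?N = UNIV" using D(6) by (simp add: add.commute)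
  thus "closed (?W + ?N)" by simp
 qed
 have "ker ?W t = {0}" using p(3) csubspace_0[OF D(2)] by auto
 hence a: "alpha ?W (app t) = 0" unfolding alpha_def by simp
 have b: "beta ?W (app t) = 0" unfolding beta_def p(2) by (rule ecodim_self[OF D(2)])
 have "closed (pran UNIV t (Suc p))" unfolding power_image_comm[symmetric] p(2) by (rule cl)
 thus ?thesis unfolding ubf_at_def lbf_at_def using cl by (intro exI[of _ p]) (simp add: a b del: power_Suc)
qed
have weak: "EX n. ubf_at UNIV t n" "EX n. lbf_at UNIV t n" if "fin_asc UNIV t" "fin_desc UNIV t"
 using d[OF that] by blast+
have dz: "EX n. ubf_at UNIV t n | lbf_at UNIV t n" if "fin_asc UNIV t & fin_desc UNIV t"
 using weak that by blast
show "EX n. ubf_at UNIV t n | lbf_at UNIV t n" if "K (app t)"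
 using assms that unfolding b_classes_def
 by (elim insertE emptyE; hypsubst; unfold B_class_iffs) (use dz in blast)+
show "K (app t)" if ad: "fin_asc UNIV t" "fin_desc UNIV t"
 using assms unfolding b_classes_def
 by (elim insertE emptyE; hypsubst; unfold B_class_iffs) (use ad weak[OF ad] d[OF ad] order_refl in force)+
qed

lemma nilpotent_transfer:
fixes T R :: "'a::complex_banach cop"
assumes sc: "semi_comm T R" and R: "R ^ d = 0" and l: "l ~= 0"
defines "A == T -. l" and "S == T + R -. l"
shows "ubf_at UNIV A n ==> ubf_at UNIV S (n + d)" "lbf_at UNIV A n ==> lbf_at UNIV S (n + d)"
 "ubf_at UNIV A n ==> lbf_at UNIV A n ==>
  alpha_pow UNIV A n + beta_pow UNIV S (n + d) =
  alpha_pow UNIV S (n + d) + beta_pow UNIV A n"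
 "fin_asc UNIV A ==> fin_asc UNIV S" "fin_desc UNIV A ==> fin_desc UNIV S"
proof -
obtain Y where Y: "ccsubspace Y" "left_comm_on Y T R" "!!x. app T x : Y" "!!x. app R x : Y"
 by (rule semi_comm_reduce[OF sc]) (rule that)
have EY: "app (T + R) x : Y" for x unfolding app_simps1(2) by (intro csubspace_add[OF ccsubspaceD(1)[OF Y(1)]] Y)
interpret N: nonzero_nilpotent_shift T R l d Y
 by unfold_locales (use l Y R in auto)
have S: "S = T -. l + R" unfolding S_def by simp
have cA: "ubf_at UNIV A n <-> ubf_at Y A n" "lbf_at UNIV A n <-> lbf_at Y A n"
 "alpha_pow UNIV A n = alpha_pow Y A n"
 "beta_pow UNIV A n = beta_pow Y A n"
 "fin_asc UNIV A <-> fin_asc Y A" "fin_desc UNIV A <-> fin_desc Y A" if "A = U -. l" "!!x. app U x : Y" for A U n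
proof -
 note c = class_range_space[OF l Y(1) that(2), folded that(1)]
 show a: "alpha_pow UNIV A n = alpha_pow Y A n" for n unfolding alpha_def c(2) ..
 show "ubf_at UNIV A n <-> ubf_at Y A n" "lbf_at UNIV A n <-> lbf_at Y A n"
  unfolding ubf_at_def lbf_at_def a c(1,3) by (rule refl)+
 show "beta_pow UNIV A n = beta_pow Y A n" by (rule c(3))
 have "(ALL x:pran UNIV A n. app A x = 0 --> x = 0) <-> (ALL x:pran Y A n. app A x = 0 --> x = 0)" for n
  using c(2)[of n] by blast
 thus "fin_asc UNIV A <-> fin_asc Y A" unfolding fin_asc_def by simp
 have sV: "csubspace V ==> app A ` V <= V ==> pran V A (Suc n) = pran V A n <-> beta_pow V A n = 0" for V n
 proof
  assume V: "csubspace V" "app A ` V <= V"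
  note r = pow_range_facts[OF V]
  show "beta_pow V A n = 0" if "pran V A (Suc n) = pran V A n"
   unfolding beta_def r(2) that by (rule ecodim_self[OF r(1)])
  show "pran V A (Suc n) = pran V A n" if "beta_pow V A n = 0"
   using that unfolding beta_def r(2) by (rule ecodim_eq_0[OF r(1) r(1) r(3), symmetric])
 qed
 have AY: "app A ` Y <= Y" unfolding that(1) by (rule shift_maps_range_space[OF l Y(1) that(2)])
 show "fin_desc UNIV A <-> fin_desc Y A"
  unfolding fin_desc_def sV[OF csubspace_UNIV subset_UNIV] sV[OF ccsubspaceD(1)[OF Y(1)] AY] c(3) ..
qed
note a = cA[OF meta_eq_to_obj_eq[OF A_def] Y(3)] and s = cA[OF meta_eq_to_obj_eq[OF S_def] EY]
show "ubf_at UNIV A n ==> ubf_at UNIV S (n + d)" "lbf_at UNIV A n ==> lbf_at UNIV S (n + d)"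
 "ubf_at UNIV A n ==> lbf_at UNIV A n ==>
  alpha_pow UNIV A n + beta_pow UNIV S (n + d) =
  alpha_pow UNIV S (n + d) + beta_pow UNIV A n"
 "fin_asc UNIV A ==> fin_asc UNIV S" "fin_desc UNIV A ==> fin_desc UNIV S"
 unfolding a s
 using N.ubf_transfer[folded A_def, folded S[folded A_def]] N.lbf_sandwich(3)[folded A_def, folded S[folded A_def]]
  N.index_transfer[folded A_def, folded S[folded A_def]] N.fin_asc_transfer[folded A_def, folded S[folded A_def]]
  N.fin_desc_transfer[folded A_def, folded S[folded A_def]] by blast+
qed

text \<open>As for the classes of Fredholm type, the sign of a semi-index needs an argument only if it is an index,
  and then both operators are B-Fredholm at the exponents in question.\<close>

lemma b_classes_nilpotent:
fixes T R :: "'a::complex_banach cop"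
assumes K: "K : b_classes" and sc: "semi_comm T R" and R: "R ^ d = 0" and l: "l ~= 0"
 and KT: "K (app (T -. l))"
shows "K (app (T + R -. l))"
proof -
define A S where "A = T -. l" and "S = T + R -. l"
have R': "(- R) ^ d = 0" using scaleC_power[of "- 1" R d] R by simp
note t = nilpotent_transfer[OF sc R l, folded A_def S_def]
have "T + R + (- R) -. l = A" unfolding A_def by simp
note t' = nilpotent_transfer[OF semi_comm_add[OF sc] R' l, folded S_def, unfolded this]
let ?a = "%t n. alpha_pow UNIV t n" and ?b = "%t n. beta_pow UNIV t n"
have idx: "?a A n <= ?b A n <-> ?a S (n + d) <= ?b S (n + d)" "?b A n <= ?a A n <-> ?b S (n + d) <= ?a S (n + d)"
 if u: "ubf_at UNIV A n" "lbf_at UNIV A n" for n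
proof -
 have "?a A n < oo" "?b A n < oo" "?a S (n + d) < oo" "?b S (n + d) < oo"
  using u t(1)[OF u(1)] t(2)[OF u(2)] unfolding ubf_at_def lbf_at_def by blast+
 thus "?a A n <= ?b A n <-> ?a S (n + d) <= ?b S (n + d)" "?b A n <= ?a A n <-> ?b S (n + d) <= ?a S (n + d)"
  using t(3)[OF u] by (cases "?a A n"; cases "?b A n"; cases "?a S (n + d)"; cases "?b S (n + d)"; force)+
qed
have full: "lbf_at UNIV A n" if u: "ubf_at UNIV A n" "?b S (n + d) < oo" for n
proof -
 have uS: "ubf_at UNIV S (n + d)" by (rule t(1)[OF u(1)])
 hence "lbf_at UNIV S (n + d)" using u(2) unfolding ubf_at_def lbf_at_def by blast
 hence bA: "?b A (n + d + d) < oo" using t'(2) unfolding lbf_at_def by blast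
 obtain e where "e < oo" "?b A n = ?b A (n + d + d) + e"
  using index_tail[OF csubspace_UNIV subset_UNIV ubf_lbf_at_min(1)[OF u(1)], of "n + d + d"] by auto
 hence "?b A n < oo" using bA by auto
 thus ?thesis using u(1) unfolding ubf_at_def lbf_at_def by blast
qed
have full': "ubf_at UNIV A n" if u: "lbf_at UNIV A n" "?a S (n + d) < oo" for n
proof -
 have lS: "lbf_at UNIV S (n + d)" "lbf_at UNIV S (Suc (n + d))"
  using t(2)[OF u(1)] lbf_at_mono[OF ccsubspace_UNIV subset_UNIV, of S "n + d" "Suc (n + d)"] by simp_all
 hence "ubf_at UNIV S (n + d)" using u(2) unfolding ubf_at_def lbf_at_def by blast
 hence aA: "?a A (n + d + d) < oo" using t'(1) unfolding ubf_at_def by blast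
 obtain e where "e < oo" "?a A n = ?a A (n + d + d) + e"
  using index_tail[OF csubspace_UNIV subset_UNIV ubf_lbf_at_min(2)[OF u(1)], of "n + d + d"] by auto
 hence "?a A n < oo" using aA by auto
 moreover have "lbf_at UNIV A (Suc n)" using lbf_at_mono[OF ccsubspace_UNIV subset_UNIV u(1), of "Suc n"] by simp
 ultimately show ?thesis using u(1) unfolding ubf_at_def lbf_at_def by blast
qed
have c1: "EX n. ubf_at UNIV S n & lbf_at UNIV S n" if "EX n. ubf_at UNIV A n & lbf_at UNIV A n" using that t(1,2) by blast
have c2: "EX n. ubf_at UNIV S n" if "EX n. ubf_at UNIV A n" using that t(1) by blast
have c3: "EX n. lbf_at UNIV S n" if "EX n. lbf_at UNIV A n" using that t(2) by blast
have c4: "EX n. ubf_at UNIV S n & lbf_at UNIV S n & ?a S n = ?b S n" if h: "EX n. ubf_at UNIV A n & lbf_at UNIV A n & ?a A n = ?b A n"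
proof -
 obtain n where n: "ubf_at UNIV A n" "lbf_at UNIV A n" "?a A n = ?b A n" using h by blast
 have "?a S (n + d) = ?b S (n + d)"
  by (rule antisym[OF idx(1)[OF n(1,2), THEN iffD1] idx(2)[OF n(1,2), THEN iffD1]]) (simp_all only: n(3) order_refl)
 thus ?thesis using t(1)[OF n(1)] t(2)[OF n(2)] by blast
qed
have c5: "EX n. ubf_at UNIV S n & ?a S n <= ?b S n" if h: "EX n. ubf_at UNIV A n & ?a A n <= ?b A n"
proof -
 obtain n where n: "ubf_at UNIV A n" "?a A n <= ?b A n" using h by blast
 have "?a S (n + d) <= ?b S (n + d)"
 proof (cases "?b S (n + d) < oo")
  case True
  thus ?thesis using idx(1)[OF n(1) full[OF n(1)]] n(2) by blast
 next
  case False
  hence "?b S (n + d) = oo" by (simp only: enat_ord_simps not_not)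
  thus ?thesis by simp
 qed
 thus ?thesis using t(1)[OF n(1)] by blast
qed
have c6: "EX n. lbf_at UNIV S n & ?b S n <= ?a S n" if h: "EX n. lbf_at UNIV A n & ?b A n <= ?a A n"
proof -
 obtain n where n: "lbf_at UNIV A n" "?b A n <= ?a A n" using h by blast
 have "?b S (n + d) <= ?a S (n + d)"
 proof (cases "?a S (n + d) < oo")
  case True
  thus ?thesis using idx(2)[OF full'[OF n(1)] n(1)] n(2) by blast
 next
  case False
  hence "?a S (n + d) = oo" by (simp only: enat_ord_simps not_not)
  thus ?thesis by simp
 qed
 thus ?thesis using t(2)[OF n(1)] by blast
qed
have c7: "fin_asc UNIV S & fin_desc UNIV S" if "fin_asc UNIV A & fin_desc UNIV A" using that t(4,5) by blast
have c8: "(EX n. ubf_at UNIV S n) & fin_asc UNIV S" if "(EX n. ubf_at UNIV A n) & fin_asc UNIV A" using that t(1,4) by blast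
have c9: "(EX n. lbf_at UNIV S n) & fin_desc UNIV S" if "(EX n. lbf_at UNIV A n) & fin_desc UNIV A" using that t(2,5) by blast
show ?thesis using K KT unfolding b_classes_def A_def[symmetric] S_def[symmetric]
 by (elim insertE emptyE; hypsubst; unfold B_class_iffs) (erule c1 c2 c3 c4 c5 c6 c7 c8 c9)+
qed

section \<open>The theorem\<close>

lemma semi_comm_of_comm:
assumes "app R : comm_l (app T) | app R : comm_r (app T)" shows "semi_comm T R"
proof -
have m: "app s \<circ> app t = app (s * t)" for s t :: "'a cop" by (auto simp: app_mult)
have e: "T * (T * R) = T * R * T & R * (R * T) = R * T * R | R * (T * R) = T * R * R & T * (R * T) = R * T * T"
 using assms unfolding comm_l_def comm_r_def comm_def mem_Collect_eq m app_inject by (elim disjE conjE) simp_all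
have l: "left_comm_on UNIV T R" if "T * (T * R) = T * R * T" "R * (R * T) = R * T * R"
proof -
 have "T * (T * R - R * T) = 0" "R * (T * R - R * T) = 0" using that by (simp_all add: right_diff_distrib mult.assoc)
 thus ?thesis unfolding left_comm_on_def by (simp add: app_simps1)
qed
have r: "right_comm T R" if "R * (T * R) = T * R * R" "T * (R * T) = R * T * T"
 unfolding right_comm_def using that by (simp add: left_diff_distrib mult.assoc)
show ?thesis using e l r unfolding semi_comm_def by blast
qed

lemma spectrum_of_app: "z : spectrum_of K (app t) <-> ~ K (app (t -. z))"
unfolding spectrum_of_def op_shift_app by simp

text \<open>Hence equality of spectra apart from zero is enough for equality of accumulation points.\<close>

lemma acc_remove_point: "acc (K - {0}) = acc K"
unfolding acc_def using islimpt_insert[of _ 0 "K - {0}"] islimpt_insert[of _ 0 K] by (simp add: insert_absorb)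

lemma acc_eqI: "K - {0} = L - {0} ==> acc K = acc L"
using acc_remove_point[of K] acc_remove_point[of L] by simp

lemma invertible_iff_below_surj:
"inv_op t <-> (EX c>0. ALL x. c * norm x <= norm (app t x)) & surj (app t)"
proof
assume i: "inv_op t"
then obtain s where s: "s * t = 1" unfolding inv_op_def by blast
have "1 / (norm s + 1) * norm x <= norm (app t x)" for x
proof -
 have "norm x = norm (app s (app t x))" by (simp only: app_mult[symmetric] s app_one)
 also have "... <= norm s * norm (app t x)" by (rule norm_app)
 also have "... <= (norm s + 1) * norm (app t x)" by (simp add: distrib_right)
 finally show ?thesis by (simp add: pos_divide_le_eq add_nonneg_pos mult.commute)
qed
hence "EX c>0. ALL x. c * norm x <= norm (app t x)" by (intro exI[of _ "1 / (norm s + 1)"]) (simp add: add_nonneg_pos)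
thus "(EX c>0. ALL x. c * norm x <= norm (app t x)) & surj (app t)" using i inv_op_iff_bij bij_is_surj by blast
next
assume a: "(EX c>0. ALL x. c * norm x <= norm (app t x)) & surj (app t)"
hence z: "x = 0" if "app t x = 0" for x using that below_kernel_mod_findim by blast
have "inj (app t)"
proof (rule injI)
 fix x y assume "app t x = app t y"
 hence "app t (x - y) = 0" by (simp add: app_diff)
 hence "x - y = 0" by (rule z)
 thus "x = y" by simp
qed
thus "inv_op t" using a unfolding inv_op_iff_bij bij_def by blast
qed

context
fixes T R :: "'a::complex_banach cop"
assumes sc: "semi_comm T R" and R: "riesz R"
begin

lemma GDRI_perturb: "GDRI (app T) ==> GDRI (app (T + R))"
proof -
assume "GDRI (app T)"
then obtain d where d: "d > 0" "!!z. 0 < cmod z ==> cmod z < d ==> browder (T -. z)"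
 unfolding GDRI_iff_browder_nearby by blast
have "browder (T + R -. z)" if "0 < cmod z" "cmod z < d" for z
 by (rule browder_semi_comm_riesz[OF sc R _ d(2)[OF that]]) (use that(1) in auto)
thus ?thesis unfolding GDRI_iff_browder_nearby using d(1) by blast
qed

lemma fredholm_classes_perturb:
assumes G: "GDRI (app T)" and K: "K : fredholm_classes" "K (app (T -. z))"
shows "K (app (T + R -. z))"
proof (cases "z = 0")
case True
hence KT: "K (app T)" using K(2) by simp
have "browder T" by (rule GDRI_semi_Fredholm[OF G fredholm_classes_between(1)[OF K(1) KT]])
hence "browder (T + R)" by (rule browder_semi_comm_riesz_0[OF sc R _ GDRI_perturb[OF G]])
hence "K (app (T + R))" by (rule fredholm_classes_between(2)[OF K(1)])
thus ?thesis using True by simp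
qed (rule fredholm_classes_semi_comm_riesz[OF K(1) sc R _ K(2)])

lemma b_classes_perturb:
assumes G: "GDRI (app T)" and d: "R ^ d = 0" and K: "K : b_classes" "K (app (T -. z))"
shows "K (app (T + R -. z))"
proof (cases "z = 0")
case True
hence KT: "K (app T)" using K(2) by simp
obtain n where n: "ubf_at UNIV T n | lbf_at UNIV T n" using b_classes_between(1)[OF K(1) KT] by blast
have "fin_asc UNIV T" "fin_desc UNIV T" using GDRI_semi_B_Fredholm[OF G n] by blast+
hence "fin_asc UNIV (T + R) & fin_desc UNIV (T + R)" by (rule asc_desc_nilpotent[OF sc d])
hence "K (app (T + R))" by (intro b_classes_between(2)[OF K(1)]) blast+
thus ?thesis using True by simp
qed (rule b_classes_nilpotent[OF K(1) sc d _ K(2)])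

lemma invertible_perturb:
assumes q: "quasinil R" and i: "inv_op (T -. z)" shows "inv_op (T + R -. z)"
proof (cases "z = 0")
case True
thus ?thesis using i invertible_semi_comm[OF sc q] by simp
next
case False
thus ?thesis
 using i bounded_below_semi_comm[OF sc q False] surj_semi_comm[OF sc q False] unfolding invertible_iff_below_surj by blast
qed

lemma gen_Drazin_perturb:
assumes q: "quasinil R" and g: "gen_Drazin_invertible (app T)" shows "gen_Drazin_invertible (app (T + R))"
using g invertible_perturb[OF q] unfolding gen_Drazin_iff_invertible_nearby by blast

end

lemma riesz_perturbation_main:
fixes T R :: "'a::complex_banach cop"
assumes sc: "semi_comm T R" and R: "riesz R"
shows "GDRI (app T) <-> GDRI (app (T + R))"
 and "GDRI (app T) ==> K : fredholm_classes ==> spectrum_of K (app T) = spectrum_of K (app (T + R))"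
 and "GDRI (app T) ==> R ^ d = 0 ==> K : b_classes ==>
  spectrum_of K (app T) = spectrum_of K (app (T + R))"
 and "quasinil R ==> \<sigma> (app T) = \<sigma> (app (T + R))"
 and "quasinil R ==> \<sigma>_a (app T) - {0} = \<sigma>_a (app (T + R)) - {0}"
 and "quasinil R ==> \<sigma>_s (app T) - {0} = \<sigma>_s (app (T + R)) - {0}"
 and "quasinil R ==> gen_Drazin_invertible (app T) ==> gen_Drazin_invertible (app (T + R))"
proof -
note sc' = semi_comm_add[OF sc] and R' = riesz_minus[OF R]
have b: "T + R + (- R) = T" by simp
show g: "GDRI (app T) <-> GDRI (app (T + R))"
 using GDRI_perturb[OF sc R] GDRI_perturb[OF sc' R'] unfolding b by blast
show "spectrum_of K (app T) = spectrum_of K (app (T + R))"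
 if G: "GDRI (app T)" and K: "K : fredholm_classes"
 using fredholm_classes_perturb[OF sc R G K] fredholm_classes_perturb[OF sc' R' G[unfolded g] K]
 unfolding b by (intro set_eqI) (simp only: spectrum_of_app, blast)
show "spectrum_of K (app T) = spectrum_of K (app (T + R))"
 if G: "GDRI (app T)" and d: "R ^ d = 0" and K: "K : b_classes"
proof -
 have d': "(- R) ^ d = 0" using scaleC_power[of "- 1" R d] d by simp
 show ?thesis
  using b_classes_perturb[OF sc R G d K] b_classes_perturb[OF sc' R' G[unfolded g] d' K]
  unfolding b by (intro set_eqI) (simp only: spectrum_of_app, blast)
qed
show "gen_Drazin_invertible (app (T + R))" if "quasinil R" "gen_Drazin_invertible (app T)"
 by (rule gen_Drazin_perturb[OF sc R that])
assume q: "quasinil R"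
note q' = quasinil_minus[OF q]
show "\<sigma> (app T) = \<sigma> (app (T + R))"
 using invertible_perturb[OF sc R q] invertible_perturb[OF sc' R' q']
 unfolding b by (intro set_eqI) (simp only: sigma_iff, blast)
have bb: "bounded_below (app t) <-> (EX c>0. ALL x. c * norm x <= norm (app t x))" for t :: "'a cop"
 unfolding bounded_below_def by simp
have "bounded_below (app (T -. z)) <-> bounded_below (app (T + R -. z))" if "z ~= 0" for z
 using bounded_below_semi_comm[OF sc q that] bounded_below_semi_comm[OF sc' q' that] unfolding b bb by blast
thus "\<sigma>_a (app T) - {0} = \<sigma>_a (app (T + R)) - {0}"
 unfolding \<sigma>_a_def by (intro set_eqI) (simp only: spectrum_of_app Diff_iff singleton_iff, blast)
have "surj (app (T -. z)) <-> surj (app (T + R -. z))" if "z ~= 0" for z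
 using surj_semi_comm[OF sc q that] surj_semi_comm[OF sc' q' that] unfolding b by blast
thus "\<sigma>_s (app T) - {0} = \<sigma>_s (app (T + R)) - {0}"
 unfolding \<sigma>_s_def by (intro set_eqI) (simp only: spectrum_of_app Diff_iff singleton_iff, blast)
qed

theorem theorem3p7:
  fixes R T :: "'a::complex_banach \<Rightarrow> 'a"
  assumes "edim (UNIV :: 'a set) = \<infinity>"
    and "bounded_clinear R" and "bounded_clinear T"
    and "Riesz UNIV R"
    and "(R \<in> comm_l T \<and> T \<in> comm (T \<circ> R)) \<or> (R \<in> comm_r T \<and> T \<in> comm (R \<circ> T))"
  defines "TR \<equiv> \<lambda>x. T x + R x"
  shows "(gen_Drazin_Riesz_invertible T \<longleftrightarrow> gen_Drazin_Riesz_invertible TR) \<and>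
    (gen_Drazin_Riesz_invertible T \<longrightarrow>
      (\<forall>sp \<in> {\<sigma>_e, \<sigma>_uf, \<sigma>_lf, \<sigma>_w, \<sigma>_uw, \<sigma>_lw, \<sigma>_b, \<sigma>_ub, \<sigma>_lb}. sp T = sp TR) \<and>
      (nilpotent_op R \<longrightarrow>
        (\<forall>sp \<in> {\<sigma>_bf, \<sigma>_ubf, \<sigma>_lbf, \<sigma>_bw, \<sigma>_ubw, \<sigma>_lbw, \<sigma>_d, \<sigma>_ld, \<sigma>_rd}.
           sp T - {0} = sp TR - {0}) \<and>
        (\<forall>sp \<in> {\<sigma>_bf, \<sigma>_bw, \<sigma>_d}. sp T = sp TR) \<and>
        (hilbert_space TYPE('a) \<longrightarrow>
          (\<forall>sp \<in> {\<sigma>_bf, \<sigma>_ubf, \<sigma>_lbf, \<sigma>_bw, \<sigma>_ubw, \<sigma>_lbw, \<sigma>_d, \<sigma>_ld, \<sigma>_rd}.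
             sp T = sp TR))) \<and>
      (quasi_nilpotent R \<longrightarrow>
        (\<forall>sp \<in> {\<sigma>, \<sigma>_a, \<sigma>_s}. acc (sp T) - {0} = acc (sp TR) - {0}) \<and>
        (gen_Drazin_invertible T \<longrightarrow>
          gen_Drazin_invertible TR \<and> \<sigma> T = \<sigma> TR \<and>
          (\<forall>sp \<in> {\<sigma>_a, \<sigma>_s}.
             sp T - {0} = sp TR - {0} \<and> acc (sp T) = acc (sp TR)))))"
proof -
define t r where "t = Cop T" and "r = Cop R"
have T: "T = app t" and R: "R = app r" unfolding t_def r_def by (simp_all only: app_Cop assms(2,3))
have TR: "TR = app (t + r)" unfolding TR_def T R by (simp only: app_simps1(2)[abs_def])
have sc: "semi_comm t r" by (rule semi_comm_of_comm) (use assms(5) in "unfold T R, blast")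
have rz: "riesz r" using assms(4) unfolding R riesz_iff .
note m = riesz_perturbation_main[OF sc rz]
have F: "sp T = sp TR" if G: "GDRI T"
 and sp: "sp : {\<sigma>_e, \<sigma>_uf, \<sigma>_lf, \<sigma>_w, \<sigma>_uw, \<sigma>_lw, \<sigma>_b, \<sigma>_ub, \<sigma>_lb}" for sp
proof -
 obtain K where "K : fredholm_classes" "sp = spectrum_of K"
  using sp unfolding fredholm_classes_def \<sigma>_e_def \<sigma>_uf_def \<sigma>_lf_def \<sigma>_w_def \<sigma>_uw_def \<sigma>_lw_def \<sigma>_b_def \<sigma>_ub_def \<sigma>_lb_def by blast
 thus ?thesis using m(2) G unfolding T TR by blast
qed
have B: "sp T = sp TR" if G: "GDRI T" and N: "nilpotent_op R"
 and sp: "sp : {\<sigma>_bf, \<sigma>_ubf, \<sigma>_lbf, \<sigma>_bw, \<sigma>_ubw, \<sigma>_lbw, \<sigma>_d, \<sigma>_ld, \<sigma>_rd}" for sp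
proof -
 obtain d where "!!x. app (r ^ d) x = 0" using N unfolding nilpotent_op_def R app_power by blast
 hence d: "r ^ d = 0" by (intro cop_eqI) (simp add: app_simps1)
 obtain K where "K : b_classes" "sp = spectrum_of K"
  using sp unfolding b_classes_def \<sigma>_bf_def \<sigma>_ubf_def \<sigma>_lbf_def \<sigma>_bw_def \<sigma>_ubw_def \<sigma>_lbw_def \<sigma>_d_def \<sigma>_ld_def \<sigma>_rd_def by blast
 thus ?thesis using m(3)[OF _ d] G unfolding T TR by blast
qed
have Q: "\<sigma> T = \<sigma> TR" "\<sigma>_a T - {0} = \<sigma>_a TR - {0}" "\<sigma>_s T - {0} = \<sigma>_s TR - {0}"
 "gen_Drazin_invertible T ==> gen_Drazin_invertible TR" if "quasi_nilpotent R"
 using m(4-7) that unfolding T TR R quasinil_iff by blast+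
have A: "acc (\<sigma>_a T) = acc (\<sigma>_a TR)" "acc (\<sigma>_s T) = acc (\<sigma>_s TR)" if q: "quasi_nilpotent R"
 by (rule acc_eqI[OF Q(2)[OF q]], rule acc_eqI[OF Q(3)[OF q]])
show ?thesis
proof (intro conjI impI ballI)
 show "GDRI T <-> GDRI TR" unfolding T TR by (rule m(1))
next
 fix sp :: "('a => 'a) => complex set"
 assume G: "GDRI T"
 {
  assume "sp : {\<sigma>_e, \<sigma>_uf, \<sigma>_lf, \<sigma>_w, \<sigma>_uw, \<sigma>_lw, \<sigma>_b, \<sigma>_ub, \<sigma>_lb}"
  thus "sp T = sp TR" by (rule F[OF G])
 next
  assume N: "nilpotent_op R"
  note B = B[OF G N]
  {
   assume "sp : {\<sigma>_bf, \<sigma>_ubf, \<sigma>_lbf, \<sigma>_bw, \<sigma>_ubw, \<sigma>_lbw, \<sigma>_d, \<sigma>_ld, \<sigma>_rd}"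
   thus "sp T = sp TR" "sp T - {0} = sp TR - {0}" by (simp_all only: B)
  next
   assume "sp : {\<sigma>_bf, \<sigma>_bw, \<sigma>_d}"
   thus "sp T = sp TR" by (intro B) blast
  }
 next
  assume q: "quasi_nilpotent R"
  {
   assume "sp : {\<sigma>, \<sigma>_a, \<sigma>_s}"
   thus "acc (sp T) - {0} = acc (sp TR) - {0}" using Q(1)[OF q] A[OF q] by (elim insertE emptyE) simp_all
  next
   assume "sp : {\<sigma>_a, \<sigma>_s}"
   thus "sp T - {0} = sp TR - {0}" "acc (sp T) = acc (sp TR)"
    using Q(2,3)[OF q] A[OF q] by (elim insertE emptyE; simp)+
  next
   show "\<sigma> T = \<sigma> TR" by (rule Q(1)[OF q])
   show "gen_Drazin_invertible TR" if "gen_Drazin_invertible T" by (rule Q(4)[OF q that])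
  }
 }
qed
qed

end
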